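(* Let $X=C\otimes^G D$ be a twisted product resolution of $A=S\rtimes G$ for differential graded coalgebras $(C,\Delta_C,\mu_C)$ and $(D,\Delta_D,\mu_D)$ resolving $kG$ and $S$, respectively, as described in the context. The Gerstenhaber bracket of elements of Hochschild cohomology of $A$ represented by cocycles $f\in\mathrm{Hom}_{A^e}(X_n,A)$ and $f'\in\mathrm{Hom}_{A^e}(X_m,A)$ is represented by the cocycle $$[f,f']=f\circ_X f'-(-1)^{(n-1)(m-1)}f'\circ_X f,$$ where $f\circ_X f'$ (similarly $f'\circ_X f$) is the composition $$X\xrightarrow{\ (1_X\otimes\Delta_X)\Delta_X\ }X\otimes_A X\otimes_A X\xrightarrow{\ 1_X\otimes f'\otimes1_X\ }X\otimes_A X\xrightarrow{\ \phi_X\ }X\xrightarrow{\ f\ }A$$ with $$\Delta_X=(1_C\otimes\tau\otimes1_D)(\Delta_C\otimes\Delta_D)$$ and $$\phi_X=\big(\phi_C\otimes\mu_D\otimes1_D+(1\otimes\mu_C)(\epsilon_C\otimes1)\otimes\phi_D\big)(1\otimes\tau^{-1}\otimes1).$$ Here $\tau$ is the twisting map, $\phi_C$ and $\phi_D$ are the homotopies, and $1_X\otimes f'\otimes 1_X$ is the signed map, all described in the context, and $\epsilon_C:C\to C$ is $c\mapsto(-1)^{|c|}c$ for homogeneous $c$.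
   Context: $k$ is a field of arbitrary characteristic and $\otimes=\otimes_k$. $G$ is a finite group acting by automorphisms on a $k$-algebra $S$, written $s\mapsto {}^g s$. The skew group algebra $A=S\rtimes G$ is $S\otimes kG$ as a vector space, with $s\otimes g$ written $sg$ and multiplication $(sg)(s'g')=s({}^g s')\,gg'$. For an algebra $R$, $R^e=R\otimes R^{op}$, so that $R$-bimodules are left $R^e$-modules. Differential graded coalgebra: for an algebra $R$ and a projective resolution $P$ of $R$ as an $R$-bimodule, with augmentation $\mu_P:P_0\to R$ (extended by zero on $P_i$, $i\ge1$), $P$ is a differential graded coalgebra if there is a degree $0$ chain map $\Delta_P:P\to P\otimes_R P$ lifting the canonical isomorphism $R\cong R\otimes_R R$ that is coassociative, $(\Delta_P\otimes1)\Delta_P=(1\otimes\Delta_P)\Delta_P$, and counital, $(\mu_P\otimes1_P)\Delta_P=1_P=(1_P\otimes\mu_P)\Delta_P$. Here $(\mu_P\otimes 1_P)(p\otimes p')=\mu_P(p)\cdot p'$, and similarly for $1_P\otimes\mu_P$. The differential on $P_n\otimes_R P_m$ is $\partial_P\otimes1_P+(-1)^n 1_P\otimes\partial_P$. As in this definition, the resolutions used to compute Hochschild cohomology, including $X$ below, are understood to be projective. Homotopy: a chain homotopy from $\mu_P\otimes1_P$ to $1_P\otimes\mu_P$ is a map $\phi_P:P\otimes_R P\to P$ with $P_m\otimes_R P_n\to P_{m+n+1}$ satisfying $\partial_P\,\phi_P+\phi_P\,\partial_{P\otimes_R P}=\mu_P\otimes1_P-1_P\otimes\mu_P$. Setting: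 $(C,\Delta_C,\mu_C)$ is a projective resolution of $kG$ as a $kG$-bimodule and $(D,\Delta_D,\mu_D)$ is a projective resolution of $S$ as an $S$-bimodule, both differential graded coalgebras. The resolution $C$ is $G$-graded with compatible group action, $g_1\big((C_i)_{g_2}\big)g_3=(C_i)_{g_1g_2g_3}$ for all $g_1,g_2,g_3\in G$ and all $i$, and $\Delta_C,\mu_C$ preserve the grading. The resolution $D$ carries a compatible action of $G$: each $D_j$ is a left $kG$-module (action written $g\cdot d$ or ${}^g d$) with $g\cdot(s\cdot d)={}^g s\cdot(g\cdot d)$ for all $g\in G$, $s\in S$, $d\in D$, and the differentials are $kG$-module homomorphisms (so that $D$ is compatible with the twisting map $g\otimes s\mapsto{}^g s\otimes g$ given by the group action); also $\Delta_D,\mu_D$ are $kG$-module homomorphisms. $\phi_C$ is a homotopy from $\mu_C\otimes1_C$ to $1_C\otimes\mu_C$ and $\phi_D$ is a homotopy from $\mu_D\otimes1_D$ to $1_D\otimes\mu_D$. Twisted product resolution: $X=C\otimes^G D$ is the total complex of $C\otimes D$, $X_n=\bigoplus_{i+j=n}C_i\otimes D_j$ with differential $\partial_n=\sum_{i+j=n}(\partial_i\otimes1)+(-1)^i(1\otimes\partial_j)$, and $A$-bimodule structure $$s'g'\cdot(c\otimes d)\cdot sg=g'cg\otimes({}^{(g'hg)^{-1}}s')({}^{g^{-1}}(ds))$$ for $c\in C_h$, $d\in D$, $g,g',h\in G$, $s,s'\in S$. It is a resolution of $A$ by $A$-bimodules. The twisting map $\tau:C\otimes D\to D\otimes C$ is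 $\tau(c\otimes d)=(-1)^{ij}({}^g d)\otimes c$ for $c\in(C_i)_g$, $d\in D_j$; it induces a well-defined chain map $1\otimes\tau\otimes1:(C\otimes_{kG}C)\otimes(D\otimes_S D)\to X\otimes_A X$, and $1\otimes\tau^{-1}\otimes1$ denotes its inverse. No further signs are inserted in the tensor products of maps defining $\phi_X$: on $(C\otimes_{kG}C)\otimes(D\otimes_S D)$ the first factor is $c\otimes c'\otimes d\otimes d'\mapsto\phi_C(c\otimes c')\otimes\mu_D(d)d'+(-1)^{|c|}c\,\mu_C(c')\otimes\phi_D(d\otimes d')$ for homogeneous $c$. Cochains: a cochain $f\in\mathrm{Hom}_{A^e}(X_n,A)$ is extended to all of $X$ by $f\equiv0$ on $X_l$, $l\ne n$. For $f'\in\mathrm{Hom}_{A^e}(X_m,A)$, the map $1_X\otimes f'\otimes1_X$ carries signs: $(1_X\otimes f'\otimes1_X)(x\otimes y\otimes z)=(-1)^{im}x\otimes f'(y)\otimes z$ for $x\in X_i$, $y,z\in X$ (with $X\otimes_A A\otimes_A X$ identified with $X\otimes_A X$). Gerstenhaber bracket: let $B$ be the bar resolution of $A$, $B_n=A\otimes A^{\otimes n}\otimes A$, and identify $\mathrm{Hom}_{A^e}(B_n,A)$ with $\mathrm{Hom}_k(A^{\otimes n},A)$. For $f\in\mathrm{Hom}_k(A^{\otimes n},A)$ and $f'\in\mathrm{Hom}_k(A^{\otimes m},A)$, $[f,f']=f\circ f'-(-1)^{(n-1)(m-1)}f'\circ f$, where $$(f\circ f')(a_1\otimes\cdots\otimes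 a_{n+m-1})=\sum_{i=1}^n(-1)^{(m-1)(i-1)}f\big(a_1\otimes\cdots\otimes a_{i-1}\otimes f'(a_i\otimes\cdots\otimes a_{i+m-1})\otimes a_{i+m}\otimes\cdots\otimes a_{n+m-1}\big).$$ This induces the Gerstenhaber bracket on the Hochschild cohomology of $A$, which is identified with the cohomology of $\mathrm{Hom}_{A^e}(X,A)$.
   Formalization: The homotopies are bimodule maps, with φ_C additionally assumed to preserve the G-grading and φ_D to be G-equivariant; without these conditions φ_X need not be an A-bimodule map and [f,f'] need not lie in Hom_{A^e}(X,A). *)

theory Defs
  imports Complex_Main "HOL-Library.Poly_Mapping"
begin

text \<open>
  Conventions.  Modules are whole types of class \<^class>\<open>ab_group_add\<close>, with the scalar
  multiplication of the ground field and the actions given as functions; homogeneous parts are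
  subsets.  A finite group is a type of class \<open>{finite, group_add}\<close>: the (in general
  noncommutative) group law is written additively, so \<open>g + h\<close>, \<open>0\<close> and \<open>- g\<close> stand for
  the product, the unit and the inverse.
\<close>

definition signed :: "int \<Rightarrow> 'a \<Rightarrow> 'a::ab_group_add" where
  "signed e x = (if even e then x else - x)"

section \<open>Algebras and bimodules\<close>

record ('k, 'r) kalg =
  asc :: "'k \<Rightarrow> 'r \<Rightarrow> 'r"
  amul :: "'r \<Rightarrow> 'r \<Rightarrow> 'r"
  aone :: "'r"

definition k_algebra :: "('k::field, 'r::ab_group_add) kalg \<Rightarrow> bool" where
  "k_algebra R \<longleftrightarrow>
     vector_space (asc R) \<and>
     (\<forall>a. Vector_Spaces.linear (asc R) (asc R) (\<lambda>b. amul R a b)) \<and>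
     (\<forall>b. Vector_Spaces.linear (asc R) (asc R) (\<lambda>a. amul R a b)) \<and>
     (\<forall>a b c. amul R (amul R a b) c = amul R a (amul R b c)) \<and>
     (\<forall>a. amul R (aone R) a = a \<and> amul R a (aone R) = a)"

record ('k, 'r, 'm) bimod =
  msc :: "'k \<Rightarrow> 'm \<Rightarrow> 'm"
  lact :: "'r \<Rightarrow> 'm \<Rightarrow> 'm"
  ract :: "'m \<Rightarrow> 'r \<Rightarrow> 'm"

text \<open>Bimodules are modules over \<open>R \<otimes> R\<^sup>o\<^sup>p\<close>, so the ground field acts in the same way on both
  sides.  Linearity of the two actions in both arguments together with unitality gives this.\<close>

definition bimodule ::
  "('k::field, 'r::ab_group_add) kalg \<Rightarrow> ('k, 'r, 'm::ab_group_add, 'z) bimod_scheme \<Rightarrow> bool" where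
  "bimodule R M \<longleftrightarrow>
     vector_space (msc M) \<and>
     (\<forall>a. Vector_Spaces.linear (msc M) (msc M) (\<lambda>m. lact M a m)) \<and>
     (\<forall>a. Vector_Spaces.linear (msc M) (msc M) (\<lambda>m. ract M m a)) \<and>
     (\<forall>m. Vector_Spaces.linear (asc R) (msc M) (\<lambda>a. lact M a m)) \<and>
     (\<forall>m. Vector_Spaces.linear (asc R) (msc M) (\<lambda>a. ract M m a)) \<and>
     (\<forall>m. lact M (aone R) m = m \<and> ract M m (aone R) = m) \<and>
     (\<forall>a b m. lact M (amul R a b) m = lact M a (lact M b m)) \<and>
     (\<forall>a b m. ract M m (amul R a b) = ract M (ract M m a) b) \<and>
     (\<forall>a b m. ract M (lact M a m) b = lact M a (ract M m b))"

definition bimod_hom ::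
  "('k::field, 'r, 'm::ab_group_add, 'y) bimod_scheme \<Rightarrow>
   ('k, 'r, 'n::ab_group_add, 'z) bimod_scheme \<Rightarrow> ('m \<Rightarrow> 'n) \<Rightarrow> bool" where
  "bimod_hom M N F \<longleftrightarrow>
     Vector_Spaces.linear (msc M) (msc N) F \<and>
     (\<forall>a m. F (lact M a m) = lact N a (F m)) \<and>
     (\<forall>m a. F (ract M m a) = ract N (F m) a)"

definition regular :: "('k, 'r) kalg \<Rightarrow> ('k, 'r, 'r) bimod" where
  "regular R = \<lparr>msc = asc R, lact = amul R, ract = amul R\<rparr>"

section \<open>Free vector spaces, free bimodules and projectivity\<close>

abbreviation gen :: "'i \<Rightarrow> 'i \<Rightarrow>\<^sub>0 'k::field" where
  "gen i \<equiv> Poly_Mapping.single i 1"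

definition pm_scale :: "'k::field \<Rightarrow> ('i \<Rightarrow>\<^sub>0 'k) \<Rightarrow> ('i \<Rightarrow>\<^sub>0 'k)" where
  "pm_scale c = Poly_Mapping.map (\<lambda>x. c * x)"

text \<open>The linear map out of the free vector space on \<open>'i\<close> with prescribed values on the basis.\<close>

definition free_ext ::
  "('k::field \<Rightarrow> 'm \<Rightarrow> 'm::ab_group_add) \<Rightarrow> ('i \<Rightarrow> 'm) \<Rightarrow> ('i \<Rightarrow>\<^sub>0 'k) \<Rightarrow> 'm" where
  "free_ext s h z = (\<Sum>i \<in> Poly_Mapping.keys z. s (Poly_Mapping.lookup z i) (h i))"

text \<open>The free \<open>R\<close>-bimodule (that is, the free \<open>R \<otimes> R\<^sup>o\<^sup>p\<close>-module) on a set \<open>'i\<close> is the free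
  vector space on the symbols \<open>(a, i, b)\<close>, standing for \<open>a \<cdot> i \<cdot> b\<close>, modulo the span of
  the following relations.\<close>

definition free_bimod_rels ::
  "('k::field, 'r::ab_group_add) kalg \<Rightarrow> (('r \<times> 'i \<times> 'r) \<Rightarrow>\<^sub>0 'k) set" where
  "free_bimod_rels R = module.span pm_scale
     ({gen (a + a', i, b) - gen (a, i, b) - gen (a', i, b) | a a' i b. True} \<union>
      {gen (a, i, b + b') - gen (a, i, b) - gen (a, i, b') | a i b b'. True} \<union>
      {gen (asc R c a, i, b) - pm_scale c (gen (a, i, b)) | c a i b. True} \<union>
      {gen (a, i, asc R c b) - pm_scale c (gen (a, i, b)) | c a i b. True})"

definition free_lact ::
  "('k::field, 'r::ab_group_add) kalg \<Rightarrow> 'r \<Rightarrow> (('r \<times> 'i \<times> 'r) \<Rightarrow>\<^sub>0 'k) \<Rightarrow> (('r \<times> 'i \<times> 'r) \<Rightarrow>\<^sub>0 'k)"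
  where "free_lact R r = free_ext pm_scale (\<lambda>(a, i, b). gen (amul R r a, i, b))"

definition free_ract ::
  "('k::field, 'r::ab_group_add) kalg \<Rightarrow> (('r \<times> 'i \<times> 'r) \<Rightarrow>\<^sub>0 'k) \<Rightarrow> 'r \<Rightarrow> (('r \<times> 'i \<times> 'r) \<Rightarrow>\<^sub>0 'k)"
  where "free_ract R z r = free_ext pm_scale (\<lambda>(a, i, b). gen (a, i, amul R b r)) z"

text \<open>A sub-bimodule \<open>P\<close> of \<open>M\<close> is projective iff it is a direct summand of a free bimodule.
  Here \<open>\<iota>\<close> is the inclusion, given by representatives and hence a homomorphism only modulo the
  relations, and the projection sends the free generator \<open>i\<close> to \<open>x i \<in> P\<close>.  Since \<open>P\<close> is a
  quotient of the free bimodule on its own elements, the type \<open>'m\<close> is a large enough set of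
  generators.\<close>

definition projective_bimodule ::
  "('k::field, 'r::ab_group_add) kalg \<Rightarrow> ('k, 'r, 'm::ab_group_add, 'z) bimod_scheme \<Rightarrow> 'm set \<Rightarrow> bool"
  where
  "projective_bimodule R M P \<longleftrightarrow>
     (\<exists>(\<iota> :: 'm \<Rightarrow> (('r \<times> 'm \<times> 'r) \<Rightarrow>\<^sub>0 'k)) (x :: 'm \<Rightarrow> 'm).
        (\<forall>i. x i \<in> P) \<and>
        (\<forall>p\<in>P. \<forall>q\<in>P. \<iota> (p + q) - (\<iota> p + \<iota> q) \<in> free_bimod_rels R) \<and>
        (\<forall>c. \<forall>p\<in>P. \<iota> (msc M c p) - pm_scale c (\<iota> p) \<in> free_bimod_rels R) \<and>
        (\<forall>a. \<forall>p\<in>P. \<iota> (lact M a p) - free_lact R a (\<iota> p) \<in> free_bimod_rels R) \<and>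
        (\<forall>a. \<forall>p\<in>P. \<iota> (ract M p a) - free_ract R (\<iota> p) a \<in> free_bimod_rels R) \<and>
        (\<forall>p\<in>P. free_ext (msc M) (\<lambda>(a, i, b). ract M (lact M a (x i)) b) (\<iota> p) = p))"

section \<open>Tensor products\<close>

record ('k, 'm, 'n, 't) tensor =
  tsc :: "'k \<Rightarrow> 't \<Rightarrow> 't"
  tpr :: "'m \<Rightarrow> 'n \<Rightarrow> 't"

definition tensor_rels ::
  "('k::field \<Rightarrow> 'm \<Rightarrow> 'm::ab_group_add) \<Rightarrow> ('k \<Rightarrow> 'n \<Rightarrow> 'n::ab_group_add) \<Rightarrow>
   ('m \<Rightarrow> 'r \<Rightarrow> 'm) \<Rightarrow> ('r \<Rightarrow> 'n \<Rightarrow> 'n) \<Rightarrow> (('m \<times> 'n) \<Rightarrow>\<^sub>0 'k) set" where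
  "tensor_rels sM sN \<rho> \<Lambda> = module.span pm_scale
     ({gen (m + m', n) - gen (m, n) - gen (m', n) | m m' n. True} \<union>
      {gen (m, n + n') - gen (m, n) - gen (m, n') | m n n'. True} \<union>
      {gen (sM c m, n) - pm_scale c (gen (m, n)) | c m n. True} \<union>
      {gen (m, sN c n) - pm_scale c (gen (m, n)) | c m n. True} \<union>
      {gen (\<rho> m r, n) - gen (m, \<Lambda> r n) | m r n. True})"

text \<open>\<open>T\<close> is a tensor product of a right module (action \<open>\<rho>\<close>) and a left module (action
  \<open>\<Lambda>\<close>) iff \<open>m \<otimes> n \<mapsto> tpr T m n\<close> is an isomorphism from the standard construction, the free
  vector space on pairs modulo the tensor relations, onto the type \<open>'t\<close>.\<close>

definition is_tensor ::
  "('k::field \<Rightarrow> 'm \<Rightarrow> 'm::ab_group_add) \<Rightarrow> ('k \<Rightarrow> 'n \<Rightarrow> 'n::ab_group_add) \<Rightarrow>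
   ('m \<Rightarrow> 'r \<Rightarrow> 'm) \<Rightarrow> ('r \<Rightarrow> 'n \<Rightarrow> 'n) \<Rightarrow> ('k, 'm, 'n, 't::ab_group_add) tensor \<Rightarrow> bool" where
  "is_tensor sM sN \<rho> \<Lambda> T \<longleftrightarrow>
     vector_space (tsc T) \<and>
     surj (free_ext (tsc T) (\<lambda>(m, n). tpr T m n)) \<and>
     (\<forall>z. free_ext (tsc T) (\<lambda>(m, n). tpr T m n) z = 0 \<longleftrightarrow> z \<in> tensor_rels sM sN \<rho> \<Lambda>)"

definition is_tensor_over ::
  "('k::field, 'r, 'm::ab_group_add, 'y) bimod_scheme \<Rightarrow>
   ('k, 'r, 'n::ab_group_add, 'z) bimod_scheme \<Rightarrow> ('k, 'm, 'n, 't::ab_group_add) tensor \<Rightarrow> bool" where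
  "is_tensor_over M N T \<longleftrightarrow> is_tensor (msc M) (msc N) (ract M) (lact N) T"

definition is_tensor_k ::
  "('k::field \<Rightarrow> 'm \<Rightarrow> 'm::ab_group_add) \<Rightarrow> ('k \<Rightarrow> 'n \<Rightarrow> 'n::ab_group_add) \<Rightarrow>
   ('k, 'm, 'n, 't::ab_group_add) tensor \<Rightarrow> bool" where
  "is_tensor_k sM sN T \<longleftrightarrow> is_tensor sM sN (\<lambda>m c. sM c m) sN T"

text \<open>The linear map out of a tensor product with values \<open>h m n\<close> on \<open>m \<otimes> n\<close>; it exists
  uniquely whenever \<open>h\<close> is bilinear and balanced.\<close>

definition tlift ::
  "('k::field, 'm, 'n, 't::ab_group_add) tensor \<Rightarrow> ('k \<Rightarrow> 'u \<Rightarrow> 'u::ab_group_add) \<Rightarrow>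
   ('m \<Rightarrow> 'n \<Rightarrow> 'u) \<Rightarrow> 't \<Rightarrow> 'u" where
  "tlift T s h = (THE F. Vector_Spaces.linear (tsc T) s F \<and> (\<forall>m n. F (tpr T m n) = h m n))"

section \<open>Complexes and projective resolutions\<close>

text \<open>A nonnegatively graded complex \<open>P = \<Oplus>P\<^sub>n\<close>, \<open>P\<^sub>n = gr P n\<close>, of bimodules with an
  augmentation to the algebra, as one bimodule.\<close>

record ('k, 'r, 'm) cplx = "('k, 'r, 'm) bimod" +
  gr :: "nat \<Rightarrow> 'm set"
  bd :: "'m \<Rightarrow> 'm"
  aug :: "'m \<Rightarrow> 'r"

definition direct_sum :: "'m::ab_group_add set \<Rightarrow> ('i \<Rightarrow> 'm set) \<Rightarrow> bool" where
  "direct_sum V F \<longleftrightarrow>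
     (\<forall>i. F i \<subseteq> V) \<and>
     (\<forall>v\<in>V. \<exists>!p. (\<forall>i. p i \<in> F i) \<and> finite {i. p i \<noteq> 0} \<and> v = (\<Sum>i\<in>{i. p i \<noteq> 0}. p i))"

definition projective_resolution ::
  "('k::field, 'r::ab_group_add) kalg \<Rightarrow> ('k, 'r, 'm::ab_group_add) cplx \<Rightarrow> bool" where
  "projective_resolution R P \<longleftrightarrow>
     bimodule R P \<and>
     (\<forall>n. module.subspace (msc P) (gr P n)) \<and>
     (\<forall>n a. \<forall>p\<in>gr P n. lact P a p \<in> gr P n \<and> ract P p a \<in> gr P n) \<and>
     direct_sum UNIV (gr P) \<and>
     (\<forall>n. projective_bimodule R P (gr P n)) \<and>
     bimod_hom P P (bd P) \<and>
     bimod_hom P (regular R) (aug P) \<and>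
     (\<forall>p\<in>gr P 0. bd P p = 0) \<and>
     (\<forall>n. \<forall>p\<in>gr P (Suc n). bd P p \<in> gr P n \<and> aug P p = 0) \<and>
     (\<forall>n. {p \<in> gr P (Suc n). bd P p = 0} = bd P ` gr P (Suc (Suc n))) \<and>
     {p \<in> gr P 0. aug P p = 0} = bd P ` gr P (Suc 0) \<and>
     aug P ` gr P 0 = UNIV"

text \<open>\<open>P \<otimes>\<^sub>R Q\<close> on the model \<open>T\<close>, augmented through \<open>R \<otimes>\<^sub>R R \<cong> R\<close>.\<close>

definition tensor_cplx ::
  "('k::field, 'r) kalg \<Rightarrow> ('k, 'r::ab_group_add, 'm::ab_group_add) cplx \<Rightarrow> 
   ('k, 'r, 'n::ab_group_add) cplx \<Rightarrow>
   ('k, 'm, 'n, 't::ab_group_add) tensor \<Rightarrow> ('k, 'r, 't) cplx" where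
  "tensor_cplx R P Q T =
     \<lparr>msc = tsc T,
      lact = (\<lambda>a. tlift T (tsc T) (\<lambda>p q. tpr T (lact P a p) q)),
      ract = (\<lambda>z a. tlift T (tsc T) (\<lambda>p q. tpr T p (ract Q q a)) z),
      gr = (\<lambda>n. module.span (tsc T) {tpr T p q | p q i j. p \<in> gr P i \<and> q \<in> gr Q j \<and> i + j = n}),
      bd = (THE F. Vector_Spaces.linear (tsc T) (tsc T) F \<and>
              (\<forall>i. \<forall>p\<in>gr P i. \<forall>q.
                 F (tpr T p q) = tpr T (bd P p) q + signed (int i) (tpr T p (bd Q q)))),
      aug = tlift T (asc R) (\<lambda>p q. amul R (aug P p) (aug Q q))\<rparr>"

text \<open>\<open>\<mu>\<^sub>P \<otimes> 1\<^sub>P\<close> and \<open>1\<^sub>P \<otimes> \<mu>\<^sub>P\<close>, both with values in \<open>P\<close>, and \<open>\<epsilon>\<^sub>P \<otimes> 1\<^sub>P\<close>.\<close>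

definition mu_one ::
  "('k::field, 'r, 'm::ab_group_add) cplx \<Rightarrow> ('k, 'm, 'm, 't::ab_group_add) tensor \<Rightarrow> 't \<Rightarrow> 'm" where
  "mu_one P T = tlift T (msc P) (\<lambda>p q. lact P (aug P p) q)"

definition one_mu ::
  "('k::field, 'r, 'm::ab_group_add) cplx \<Rightarrow> ('k, 'm, 'm, 't::ab_group_add) tensor \<Rightarrow> 't \<Rightarrow> 'm" where
  "one_mu P T = tlift T (msc P) (\<lambda>p q. ract P p (aug P q))"

definition parity :: "('k::field, 'r, 'm::ab_group_add) cplx \<Rightarrow> 'm \<Rightarrow> 'm" where
  "parity P = (THE F. Vector_Spaces.linear (msc P) (msc P) F \<and>
                 (\<forall>i. \<forall>p\<in>gr P i. F p = signed (int i) p))"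

definition parity_one ::
  "('k::field, 'r, 'm::ab_group_add) cplx \<Rightarrow> ('k, 'm, 'm, 't::ab_group_add) tensor \<Rightarrow> 't \<Rightarrow> 't" where
  "parity_one P T = tlift T (tsc T) (\<lambda>p q. tpr T (parity P p) q)"

section \<open>Differential graded coalgebras and homotopies\<close>

text \<open>\<open>T2\<close> is \<open>P \<otimes>\<^sub>R P\<close> and \<open>T3\<close> is \<open>P \<otimes>\<^sub>R (P \<otimes>\<^sub>R P)\<close>.\<close>

definition one_Delta ::
  "('k::field, 'm::ab_group_add, 'm, 't::ab_group_add) tensor \<Rightarrow>
   ('k, 'm, 't, 'u::ab_group_add) tensor \<Rightarrow> ('m \<Rightarrow> 't) \<Rightarrow> 't \<Rightarrow> 'u" where
  "one_Delta T2 T3 \<Delta> = tlift T2 (tsc T3) (\<lambda>p q. tpr T3 p (\<Delta> q))"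

text \<open>\<open>\<Delta> \<otimes> 1\<close> followed by the associativity isomorphism
  \<open>(P \<otimes>\<^sub>R P) \<otimes>\<^sub>R P \<cong> P \<otimes>\<^sub>R (P \<otimes>\<^sub>R P)\<close>.\<close>

definition Delta_one ::
  "('k::field, 'm::ab_group_add, 'm, 't::ab_group_add) tensor \<Rightarrow>
   ('k, 'm, 't, 'u::ab_group_add) tensor \<Rightarrow> ('m \<Rightarrow> 't) \<Rightarrow> 't \<Rightarrow> 'u" where
  "Delta_one T2 T3 \<Delta> =
     tlift T2 (tsc T3) (\<lambda>p q. tlift T2 (tsc T3) (\<lambda>a b. tpr T3 a (tpr T2 b q)) (\<Delta> p))"

definition dg_coalgebra ::
  "('k::field, 'r::ab_group_add) kalg \<Rightarrow> ('k, 'r, 'm::ab_group_add) cplx \<Rightarrow>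
   ('k, 'm, 'm, 't::ab_group_add) tensor \<Rightarrow> ('k, 'm, 't, 'u::ab_group_add) tensor \<Rightarrow>
   ('m \<Rightarrow> 't) \<Rightarrow> bool" where
  "dg_coalgebra R P T2 T3 \<Delta> \<longleftrightarrow>
     projective_resolution R P \<and>
     is_tensor_over P P T2 \<and>
     is_tensor_over P (tensor_cplx R P P T2) T3 \<and>
     \<comment> \<open>\<open>\<Delta>\<close> is a degree \<open>0\<close> chain map of bimodules lifting \<open>R \<cong> R \<otimes>\<^sub>R R\<close>\<close>
     bimod_hom P (tensor_cplx R P P T2) \<Delta> \<and>
     (\<forall>n. \<Delta> ` gr P n \<subseteq> gr (tensor_cplx R P P T2) n) \<and>
     (\<forall>p. \<Delta> (bd P p) = bd (tensor_cplx R P P T2) (\<Delta> p)) \<and>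
     (\<forall>p. aug (tensor_cplx R P P T2) (\<Delta> p) = aug P p) \<and>
     \<comment> \<open>coassociative and counital\<close>
     (\<forall>p. Delta_one T2 T3 \<Delta> (\<Delta> p) = one_Delta T2 T3 \<Delta> (\<Delta> p)) \<and>
     (\<forall>p. mu_one P T2 (\<Delta> p) = p) \<and>
     (\<forall>p. one_mu P T2 (\<Delta> p) = p)"

definition homotopy ::
  "('k::field, 'r::ab_group_add) kalg \<Rightarrow> ('k, 'r, 'm::ab_group_add) cplx \<Rightarrow>
   ('k, 'm, 'm, 't::ab_group_add) tensor \<Rightarrow> ('t \<Rightarrow> 'm) \<Rightarrow> bool" where
  "homotopy R P T2 \<phi> \<longleftrightarrow>
     bimod_hom (tensor_cplx R P P T2) P \<phi> \<and>
     (\<forall>n. \<phi> ` gr (tensor_cplx R P P T2) n \<subseteq> gr P (n + 1)) \<and>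
     (\<forall>z. bd P (\<phi> z) + \<phi> (bd (tensor_cplx R P P T2) z) = mu_one P T2 z - one_mu P T2 z)"

section \<open>Group actions, group algebras and skew group algebras\<close>

definition algebra_action ::
  "('k::field, 's::ab_group_add) kalg \<Rightarrow> ('g::group_add \<Rightarrow> 's \<Rightarrow> 's) \<Rightarrow> bool" where
  "algebra_action S act \<longleftrightarrow>
     (\<forall>s. act 0 s = s) \<and>
     (\<forall>g h s. act (g + h) s = act g (act h s)) \<and>
     (\<forall>g. Vector_Spaces.linear (asc S) (asc S) (act g)) \<and>
     (\<forall>g s t. act g (amul S s t) = amul S (act g s) (act g t)) \<and>
     (\<forall>g. act g (aone S) = aone S)"

text \<open>The multiplication of \<open>'g \<Rightarrow>\<^sub>0 'k\<close> is convolution.\<close>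

definition group_algebra :: "('k::field, 'g::group_add \<Rightarrow>\<^sub>0 'k) kalg" where
  "group_algebra = \<lparr>asc = pm_scale, amul = (*), aone = 1\<rparr>"

text \<open>\<open>S \<rtimes> G\<close>; the element \<open>s g = s \<otimes> g\<close> is \<open>Poly_Mapping.single g s\<close>.\<close>

definition skew_group_algebra ::
  "('k::field, 's::ab_group_add) kalg \<Rightarrow> ('g::{finite,group_add} \<Rightarrow> 's \<Rightarrow> 's) \<Rightarrow> ('k, 'g \<Rightarrow>\<^sub>0 's) kalg"
  where
  "skew_group_algebra S act =
     \<lparr>asc = (\<lambda>c. Poly_Mapping.map (asc S c)),
      amul = (\<lambda>x y. \<Sum>g\<in>UNIV. \<Sum>h\<in>UNIV. Poly_Mapping.single (g + h)
                (amul S (Poly_Mapping.lookup x g) (act g (Poly_Mapping.lookup y h)))),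
      aone = Poly_Mapping.single 0 (aone S)\<rparr>"

text \<open>The inclusion of \<open>kG\<close> into \<open>S \<rtimes> G\<close>.\<close>

definition kG_incl :: "('k::field, 's::ab_group_add) kalg \<Rightarrow> ('g \<Rightarrow>\<^sub>0 'k) \<Rightarrow> ('g \<Rightarrow>\<^sub>0 's)" where
  "kG_incl S = Poly_Mapping.map (\<lambda>c. asc S c (aone S))"

text \<open>\<open>Cg i g\<close> is \<open>(C\<^sub>i)\<^sub>g\<close>.  The \<open>g\<close>-component of \<open>(C \<otimes>\<^bsub>kG\<^esub> C)\<^sub>n\<close> is the sum of the
  \<open>(C\<^sub>p)\<^sub>a \<otimes> (C\<^sub>q)\<^sub>b\<close> with \<open>p + q = n\<close> and \<open>ab = g\<close>.\<close>

definition tensor_Ggr ::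
  "('k::field, 'c, 'c, 't::ab_group_add) tensor \<Rightarrow> (nat \<Rightarrow> 'g::group_add \<Rightarrow> 'c set) \<Rightarrow>
   nat \<Rightarrow> 'g \<Rightarrow> 't set" where
  "tensor_Ggr T2 Cg n g = module.span (tsc T2)
     {tpr T2 c c' | c c' p q a b. c \<in> Cg p a \<and> c' \<in> Cg q b \<and> p + q = n \<and> a + b = g}"

text \<open>A \<open>G\<close>-grading of the complex \<open>C\<close> (in particular respected by the differential) with
  compatible group action, preserved by \<open>\<Delta>\<close> and \<open>\<mu>\<close>.\<close>

definition G_graded ::
  "('k::field, 'g::group_add \<Rightarrow>\<^sub>0 'k, 'c::ab_group_add) cplx \<Rightarrow> ('k, 'c, 'c, 't::ab_group_add) tensor \<Rightarrow>
   ('c \<Rightarrow> 't) \<Rightarrow> (nat \<Rightarrow> 'g \<Rightarrow> 'c set) \<Rightarrow> bool" where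
  "G_graded C T2 \<Delta> Cg \<longleftrightarrow>
     (\<forall>i g. module.subspace (msc C) (Cg i g)) \<and>
     (\<forall>i. direct_sum (gr C i) (Cg i)) \<and>
     (\<forall>i g. bd C ` Cg (Suc i) g \<subseteq> Cg i g) \<and>
     (\<forall>i g1 g2 g3. (\<lambda>c. ract C (lact C (gen g1) c) (gen g3)) ` Cg i g2 = Cg i (g1 + g2 + g3)) \<and>
     (\<forall>i g. \<Delta> ` Cg i g \<subseteq> tensor_Ggr T2 Cg i g) \<and>
     (\<forall>g. aug C ` Cg 0 g \<subseteq> range (\<lambda>c. Poly_Mapping.single g c))"

text \<open>A compatible action of \<open>G\<close> on the complex \<open>D\<close> of \<open>S\<close>-bimodules; on \<open>D \<otimes>\<^sub>S D\<close> the
  group acts diagonally.  Compatibility with the right action of \<open>S\<close> is what makes that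
  diagonal action, and the right action of \<open>S \<rtimes> G\<close> on the twisted product, well defined.\<close>

definition diag_act ::
  "('k::field, 'd, 'd, 't::ab_group_add) tensor \<Rightarrow> ('g \<Rightarrow> 'd \<Rightarrow> 'd) \<Rightarrow> 'g \<Rightarrow> 't \<Rightarrow> 't" where
  "diag_act T2 dact g = tlift T2 (tsc T2) (\<lambda>d d'. tpr T2 (dact g d) (dact g d'))"

definition G_action ::
  "('k::field, 's::ab_group_add, 'd::ab_group_add) cplx \<Rightarrow> ('k, 'd, 'd, 't::ab_group_add) tensor \<Rightarrow>
   ('d \<Rightarrow> 't) \<Rightarrow> ('g::group_add \<Rightarrow> 's \<Rightarrow> 's) \<Rightarrow> ('g \<Rightarrow> 'd \<Rightarrow> 'd) \<Rightarrow> bool" where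
  "G_action D T2 \<Delta> act dact \<longleftrightarrow>
     (\<forall>d. dact 0 d = d) \<and>
     (\<forall>g h d. dact (g + h) d = dact g (dact h d)) \<and>
     (\<forall>g. Vector_Spaces.linear (msc D) (msc D) (dact g)) \<and>
     (\<forall>g j. dact g ` gr D j \<subseteq> gr D j) \<and>
     (\<forall>g s d. dact g (lact D s d) = lact D (act g s) (dact g d)) \<and>
     (\<forall>g s d. dact g (ract D d s) = ract D (dact g d) (act g s)) \<and>
     (\<forall>g d. dact g (bd D d) = bd D (dact g d)) \<and>
     (\<forall>g d. \<Delta> (dact g d) = diag_act T2 dact g (\<Delta> d)) \<and>
     (\<forall>g d. aug D (dact g d) = act g (aug D d))"

text \<open>The homotopies live in the category of \<open>G\<close>-graded complexes, respectively of complexes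
  with \<open>G\<close>-action.\<close>

definition preserves_G_grading ::
  "('k::field, 'c, 'c, 't::ab_group_add) tensor \<Rightarrow> (nat \<Rightarrow> 'g::group_add \<Rightarrow> 'c set) \<Rightarrow> ('t \<Rightarrow> 'c) \<Rightarrow> bool"
  where
  "preserves_G_grading T2 Cg \<phi> \<longleftrightarrow> (\<forall>n g. \<phi> ` tensor_Ggr T2 Cg n g \<subseteq> Cg (n + 1) g)"

definition G_equivariant ::
  "('k::field, 'd, 'd, 't::ab_group_add) tensor \<Rightarrow> ('g \<Rightarrow> 'd \<Rightarrow> 'd) \<Rightarrow> ('t \<Rightarrow> 'd) \<Rightarrow> bool" where
  "G_equivariant T2 dact \<phi> \<longleftrightarrow> (\<forall>g z. \<phi> (diag_act T2 dact g z) = dact g (\<phi> z))"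

section \<open>The twisted product resolution\<close>

text \<open>\<open>XT\<close> is \<open>C \<otimes> D\<close> over the ground field.\<close>

text \<open>\<open>x \<mapsto> s' g' \<cdot> x \<cdot> s g\<close>.\<close>

definition twisted_act ::
  "('k::field, 'g::group_add \<Rightarrow>\<^sub>0 'k, 'c) cplx \<Rightarrow> (nat \<Rightarrow> 'g \<Rightarrow> 'c set) \<Rightarrow> ('k, 's, 'd) cplx \<Rightarrow>
   ('g \<Rightarrow> 's \<Rightarrow> 's) \<Rightarrow> ('g \<Rightarrow> 'd \<Rightarrow> 'd) \<Rightarrow> ('k, 'c, 'd, 'x::ab_group_add) tensor \<Rightarrow>
   's \<Rightarrow> 'g \<Rightarrow> 's \<Rightarrow> 'g \<Rightarrow> 'x \<Rightarrow> 'x" where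
  "twisted_act C Cg D act dact XT s' g' s g =
     (THE F. Vector_Spaces.linear (tsc XT) (tsc XT) F \<and>
        (\<forall>i h. \<forall>c\<in>Cg i h. \<forall>d. F (tpr XT c d) =
           tpr XT (ract C (lact C (gen g') c) (gen g))
                  (lact D (act (- (g' + h + g)) s') (dact (- g) (ract D d s)))))"

definition twisted_product ::
  "('k::field, 's::ab_group_add) kalg \<Rightarrow> ('g::{finite,group_add} \<Rightarrow> 's \<Rightarrow> 's) \<Rightarrow>
   ('k, 'g \<Rightarrow>\<^sub>0 'k, 'c) cplx \<Rightarrow> (nat \<Rightarrow> 'g \<Rightarrow> 'c set) \<Rightarrow> ('k, 's, 'd) cplx \<Rightarrow> ('g \<Rightarrow> 'd \<Rightarrow> 'd) \<Rightarrow>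
   ('k, 'c, 'd, 'x::ab_group_add) tensor \<Rightarrow> ('k, 'g \<Rightarrow>\<^sub>0 's, 'x) cplx" where
  "twisted_product S act C Cg D dact XT =
     \<lparr>msc = tsc XT,
      lact = (\<lambda>a x. \<Sum>g\<in>UNIV.
                twisted_act C Cg D act dact XT (Poly_Mapping.lookup a g) g (aone S) 0 x),
      ract = (\<lambda>x a. \<Sum>g\<in>UNIV.
                twisted_act C Cg D act dact XT (aone S) 0 (Poly_Mapping.lookup a g) g x),
      gr = (\<lambda>n. module.span (tsc XT) {tpr XT c d | c d i j. c \<in> gr C i \<and> d \<in> gr D j \<and> i + j = n}),
      bd = (THE F. Vector_Spaces.linear (tsc XT) (tsc XT) F \<and>
              (\<forall>i. \<forall>c\<in>gr C i. \<forall>d.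
                 F (tpr XT c d) = tpr XT (bd C c) d + signed (int i) (tpr XT c (bd D d)))),
      aug = tlift XT (asc (skew_group_algebra S act))
              (\<lambda>c d. amul (skew_group_algebra S act)
                       (kG_incl S (aug C c)) (Poly_Mapping.single 0 (aug D d)))\<rparr>"

text \<open>In what follows \<open>C2\<close>, \<open>D2\<close>, \<open>X2\<close> are \<open>C \<otimes>\<^bsub>kG\<^esub> C\<close>, \<open>D \<otimes>\<^sub>S D\<close>, \<open>X \<otimes>\<^sub>A X\<close>, \<open>X3\<close> is
  \<open>X \<otimes>\<^sub>A (X \<otimes>\<^sub>A X)\<close>, and \<open>Y\<close> is \<open>(C \<otimes>\<^bsub>kG\<^esub> C) \<otimes> (D \<otimes>\<^sub>S D)\<close>.\<close>

text \<open>\<open>1 \<otimes> \<tau> \<otimes> 1\<close> from \<open>Y\<close> to \<open>X2\<close>; the element \<open>c \<otimes> c' \<otimes> d \<otimes> d'\<close>, with \<open>c'\<close> of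
  \<open>G\<close>-degree \<open>g\<close>, goes to \<open>\<plusminus>(c \<otimes> \<^sup>gd) \<otimes> (c' \<otimes> d')\<close>.\<close>

definition tau_map ::
  "(nat \<Rightarrow> 'g \<Rightarrow> 'c set) \<Rightarrow> ('k::field, 's, 'd) cplx \<Rightarrow> ('g \<Rightarrow> 'd \<Rightarrow> 'd) \<Rightarrow>
   ('k, 'c, 'c, 'c2) tensor \<Rightarrow> ('k, 'd, 'd, 'd2) tensor \<Rightarrow> ('k, 'c, 'd, 'x) tensor \<Rightarrow>
   ('k, 'c2, 'd2, 'y::ab_group_add) tensor \<Rightarrow> ('k, 'x, 'x, 'x2::ab_group_add) tensor \<Rightarrow> 'y \<Rightarrow> 'x2" where
  "tau_map Cg D dact C2 D2 XT Y X2 =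
     (THE F. Vector_Spaces.linear (tsc Y) (tsc X2) F \<and>
        (\<forall>c i g. \<forall>c'\<in>Cg i g. \<forall>j. \<forall>d\<in>gr D j. \<forall>d'.
           F (tpr Y (tpr C2 c c') (tpr D2 d d')) =
             signed (int i * int j) (tpr X2 (tpr XT c (dact g d)) (tpr XT c' d'))))"

definition Delta_X ::
  "(nat \<Rightarrow> 'g \<Rightarrow> 'c set) \<Rightarrow> ('k::field, 's, 'd) cplx \<Rightarrow> ('g \<Rightarrow> 'd \<Rightarrow> 'd) \<Rightarrow>
   ('k, 'c, 'c, 'c2) tensor \<Rightarrow> ('k, 'd, 'd, 'd2) tensor \<Rightarrow> ('k, 'c, 'd, 'x::ab_group_add) tensor \<Rightarrow>
   ('k, 'c2, 'd2, 'y::ab_group_add) tensor \<Rightarrow> ('k, 'x, 'x, 'x2::ab_group_add) tensor \<Rightarrow>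
   ('c \<Rightarrow> 'c2) \<Rightarrow> ('d \<Rightarrow> 'd2) \<Rightarrow> 'x \<Rightarrow> 'x2" where
  "Delta_X Cg D dact C2 D2 XT Y X2 \<Delta>C \<Delta>D =
     tau_map Cg D dact C2 D2 XT Y X2 \<circ> tlift XT (tsc Y) (\<lambda>c d. tpr Y (\<Delta>C c) (\<Delta>D d))"

definition phi_X ::
  "('k::field, 'g \<Rightarrow>\<^sub>0 'k, 'c::ab_group_add) cplx \<Rightarrow> (nat \<Rightarrow> 'g \<Rightarrow> 'c set) \<Rightarrow>
   ('k, 's, 'd::ab_group_add) cplx \<Rightarrow> ('g \<Rightarrow> 'd \<Rightarrow> 'd) \<Rightarrow>
   ('k, 'c, 'c, 'c2::ab_group_add) tensor \<Rightarrow> ('k, 'd, 'd, 'd2::ab_group_add) tensor \<Rightarrow>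
   ('k, 'c, 'd, 'x::ab_group_add) tensor \<Rightarrow>
   ('k, 'c2, 'd2, 'y::ab_group_add) tensor \<Rightarrow> ('k, 'x, 'x, 'x2::ab_group_add) tensor \<Rightarrow>
   ('c2 \<Rightarrow> 'c) \<Rightarrow> ('d2 \<Rightarrow> 'd) \<Rightarrow> 'x2 \<Rightarrow> 'x" where
  "phi_X C Cg D dact C2 D2 XT Y X2 \<phi>C \<phi>D =
     (\<lambda>y. tlift Y (tsc XT) (\<lambda>u v. tpr XT (\<phi>C u) (mu_one D D2 v)) y
        + tlift Y (tsc XT) (\<lambda>u v. tpr XT (one_mu C C2 (parity_one C C2 u)) (\<phi>D v)) y)
     \<circ> inv (tau_map Cg D dact C2 D2 XT Y X2)"

section \<open>Cochains on a resolution and the composition product\<close>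

text \<open>Cochains are defined on all of \<open>X\<close> and vanish off their degree.  Degrees of cochains are
  integers, since the bracket of two cochains of degree \<open>0\<close> has degree \<open>-1\<close> (and is zero).\<close>

definition cochain ::
  "('k::field, 'a::ab_group_add) kalg \<Rightarrow> ('k, 'a, 'x::ab_group_add) cplx \<Rightarrow> int \<Rightarrow> ('x \<Rightarrow> 'a) \<Rightarrow> bool"
  where
  "cochain A X p f \<longleftrightarrow>
     bimod_hom X (regular A) f \<and> (\<forall>l. int l \<noteq> p \<longrightarrow> (\<forall>x\<in>gr X l. f x = 0))"

definition cocycle ::
  "('k::field, 'a::ab_group_add) kalg \<Rightarrow> ('k, 'a, 'x::ab_group_add) cplx \<Rightarrow> int \<Rightarrow> ('x \<Rightarrow> 'a) \<Rightarrow> bool"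
  where "cocycle A X p f \<longleftrightarrow> cochain A X p f \<and> (\<forall>x. f (bd X x) = 0)"

text \<open>\<open>1\<^sub>X \<otimes> f' \<otimes> 1\<^sub>X\<close> for \<open>f'\<close> of degree \<open>m\<close>, with its sign.\<close>

definition one_f_one ::
  "('k::field, 'a, 'x::ab_group_add) cplx \<Rightarrow> ('k, 'x, 'x, 'x2::ab_group_add) tensor \<Rightarrow>
   ('k, 'x, 'x2, 'x3::ab_group_add) tensor \<Rightarrow> nat \<Rightarrow> ('x \<Rightarrow> 'a) \<Rightarrow> 'x3 \<Rightarrow> 'x2" where
  "one_f_one X X2 X3 m f' =
     (THE F. Vector_Spaces.linear (tsc X3) (tsc X2) F \<and>
        (\<forall>i. \<forall>x\<in>gr X i. \<forall>y z.
           F (tpr X3 x (tpr X2 y z)) = signed (int i * int m) (tpr X2 x (lact X (f' y) z))))"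

definition circ_X ::
  "('k::field, 'a, 'x::ab_group_add) cplx \<Rightarrow> ('k, 'x, 'x, 'x2::ab_group_add) tensor \<Rightarrow>
   ('k, 'x, 'x2, 'x3::ab_group_add) tensor \<Rightarrow> ('x \<Rightarrow> 'x2) \<Rightarrow> ('x2 \<Rightarrow> 'x) \<Rightarrow>
   nat \<Rightarrow> ('x \<Rightarrow> 'a) \<Rightarrow> ('x \<Rightarrow> 'a) \<Rightarrow> 'x \<Rightarrow> 'a" where
  "circ_X X X2 X3 \<Delta> \<phi> m f f' = f \<circ> \<phi> \<circ> one_f_one X X2 X3 m f' \<circ> (one_Delta X2 X3 \<Delta> \<circ> \<Delta>)"

definition bracket_X ::
  "('k::field, 'a::ab_group_add, 'x::ab_group_add) cplx \<Rightarrow> ('k, 'x, 'x, 'x2::ab_group_add) tensor \<Rightarrow>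
   ('k, 'x, 'x2, 'x3::ab_group_add) tensor \<Rightarrow> ('x \<Rightarrow> 'x2) \<Rightarrow> ('x2 \<Rightarrow> 'x) \<Rightarrow>
   nat \<Rightarrow> nat \<Rightarrow> ('x \<Rightarrow> 'a) \<Rightarrow> ('x \<Rightarrow> 'a) \<Rightarrow> 'x \<Rightarrow> 'a" where
  "bracket_X X X2 X3 \<Delta> \<phi> n m f f' x =
     circ_X X X2 X3 \<Delta> \<phi> m f f' x
     - signed ((int n - 1) * (int m - 1)) (circ_X X X2 X3 \<Delta> \<phi> n f' f x)"

section \<open>Hochschild cohomology and the Gerstenhaber bracket\<close>

text \<open>For the bar resolution \<open>B\<close>, a bimodule map \<open>B\<^sub>p \<rightarrow> M\<close> is identified with its values
  \<open>F [a\<^sub>1, \<dots>, a\<^sub>p]\<close> on \<open>1 \<otimes> a\<^sub>1 \<otimes> \<cdots> \<otimes> a\<^sub>p \<otimes> 1\<close>, that is, with a linear map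
  \<open>A\<^sup>\<otimes>\<^sup>p \<rightarrow> M\<close>, written as a multilinear function of lists of length \<open>p\<close>.\<close>

definition multilinear ::
  "('k::field, 'a::ab_group_add) kalg \<Rightarrow> ('k \<Rightarrow> 'm \<Rightarrow> 'm::ab_group_add) \<Rightarrow> ('a list \<Rightarrow> 'm) \<Rightarrow> bool" where
  "multilinear A s F \<longleftrightarrow> (\<forall>as bs. Vector_Spaces.linear (asc A) s (\<lambda>a. F (as @ [a] @ bs)))"

definition hcochain ::
  "('k::field, 'a::ab_group_add) kalg \<Rightarrow> int \<Rightarrow> ('a list \<Rightarrow> 'a) \<Rightarrow> bool" where
  "hcochain A p F \<longleftrightarrow> multilinear A (asc A) F \<and> (\<forall>as. int (length as) \<noteq> p \<longrightarrow> F as = 0)"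

text \<open>Composition of \<open>F\<close>, viewed as a bimodule map \<open>B \<rightarrow> M\<close>, with the differential of \<open>B\<close>.\<close>

definition bar_bd ::
  "('k, 'a) kalg \<Rightarrow> ('k, 'a, 'm::ab_group_add, 'z) bimod_scheme \<Rightarrow> ('a list \<Rightarrow> 'm) \<Rightarrow> 'a list \<Rightarrow> 'm"
  where
  "bar_bd A M F as =
     (if as = [] then 0
      else lact M (hd as) (F (tl as))
         + (\<Sum>i = 1..<length as. signed (int i)
              (F (take (i - 1) as @ [amul A (as ! (i - 1)) (as ! i)] @ drop (i + 1) as)))
         + signed (int (length as)) (ract M (F (butlast as)) (last as)))"

definition hcocycle ::
  "('k::field, 'a::ab_group_add) kalg \<Rightarrow> int \<Rightarrow> ('a list \<Rightarrow> 'a) \<Rightarrow> bool" where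
  "hcocycle A p F \<longleftrightarrow> hcochain A p F \<and> (\<forall>as. bar_bd A (regular A) F as = 0)"

definition hcohomologous ::
  "('k::field, 'a::ab_group_add) kalg \<Rightarrow> int \<Rightarrow> ('a list \<Rightarrow> 'a) \<Rightarrow> ('a list \<Rightarrow> 'a) \<Rightarrow> bool" where
  "hcohomologous A p F F' \<longleftrightarrow>
     (\<exists>H. hcochain A (p - 1) H \<and> (\<forall>as. F as - F' as = bar_bd A (regular A) H as))"

definition HH :: "('k::field, 'a::ab_group_add) kalg \<Rightarrow> int \<Rightarrow> ('a list \<Rightarrow> 'a) set set" where
  "HH A p = {{F'. hcocycle A p F' \<and> hcohomologous A p F' F} | F. hcocycle A p F}"

definition circ ::
  "nat \<Rightarrow> nat \<Rightarrow> ('a list \<Rightarrow> 'a) \<Rightarrow> ('a list \<Rightarrow> 'a) \<Rightarrow> 'a list \<Rightarrow> 'a::ab_group_add" where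
  "circ n m F F' as =
     (if length as + 1 = n + m
      then \<Sum>i = 1..n. signed ((int m - 1) * (int i - 1))
             (F (take (i - 1) as @ [F' (take m (drop (i - 1) as))] @ drop (i - 1 + m) as))
      else 0)"

definition gerstenhaber ::
  "nat \<Rightarrow> nat \<Rightarrow> ('a list \<Rightarrow> 'a) \<Rightarrow> ('a list \<Rightarrow> 'a) \<Rightarrow> 'a list \<Rightarrow> 'a::ab_group_add" where
  "gerstenhaber n m F F' as =
     circ n m F F' as - signed ((int n - 1) * (int m - 1)) (circ m n F' F as)"

definition HH_bracket ::
  "('k::field, 'a::ab_group_add) kalg \<Rightarrow> nat \<Rightarrow> nat \<Rightarrow>
   ('a list \<Rightarrow> 'a) set \<Rightarrow> ('a list \<Rightarrow> 'a) set \<Rightarrow> ('a list \<Rightarrow> 'a) set" where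
  "HH_bracket A n m \<alpha> \<beta> =
     {K. hcocycle A (int n + int m - 1) K \<and>
         (\<exists>F\<in>\<alpha>. \<exists>F'\<in>\<beta>. hcohomologous A (int n + int m - 1) K (gerstenhaber n m F F'))}"

text \<open>Chain maps of bimodules \<open>B \<rightarrow> X\<close> lifting the identity of \<open>A\<close>.  Such maps exist and are
  unique up to homotopy; composition with any of them identifies the cohomology of
  \<open>Hom(X, A)\<close> with that of \<open>Hom(B, A)\<close>.\<close>

definition comparison ::
  "('k::field, 'a::ab_group_add) kalg \<Rightarrow> ('k, 'a, 'x::ab_group_add) cplx \<Rightarrow> ('a list \<Rightarrow> 'x) \<Rightarrow> bool" where
  "comparison A X \<theta> \<longleftrightarrow>
     multilinear A (msc X) \<theta> \<and>
     (\<forall>as. \<theta> as \<in> gr X (length as)) \<and>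
     aug X (\<theta> []) = aone A \<and>
     (\<forall>as. bd X (\<theta> as) = bar_bd A X \<theta> as)"

text \<open>The class \<open>\<alpha>\<close> in degree \<open>p\<close> is represented by the cocycle \<open>f\<close> on \<open>X\<close>.\<close>

definition HH_represents ::
  "('k::field, 'a::ab_group_add) kalg \<Rightarrow> ('k, 'a, 'x::ab_group_add) cplx \<Rightarrow> int \<Rightarrow>
   ('x \<Rightarrow> 'a) \<Rightarrow> ('a list \<Rightarrow> 'a) set \<Rightarrow> bool" where
  "HH_represents A X p f \<alpha> \<longleftrightarrow>
     cocycle A X p f \<and> \<alpha> \<in> HH A p \<and> (\<exists>\<theta>. comparison A X \<theta> \<and> f \<circ> \<theta> \<in> \<alpha>)"

end

theory Submission
  imports Defs
begin

text \<open>For a cocycle \<open>f'\<close> of degree \<open>m\<close> the map \<open>\<psi> = \<phi> (1 \<otimes> f' \<otimes> 1) (1 \<otimes> \<Delta>) \<Delta>\<close> satisfies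
  \<open>\<partial> \<psi> + (-1)\<^sup>m \<psi> \<partial> = (f' \<otimes> 1 - 1 \<otimes> f') \<Delta>\<close> up to signs.  Along a comparison map \<open>\<theta>\<close> from the bar
  resolution, \<open>\<psi> \<theta>\<close> and the circle product with \<open>f' \<theta>\<close> therefore differ, after correction by a
  homotopy between \<open>\<Delta> \<theta>\<close> and \<open>(\<theta> \<otimes> \<theta>) \<Delta>\<close>, by a null homotopic map; the correction terms
  cancel in the graded commutator.  This works for every differential graded coalgebra with a
  homotopy \<open>\<phi>\<close>.  The twisted product \<open>X\<close> is one: \<open>1 \<otimes> \<tau> \<otimes> 1\<close> is an isomorphism of complexes, and
  through it \<open>X\<close> inherits \<open>\<Delta>\<close> and \<open>\<phi>\<close> from \<open>C\<close> and \<open>D\<close>.\<close>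

section \<open>Linear maps and signs\<close>

text \<open>A cochain on the bar resolution is a multilinear function of lists, so homotopies out of
  that resolution need no lifting argument: they come by recursion on the length from a contraction
  of the target. Two contractions of a resolution \<open>P\<close> serve as input. One is
  \<open>k\<close>-linear. The other is right \<open>R\<close>-linear; it exists because the terms
  are projective, and its right linearity is what allows \<open>s \<otimes> 1\<close> on
  \<open>P \<otimes> P\<close> over \<open>R\<close>. The obstacle sits in degree 0, where the
  recursion works only for maps with zero augmentation. The homotopy \<open>h\<close> between the
  two diagonals can be kept in the kernel of \<open>\<mu> \<otimes> 1\<close>, but its image under
  \<open>1 \<otimes> \<mu>\<close> is then merely null homotopic. The difference of the circle
  products thus has a coboundary as augmentation, which is lifted to degree 0 and subtracted. On
  \<open>X\<close> signs and twists depend on the degree and the group degree of the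
  \<open>C\<close> factor, so its structure maps are defined on the pieces \<open>Cg i g\<close> and
  extended. The left action reads off a group degree and the right one moves \<open>D\<close> by a
  group element; hence a homotopy on \<open>C\<close> that keeps degrees and one on \<open>D\<close>
  that is equivariant combine to an \<open>A\<close>-bilinear one.\<close>

abbreviation lin :: "('k::field \<Rightarrow> 'a \<Rightarrow> 'a::ab_group_add) \<Rightarrow> ('k \<Rightarrow> 'b \<Rightarrow> 'b::ab_group_add) \<Rightarrow> ('a \<Rightarrow> 'b) \<Rightarrow> bool"
  where "lin \<equiv> Vector_Spaces.linear"

lemma linI:
  assumes "vector_space s1" "vector_space s2"
    and "\<And>x y. f (x + y) = f x + f y" "\<And>c x. f (s1 c x) = s2 c (f x)"
  shows "lin s1 s2 f"
  using assms by (simp add: Vector_Spaces.linear_iff)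

lemma lin_vs: "lin s1 s2 f \<Longrightarrow> vector_space s1" "lin s1 s2 f \<Longrightarrow> vector_space s2"
  by (simp_all add: Vector_Spaces.linear_iff)

lemma lin_add: "lin s1 s2 f \<Longrightarrow> f (x + y) = f x + f y"
  and lin_scale: "lin s1 s2 f \<Longrightarrow> f (s1 c x) = s2 c (f x)"
  by (simp_all add: Vector_Spaces.linear_iff)

lemma additive_0: "(\<And>x y. f (x + y) = f x + f y) \<Longrightarrow> f (0::'a::ab_group_add) = (0::'b::ab_group_add)"
  by (metis add_cancel_right_right)

lemma additive_neg:
  assumes "\<And>x y. f (x + y) = f x + (f y :: 'b::ab_group_add)"
  shows "f (- x :: 'a::ab_group_add) = - f x"
  using additive_0[of f, OF assms] assms[of "- x" x] by (simp add: eq_neg_iff_add_eq_0)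

lemma additive_sum:
  assumes "\<And>x y. f (x + y) = f x + (f y :: 'b::ab_group_add)"
  shows "f (\<Sum>i\<in>I. g i :: 'a::ab_group_add) = (\<Sum>i\<in>I. f (g i))"
  by (induction I rule: infinite_finite_induct) (simp_all add: additive_0[of f, OF assms] assms)

lemma lin_0: "lin s1 s2 f \<Longrightarrow> f 0 = 0"
  by (rule additive_0) (rule lin_add)

lemma lin_neg: "lin s1 s2 f \<Longrightarrow> f (- x) = - f x"
  by (rule additive_neg) (rule lin_add)

lemma lin_diff: "lin s1 s2 f \<Longrightarrow> f (x - y) = f x - f y"
  using lin_add[of s1 s2 f x "- y"] lin_neg[of s1 s2 f y] by simp

lemma lin_sum: "lin s1 s2 f \<Longrightarrow> f (\<Sum>i\<in>I. g i) = (\<Sum>i\<in>I. f (g i))"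
  by (rule additive_sum) (rule lin_add)

lemma lin_signed: "lin s1 s2 f \<Longrightarrow> f (signed e x) = signed e (f x)"
  by (simp add: signed_def lin_neg)

lemmas lin_simps = lin_add lin_0 lin_neg lin_diff lin_sum lin_signed

lemma vs_add: "vector_space s \<Longrightarrow> s c (x + y) = s c x + s c y"
  and vs_add_left: "vector_space s \<Longrightarrow> s (c + d) x = s c x + s d x"
  and vs_assoc: "vector_space s \<Longrightarrow> s c (s d x) = s (c * d) x"
  and vs_one: "vector_space s \<Longrightarrow> s 1 x = x"
  by (simp_all add: vector_space_def)

lemma vs_0_left: "vector_space s \<Longrightarrow> s 0 x = 0"
  by (rule additive_0[of "\<lambda>c. s c x"]) (rule vs_add_left)

lemma lin_scale_map: "vector_space s \<Longrightarrow> lin s s (s c)"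
  by (rule linI) (simp_all add: vs_add vs_assoc mult.commute)

lemmas vs_simps = lin_simps[OF lin_scale_map]

lemma lin_id: "vector_space s \<Longrightarrow> lin s s (\<lambda>x. x)"
  by (rule linI) simp_all

lemma lin_zero: "vector_space s1 \<Longrightarrow> vector_space s2 \<Longrightarrow> lin s1 s2 (\<lambda>x. 0)"
  by (rule linI) (simp_all add: vs_simps(2))

lemma lin_comp: "lin s1 s2 f \<Longrightarrow> lin s2 s3 g \<Longrightarrow> lin s1 s3 (\<lambda>x. g (f x))"
  by (rule linI) (simp_all add: lin_vs lin_add lin_scale)

lemma lin_plus: "lin s1 s2 f \<Longrightarrow> lin s1 s2 g \<Longrightarrow> lin s1 s2 (\<lambda>x. f x + g x)"
  by (rule linI) (simp_all add: lin_vs lin_add lin_scale vs_add[OF lin_vs(2)] algebra_simps)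

lemma lin_uminus: "lin s1 s2 f \<Longrightarrow> lin s1 s2 (\<lambda>x. - f x)"
  by (rule linI) (simp_all add: lin_vs lin_add lin_scale vs_simps(3)[OF lin_vs(2)])

lemma lin_minus: "lin s1 s2 f \<Longrightarrow> lin s1 s2 g \<Longrightarrow> lin s1 s2 (\<lambda>x. f x - g x)"
  using lin_plus[of s1 s2 f "\<lambda>x. - g x"] lin_uminus[of s1 s2 g] by simp

lemma lin_sgn: "lin s1 s2 f \<Longrightarrow> lin s1 s2 (\<lambda>x. signed e (f x))"
  by (cases "even e") (simp_all add: signed_def lin_uminus)

lemma lin_sums:
  assumes "vector_space s1" "vector_space s2" "\<And>i. i \<in> I \<Longrightarrow> lin s1 s2 (f i)"
  shows "lin s1 s2 (\<lambda>x. \<Sum>i\<in>I. f i x)"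
  using assms(3)
  by (induction I rule: infinite_finite_induct) (simp_all add: lin_zero assms(1,2) lin_plus)

lemma lin_smult: "lin s1 s2 f \<Longrightarrow> lin s1 s2 (\<lambda>x. s2 c (f x))"
  by (rule lin_comp[OF _ lin_scale_map]) (simp_all add: lin_vs)

lemmas lin_intros = lin_plus lin_minus lin_uminus lin_sgn lin_smult

lemma signed_add: "signed e (x + y) = signed e x + signed e y"
  and signed_neg: "signed e (- x) = - signed e x"
  and signed_diff: "signed e (x - y) = signed e x - signed e y"
  and signed_0: "signed e 0 = 0"
  and signed_signed: "signed e (signed e' x) = signed (e + e') x"
  and signed_zero: "signed 0 x = x"
  and signed_Suc: "signed (1 + e) x = - signed e x"
  and signed_pred: "- signed (e - 1) x = signed e x"
  and signed_double [simp]: "signed (e + e) x = x" "signed (2 * e) x = x"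
  by (auto simp: signed_def)

lemma signed_cong: "even (e - e') \<Longrightarrow> signed e x = signed e' x"
  by (auto simp: signed_def)

lemma signed_sum: "signed e (\<Sum>i\<in>I. f i) = (\<Sum>i\<in>I. signed e (f i))"
  by (simp add: signed_def sum_negf)

lemma subspaceD:
  assumes "vector_space s" "module.subspace s V"
  shows "0 \<in> V" "x \<in> V \<Longrightarrow> y \<in> V \<Longrightarrow> x + y \<in> V" "x \<in> V \<Longrightarrow> s c x \<in> V"
    "x \<in> V \<Longrightarrow> - x \<in> V" "x \<in> V \<Longrightarrow> y \<in> V \<Longrightarrow> x - y \<in> V" "x \<in> V \<Longrightarrow> signed e x \<in> V"
    "(\<And>i. i \<in> I \<Longrightarrow> g i \<in> V) \<Longrightarrow> (\<Sum>i\<in>I. g i) \<in> V"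
proof -
  interpret vector_space s by fact
  show "0 \<in> V" "x \<in> V \<Longrightarrow> y \<in> V \<Longrightarrow> x + y \<in> V" "x \<in> V \<Longrightarrow> s c x \<in> V"
    "x \<in> V \<Longrightarrow> - x \<in> V" "x \<in> V \<Longrightarrow> y \<in> V \<Longrightarrow> x - y \<in> V"
    "(\<And>i. i \<in> I \<Longrightarrow> g i \<in> V) \<Longrightarrow> (\<Sum>i\<in>I. g i) \<in> V"
    using assms(2) by (auto intro: subspace_0 subspace_add subspace_scale subspace_neg subspace_diff subspace_sum)
  then show "x \<in> V \<Longrightarrow> signed e x \<in> V" by (simp add: signed_def)
qed

lemma subspaceI:
  assumes "vector_space s" "0 \<in> V" "\<And>x y. x \<in> V \<Longrightarrow> y \<in> V \<Longrightarrow> x + y \<in> V"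
    "\<And>c x. x \<in> V \<Longrightarrow> s c x \<in> V"
  shows "module.subspace s V"
proof -
  interpret vector_space s by fact
  show ?thesis using assms(2-) by (simp add: subspace_def)
qed

lemma span_sub: "vector_space s \<Longrightarrow> module.subspace s (module.span s B)"
  by (metis module.subspace_span module_iff_vector_space)

lemma span_mem: "vector_space s \<Longrightarrow> x \<in> B \<Longrightarrow> x \<in> module.span s B"
  by (metis module.span_base module_iff_vector_space)

lemma span_to_subspace:
  assumes "vector_space s" "x \<in> module.span s B" "module.subspace s V" "B \<subseteq> V"
  shows "x \<in> V"
  using assms by (metis module.span_minimal module_iff_vector_space subsetD)

lemma span_lin_ind:
  assumes "vector_space s" "x \<in> module.span s B" "\<And>b. b \<in> B \<Longrightarrow> P b" "P 0"
    "\<And>x y. P x \<Longrightarrow> P y \<Longrightarrow> P (x + y)" "\<And>c x. P x \<Longrightarrow> P (s c x)"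
  shows "P x"
proof -
  have "x \<in> {x. P x}"
    by (rule span_to_subspace[OF assms(1,2)]) (use assms in \<open>auto intro!: subspaceI\<close>)
  then show ?thesis by simp
qed

section \<open>Free vector spaces\<close>

lemma lookup_pm_scale [simp]: "Poly_Mapping.lookup (pm_scale c z) i = c * Poly_Mapping.lookup z i"
  unfolding pm_scale_def by (transfer) (auto simp: when_def)

lemma vs_pm_scale: "vector_space pm_scale"
  by (simp add: vector_space_def poly_mapping_eq_iff fun_eq_iff lookup_add algebra_simps)

lemma free_ext_superset:
  assumes "vector_space s" "finite K" "Poly_Mapping.keys z \<subseteq> K"
  shows "free_ext s h z = (\<Sum>i\<in>K. s (Poly_Mapping.lookup z i) (h i))"
  unfolding free_ext_def
  by (rule sum.mono_neutral_left) (use assms in \<open>auto simp: in_keys_iff vs_0_left\<close>)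

lemma lin_free_ext:
  fixes s :: "'k::field \<Rightarrow> 'm \<Rightarrow> 'm::ab_group_add" and h :: "'i \<Rightarrow> 'm"
  assumes "vector_space s"
  shows "lin pm_scale s (free_ext s h)"
proof (rule linI[OF vs_pm_scale assms])
  fix x y :: "'i \<Rightarrow>\<^sub>0 'k"
  let ?K = "Poly_Mapping.keys x \<union> Poly_Mapping.keys y"
  have "Poly_Mapping.keys (x + y) \<subseteq> ?K" by (rule Poly_Mapping.keys_add)
  then show "free_ext s h (x + y) = free_ext s h x + free_ext s h y"
    by (simp add: free_ext_superset[OF assms, of ?K] lookup_add vs_add_left[OF assms] sum.distrib)
next
  fix c and x :: "'i \<Rightarrow>\<^sub>0 'k"
  have "Poly_Mapping.keys (pm_scale c x) \<subseteq> Poly_Mapping.keys x" by (auto simp: in_keys_iff)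
  then show "free_ext s h (pm_scale c x) = s c (free_ext s h x)"
    by (simp add: free_ext_superset[OF assms, of "Poly_Mapping.keys x"] vs_simps(5)[OF assms] vs_assoc[OF assms])
qed

lemma lin_free_eq:
  assumes L: "lin pm_scale s f"
  shows "f z = free_ext s (\<lambda>i. f (gen i)) z"
proof -
  have "z = (\<Sum>i\<in>Poly_Mapping.keys z. pm_scale (Poly_Mapping.lookup z i) (gen i))"
    by (rule poly_mapping_eqI)
      (simp add: lookup_sum lookup_single when_def if_distrib[of "\<lambda>x. _ * x"] sum.delta in_keys_iff cong: if_cong)
  then have "f z = f (\<Sum>i\<in>Poly_Mapping.keys z. pm_scale (Poly_Mapping.lookup z i) (gen i))" by simp
  then show ?thesis by (simp only: free_ext_def lin_sum[OF L] lin_scale[OF L])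
qed

lemma free_ext_gen: "vector_space s \<Longrightarrow> free_ext s h (gen i) = h i"
  by (simp add: free_ext_def vs_one)

section \<open>Tensor products\<close>

lemma tensor_vs: "is_tensor sM sN \<rho> \<Lambda> T \<Longrightarrow> vector_space (tsc T)"
  by (simp add: is_tensor_def)

lemma tensor_rel_0:
  assumes "is_tensor sM sN \<rho> \<Lambda> T"
    and "z \<in> tensor_rels sM sN \<rho> \<Lambda>"
  shows "free_ext (tsc T) (\<lambda>(m, n). tpr T m n) z = 0"
  using assms by (simp add: is_tensor_def)

lemma
  assumes T: "is_tensor sM sN \<rho> \<Lambda> T"
  shows tpr_add_left: "tpr T (m + m') n = tpr T m n + tpr T m' n"
    and tpr_add_right: "tpr T m (n + n') = tpr T m n + tpr T m n'"
    and tpr_scale_left: "tpr T (sM c m) n = tsc T c (tpr T m n)"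
    and tpr_scale_right: "tpr T m (sN c n) = tsc T c (tpr T m n)"
    and tpr_bal: "tpr T (\<rho> m r) n = tpr T m (\<Lambda> r n)"
proof -
  note vs = tensor_vs[OF T]
  note L = lin_free_ext[OF vs, of "\<lambda>(m, n). tpr T m n"]
  note simps = lin_diff[OF L] lin_scale[OF L] free_ext_gen[OF vs] lin_add[OF L]
  have *: "free_ext (tsc T) (\<lambda>(m, n). tpr T m n) z = 0"
    if "z \<in> {gen (m + m', n) - gen (m, n) - gen (m', n) | m m' n. True} \<union>
      {gen (m, n + n') - gen (m, n) - gen (m, n') | m n n'. True} \<union>
      {gen (sM c m, n) - pm_scale c (gen (m, n)) | c m n. True} \<union>
      {gen (m, sN c n) - pm_scale c (gen (m, n)) | c m n. True} \<union>
      {gen (\<rho> m r, n) - gen (m, \<Lambda> r n) | m r n. True}" for z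
    by (rule tensor_rel_0[OF T]) (unfold tensor_rels_def, rule span_mem[OF vs_pm_scale that])
  show "tpr T (m + m') n = tpr T m n + tpr T m' n"
    using *[of "gen (m + m', n) - gen (m, n) - gen (m', n)", OF UnI1, OF UnI1, OF UnI1, OF UnI1] by (fastforce simp: simps algebra_simps)
  show "tpr T m (n + n') = tpr T m n + tpr T m n'"
    using *[of "gen (m, n + n') - gen (m, n) - gen (m, n')", OF UnI1, OF UnI1, OF UnI1, OF UnI2] by (fastforce simp: simps algebra_simps)
  show "tpr T (sM c m) n = tsc T c (tpr T m n)"
    using *[of "gen (sM c m, n) - pm_scale c (gen (m, n))", OF UnI1, OF UnI1, OF UnI2] by (fastforce simp: simps algebra_simps)
  show "tpr T m (sN c n) = tsc T c (tpr T m n)"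
    using *[of "gen (m, sN c n) - pm_scale c (gen (m, n))", OF UnI1, OF UnI2] by (fastforce simp: simps algebra_simps)
  show "tpr T (\<rho> m r) n = tpr T m (\<Lambda> r n)"
    using *[of "gen (\<rho> m r, n) - gen (m, \<Lambda> r n)", OF UnI2] by (fastforce simp: simps)
qed

text \<open>Scalars are absorbed into the left factor and \<open>0\<close> is itself a pure tensor,
  so sums of pure tensors exhaust the type and no closure under scalars has to be assumed.\<close>

lemma tensor_induct:
  assumes T: "is_tensor sM sN \<rho> \<Lambda> T"
    and "\<And>m n. P (tpr T m n)" "\<And>x y. P x \<Longrightarrow> P y \<Longrightarrow> P (x + y)"
  shows "P t"
proof -
  note vs = tensor_vs[OF T]
  obtain z where t: "t = free_ext (tsc T) (\<lambda>(m, n). tpr T m n) z"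
    using T by (auto simp: is_tensor_def surj_def)
  have P0: "P 0"
    using assms(2)[of 0 0] by (simp add: additive_0[of "\<lambda>m. tpr T m 0", OF tpr_add_left[OF T]])
  have "P (\<Sum>i\<in>K. tsc T (u i) (case i of (m, n) \<Rightarrow> tpr T m n))" for K u
    by (induction K rule: infinite_finite_induct)
      (auto simp: P0 tpr_scale_left[OF T, symmetric] split: prod.split intro!: assms(2,3))
  then show ?thesis unfolding t free_ext_def by simp
qed

lemma tensor_lin_eq:
  assumes T: "is_tensor sM sN \<rho> \<Lambda> T"
    and "\<And>x y. F (x + y) = F x + F y" "\<And>x y. G (x + y) = G x + G y"
    and "\<And>m n. F (tpr T m n) = G (tpr T m n)"
  shows "F t = G t"
  by (rule tensor_induct[OF T]) (simp_all add: assms(2-))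

text \<open>The kernel of the presentation by the free space is exactly the span of the relations,
  and a balanced bilinear \<open>h\<close>, extended to the free space, kills each of them. It
  therefore factors, through an arbitrary choice of preimages.\<close>

lemma tensor_ex:
  assumes T: "is_tensor sM sN \<rho> \<Lambda> T" and s: "vector_space s"
    and h: "\<And>m m' n. h (m + m') n = h m n + h m' n" "\<And>m n n'. h m (n + n') = h m n + h m n'"
      "\<And>c m n. h (sM c m) n = s c (h m n)" "\<And>c m n. h m (sN c n) = s c (h m n)"
      "\<And>m r n. h (\<rho> m r) n = h m (\<Lambda> r n)"
  shows "\<exists>F. lin (tsc T) s F \<and> (\<forall>m n. F (tpr T m n) = h m n)"
proof -
  note vs = tensor_vs[OF T]
  let ?p = "free_ext (tsc T) (\<lambda>(m, n). tpr T m n)" and ?h = "free_ext s (\<lambda>(m, n). h m n)"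
  note Lp = lin_free_ext[OF vs, of "\<lambda>(m, n). tpr T m n"]
  note Lh = lin_free_ext[OF s, of "\<lambda>(m, n). h m n"]
  have ker: "?h z = 0" if "?p z = 0" for z
  proof -
    have "z \<in> tensor_rels sM sN \<rho> \<Lambda>" using T that by (simp add: is_tensor_def)
    then show ?thesis unfolding tensor_rels_def
      by (rule span_lin_ind[OF vs_pm_scale])
        (auto simp: lin_simps[OF Lh] lin_scale[OF Lh] free_ext_gen[OF s] h vs_simps(2)[OF s])
  qed
  have wd: "?h z = ?h z'" if "?p z = ?p z'" for z z'
    using ker[of "z - z'"] that by (simp add: lin_diff[OF Lp] lin_diff[OF Lh])
  define F where "F t = ?h (SOME z. ?p z = t)" for t
  have F: "F (?p z) = ?h z" for z
    unfolding F_def by (rule wd, rule someI[of _ z], rule refl)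
  have surj: "\<exists>z. t = ?p z" for t using T by (auto simp: is_tensor_def surj_def)
  have "lin (tsc T) s F"
  proof (rule linI[OF vs s])
    fix x y show "F (x + y) = F x + F y"
      using surj[of x] surj[of y] by (auto simp: F lin_add[OF Lp, symmetric] lin_add[OF Lh])
  next
    fix c x show "F (tsc T c x) = s c (F x)"
      using surj[of x] by (auto simp: F lin_scale[OF Lp, symmetric] lin_scale[OF Lh])
  qed
  moreover have "F (tpr T m n) = h m n" for m n
    using F[of "gen (m, n)"] by (simp add: free_ext_gen[OF s] free_ext_gen[OF vs])
  ultimately show ?thesis by blast
qed

lemma tlift_unique:
  assumes T: "is_tensor sM sN \<rho> \<Lambda> T" and "lin (tsc T) s F" "\<And>m n. F (tpr T m n) = h m n"
  shows "tlift T s h = F"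
  unfolding tlift_def
proof (rule the_equality)
  fix G assume G: "lin (tsc T) s G \<and> (\<forall>m n. G (tpr T m n) = h m n)"
  show "G = F"
    by (rule ext, rule tensor_lin_eq[OF T, where F = G and G = F])
      (use G in \<open>auto simp: lin_add[OF assms(2)] assms(3) intro: lin_add\<close>)
qed (use assms in simp)

lemma
  assumes T: "is_tensor sM sN \<rho> \<Lambda> T" and s: "vector_space s"
    and h: "\<And>m m' n. h (m + m') n = h m n + h m' n" "\<And>m n n'. h m (n + n') = h m n + h m n'"
      "\<And>c m n. h (sM c m) n = s c (h m n)" "\<And>c m n. h m (sN c n) = s c (h m n)"
      "\<And>m r n. h (\<rho> m r) n = h m (\<Lambda> r n)"
  shows lin_tlift: "lin (tsc T) s (tlift T s h)"
    and tlift_tpr: "tlift T s h (tpr T m n) = h m n"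
proof -
  obtain F where F: "lin (tsc T) s F" "\<And>m n. F (tpr T m n) = h m n"
    using tensor_ex[of sM sN \<rho> \<Lambda> T s h, OF T s h] by blast
  have "tlift T s h = F" by (rule tlift_unique[OF T F])
  with F show "lin (tsc T) s (tlift T s h)" "tlift T s h (tpr T m n) = h m n" by simp_all
qed

section \<open>Direct sums\<close>

definition dcomp :: "('i \<Rightarrow> 'm::ab_group_add set) \<Rightarrow> 'i \<Rightarrow> 'm \<Rightarrow> 'm" where
  "dcomp F i v = (THE p. (\<forall>i. p i \<in> F i) \<and> finite {i. p i \<noteq> 0} \<and> v = (\<Sum>i\<in>{i. p i \<noteq> 0}. p i)) i"

text \<open>The values of \<open>L i\<close> matter on \<open>F i\<close> only. This allows formulas
  in which the degree occurs as a parameter, such as a sign or the twist by a group degree, and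
  which have no meaning on inhomogeneous elements.\<close>

definition gext :: "('i \<Rightarrow> 'm::ab_group_add set) \<Rightarrow> ('i \<Rightarrow> 'm \<Rightarrow> 'n) \<Rightarrow> 'm \<Rightarrow> 'n::ab_group_add" where
  "gext F L v = (\<Sum>i\<in>{i. dcomp F i v \<noteq> 0}. L i (dcomp F i v))"

locale grading =
  fixes s :: "'k::field \<Rightarrow> 'm \<Rightarrow> 'm::ab_group_add" and F :: "'i \<Rightarrow> 'm set"
  assumes vs: "vector_space s" and sub: "\<And>i. module.subspace s (F i)" and ds: "direct_sum UNIV F"
begin

lemmas F_mem = subspaceD[OF vs sub]

lemma dcomp_ex1: "\<exists>!p. (\<forall>i. p i \<in> F i) \<and> finite {i. p i \<noteq> 0} \<and> v = (\<Sum>i\<in>{i. p i \<noteq> 0}. p i)"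
  using ds by (simp add: direct_sum_def)

lemma
  shows dcomp_mem: "dcomp F i v \<in> F i"
    and dcomp_fin: "finite {i. dcomp F i v \<noteq> 0}"
    and dcomp_sum: "v = (\<Sum>i\<in>{i. dcomp F i v \<noteq> 0}. dcomp F i v)"
  using theI'[OF dcomp_ex1[of v]] unfolding dcomp_def by blast+

lemma dcomp_eqI:
  assumes "\<And>i. p i \<in> F i" "finite K" "\<And>i. i \<notin> K \<Longrightarrow> p i = 0" "v = (\<Sum>i\<in>K. p i)"
  shows "dcomp F i v = p i"
proof -
  have sub: "{i. p i \<noteq> 0} \<subseteq> K" using assms(3) by auto
  have "v = (\<Sum>i\<in>{i. p i \<noteq> 0}. p i)"
    unfolding assms(4) by (rule sum.mono_neutral_right) (use assms sub in auto)
  then have "(THE p. (\<forall>i. p i \<in> F i) \<and> finite {i. p i \<noteq> 0} \<and> v = (\<Sum>i\<in>{i. p i \<noteq> 0}. p i)) = p"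
    by (intro the1_equality[OF dcomp_ex1]) (use assms sub in \<open>auto intro: finite_subset\<close>)
  then show ?thesis by (simp add: dcomp_def)
qed

lemma dcomp_sum_superset:
  assumes "finite K" "{i. dcomp F i v \<noteq> 0} \<subseteq> K"
  shows "(\<Sum>i\<in>K. dcomp F i v) = v"
  using sum.mono_neutral_left[OF assms, of "\<lambda>i. dcomp F i v"] dcomp_sum[of v] by simp

lemma dcomp_lin: "lin s s (dcomp F i)"
proof (rule linI[OF vs vs])
  fix x y
  let ?K = "{i. dcomp F i x \<noteq> 0} \<union> {i. dcomp F i y \<noteq> 0}"
  show "dcomp F i (x + y) = dcomp F i x + dcomp F i y"
    by (rule dcomp_eqI[of _ ?K])
      (auto simp: dcomp_fin dcomp_sum_superset sum.distrib intro: F_mem dcomp_mem)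
next
  fix c x
  let ?K = "{i. dcomp F i x \<noteq> 0}"
  show "dcomp F i (s c x) = s c (dcomp F i x)"
    by (rule dcomp_eqI[of _ ?K])
      (auto simp: dcomp_fin dcomp_sum[symmetric] vs_simps[OF vs, symmetric] vs_simps(2)[OF vs] intro: F_mem dcomp_mem)
qed

lemma dcomp_same: "x \<in> F i \<Longrightarrow> dcomp F j x = (if j = i then x else 0)"
  by (rule dcomp_eqI[of _ "{i}"]) (auto intro: F_mem)

lemma dsum_induct:
  assumes "\<And>i x. x \<in> F i \<Longrightarrow> P x" "\<And>x y. P x \<Longrightarrow> P y \<Longrightarrow> P (x + y)"
  shows "P x"
proof -
  have P0: "P 0" using assms(1)[OF F_mem(1)] .
  have "P (\<Sum>i\<in>K. dcomp F i x)" for K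
    by (induction K rule: infinite_finite_induct) (auto simp: P0 intro!: assms(2) assms(1)[OF dcomp_mem])
  then show ?thesis using dcomp_sum[of x] by metis
qed

lemma gext_superset:
  assumes "finite K" "{i. dcomp F i v \<noteq> 0} \<subseteq> K" "\<And>i. L i 0 = 0"
  shows "gext F L v = (\<Sum>i\<in>K. L i (dcomp F i v))"
  unfolding gext_def by (rule sum.mono_neutral_left) (use assms in auto)

lemma
  assumes s2: "vector_space s2"
    and L: "\<And>i x y. x \<in> F i \<Longrightarrow> y \<in> F i \<Longrightarrow> L i (x + y) = L i x + L i y"
      "\<And>i c x. x \<in> F i \<Longrightarrow> L i (s c x) = s2 c (L i x)"
  shows gext_lin: "lin s s2 (gext F L)"
    and gext_eq: "x \<in> F i \<Longrightarrow> gext F L x = L i x"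
proof -
  have L0: "L i 0 = 0" for i using L(1)[OF F_mem(1) F_mem(1), of i] by simp
  show "lin s s2 (gext F L)"
  proof (rule linI[OF vs s2])
    fix x y
    let ?K = "{i. dcomp F i x \<noteq> 0} \<union> {i. dcomp F i y \<noteq> 0}"
    have "finite ?K" by (simp add: dcomp_fin)
    moreover have "{i. dcomp F i (x + y) \<noteq> 0} \<subseteq> ?K" by (auto simp: lin_add[OF dcomp_lin])
    ultimately show "gext F L (x + y) = gext F L x + gext F L y"
      by (simp add: gext_superset[of ?K _ L, OF _ _ L0] lin_add[OF dcomp_lin] L dcomp_mem sum.distrib)
  next
    fix c x
    let ?K = "{i. dcomp F i x \<noteq> 0}"
    have "{i. dcomp F i (s c x) \<noteq> 0} \<subseteq> ?K" by (auto simp: lin_scale[OF dcomp_lin] vs_simps(2)[OF vs])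
    then show "gext F L (s c x) = s2 c (gext F L x)"
      by (simp add: gext_superset[of ?K _ L, OF dcomp_fin _ L0] lin_scale[OF dcomp_lin] L dcomp_mem vs_simps(5)[OF s2])
  qed
  assume x: "x \<in> F i"
  have "{j. dcomp F j x \<noteq> 0} \<subseteq> {i}" by (auto simp: dcomp_same[OF x])
  then show "gext F L x = L i x"
    by (simp add: gext_superset[of "{i}" _ L, OF _ _ L0] dcomp_same[OF x])
qed

end

lemma direct_sum_projections:
  assumes s: "vector_space s" and p: "\<And>i. lin s s (\<pi> i)" and "\<And>i x. \<pi> i x \<in> F i"
    and F: "\<And>i j x. x \<in> F j \<Longrightarrow> \<pi> i x = (if i = j then x else 0)"
    and fin: "\<And>x. finite {i. \<pi> i x \<noteq> 0}" and sum: "\<And>x. x = (\<Sum>i\<in>{i. \<pi> i x \<noteq> 0}. \<pi> i x)"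
  shows "direct_sum UNIV F"
  unfolding direct_sum_def
proof (intro conjI allI ballI ex1I)
  fix v
  show "\<pi> i v \<in> F i" "finite {i. \<pi> i v \<noteq> 0}" "v = (\<Sum>i\<in>{i. \<pi> i v \<noteq> 0}. \<pi> i v)" for i
    using assms by blast+
  fix p assume p': "(\<forall>i. p i \<in> F i) \<and> finite {i. p i \<noteq> 0} \<and> v = (\<Sum>i\<in>{i. p i \<noteq> 0}. p i)"
  show "p = (\<lambda>i. \<pi> i v)"
  proof
    fix i
    have "\<pi> i v = (\<Sum>j\<in>{i. p i \<noteq> 0}. \<pi> i (p j))"
      using p' lin_sum[OF p] by metis
    also have "\<dots> = (\<Sum>j\<in>{i. p i \<noteq> 0}. if i = j then p j else 0)"
      using F p' by (intro sum.cong) auto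
    also have "\<dots> = p i" using p' by (auto simp: sum.delta')
    finally show "p i = \<pi> i v" ..
  qed
qed simp

text \<open>The prescription \<open>h i\<close> may depend on the degree of the left factor. Over
  the ground field there is nothing to balance beyond scalars, so extending by \<open>gext\<close>
  in the left argument is enough. The actions on \<open>X\<close> and the projections onto its
  degrees arise this way.\<close>

lemma tensor_k_graded_ex:
  assumes T: "is_tensor_k sM sN T" and G: "grading sM F" and s: "vector_space s" and N: "vector_space sN"
    and h: "\<And>i m m' n. m \<in> F i \<Longrightarrow> m' \<in> F i \<Longrightarrow> h i (m + m') n = h i m n + h i m' n"
      "\<And>i m n n'. m \<in> F i \<Longrightarrow> h i m (n + n') = h i m n + h i m n'"
      "\<And>i c m n. m \<in> F i \<Longrightarrow> h i (sM c m) n = s c (h i m n)"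
      "\<And>i c m n. m \<in> F i \<Longrightarrow> h i m (sN c n) = s c (h i m n)"
  shows "\<exists>Fu. lin (tsc T) s Fu \<and> (\<forall>i. \<forall>m\<in>F i. \<forall>n. Fu (tpr T m n) = h i m n)"
proof -
  interpret grading sM F by fact
  let ?h = "\<lambda>m n. gext F (\<lambda>i m. h i m n) m"
  have L: "lin sM s (\<lambda>m. ?h m n)" for n
    using gext_lin[where L = "\<lambda>i m. h i m n", OF s] h by blast
  have E: "?h m n = h i m n" if "m \<in> F i" for i m n
    using gext_eq[where L = "\<lambda>i m. h i m n", OF s] h that by blast
  have a: "?h m (n + n') = ?h m n + ?h m n'" for m n n'
    by (simp add: gext_def h(2) dcomp_mem sum.distrib)
  have b: "?h m (sN c n) = s c (?h m n)" for m n c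
    by (simp add: gext_def h(4) dcomp_mem vs_simps(5)[OF s])
  have "\<exists>Fu. lin (tsc T) s Fu \<and> (\<forall>m n. Fu (tpr T m n) = ?h m n)"
    by (rule tensor_ex[OF T[unfolded is_tensor_k_def] s]) (simp_all add: lin_add[OF L] lin_scale[OF L] a b)
  with E show ?thesis by metis
qed

section \<open>Bimodules and complexes\<close>

locale algebra =
  fixes R :: "('k::field, 'r::ab_group_add) kalg"
  assumes alg: "k_algebra R"
begin

lemma vsR: "vector_space (asc R)"
  and mul_lin_right: "lin (asc R) (asc R) (amul R a)"
  and mul_lin_left: "lin (asc R) (asc R) (\<lambda>a. amul R a b)"
  and mul_assoc: "amul R (amul R a b) c = amul R a (amul R b c)"
  and mul_one: "amul R (aone R) a = a" "amul R a (aone R) = a"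
  using alg by (simp_all add: k_algebra_def)

end

locale bimod = algebra R for R :: "('k::field, 'r::ab_group_add) kalg" +
  fixes M :: "('k, 'r, 'm::ab_group_add, 'z) bimod_scheme"
  assumes bim: "bimodule R M"
begin

lemma vsM: "vector_space (msc M)"
  and la_lin: "lin (msc M) (msc M) (lact M a)"
  and ra_lin: "lin (msc M) (msc M) (\<lambda>m. ract M m a)"
  and la_lin': "lin (asc R) (msc M) (\<lambda>a. lact M a m)"
  and ra_lin': "lin (asc R) (msc M) (ract M m)"
  and la_one [simp]: "lact M (aone R) m = m"
  and ra_one [simp]: "ract M m (aone R) = m"
  and la_mul: "lact M (amul R a b) m = lact M a (lact M b m)"
  and ra_mul: "ract M m (amul R a b) = ract M (ract M m a) b"
  and ra_la: "ract M (lact M a m) b = lact M a (ract M m b)"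
  using bim by (simp_all add: bimodule_def)

end

lemma (in algebra) bimodule_regular: "bimodule R (regular R)"
  by (simp add: bimodule_def regular_def vsR mul_lin_right mul_lin_left mul_assoc mul_one)

lemma regular_simps [simp]:
  "msc (regular R) = asc R" "lact (regular R) = amul R" "ract (regular R) = amul R"
  by (simp_all add: regular_def)

lemma bimod_homI:
  assumes "lin (msc M) (msc N) F" "\<And>a m. F (lact M a m) = lact N a (F m)"
    "\<And>m a. F (ract M m a) = ract N (F m) a"
  shows "bimod_hom M N F"
  using assms by (simp add: bimod_hom_def)

lemma
  assumes "bimod_hom M N F"
  shows bh_lin: "lin (msc M) (msc N) F"
    and bh_l: "F (lact M a m) = lact N a (F m)"
    and bh_r: "F (ract M m a) = ract N (F m) a"
  using assms by (simp_all add: bimod_hom_def)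

lemma bh_comp: "bimod_hom M N F \<Longrightarrow> bimod_hom N L G \<Longrightarrow> bimod_hom M L (\<lambda>x. G (F x))"
  by (rule bimod_homI) (auto simp: bh_l bh_r intro: lin_comp bh_lin)

text \<open>An augmented complex of bimodules, before exactness and projectivity. The twisted
  product is first shown to be one of these, so that the calculus of its tensor square is available
  before it is known to be a resolution.\<close>

locale gcplx = bimod R P for R :: "('k::field, 'r::ab_group_add) kalg" and P :: "('k, 'r, 'm::ab_group_add) cplx" +
  assumes gr_sub: "\<And>n. module.subspace (msc P) (gr P n)"
    and gr_l: "\<And>n a p. p \<in> gr P n \<Longrightarrow> lact P a p \<in> gr P n"
    and gr_r: "\<And>n a p. p \<in> gr P n \<Longrightarrow> ract P p a \<in> gr P n"
    and gr_ds: "direct_sum UNIV (gr P)"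
    and bd_hom: "bimod_hom P P (bd P)"
    and aug_hom: "bimod_hom P (regular R) (aug P)"
    and bd_0: "\<And>p. p \<in> gr P 0 \<Longrightarrow> bd P p = 0"
    and bd_gr: "\<And>n p. p \<in> gr P (Suc n) \<Longrightarrow> bd P p \<in> gr P n"
    and aug_Suc: "\<And>n p. p \<in> gr P (Suc n) \<Longrightarrow> aug P p = 0"
    and bd_bd: "\<And>p. bd P (bd P p) = 0"
    and aug_bd: "\<And>p. aug P (bd P p) = 0"
begin

sublocale gr: grading "msc P" "gr P"
  by (intro grading.intro vsM gr_sub gr_ds)

lemmas bd_lin = bh_lin[OF bd_hom]
lemmas aug_lin = bh_lin[OF aug_hom, simplified]
lemmas bd_l = bh_l[OF bd_hom] and bd_r = bh_r[OF bd_hom]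
lemmas aug_l = bh_l[OF aug_hom, simplified] and aug_r = bh_r[OF aug_hom, simplified]

lemma aug_pos: "p \<in> gr P n \<Longrightarrow> n \<noteq> 0 \<Longrightarrow> aug P p = 0"
  using aug_Suc by (cases n) auto

text \<open>Turning the sign of a homogeneous element into a linear operator lets the Leibniz rule
  on tensor products, and later all homotopy identities, be stated for arbitrary elements.\<close>

lemma parity_all:
  "lin (msc P) (msc P) (parity P) \<and> (\<forall>i. \<forall>p\<in>gr P i. parity P p = signed (int i) p)"
proof -
  let ?E = "gext (gr P) (\<lambda>i p. signed (int i) p)"
  have 1: "lin (msc P) (msc P) ?E" and 2: "p \<in> gr P i \<Longrightarrow> ?E p = signed (int i) p" for i p
    using gr.gext_lin[OF vsM, of "\<lambda>i p. signed (int i) p"] gr.gext_eq[OF vsM, of "\<lambda>i p. signed (int i) p"]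
    by (auto simp: signed_add lin_signed[OF lin_scale_map[OF vsM]])
  have "\<exists>!F. lin (msc P) (msc P) F \<and> (\<forall>i. \<forall>p\<in>gr P i. F p = signed (int i) p)"
  proof (rule ex1I[of _ ?E])
    show "lin (msc P) (msc P) ?E \<and> (\<forall>i. \<forall>p\<in>gr P i. ?E p = signed (int i) p)" using 1 2 by blast
    fix F assume F: "lin (msc P) (msc P) F \<and> (\<forall>i. \<forall>p\<in>gr P i. F p = signed (int i) p)"
    show "F = ?E"
    proof
      fix x show "F x = ?E x"
        by (rule gr.dsum_induct[of "\<lambda>x. F x = ?E x"])
          (use F 2 in \<open>auto simp: lin_add[OF 1] lin_add[of "msc P" "msc P" F]\<close>)
    qed
  qed
  then show ?thesis unfolding parity_def by (rule theI')
qed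

lemma parity_lin: "lin (msc P) (msc P) (parity P)"
  and parity_eq: "p \<in> gr P i \<Longrightarrow> parity P p = signed (int i) p"
  using parity_all by blast+

lemma parity_gr: "p \<in> gr P i \<Longrightarrow> parity P p \<in> gr P i"
  by (simp add: parity_eq gr.F_mem)

lemma gr_induct [case_names hom add]:
  assumes "\<And>i p. p \<in> gr P i \<Longrightarrow> \<Phi> p" "\<And>x y. \<Phi> x \<Longrightarrow> \<Phi> y \<Longrightarrow> \<Phi> (x + y)"
  shows "\<Phi> x"
  using gr.dsum_induct[of \<Phi>] assms by blast

lemma parity_parity [simp]: "parity P (parity P p) = p"
  by (induction p rule: gr_induct)
    (auto simp: parity_eq lin_signed[OF parity_lin] signed_signed lin_add[OF parity_lin])

lemma parity_l: "parity P (lact P a p) = lact P a (parity P p)"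
  and parity_r: "parity P (ract P p a) = ract P (parity P p) a"
  by (induction p rule: gr_induct)
    (auto simp: parity_eq gr_l gr_r lin_add[OF parity_lin] lin_signed[OF la_lin] lin_signed[OF ra_lin]
      lin_add[OF la_lin] lin_add[OF ra_lin])

lemma bd_parity: "bd P (parity P p) = - parity P (bd P p)"
proof (induction p rule: gr_induct)
  case (hom i p)
  then show ?case
    by (cases i) (simp_all add: parity_eq lin_signed[OF bd_lin] bd_0 lin_0[OF parity_lin] signed_0
        parity_eq[OF bd_gr] signed_Suc lin_neg[OF bd_lin])
qed (simp add: lin_add[OF bd_lin] lin_add[OF parity_lin])

lemma parity_bd: "parity P (bd P p) = - bd P (parity P p)"
  by (simp add: bd_parity)

lemma aug_parity: "aug P (parity P p) = aug P p"
proof (induction p rule: gr_induct)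
  case (hom i p)
  then show ?case
    by (cases i) (auto simp: parity_eq signed_zero lin_signed[OF aug_lin] aug_Suc signed_0)
qed (simp add: lin_add[OF aug_lin] lin_add[OF parity_lin])

end

section \<open>The tensor square of a complex\<close>

locale tcplx = gcplx R P for R :: "('k::field, 'r::ab_group_add) kalg" and P :: "('k, 'r, 'm::ab_group_add) cplx" +
  fixes T :: "('k, 'm, 'm, 't::ab_group_add) tensor"
  assumes tens: "is_tensor_over P P T"
begin

abbreviation Q where "Q \<equiv> tensor_cplx R P P T"

lemmas T = tens[unfolded is_tensor_over_def]
lemmas vsT = tensor_vs[OF T]
lemmas bal = tpr_bal[OF T]

lemma tl_lin: "lin (msc P) (tsc T) (\<lambda>p. tpr T p q)"
  and tr_lin: "lin (msc P) (tsc T) (tpr T p)"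
  by (auto intro!: linI vsT vsM simp: tpr_add_left[OF T] tpr_add_right[OF T] tpr_scale_left[OF T] tpr_scale_right[OF T])

lemma t_induct [case_names tpr add]:
  assumes "\<And>p q i j. p \<in> gr P i \<Longrightarrow> q \<in> gr P j \<Longrightarrow> \<Phi> (tpr T p q)"
    and "\<And>x y. \<Phi> x \<Longrightarrow> \<Phi> y \<Longrightarrow> \<Phi> (x + y)"
  shows "\<Phi> z"
proof (rule tensor_induct[OF T])
  show "\<Phi> (tpr T p q)" for p q
  proof (induction p rule: gr_induct)
    case (hom i p)
    then show ?case
      by (induction q rule: gr_induct) (auto simp: tpr_add_right[OF T] intro: assms)
  qed (auto simp: tpr_add_left[OF T] intro: assms)
qed (fact assms)

lemma t_lift:
  assumes s: "vector_space s" and h: "\<And>q. lin (msc P) s (\<lambda>p. h p q)" "\<And>p. lin (msc P) s (h p)"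
      "\<And>p r q. h (ract P p r) q = h p (lact P r q)"
  shows "lin (tsc T) s (tlift T s h)" "tlift T s h (tpr T p q) = h p q"
  by (rule lin_tlift[OF T s] tlift_tpr[OF T s]; simp add: lin_add[OF h(1)] lin_add[OF h(2)]
      lin_scale[OF h(1)] lin_scale[OF h(2)] h(3))+

lemma Q_sc [simp]: "msc Q = tsc T" by (simp add: tensor_cplx_def)

lemma Q_l_lin: "lin (tsc T) (tsc T) (lact Q a)"
  and Q_l: "lact Q a (tpr T p q) = tpr T (lact P a p) q"
proof -
  note * = t_lift[OF vsT, of "\<lambda>p q. tpr T (lact P a p) q", OF lin_comp[OF la_lin tl_lin] tr_lin]
  show "lin (tsc T) (tsc T) (lact Q a)" "lact Q a (tpr T p q) = tpr T (lact P a p) q"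
    using * by (simp_all add: tensor_cplx_def ra_la[symmetric] bal)
qed

lemma Q_r_lin: "lin (tsc T) (tsc T) (\<lambda>z. ract Q z a)"
  and Q_r: "ract Q (tpr T p q) a = tpr T p (ract P q a)"
proof -
  note * = t_lift[OF vsT, of "\<lambda>p q. tpr T p (ract P q a)", OF tl_lin lin_comp[OF ra_lin tr_lin]]
  show "lin (tsc T) (tsc T) (\<lambda>z. ract Q z a)" "ract Q (tpr T p q) a = tpr T p (ract P q a)"
    using * by (simp_all add: tensor_cplx_def ra_la bal)
qed

lemma Q_bimodule: "bimodule R Q"
proof -
  have "lact Q (a + b) z = lact Q a z + lact Q b z \<and> ract Q z (a + b) = ract Q z a + ract Q z b" for a b z
    by (induction z rule: t_induct)
      (auto simp: Q_l Q_r lin_add[OF Q_l_lin] lin_add[OF Q_r_lin] lin_add[OF la_lin'] lin_add[OF ra_lin']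
        lin_add[OF tl_lin] lin_add[OF tr_lin])
  moreover have "lact Q (asc R c a) z = tsc T c (lact Q a z) \<and> ract Q z (asc R c a) = tsc T c (ract Q z a)" for a c z
    by (induction z rule: t_induct)
      (auto simp: Q_l Q_r lin_add[OF Q_l_lin] lin_add[OF Q_r_lin] lin_scale[OF la_lin'] lin_scale[OF ra_lin']
        lin_scale[OF tl_lin] lin_scale[OF tr_lin] vs_add[OF vsT])
  moreover have "lact Q (aone R) z = z \<and> ract Q z (aone R) = z" for z
    by (induction z rule: t_induct) (auto simp: Q_l Q_r lin_add[OF Q_l_lin] lin_add[OF Q_r_lin])
  moreover have "lact Q (amul R a b) z = lact Q a (lact Q b z) \<and> ract Q z (amul R a b) = ract Q (ract Q z a) b
      \<and> ract Q (lact Q a z) b = lact Q a (ract Q z b)" for a b z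
    by (induction z rule: t_induct)
      (auto simp: Q_l Q_r lin_add[OF Q_l_lin] lin_add[OF Q_r_lin] la_mul ra_mul)
  ultimately show ?thesis
    unfolding bimodule_def
    by (auto simp: vsT Q_l_lin Q_r_lin intro!: linI vsR)
qed

sublocale Q: bimod R Q
  by unfold_locales (rule Q_bimodule)

lemma bdQ_lin: "lin (tsc T) (tsc T) (bd Q)"
  and bdQ: "bd Q (tpr T p q) = tpr T (bd P p) q + tpr T (parity P p) (bd P q)"
proof -
  define D where "D = tlift T (tsc T) (\<lambda>p q. tpr T (bd P p) q + tpr T (parity P p) (bd P q))"
  have D1: "lin (tsc T) (tsc T) D" and D2: "D (tpr T p q) = tpr T (bd P p) q + tpr T (parity P p) (bd P q)" for p q
    unfolding D_def
    by (rule t_lift[OF vsT]; auto simp: bd_l bd_r parity_r bal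
        intro!: lin_plus lin_comp[OF bd_lin tl_lin] lin_comp[OF parity_lin tl_lin] lin_comp[OF bd_lin tr_lin] tr_lin)+
  have "bd Q = D"
    unfolding tensor_cplx_def cplx.simps
  proof (rule the_equality)
    show "lin (tsc T) (tsc T) D \<and> (\<forall>i. \<forall>p\<in>gr P i. \<forall>q. D (tpr T p q) = tpr T (bd P p) q + signed (int i) (tpr T p (bd P q)))"
      by (simp add: D1 D2 parity_eq lin_signed[OF tl_lin])
    fix F assume F: "lin (tsc T) (tsc T) F \<and> (\<forall>i. \<forall>p\<in>gr P i. \<forall>q. F (tpr T p q) = tpr T (bd P p) q + signed (int i) (tpr T p (bd P q)))"
    show "F = D"
    proof
      fix z show "F z = D z"
        by (induction z rule: t_induct)
          (use F in \<open>auto simp: D2 parity_eq lin_signed[OF tl_lin] lin_add[OF D1] lin_add[of "tsc T" "tsc T" F]\<close>)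
    qed
  qed
  with D1 D2 show "lin (tsc T) (tsc T) (bd Q)" "bd Q (tpr T p q) = tpr T (bd P p) q + tpr T (parity P p) (bd P q)"
    by simp_all
qed

lemma bdQ_hom: "bimod_hom Q Q (bd Q)"
proof (rule bimod_homI)
  show "bd Q (lact Q a z) = lact Q a (bd Q z)" for a z
    by (induction z rule: t_induct)
      (simp_all add: Q_l bdQ bd_l parity_l lin_add[OF Q_l_lin] lin_add[OF bdQ_lin])
  show "bd Q (ract Q z a) = ract Q (bd Q z) a" for a z
    by (induction z rule: t_induct)
      (simp_all add: Q_r bdQ bd_r lin_add[OF Q_r_lin] lin_add[OF bdQ_lin])
qed (simp add: bdQ_lin)

lemma grQ: "gr Q n = module.span (tsc T) {tpr T p q | p q i j. p \<in> gr P i \<and> q \<in> gr P j \<and> i + j = n}"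
  by (simp add: tensor_cplx_def)

lemma grQ_sub: "module.subspace (tsc T) (gr Q n)"
  unfolding grQ by (rule span_sub[OF vsT])

lemmas grQ_mem = subspaceD[OF vsT grQ_sub]

lemma grQ_tpr: "p \<in> gr P i \<Longrightarrow> q \<in> gr P j \<Longrightarrow> i + j = n \<Longrightarrow> tpr T p q \<in> gr Q n"
  unfolding grQ by (rule span_mem[OF vsT]) blast

lemma grQ_lin_image:
  assumes z: "z \<in> gr Q n" and F: "lin (tsc T) s F" and V: "module.subspace s V"
    and h: "\<And>p q i j. p \<in> gr P i \<Longrightarrow> q \<in> gr P j \<Longrightarrow> i + j = n \<Longrightarrow> F (tpr T p q) \<in> V"
  shows "F z \<in> V"
proof -
  note V = subspaceD[OF lin_vs(2)[OF F] V]
  show ?thesis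
    using z unfolding grQ
    by (rule span_lin_ind[OF vsT]) (auto simp: lin_0[OF F] lin_add[OF F] lin_scale[OF F] intro: V h)
qed

lemma grQ_l: "z \<in> gr Q n \<Longrightarrow> lact Q a z \<in> gr Q n"
  by (erule grQ_lin_image[OF _ Q_l_lin grQ_sub]) (auto simp: Q_l intro: grQ_tpr gr_l)

lemma grQ_r: "z \<in> gr Q n \<Longrightarrow> ract Q z a \<in> gr Q n"
  by (erule grQ_lin_image[OF _ Q_r_lin grQ_sub]) (auto simp: Q_r intro: grQ_tpr gr_r)

abbreviation \<mu>1 where "\<mu>1 \<equiv> mu_one P T"
abbreviation r\<mu> where "r\<mu> \<equiv> one_mu P T"

lemma mu_lin: "lin (tsc T) (msc P) \<mu>1"
  and mu_tpr: "\<mu>1 (tpr T p q) = lact P (aug P p) q"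
  unfolding mu_one_def
  by (rule t_lift[OF vsM]; auto simp: aug_r la_mul intro!: lin_comp[OF aug_lin la_lin'] la_lin)+

lemma rmu_lin: "lin (tsc T) (msc P) r\<mu>"
  and rmu_tpr: "r\<mu> (tpr T p q) = ract P p (aug P q)"
  unfolding one_mu_def
  by (rule t_lift[OF vsM]; auto simp: aug_l ra_mul intro!: lin_comp[OF aug_lin ra_lin'] ra_lin)+

lemma mu_hom: "bimod_hom Q P \<mu>1"
proof (rule bimod_homI)
  show "\<mu>1 (lact Q a z) = lact P a (\<mu>1 z)" for a z
    by (induction z rule: t_induct)
      (simp_all add: Q_l mu_tpr aug_l la_mul lin_add[OF Q_l_lin] lin_add[OF mu_lin] lin_add[OF la_lin])
  show "\<mu>1 (ract Q z a) = ract P (\<mu>1 z) a" for a z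
    by (induction z rule: t_induct)
      (simp_all add: Q_r mu_tpr ra_la lin_add[OF Q_r_lin] lin_add[OF mu_lin] lin_add[OF ra_lin])
qed (simp add: mu_lin)

lemma rmu_hom: "bimod_hom Q P r\<mu>"
proof (rule bimod_homI)
  show "r\<mu> (lact Q a z) = lact P a (r\<mu> z)" for a z
    by (induction z rule: t_induct)
      (simp_all add: Q_l rmu_tpr ra_la lin_add[OF Q_l_lin] lin_add[OF rmu_lin] lin_add[OF la_lin])
  show "r\<mu> (ract Q z a) = ract P (r\<mu> z) a" for a z
    by (induction z rule: t_induct)
      (simp_all add: Q_r rmu_tpr aug_r ra_mul lin_add[OF Q_r_lin] lin_add[OF rmu_lin] lin_add[OF ra_lin])
qed (simp add: rmu_lin)

lemma mu_bd: "\<mu>1 (bd Q z) = bd P (\<mu>1 z)"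
  by (induction z rule: t_induct)
    (simp_all add: bdQ mu_tpr lin_add[OF mu_lin] lin_add[OF bdQ_lin] lin_add[OF bd_lin] aug_bd
      aug_parity bd_l lin_0[OF la_lin'])

lemma rmu_bd: "r\<mu> (bd Q z) = bd P (r\<mu> z)"
  by (induction z rule: t_induct)
    (simp_all add: bdQ rmu_tpr lin_add[OF rmu_lin] lin_add[OF bdQ_lin] lin_add[OF bd_lin] aug_bd
      bd_r lin_0[OF ra_lin'])

lemma mu_gr: "z \<in> gr Q n \<Longrightarrow> \<mu>1 z \<in> gr P n"
proof (erule grQ_lin_image[OF _ mu_lin gr_sub])
  show "\<mu>1 (tpr T p q) \<in> gr P n" if "p \<in> gr P i" "q \<in> gr P j" "i + j = n" for p q i j
    using that by (cases i) (simp_all add: mu_tpr gr_l aug_Suc lin_0[OF la_lin'] gr.F_mem(1))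
qed

lemma rmu_gr: "z \<in> gr Q n \<Longrightarrow> r\<mu> z \<in> gr P n"
proof (erule grQ_lin_image[OF _ rmu_lin gr_sub])
  fix p q i j assume *: "p \<in> gr P i" "q \<in> gr P j" "i + j = n"
  show "r\<mu> (tpr T p q) \<in> gr P n"
  proof (cases "j = 0")
    case True
    then have "p \<in> gr P n" using * by simp
    then show ?thesis unfolding rmu_tpr by (rule gr_r)
  next
    case False
    have "aug P q = 0" using *(2) False by (rule aug_pos)
    then show ?thesis unfolding rmu_tpr by (simp only: lin_0[OF ra_lin'] gr.F_mem(1))
  qed
qed

end

section \<open>Contractions of projective resolutions\<close>

text \<open>That the differential squares to zero is not a separate clause of
  \<open>projective_resolution\<close>. It is the inclusion of images in kernels contained in the
  exactness equations, degree by degree, and then extends to sums.\<close>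

lemma gcplx_resolution:
  assumes "k_algebra R" "projective_resolution R P"
  shows "gcplx R P"
proof -
  note r = assms(2)[unfolded projective_resolution_def]
  have b: "bimodule R P" and sub: "\<forall>n. module.subspace (msc P) (gr P n)" and ds: "direct_sum UNIV (gr P)"
    and h: "bimod_hom P P (bd P)" "bimod_hom P (regular R) (aug P)"
    and z: "\<forall>p\<in>gr P 0. bd P p = 0"
    and g: "\<forall>n. \<forall>p\<in>gr P (Suc n). bd P p \<in> gr P n \<and> aug P p = 0"
    and e: "\<forall>n. {p \<in> gr P (Suc n). bd P p = 0} = bd P ` gr P (Suc (Suc n))"
      "{p \<in> gr P 0. aug P p = 0} = bd P ` gr P (Suc 0)"
    and lr: "\<forall>n a. \<forall>p\<in>gr P n. lact P a p \<in> gr P n \<and> ract P p a \<in> gr P n"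
    by (insert r, (elim conjE, assumption)+)
  have "vector_space (msc P)" using b by (simp add: bimodule_def)
  then interpret grading "msc P" "gr P"
    by (intro grading.intro sub[rule_format] ds)
  note bl = bh_lin[OF h(1)] and al = bh_lin[OF h(2)]
  have 1: "bd P (bd P p) = 0 \<and> aug P (bd P p) = 0" if p: "p \<in> gr P i" for p i
  proof (cases i)
    case 0
    then show ?thesis using p z by (simp add: lin_0[OF bl] lin_0[OF al])
  next
    case (Suc j)
    show ?thesis
    proof (cases j)
      case 0
      then have "bd P p \<in> {p \<in> gr P 0. aug P p = 0}" unfolding e(2) using p Suc by blast
      then show ?thesis using z by blast
    next
      case (Suc l)
      then have "bd P p \<in> {p \<in> gr P (Suc l). bd P p = 0}" unfolding e(1)[rule_format] using p \<open>i = Suc j\<close> by blast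
      then show ?thesis using g by blast
    qed
  qed
  have "bd P (bd P p) = 0 \<and> aug P (bd P p) = 0" for p
    by (rule dsum_induct[of "\<lambda>p. bd P (bd P p) = 0 \<and> aug P (bd P p) = 0"])
      (erule 1, simp add: lin_add[OF bl] lin_add[OF al])
  then show ?thesis
    using assms(1) b sub ds h z g lr
    by (intro gcplx.intro bimod.intro algebra.intro bimod_axioms.intro gcplx_axioms.intro) simp_all
qed

text \<open>On a cycle with zero augmentation the homotopy identity reads
  \<open>bd P (c p) = p\<close>, because \<open>c\<close> and \<open>\<eta>\<close> vanish at
  \<open>0\<close>. So \<open>c p\<close> is the preimage that exactness asks for.\<close>

lemma projective_resolutionI:
  assumes "gcplx R P" and proj: "\<And>n. projective_bimodule R P (gr P n)"
    and \<eta>: "\<And>r. \<eta> r \<in> gr P 0" "\<And>r. aug P (\<eta> r) = r"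
    and c: "\<And>n p. p \<in> gr P n \<Longrightarrow> c p \<in> gr P (Suc n)"
    and lin0: "c 0 = 0" "\<eta> 0 = 0"
    and h: "\<And>p. bd P (c p) + c (bd P p) = p - \<eta> (aug P p)"
  shows "projective_resolution R P"
proof -
  interpret gcplx R P by fact
  have e: "bd P (c p) = p" if "bd P p = 0" "aug P p = 0" for p
    using h[of p] that by (simp add: lin0)
  have 1: "{p \<in> gr P (Suc n). bd P p = 0} = bd P ` gr P (Suc (Suc n))" for n
  proof (intro equalityI subsetI)
    fix p assume "p \<in> {p \<in> gr P (Suc n). bd P p = 0}"
    then show "p \<in> bd P ` gr P (Suc (Suc n))" using e[of p] aug_Suc c by (intro image_eqI[of _ _ "c p"]) auto
  qed (auto simp: bd_bd bd_gr)
  have 2: "{p \<in> gr P 0. aug P p = 0} = bd P ` gr P (Suc 0)"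
  proof (intro equalityI subsetI)
    fix p assume "p \<in> {p \<in> gr P 0. aug P p = 0}"
    then show "p \<in> bd P ` gr P (Suc 0)" using e[of p] bd_0 c by (intro image_eqI[of _ _ "c p"]) auto
  qed (auto simp: aug_bd bd_gr)
  have 3: "aug P ` gr P 0 = UNIV"
  proof (intro equalityI subset_UNIV subsetI)
    show "r \<in> aug P ` gr P 0" for r by (rule image_eqI[of _ _ "\<eta> r"]) (simp_all add: \<eta>)
  qed
  show ?thesis
    unfolding projective_resolution_def
    by (intro conjI allI ballI bim gr_sub gr_l gr_r gr_ds proj bd_hom aug_hom bd_0 bd_gr aug_Suc 1 2 3)
qed

locale resolution = gcplx R P for R :: "('k::field, 'r::ab_group_add) kalg" and P :: "('k, 'r, 'm::ab_group_add) cplx" +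
  assumes res: "projective_resolution R P"
begin

lemma exact: "p \<in> gr P (Suc n) \<Longrightarrow> bd P p = 0 \<Longrightarrow> p \<in> bd P ` gr P (Suc (Suc n))"
  and exact0: "p \<in> gr P 0 \<Longrightarrow> aug P p = 0 \<Longrightarrow> p \<in> bd P ` gr P (Suc 0)"
  and surj0: "aug P ` gr P 0 = UNIV"
proof -
  note r = res[unfolded projective_resolution_def]
  have "\<forall>n. {p \<in> gr P (Suc n). bd P p = 0} = bd P ` gr P (Suc (Suc n))"
      "{p \<in> gr P 0. aug P p = 0} = bd P ` gr P (Suc 0)" and 3: "aug P ` gr P 0 = UNIV"
    by (insert r, (elim conjE, assumption)+)
  then show "p \<in> gr P (Suc n) \<Longrightarrow> bd P p = 0 \<Longrightarrow> p \<in> bd P ` gr P (Suc (Suc n))"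
    "p \<in> gr P 0 \<Longrightarrow> aug P p = 0 \<Longrightarrow> p \<in> bd P ` gr P (Suc 0)" by blast+
  show "aug P ` gr P 0 = UNIV" by (fact 3)
qed

text \<open>Over a field every differential and the augmentation have linear sections on their
  images; exactness glues these to a contraction.\<close>

lemma k_contraction:
  "\<exists>c \<eta>. lin (msc P) (msc P) c \<and> lin (asc R) (msc P) \<eta> \<and> (\<forall>n. \<forall>p\<in>gr P n. c p \<in> gr P (Suc n)) \<and>
     (\<forall>r. \<eta> r \<in> gr P 0 \<and> aug P (\<eta> r) = r) \<and> (\<forall>p. bd P (c p) + c (bd P p) = p - \<eta> (aug P p))"
proof -
  interpret vector_space_pair "msc P" "msc P" by (intro vector_space_pair.intro vsM)
  interpret ra: vector_space_pair "msc P" "asc R" by (intro vector_space_pair.intro vsM vsR)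
  have "\<exists>g. range g \<subseteq> gr P (Suc n) \<and> lin (msc P) (msc P) g \<and> (\<forall>v\<in>bd P ` gr P (Suc n). bd P (g v) = v)" for n
    by (rule linear_exists_right_inverse_on[OF bd_lin gr_sub])
  then obtain g where g: "\<And>n v. g n v \<in> gr P (Suc n)" "\<And>n. lin (msc P) (msc P) (g n)"
    "\<And>n v. v \<in> bd P ` gr P (Suc n) \<Longrightarrow> bd P (g n v) = v"
    by (metis rangeI subsetD)
  have "\<exists>g. range g \<subseteq> gr P 0 \<and> lin (asc R) (msc P) g \<and> (\<forall>v\<in>aug P ` gr P 0. aug P (g v) = v)"
    by (rule ra.linear_exists_right_inverse_on[OF aug_lin gr_sub])
  then obtain \<eta> where \<eta>: "\<And>r. \<eta> r \<in> gr P 0" "lin (asc R) (msc P) \<eta>" "\<And>r. aug P (\<eta> r) = r"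
    using surj0 by (metis UNIV_I rangeI subsetD)
  \<comment> \<open>\<open>p - g k (bd P p)\<close> is a cycle, so \<open>g n\<close> lifts it. On a
    boundary the inner correction vanishes, which makes \<open>c (bd P p)\<close> equal to
    \<open>g k (bd P p)\<close>. Hence an explicit formula from two neighbouring sections suffices,
    with no recursion over the degree.\<close>
  define L where "L n p = (case n of 0 \<Rightarrow> g 0 (p - \<eta> (aug P p)) | Suc k \<Rightarrow> g n (p - g k (bd P p)))" for n p
  have Ll: "lin (msc P) (msc P) (L n)" for n
    unfolding L_def
    by (cases n) (auto intro!: lin_comp[OF _ g(2)] lin_minus lin_id[OF vsM] lin_comp[OF aug_lin \<eta>(2)] lin_comp[OF bd_lin g(2)])
  define c where "c = gext (gr P) L"
  have c: "lin (msc P) (msc P) c" and ce: "\<And>n p. p \<in> gr P n \<Longrightarrow> c p = L n p"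
    unfolding c_def
    by (rule gr.gext_lin[OF vsM]; simp add: lin_add[OF Ll] lin_scale[OF Ll])
      (rule gr.gext_eq[OF vsM]; simp add: lin_add[OF Ll] lin_scale[OF Ll])
  have "bd P (c p) + c (bd P p) = p - \<eta> (aug P p)" for p
  proof (induction p rule: gr_induct)
    case (hom n p)
    show ?case
    proof (cases n)
      case 0
      have "p - \<eta> (aug P p) \<in> bd P ` gr P (Suc 0)"
        by (rule exact0) (use hom 0 \<eta> in \<open>auto simp: gr.F_mem lin_diff[OF aug_lin]\<close>)
      then show ?thesis using hom 0 by (simp add: ce L_def g(3) bd_0 lin_0[OF c])
    next
      case (Suc k)
      have b: "bd P p \<in> bd P ` gr P (Suc k)" using hom Suc by auto
      have "p - g k (bd P p) \<in> bd P ` gr P (Suc (Suc k))"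
        by (rule exact) (use hom Suc g(1) in \<open>auto simp: gr.F_mem lin_diff[OF bd_lin] g(3)[OF b]\<close>)
      then have 1: "bd P (c p) = p - g k (bd P p)" using hom Suc by (simp add: ce L_def g(3))
      have "c (bd P p) = L k (bd P p)" using hom Suc by (simp add: ce bd_gr)
      also have "\<dots> = g k (bd P p)"
        by (cases k) (simp_all add: L_def aug_bd bd_bd lin_0[OF \<eta>(2)] lin_0[OF g(2)])
      finally show ?thesis using 1 hom Suc by (simp add: aug_Suc lin_0[OF \<eta>(2)])
    qed
  next
    case (add x y)
    show ?case
      using arg_cong2[of _ _ _ _ "(+)", OF add]
      by (simp add: lin_add[OF bd_lin] lin_add[OF c] lin_add[OF aug_lin] lin_add[OF \<eta>(2)] algebra_simps)
  qed
  moreover have "\<forall>n. \<forall>p\<in>gr P n. c p \<in> gr P (Suc n)"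
    by (auto simp: ce L_def g(1) split: nat.split)
  ultimately show ?thesis using c \<eta> by (intro exI[of _ c] exI[of _ \<eta>] conjI) simp_all
qed

lemma lin_on_sum:
  assumes w: "\<And>p q. p \<in> gr P n \<Longrightarrow> q \<in> gr P n \<Longrightarrow> w (p + q) = w p + (w q :: 'm)"
    "\<And>c p. p \<in> gr P n \<Longrightarrow> w (msc P c p) = msc P c (w p)" and v: "\<And>i. v i \<in> gr P n"
  shows "w (free_ext (msc P) v z) = free_ext (msc P) (\<lambda>i. w (v i)) z"
proof -
  have w0: "w 0 = 0" using w(1)[of 0 0] by (simp add: gr.F_mem)
  have "w (\<Sum>i\<in>K. msc P (u i) (v i)) = (\<Sum>i\<in>K. msc P (u i) (w (v i)))" for K u
    by (induction K rule: infinite_finite_induct) (auto simp: w0 w gr.F_mem v)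
  then show ?thesis by (simp add: free_ext_def)
qed

text \<open>The lifting property of the projective bimodule \<open>gr P n\<close> for right module maps: on the
  free bimodule, composing with a \<open>k\<close>-linear section on \<open>a \<cdot> j\<close> and extending by the right action
  gives a right linear lift.\<close>

lemma right_lift:
  assumes c: "lin (msc P) (msc P) c" "\<And>n p. p \<in> gr P n \<Longrightarrow> c p \<in> gr P (Suc n)"
    and w: "\<And>p q. p \<in> gr P n \<Longrightarrow> q \<in> gr P n \<Longrightarrow> w (p + q) = w p + w q"
      "\<And>c p. p \<in> gr P n \<Longrightarrow> w (msc P c p) = msc P c (w p)"
      "\<And>p a. p \<in> gr P n \<Longrightarrow> w (ract P p a) = ract P (w p) a"
      "\<And>p. p \<in> gr P n \<Longrightarrow> w p \<in> gr P n" "\<And>p. p \<in> gr P n \<Longrightarrow> bd P (c (w p)) = w p"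
  shows "\<exists>s. (\<forall>p\<in>gr P n. \<forall>q\<in>gr P n. s (p + q) = s p + s q) \<and> (\<forall>c. \<forall>p\<in>gr P n. s (msc P c p) = msc P c (s p)) \<and>
      (\<forall>p\<in>gr P n. \<forall>a. s (ract P p a) = ract P (s p) a) \<and> (\<forall>p\<in>gr P n. s p \<in> gr P (Suc n) \<and> bd P (s p) = w p)"
proof -
  have "projective_bimodule R P (gr P n)"
    by (insert res[unfolded projective_resolution_def], elim conjE, erule spec)
  then obtain \<iota> :: "'m \<Rightarrow> (('r \<times> 'm \<times> 'r) \<Rightarrow>\<^sub>0 'k)" and x where x: "\<forall>i. x i \<in> gr P n"
    and \<iota>': "\<forall>p\<in>gr P n. \<forall>q\<in>gr P n. \<iota> (p + q) - (\<iota> p + \<iota> q) \<in> free_bimod_rels R"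
      "\<forall>c. \<forall>p\<in>gr P n. \<iota> (msc P c p) - pm_scale c (\<iota> p) \<in> free_bimod_rels R"
      "\<forall>a. \<forall>p\<in>gr P n. \<iota> (ract P p a) - free_ract R (\<iota> p) a \<in> free_bimod_rels R"
      "\<forall>p\<in>gr P n. free_ext (msc P) (\<lambda>(a, i, b). ract P (lact P a (x i)) b) (\<iota> p) = p"
    unfolding projective_bimodule_def by (elim exE conjE) (rule that, assumption+)
  note x = x[rule_format] and \<iota> = \<iota>'[rule_format]
  define h where "h = (\<lambda>(a, i, b). ract P (c (w (lact P a (x i)))) b)"
  have hv: "h (a, i, b) = ract P (c (w (lact P a (x i)))) b" for a i b by (simp add: h_def)
  let ?h = "free_ext (msc P) h"
  note hl = lin_free_ext[OF vsM, of h] and hg = free_ext_gen[OF vsM, of h]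
  have m: "lact P a (x i) \<in> gr P n" for a i by (rule gr_l[OF x])
  have rel: "?h z = 0" if "z \<in> free_bimod_rels R" for z
    using that unfolding free_bimod_rels_def
    by (rule span_lin_ind[OF vs_pm_scale])
      (auto simp: lin_simps[OF hl] lin_scale[OF hl] hg hv w m lin_simps[OF c(1)] lin_scale[OF c(1)]
        lin_simps[OF ra_lin] lin_scale[OF ra_lin] lin_add[OF la_lin'] lin_scale[OF la_lin']
        lin_add[OF ra_lin'] lin_scale[OF ra_lin'] vs_simps(2)[OF vsM])
  \<comment> \<open>\<open>\<iota>\<close> is additive and right linear only modulo the relations;
    since \<open>?h\<close> kills those, the composite is honestly right linear.\<close>
  have eq: "?h z = ?h z'" if "z - z' \<in> free_bimod_rels R" for z z'
    using rel[OF that] by (simp add: lin_diff[OF hl])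
  let ?fr = "\<lambda>a z. free_ract R z a :: ('r \<times> 'm \<times> 'r) \<Rightarrow>\<^sub>0 'k"
  have frl: "lin pm_scale pm_scale (?fr a)" for a
    unfolding free_ract_def by (rule lin_free_ext[OF vs_pm_scale])
  have hr: "?h (?fr a z) = ract P (?h z) a" for a z
  proof -
    have "?h (?fr a z) = free_ext (msc P) (\<lambda>i. ?h (?fr a (gen i))) z"
      by (rule lin_free_eq[OF lin_comp[OF frl hl]])
    also have "(\<lambda>i. ?h (?fr a (gen i))) = (\<lambda>i. ract P (?h (gen i)) a)"
      by (auto simp: free_ract_def free_ext_gen[OF vs_pm_scale] hg hv ra_mul)
    also have "free_ext (msc P) (\<lambda>i. ract P (?h (gen i)) a) z = ract P (?h z) a"
      by (rule lin_free_eq[OF lin_comp[OF hl ra_lin], symmetric])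
    finally show ?thesis .
  qed
  have hgr: "?h z \<in> gr P (Suc n)" for z
    unfolding free_ext_def by (rule gr.F_mem(7)) (auto simp: h_def w m intro!: gr.F_mem gr_r c(2) split: prod.split)
  have bdh: "bd P (?h (\<iota> p)) = w p" if p: "p \<in> gr P n" for p
  proof -
    have "bd P (?h (\<iota> p)) = free_ext (msc P) (\<lambda>i. bd P (?h (gen i))) (\<iota> p)"
      by (rule lin_free_eq[OF lin_comp[OF hl bd_lin]])
    also have "(\<lambda>i. bd P (?h (gen i))) = (\<lambda>i. w ((\<lambda>(a, i, b). ract P (lact P a (x i)) b) i))"
      by (auto simp: hg hv bd_r w m)
    also have "free_ext (msc P) \<dots> (\<iota> p) = w (free_ext (msc P) (\<lambda>(a, i, b). ract P (lact P a (x i)) b) (\<iota> p))"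
      by (rule lin_on_sum[symmetric]) (auto simp: w m intro: gr_r gr_l x)
    finally show ?thesis by (simp add: \<iota>(4)[OF p])
  qed
  show ?thesis
  proof (rule exI[of _ "\<lambda>p. ?h (\<iota> p)"], intro conjI ballI allI)
    fix p assume p: "p \<in> gr P n"
    show "?h (\<iota> (p + q)) = ?h (\<iota> p) + ?h (\<iota> q)" if "q \<in> gr P n" for q
      using eq[OF \<iota>(1)[OF p that]] by (simp add: lin_add[OF hl])
    show "?h (\<iota> (msc P c p)) = msc P c (?h (\<iota> p))" for c
      using eq[OF \<iota>(2)[OF p]] by (simp add: lin_scale[OF hl])
    show "?h (\<iota> (ract P p a)) = ract P (?h (\<iota> p)) a" for a
      using eq[OF \<iota>(3)[OF p]] by (simp add: hr)
    show "?h (\<iota> p) \<in> gr P (Suc n)" "bd P (?h (\<iota> p)) = w p"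
      using hgr bdh p by auto
  qed
qed

text \<open>Right linearity is what lets \<open>s \<otimes> 1\<close> be formed on
  \<open>P \<otimes> P\<close> over \<open>R\<close>. On the augmentation module the section is
  \<open>r \<mapsto> e r\<close> with one element \<open>e\<close> over the unit, and higher degrees
  follow by lifting \<open>p - s (bd P p)\<close> with \<open>right_lift\<close>.\<close>

lemma right_contraction:
  "\<exists>s e. lin (msc P) (msc P) s \<and> (\<forall>p a. s (ract P p a) = ract P (s p) a) \<and> (\<forall>n. \<forall>p\<in>gr P n. s p \<in> gr P (Suc n)) \<and>
     e \<in> gr P 0 \<and> (\<forall>p. bd P (s p) + s (bd P p) = p - ract P e (aug P p))"
proof -
  obtain c \<eta> where c: "lin (msc P) (msc P) c" "\<And>n p. p \<in> gr P n \<Longrightarrow> c p \<in> gr P (Suc n)"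
    "\<And>r. \<eta> r \<in> gr P 0" "\<And>r. aug P (\<eta> r) = r" "\<And>p. bd P (c p) + c (bd P p) = p - \<eta> (aug P p)"
    "lin (asc R) (msc P) \<eta>"
    using k_contraction by blast
  have dc: "bd P (c p) = p" if "bd P p = 0" "aug P p = 0" for p
    using c(5)[of p] that by (simp add: lin_0[OF c(1)] lin_0[OF c(6)])
  define e where "e = \<eta> (aone R)"
  have e: "e \<in> gr P 0" "aug P e = aone R" by (simp_all add: e_def c)
  \<comment> \<open>The clause on \<open>gr P (Suc n)\<close> carries the induction: a right inverse
    on boundaries makes \<open>p - s (bd P p)\<close> a cycle in the next degree, so that it can be
    lifted again.\<close>
  define good where "good n s \<longleftrightarrow> (\<forall>p\<in>gr P n. \<forall>q\<in>gr P n. s (p + q) = s p + s q) \<and> (\<forall>c. \<forall>p\<in>gr P n. s (msc P c p) = msc P c (s p)) \<and>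
      (\<forall>p\<in>gr P n. \<forall>a. s (ract P p a) = ract P (s p) a) \<and> (\<forall>p\<in>gr P n. s p \<in> gr P (Suc n)) \<and>
      (\<forall>p\<in>gr P (Suc n). bd P (s (bd P p)) = bd P p) \<and>
      (n = 0 \<longrightarrow> (\<forall>p\<in>gr P 0. bd P (s p) = p - ract P e (aug P p)))"
    for n and s :: "'m \<Rightarrow> 'm"
  have good0: "\<exists>s. good 0 s"
  proof -
    let ?w = "\<lambda>p. p - ract P e (aug P p)"
    have "\<exists>s. (\<forall>p\<in>gr P 0. \<forall>q\<in>gr P 0. s (p + q) = s p + s q) \<and> (\<forall>c. \<forall>p\<in>gr P 0. s (msc P c p) = msc P c (s p)) \<and>
      (\<forall>p\<in>gr P 0. \<forall>a. s (ract P p a) = ract P (s p) a) \<and> (\<forall>p\<in>gr P 0. s p \<in> gr P (Suc 0) \<and> bd P (s p) = ?w p)"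
    proof (rule right_lift[OF c(1,2)])
      fix p assume p: "p \<in> gr P 0"
      have "aug P (ract P e (aug P p)) = aug P p" by (simp add: aug_r e mul_one)
      then show "bd P (c (?w p)) = ?w p"
        by (intro dc) (simp_all add: lin_diff[OF bd_lin] lin_diff[OF aug_lin] bd_0 p gr_r e)
    qed (auto simp: lin_add[OF aug_lin] lin_scale[OF aug_lin] aug_r ra_mul lin_add[OF ra_lin'] lin_scale[OF ra_lin']
        lin_diff[OF ra_lin] vs_simps[OF vsM] gr.F_mem gr_r e)
    then obtain s where "(\<forall>p\<in>gr P 0. \<forall>q\<in>gr P 0. s (p + q) = s p + s q) \<and> (\<forall>c. \<forall>p\<in>gr P 0. s (msc P c p) = msc P c (s p)) \<and>
      (\<forall>p\<in>gr P 0. \<forall>a. s (ract P p a) = ract P (s p) a) \<and> (\<forall>p\<in>gr P 0. s p \<in> gr P (Suc 0) \<and> bd P (s p) = ?w p)" by blast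
    then have "good 0 s" unfolding good_def by (auto simp: bd_gr aug_bd lin_0[OF ra_lin'])
    then show ?thesis by (rule exI[of "good 0"])
  qed
  have goodS: "\<exists>s'. good (Suc n) s' \<and> (\<forall>p\<in>gr P (Suc n). bd P (s' p) = p - s (bd P p))" if s: "good n s" for n s
  proof -
    have s1: "p \<in> gr P n \<Longrightarrow> q \<in> gr P n \<Longrightarrow> s (p + q) = s p + s q" "p \<in> gr P n \<Longrightarrow> s (msc P c p) = msc P c (s p)"
      "p \<in> gr P n \<Longrightarrow> s (ract P p a) = ract P (s p) a" "p \<in> gr P n \<Longrightarrow> s p \<in> gr P (Suc n)"
      "p \<in> gr P (Suc n) \<Longrightarrow> bd P (s (bd P p)) = bd P p"
      for p q a c using s unfolding good_def by blast+
    have s0: "s 0 = 0" using s1(1)[of 0 0] by (simp add: gr.F_mem)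
    let ?w = "\<lambda>p. p - s (bd P p)"
    have "\<exists>s. (\<forall>p\<in>gr P (Suc n). \<forall>q\<in>gr P (Suc n). s (p + q) = s p + s q) \<and> (\<forall>c. \<forall>p\<in>gr P (Suc n). s (msc P c p) = msc P c (s p)) \<and>
      (\<forall>p\<in>gr P (Suc n). \<forall>a. s (ract P p a) = ract P (s p) a) \<and> (\<forall>p\<in>gr P (Suc n). s p \<in> gr P (Suc (Suc n)) \<and> bd P (s p) = ?w p)"
    proof (rule right_lift[OF c(1,2)])
      fix p assume p: "p \<in> gr P (Suc n)"
      have "?w p \<in> gr P (Suc n)" by (simp add: gr.F_mem p s1 bd_gr)
      then show "bd P (c (?w p)) = ?w p"
        by (intro dc) (simp_all add: lin_diff[OF bd_lin] s1(5)[OF p] aug_Suc)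
    qed (auto simp: lin_add[OF bd_lin] lin_scale[OF bd_lin] bd_r s1 bd_gr gr.F_mem lin_diff[OF ra_lin] vs_simps[OF vsM])
    then obtain s' where "(\<forall>p\<in>gr P (Suc n). \<forall>q\<in>gr P (Suc n). s' (p + q) = s' p + s' q) \<and> (\<forall>c. \<forall>p\<in>gr P (Suc n). s' (msc P c p) = msc P c (s' p)) \<and>
      (\<forall>p\<in>gr P (Suc n). \<forall>a. s' (ract P p a) = ract P (s' p) a) \<and> (\<forall>p\<in>gr P (Suc n). s' p \<in> gr P (Suc (Suc n)) \<and> bd P (s' p) = ?w p)"
      by blast
    then show ?thesis unfolding good_def by (intro exI[of _ s']) (auto simp: bd_gr bd_bd s0)
  qed
  obtain rs where rs: "\<And>n. good n (rs n)" "\<And>n p. p \<in> gr P (Suc n) \<Longrightarrow> bd P (rs (Suc n) p) = p - rs n (bd P p)"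
    using dependent_nat_choice[of good "\<lambda>n s s'. \<forall>p\<in>gr P (Suc n). bd P (s' p) = p - s (bd P p)", OF good0 goodS]
    by blast
  have r: "p \<in> gr P n \<Longrightarrow> q \<in> gr P n \<Longrightarrow> rs n (p + q) = rs n p + rs n q" "p \<in> gr P n \<Longrightarrow> rs n (msc P c p) = msc P c (rs n p)"
      "p \<in> gr P n \<Longrightarrow> rs n (ract P p a) = ract P (rs n p) a" "p \<in> gr P n \<Longrightarrow> rs n p \<in> gr P (Suc n)"
      for p q a c n using rs(1)[of n] unfolding good_def by blast+
  have r0: "p \<in> gr P 0 \<Longrightarrow> bd P (rs 0 p) = p - ract P e (aug P p)" for p using rs(1)[of 0] unfolding good_def by blast
  define s where "s = gext (gr P) rs"
  have sl: "lin (msc P) (msc P) s" and se: "\<And>n p. p \<in> gr P n \<Longrightarrow> s p = rs n p"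
    unfolding s_def
    by (rule gr.gext_lin[OF vsM]; simp add: r) (rule gr.gext_eq[OF vsM]; simp add: r)
  have 1: "s (ract P p a) = ract P (s p) a" for p a
    by (induction p rule: gr_induct) (simp_all add: se se[OF gr_r] r lin_add[OF ra_lin] lin_add[OF sl])
  have 2: "bd P (s p) + s (bd P p) = p - ract P e (aug P p)" for p
  proof (induction p rule: gr_induct)
    case (hom i p)
    then show ?case
      by (cases i) (simp_all add: se r0 bd_0 lin_0[OF sl] rs(2) se[OF bd_gr] aug_Suc lin_0[OF ra_lin'])
  next
    case (add x y)
    show ?case
      using arg_cong2[of _ _ _ _ "(+)", OF add]
      by (simp add: lin_add[OF bd_lin] lin_add[OF sl] lin_add[OF aug_lin] lin_add[OF ra_lin'] algebra_simps)
  qed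
  have 3: "s p \<in> gr P (Suc n)" if "p \<in> gr P n" for p n using that by (simp add: se r)
  show ?thesis by (intro exI[of _ s] exI[of _ e] conjI allI ballI sl 1 3 e(1) 2)
qed

end

section \<open>Cochains on the bar resolution\<close>

text \<open>The alternating sum over all ways to multiply two neighbours.  On lists that include the two
  outer bimodule entries it is the differential of the bar resolution.\<close>

fun msum :: "('r \<Rightarrow> 'r \<Rightarrow> 'r) \<Rightarrow> ('r list \<Rightarrow> 'm::ab_group_add) \<Rightarrow> 'r list \<Rightarrow> 'm" where
  "msum \<mu> H (a # b # r) = H (\<mu> a b # r) - msum \<mu> (\<lambda>s. H (a # s)) (b # r)"
| "msum \<mu> H _ = 0"

lemma msum_closed:
  "msum \<mu> H as = (\<Sum>i = 1..<length as. signed (int i - 1)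
     (H (take (i - 1) as @ [\<mu> (as ! (i - 1)) (as ! i)] @ drop (i + 1) as)))"
proof (induction \<mu> H as rule: msum.induct)
  case (1 \<mu> H a b r)
  define f where "f i = signed (int i - 1)
      (H (take (i - 1) (a # b # r) @ [\<mu> ((a # b # r) ! (i - 1)) ((a # b # r) ! i)] @ drop (i + 1) (a # b # r)))" for i
  have "(\<Sum>i = Suc 1..<Suc (length (b # r)). f i)
    = (\<Sum>i = 1..<length (b # r). - signed (int i - 1)
      (H (a # take (i - 1) (b # r) @ [\<mu> ((b # r) ! (i - 1)) ((b # r) ! i)] @ drop (i + 1) (b # r))))"
    unfolding sum.shift_bounds_Suc_ivl
  proof (rule sum.cong[OF refl])
    fix i assume "i \<in> {1..<length (b # r)}"
    then obtain j where "i = Suc j" by (cases i) auto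
    then show "f (Suc i) =
      - signed (int i - 1) (H (a # take (i - 1) (b # r) @ [\<mu> ((b # r) ! (i - 1)) ((b # r) ! i)] @ drop (i + 1) (b # r)))"
      by (auto simp: signed_def f_def)
  qed
  also have "\<dots> = - msum \<mu> (\<lambda>s. H (a # s)) (b # r)" by (simp only: 1 sum_negf)
  finally have 2: "(\<Sum>i = Suc 1..<Suc (length (b # r)). f i) = - msum \<mu> (\<lambda>s. H (a # s)) (b # r)" .
  have "f 1 = H (\<mu> a b # r)" by (simp add: f_def signed_zero)
  moreover have "(\<Sum>i = 1..<length (a # b # r). f i) = f 1 + (\<Sum>i = Suc 1..<Suc (length (b # r)). f i)"
    by (subst sum.atLeast_Suc_lessThan) auto
  ultimately show ?case unfolding f_def[symmetric] 2 by simp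
qed auto

lemma msum_cong:
  "(\<And>s. Suc (length s) = length as \<Longrightarrow> H s = K s) \<Longrightarrow> msum \<mu> H as = msum \<mu> K as"
  by (induction \<mu> H as arbitrary: K rule: msum.induct) auto

lemma msum_additive:
  assumes "\<And>x y. f (x + y) = f x + (f y :: 'b::ab_group_add)"
  shows "msum \<mu> (\<lambda>s. f (H s)) as = f (msum \<mu> H as)"
proof -
  have "f (x - y) = f x - f y" for x y
    using assms[of x "- y"] additive_neg[of f, OF assms] by simp
  then show ?thesis
    by (induction \<mu> H as rule: msum.induct) (auto simp: additive_0[of f, OF assms])
qed

lemma msum_zero [simp]: "msum \<mu> (\<lambda>s. 0) as = (0::'b::ab_group_add)"
  using msum_additive[of "\<lambda>x. 0 :: 'b"] by simp

lemma msum_diff: "msum \<mu> (\<lambda>s. H s - K s) as = msum \<mu> H as - msum \<mu> K as"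
  by (induction \<mu> H as arbitrary: K rule: msum.induct) auto

lemma msum_add: "msum \<mu> (\<lambda>s. H s + K s) as = msum \<mu> H as + msum \<mu> K as"
  by (induction \<mu> H as arbitrary: K rule: msum.induct) auto

text \<open>The entry \<open>z\<close> belongs to both pieces, so each pair of neighbours lies in
  exactly one of them. Passing over \<open>u\<close> costs the sign of its length.\<close>

lemma msum_append:
  "msum \<mu> H (u @ z # v) = msum \<mu> (\<lambda>s. H (s @ v)) (u @ [z]) + signed (int (length u)) (msum \<mu> (\<lambda>s. H (u @ s)) (z # v))"
proof (induction u arbitrary: H)
  case (Cons a u)
  then show ?case by (cases u) (auto simp: signed_def)
qed (simp add: signed_zero)

text \<open>The part of \<open>msum\<close> in which \<open>a\<close> is multiplied into the next
  entry. The value at the empty list makes \<open>msum_Cons\<close> valid for singletons too, which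
  keeps the inductions below free of cases.\<close>

definition hmul :: "('r \<Rightarrow> 'r \<Rightarrow> 'r) \<Rightarrow> 'r \<Rightarrow> ('r list \<Rightarrow> 'm::ab_group_add) \<Rightarrow> 'r list \<Rightarrow> 'm" where
  "hmul \<mu> a H s = (case s of [] \<Rightarrow> 0 | b # r \<Rightarrow> H (\<mu> a b # r))"

lemma msum_Cons: "msum \<mu> H (a # s) = hmul \<mu> a H s - msum \<mu> (\<lambda>s. H (a # s)) s"
  by (cases s) (simp_all add: hmul_def)

lemma hmul_Cons [simp]: "hmul \<mu> a H (b # r) = H (\<mu> a b # r)"
  by (simp add: hmul_def)

text \<open>Disjoint pairs of products occur twice with opposite signs, overlapping ones cancel by
  associativity. Splitting off the first entry \<open>a\<close>, the products away from
  \<open>a\<close> vanish by induction, and what remains compares \<open>(a b) c\<close> with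
  \<open>a (b c)\<close>.\<close>

lemma msum_msum:
  assumes "\<And>a b c. \<mu> (\<mu> a b) c = \<mu> a (\<mu> b c)"
  shows "msum \<mu> (msum \<mu> H) as = 0"
proof (induction "length as" arbitrary: as H)
  case (Suc n)
  then show ?case
  proof (cases as rule: remdups_adj.cases)
    case (3 a b as')
    show ?thesis
    proof (cases as')
      case (Cons c r)
      have IH: "msum \<mu> (msum \<mu> (\<lambda>s. H (a # s))) (b # c # r) = 0"
        by (rule Suc(1)) (use Suc 3 Cons in simp)
      have e: "(\<lambda>s. msum \<mu> H (a # s)) = (\<lambda>s. hmul \<mu> a H s - msum \<mu> (\<lambda>s. H (a # s)) s)"
        by (rule ext) (rule msum_Cons)
      have "msum \<mu> (msum \<mu> H) as = msum \<mu> H (\<mu> a b # c # r) - msum \<mu> (hmul \<mu> a H) (b # c # r)"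
      proof -
        have "msum \<mu> (\<lambda>s. msum \<mu> H (a # s)) (b # c # r) = msum \<mu> (hmul \<mu> a H) (b # c # r)"
          unfolding e msum_diff IH by (rule diff_0_right)
        then show ?thesis by (simp only: 3 Cons msum.simps(1)[of \<mu> "msum \<mu> H"])
      qed
      also have "\<dots> = 0" by (simp add: assms)
      finally show ?thesis .
    qed (simp add: 3)
  qed auto
qed simp

text \<open>The bimodule map on the bar resolution that corresponds to the cochain \<open>F\<close>,
  evaluated on lists which include the left and right outer entries; lists too short to have both
  are sent to \<open>0\<close>.\<close>

definition hat :: "('k, 'r, 'm::ab_group_add, 'z) bimod_scheme \<Rightarrow> ('r list \<Rightarrow> 'm) \<Rightarrow> 'r list \<Rightarrow> 'm" where
  "hat M F s = (if length s < 2 then 0 else lact M (hd s) (ract M (F (butlast (tl s))) (last s)))"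

lemma hat_snoc [simp]: "hat M F (x # as @ [y]) = lact M x (ract M (F as) y)"
  by (simp add: hat_def)

lemma hat_short [simp]: "hat M F [] = 0" "hat M F [x] = 0"
  by (simp_all add: hat_def)

lemma bar_bd_msum:
  assumes "as \<noteq> []"
  shows "bar_bd A M F as = lact M (hd as) (F (tl as)) - msum (amul A) F as
     + signed (int (length as)) (ract M (F (butlast as)) (last as))"
  using assms by (simp add: bar_bd_def msum_closed sum_negf[symmetric] signed_pred)

lemma multilinear_iff: "multilinear A s F \<longleftrightarrow> (\<forall>p z. lin (asc A) s (\<lambda>a. F (p @ a # z)))"
  by (simp add: multilinear_def)

lemma multilinear_Cons:
  assumes "multilinear A s F"
  shows "multilinear A s (\<lambda>as. F (a # as))"
  unfolding multilinear_iff
proof (intro allI)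
  fix p z show "lin (asc A) s (\<lambda>b. F (a # p @ b # z))"
    using assms[unfolded multilinear_iff, rule_format, of "a # p" z] by simp
qed

lemma multilinear_comp: "multilinear A s F \<Longrightarrow> lin s s' g \<Longrightarrow> multilinear A s' (\<lambda>as. g (F as))"
  unfolding multilinear_iff using lin_comp by blast

lemma multilinear_plus: "multilinear A s F \<Longrightarrow> multilinear A s G \<Longrightarrow> multilinear A s (\<lambda>as. F as + G as)"
  and multilinear_minus: "multilinear A s F \<Longrightarrow> multilinear A s G \<Longrightarrow> multilinear A s (\<lambda>as. F as - G as)"
  and multilinear_sgn: "multilinear A s F \<Longrightarrow> multilinear A s (\<lambda>as. signed e (F as))"
  by (simp_all add: multilinear_iff lin_intros)

lemma multilinear_length: "multilinear A s F \<Longrightarrow> multilinear A s (\<lambda>as. signed (e (length as)) (F as))"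
  unfolding multilinear_iff by (simp add: lin_sgn)

lemma lin_msum:
  assumes "vector_space s1" "vector_space s2" "\<And>s. lin s1 s2 (\<lambda>a. H a s)"
  shows "lin s1 s2 (\<lambda>a. msum \<mu> (H a) z)"
  using assms(3)
proof (induction "length z" arbitrary: z H)
  case (Suc n)
  show ?case
  proof (cases z rule: remdups_adj.cases)
    case (3 b c r)
    have "lin s1 s2 (\<lambda>a. msum \<mu> (\<lambda>s. H a (b # s)) (c # r))"
      by (rule Suc(1)) (use Suc 3 in auto)
    then show ?thesis using Suc(3) by (simp add: 3 lin_minus)
  qed (simp_all add: lin_zero assms)
qed (simp add: lin_zero assms)

lemma (in algebra) multilinear_msum:
  assumes "vector_space s" "multilinear R s H"
  shows "multilinear R s (msum (amul R) H)"
proof -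
  have "\<forall>z. lin (asc R) s (\<lambda>a. msum (amul R) H (p @ a # z))" for p
    using assms(2)
  proof (induction p arbitrary: H)
    case Nil
    have H: "lin (asc R) s (\<lambda>a. H (a # z))" for z
      using Nil[unfolded multilinear_iff, rule_format, of "[]"] by simp
    have "lin (asc R) s (\<lambda>a. hmul (amul R) a H z)" for z
      by (cases z) (simp_all add: hmul_def lin_zero[OF vsR assms(1)] lin_comp[OF mul_lin_left H])
    moreover have "lin (asc R) s (\<lambda>a. msum (amul R) (\<lambda>s. H (a # s)) z)" for z
      by (rule lin_msum[OF vsR assms(1)]) (rule H)
    ultimately show ?case by (simp add: msum_Cons lin_minus)
  next
    case (Cons c p)
    note H = Cons(2)[unfolded multilinear_iff, rule_format]
    have "lin (asc R) s (\<lambda>a. hmul (amul R) c H (p @ a # z))" for z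
    proof (cases p)
      case Nil
      then show ?thesis using lin_comp[OF mul_lin_right, of s "\<lambda>a. H (a # z)"] H[of "[]"] by simp
    next
      case (Cons d q)
      then show ?thesis using H[of "amul R c d # q"] by simp
    qed
    then show ?case using Cons(1)[OF multilinear_Cons[OF Cons(2)]] by (simp add: msum_Cons lin_minus)
  qed
  then show ?thesis unfolding multilinear_iff by blast
qed

context bimod
begin

text \<open>With the outer entries in the list, the two boundary terms of \<open>bar_bd\<close> are
  products of neighbours like all others. This is what makes \<open>msum\<close> the right tool:
  \<open>bar_bd\<close> squares to zero and the Leibniz rules below become statements about
  \<open>msum\<close>.\<close>

lemma hat_bar_bd: "hat M (bar_bd R M F) s = msum (amul R) (hat M F) s"
proof (cases s)
  case (Cons x t)
  show ?thesis
  proof (cases t rule: rev_cases)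
    case (snoc as y)
    show ?thesis
    proof (cases as)
      case Nil
      then show ?thesis by (simp add: Cons snoc hat_def bar_bd_def lin_0[OF la_lin] lin_0[OF ra_lin])
    next
      case (Cons a r)
      let ?H = "\<lambda>s. hat M F (x # s)"
      \<comment> \<open>The list is cut at the last inner entry, so that its product with the right
        outer entry is separated from the products among inner entries.\<close>
      have b: "butlast as @ [last as] = as" by (rule append_butlast_last_id) (simp add: Cons)
      have "butlast as @ last as # [y] = (butlast as @ [last as]) @ [y]" by (simp only: append_assoc append_Cons append_Nil)
      then have "as @ [y] = butlast as @ last as # [y]" by (simp only: b)
      then have "msum (amul R) ?H (as @ [y]) = msum (amul R) ?H (butlast as @ last as # [y])" by (rule arg_cong)
      also have "\<dots> = msum (amul R) (\<lambda>s. ?H (s @ [y])) as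
          + signed (int (length r)) (lact M x (ract M (F (butlast as)) (amul R (last as) y)))"
        unfolding msum_append[of _ _ "butlast as" "last as" "[y]"] b using hat_snoc[of M F x "butlast as" "amul R (last as) y"] by (simp add: Cons)
      also have "msum (amul R) (\<lambda>s. ?H (s @ [y])) as = lact M x (ract M (msum (amul R) F as) y)"
        by (simp add: msum_additive[of "\<lambda>p. lact M x (ract M p y)"] lin_add[OF la_lin] lin_add[OF ra_lin])
      finally have 1: "msum (amul R) ?H (as @ [y]) = lact M x (ract M (msum (amul R) F as) y)
        + signed (int (length r)) (lact M x (ract M (F (butlast as)) (amul R (last as) y)))" .
      have "msum (amul R) (hat M F) s = lact M (amul R x a) (ract M (F r) y) - msum (amul R) ?H (as @ [y])"
        by (simp add: \<open>s = x # t\<close> snoc msum_Cons[of _ _ x] Cons)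
      also have "\<dots> = lact M x (ract M (bar_bd R M F as) y)"
        unfolding 1 using Cons
        by (simp add: bar_bd_msum la_mul ra_mul ra_la lin_simps[OF la_lin] lin_simps[OF ra_lin] signed_Suc)
      finally show ?thesis by (simp add: \<open>s = x # t\<close> snoc)
    qed
  qed (simp add: Cons)
qed simp

lemma bar_bd_hat: "bar_bd R M F as = hat M (bar_bd R M F) (aone R # as @ [aone R])"
  by simp

lemma bar_bd_bar_bd: "bar_bd R M (bar_bd R M F) as = 0"
proof -
  have "hat M (bar_bd R M F) = msum (amul R) (hat M F)" by (rule ext) (rule hat_bar_bd)
  then show ?thesis
    unfolding bar_bd_hat[of "bar_bd R M F"] hat_bar_bd[of "bar_bd R M F"] by (simp add: msum_msum mul_assoc del: msum.simps)
qed

lemma multilinear_lact_hd: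
  assumes F: "multilinear R (msc M) F"
  shows "multilinear R (msc M) (\<lambda>as. if as = [] then 0 else lact M (hd as) (F (tl as)))"
  unfolding multilinear_iff
proof (intro allI)
  fix p z
  show "lin (asc R) (msc M) (\<lambda>a. if p @ a # z = [] then 0 else lact M (hd (p @ a # z)) (F (tl (p @ a # z))))"
    using F[unfolded multilinear_iff, rule_format, THEN lin_comp, OF la_lin] by (cases p) (simp_all add: la_lin')
qed

lemma multilinear_ract_last:
  assumes F: "multilinear R (msc M) F"
  shows "multilinear R (msc M) (\<lambda>as. if as = [] then 0 else ract M (F (butlast as)) (last as))"
  unfolding multilinear_iff
proof (intro allI)
  fix p z
  show "lin (asc R) (msc M) (\<lambda>a. if p @ a # z = [] then 0 else ract M (F (butlast (p @ a # z))) (last (p @ a # z)))"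
    using F[unfolded multilinear_iff, rule_format, THEN lin_comp, OF ra_lin]
    by (cases z rule: rev_cases) (simp_all add: ra_lin' butlast_append)
qed

lemma bar_bd_parts: "bar_bd R M F as = (if as = [] then 0 else lact M (hd as) (F (tl as))) - msum (amul R) F as
     + signed (int (length as)) (if as = [] then 0 else ract M (F (butlast as)) (last as))"
  using bar_bd_msum[of as R M F] by (simp add: bar_bd_def signed_0)

lemma multilinear_bar_bd:
  assumes F: "multilinear R (msc M) F"
  shows "multilinear R (msc M) (bar_bd R M F)"
  unfolding bar_bd_parts
  by (intro multilinear_plus multilinear_minus multilinear_lact_hd F multilinear_msum vsM
      multilinear_length[where e = int] multilinear_ract_last)

lemma multilinear_hat:
  assumes F: "multilinear R (msc M) F"
  shows "multilinear R (msc M) (\<lambda>s. hat M F (x # s))"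
proof -
  have "hat M F (x # s) = (if s = [] then 0 else ract M (lact M x (F (butlast s))) (last s))" for s
    by (cases s rule: rev_cases) (simp_all add: ra_la)
  then show ?thesis by (simp add: multilinear_ract_last[OF multilinear_comp[OF F la_lin]])
qed

end

section \<open>The circle product on the bar resolution\<close>

text \<open>The circle product with the number of places read off from the list instead of the
  degree of the outer map. The outer map may thus be a whole chain map, such as a comparison map
  into \<open>P\<close>, and not just a cochain of one degree.\<close>

definition ccirc :: "nat \<Rightarrow> ('r list \<Rightarrow> 'm) \<Rightarrow> ('r list \<Rightarrow> 'r) \<Rightarrow> 'r list \<Rightarrow> 'm::ab_group_add" where
  "ccirc m G F as = (\<Sum>i = 1..length as + 1 - m. signed ((int m - 1) * (int i - 1))
     (G (take (i - 1) as @ [F (take m (drop (i - 1) as))] @ drop (i - 1 + m) as)))"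

lemma circ_ccirc: "circ n m G F as = (if length as + 1 = n + m then ccirc m G F as else 0)"
  by (auto simp: circ_def ccirc_def)

text \<open>The strict inequality leaves at least one entry after the window, namely the right outer
  entry of the bar resolution.\<close>

definition win :: "nat \<Rightarrow> ('r list \<Rightarrow> 'r) \<Rightarrow> ('r list \<Rightarrow> 'm) \<Rightarrow> 'r list \<Rightarrow> 'm::ab_group_add" where
  "win m F H s = (if m < length s then H (F (take m s) # drop m s) else 0)"

text \<open>Insertion of \<open>F\<close> at all places, except that the last entry of the list is never used as an
  argument of \<open>F\<close>.\<close>

fun ins :: "nat \<Rightarrow> ('r list \<Rightarrow> 'r) \<Rightarrow> ('r list \<Rightarrow> 'm) \<Rightarrow> 'r list \<Rightarrow> 'm::ab_group_add" where
  "ins m F H [] = 0"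
| "ins m F H (a # r) = win m F H (a # r) + signed (int m - 1) (ins m F (\<lambda>s. H (a # s)) r)"

lemma ins_closed:
  "ins m F H (as @ [y]) = (\<Sum>i = 1..length as + 1 - m. signed ((int m - 1) * (int i - 1))
     (H (take (i - 1) as @ [F (take m (drop (i - 1) as))] @ drop (i - 1 + m) as @ [y])))"
proof (induction as arbitrary: H)
  case Nil
  show ?case by (cases m) (auto simp: win_def signed_zero signed_0)
next
  case (Cons a r)
  show ?case
  proof (cases "m \<le> Suc (length r)")
    case True
    then have l: "length (a # r) + 1 - m = Suc (length r + 1 - m)" by simp
    define f where "f i = signed ((int m - 1) * (int i - 1))
       (H (take (i - 1) (a # r) @ [F (take m (drop (i - 1) (a # r)))] @ drop (i - 1 + m) (a # r) @ [y]))" for i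
    have "(\<Sum>i = Suc 1..Suc (length r + 1 - m). f i)
      = (\<Sum>i = 1..length r + 1 - m. signed (int m - 1) (signed ((int m - 1) * (int i - 1))
       (H (a # take (i - 1) r @ [F (take m (drop (i - 1) r))] @ drop (i - 1 + m) r @ [y]))))"
      unfolding sum.shift_bounds_cl_Suc_ivl
    proof (rule sum.cong[OF refl])
      fix i assume "i \<in> {1..length r + 1 - m}"
      then obtain j where "i = Suc j" by (cases i) auto
      then show "f (Suc i) = signed (int m - 1) (signed ((int m - 1) * (int i - 1))
          (H (a # take (i - 1) r @ [F (take m (drop (i - 1) r))] @ drop (i - 1 + m) r @ [y])))"
        by (auto simp: f_def signed_signed intro!: signed_cong)
    qed
    also have "\<dots> = signed (int m - 1) (ins m F (\<lambda>s. H (a # s)) (r @ [y]))"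
      unfolding Cons signed_sum ..
    finally have 1: "(\<Sum>i = Suc 1..Suc (length r + 1 - m). f i) = signed (int m - 1) (ins m F (\<lambda>s. H (a # s)) (r @ [y]))" .
    have 2: "(\<Sum>i = 1..Suc (length r + 1 - m). f i) = f 1 + (\<Sum>i = Suc 1..Suc (length r + 1 - m). f i)"
      by (rule sum.atLeast_Suc_atMost) simp
    have "take m (a # r @ [y]) = take m (a # r)" "drop m (a # r @ [y]) = drop m (a # r) @ [y]"
      using True take_append[of m "a # r" "[y]"] drop_append[of m "a # r" "[y]"] by simp_all
    then have "win m F H (a # r @ [y]) = f 1"
      using True by (simp add: win_def f_def signed_zero)
    then show ?thesis
      unfolding l f_def[symmetric] 1 2 by simp
  next
    case False
    then show ?thesis by (simp add: Cons win_def signed_0)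
  qed
qed

lemma ins_diff: "ins m F (\<lambda>s. H s - K s) as = ins m F H as - ins m F K as"
  by (induction as arbitrary: H K) (auto simp: win_def signed_diff)

lemma win_short: "length s \<le> m \<Longrightarrow> win m F H s = 0"
  by (simp add: win_def)

lemma multilinear_win:
  assumes "multilinear A (asc A) F" "multilinear A s H" "vector_space (asc A)" "vector_space s"
  shows "multilinear A s (win m F H)"
  unfolding multilinear_iff
proof (intro allI)
  fix p z
  note H = assms(2)[unfolded multilinear_iff, rule_format]
  note F = assms(1)[unfolded multilinear_iff, rule_format]
  show "lin (asc A) s (\<lambda>a. win m F H (p @ a # z))"
  proof (cases "m < length (p @ undefined # z)")
    case True
    show ?thesis
    proof (cases "m \<le> length p")
      case True
      then show ?thesis using H[of "F (take m p) # drop m p"] by (simp add: win_def)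
    next
      case False
      then obtain j where j: "m = length p + Suc j" using less_imp_add_positive[of "length p" m] by (auto simp: gr0_conv_Suc)
      have "lin (asc A) s (\<lambda>a. H ([] @ F (p @ a # take j z) # drop j z))"
        by (rule lin_comp[OF F H])
      then show ?thesis using True by (simp add: win_def j)
    qed
  next
    case False
    then show ?thesis by (simp add: win_def lin_zero assms)
  qed
qed

lemma lin_ins:
  assumes "vector_space s1" "vector_space s2" "\<And>s. lin s1 s2 (\<lambda>a. H a s)"
  shows "lin s1 s2 (\<lambda>a. ins m F (H a) z)"
  using assms(3)
proof (induction z arbitrary: H)
  case (Cons b z)
  have "lin s1 s2 (\<lambda>a. win m F (H a) (b # z))"
    by (cases "m < Suc (length z)") (simp_all add: win_def assms(1,2) Cons lin_zero)
  then show ?case by (simp add: Cons lin_plus lin_sgn)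
qed (simp add: lin_zero assms(1,2))

lemma multilinear_ins:
  assumes "multilinear A (asc A) F" "multilinear A s H" "vector_space (asc A)" "vector_space s"
  shows "multilinear A s (ins m F H)"
proof -
  have "\<forall>z. lin (asc A) s (\<lambda>a. ins m F H (p @ a # z))" for p
    using assms(2)
  proof (induction p arbitrary: H)
    case Nil
    have "lin (asc A) s (\<lambda>a. win m F H ([] @ a # z))" for z
      using multilinear_win[OF assms(1) Nil assms(3,4)] unfolding multilinear_iff by blast
    moreover have "lin (asc A) s (\<lambda>a. ins m F (\<lambda>s. H (a # s)) z)" for z
      by (rule lin_ins[OF assms(3,4)]) (use Nil[unfolded multilinear_iff, rule_format, of "[]"] in simp)
    ultimately show ?case by (simp add: lin_plus lin_sgn)
  next
    case (Cons c p)
    have "lin (asc A) s (\<lambda>a. win m F H ((c # p) @ a # z))" for z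
      using multilinear_win[OF assms(1) Cons(2) assms(3,4)] unfolding multilinear_iff by blast
    then show ?case using Cons(1)[OF multilinear_Cons[OF Cons(2)]] by (simp add: lin_plus lin_sgn)
  qed
  then show ?thesis unfolding multilinear_iff by blast
qed

section \<open>The Leibniz rule for insertions\<close>

context algebra
begin

abbreviation "bdR \<equiv> bar_bd R (regular R)"

text \<open>Products to the right of the window cancel. The others assemble \<open>bdR F\<close> on
  a window longer by one: its left factor arises from \<open>hmul\<close>, its right factor from the
  entry behind the window, its inner products from \<open>msum\<close> inside the window. With a
  single entry behind the window there is no room for the longer one, and the product with that
  entry is left over.\<close>

lemma win_step:
  assumes H: "multilinear R s H"
  shows "win m F (msum (amul R) H) (a # r) + signed (int m - 1) (win m F (hmul (amul R) a H) r)
      - signed (int m - 1) (msum (amul R) (win m F H) (a # r))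
    = signed (int m - 1) (win (Suc m) (bdR F) H (a # r))
      + (if length r = m then H [amul R (F (take m (a # r))) (last (a # r))] else 0)"
proof -
  let ?as = "a # r" and ?\<mu> = "amul R"
  have msum0: "length ?as \<le> Suc m \<Longrightarrow> msum ?\<mu> (win m F H) ?as = 0"
    using msum_cong[of ?as "win m F H" "\<lambda>_. 0" ?\<mu>] by (simp add: win_short del: msum.simps)
  consider "length ?as \<le> m" | "length ?as = Suc m" | "length ?as \<ge> Suc (Suc m)" by linarith
  then show ?thesis
  proof cases
    case 1
    then show ?thesis by (simp add: msum0 win_short signed_0 del: msum.simps)
  next
    case 2
    have d: "drop m ?as = [last ?as]"
      using 2 by (metis append_butlast_last_id append_eq_conv_conj length_butlast diff_Suc_1 list.distinct(1))
    have "win m F (msum ?\<mu> H) ?as = H [?\<mu> (F (take m ?as)) (last ?as)]"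
      using 2 unfolding win_def d by simp
    then show ?thesis using 2 by (simp add: msum0 win_short signed_0 del: msum.simps)
  next
    case 3
    define w where "w = take m ?as"
    define z1 where "z1 = ?as ! m"
    define z where "z = drop (Suc m) ?as"
    have as: "?as = w @ z1 # z" using 3 unfolding w_def z1_def z_def by (intro id_take_nth_drop) simp
    have H1: "lin (asc R) s (\<lambda>x. H (x # z))"
      using H[unfolded multilinear_iff, rule_format, of "[]"] by simp
    have w: "length w = m" and z: "z \<noteq> []" using 3 by (auto simp: w_def z_def)
    have "take (Suc m) ?as = w @ [z1]"
      unfolding w_def z1_def by (rule take_Suc_conv_app_nth) (use 3 in simp)
    then have ar: "a # take m r = w @ [z1]" "drop m r = z" by (simp_all add: z_def)
    have ht: "hd (w @ [z1]) = a" "tl (w @ [z1]) = take m r" by (simp_all only: ar(1)[symmetric] list.sel)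
    have "msum ?\<mu> (win m F H) ?as = msum ?\<mu> (\<lambda>s. win m F H (s @ z)) (w @ [z1])
        + signed (int m) (msum ?\<mu> (\<lambda>s. win m F H (w @ s)) (z1 # z))"
      using msum_append[of ?\<mu> "win m F H" w z1 z] unfolding as w .
    also have "msum ?\<mu> (\<lambda>s. win m F H (s @ z)) (w @ [z1]) = msum ?\<mu> (\<lambda>s. H (F s # z)) (w @ [z1])"
      by (rule msum_cong) (use w z in \<open>simp add: win_def\<close>)
    also have "\<dots> = H (msum ?\<mu> F (w @ [z1]) # z)"
      by (rule msum_additive[of "\<lambda>x. H (x # z)"]) (rule lin_add[OF H1])
    also have "msum ?\<mu> (\<lambda>s. win m F H (w @ s)) (z1 # z) = msum ?\<mu> (\<lambda>s. H (F w # s)) (z1 # z)"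
      by (rule msum_cong) (use w z in \<open>auto simp: win_def\<close>)
    finally have 1: "msum ?\<mu> (win m F H) ?as
      = H (msum ?\<mu> F (w @ [z1]) # z) + signed (int m) (msum ?\<mu> (\<lambda>s. H (F w # s)) (z1 # z))" .
    have 2: "win m F (msum ?\<mu> H) ?as = H (?\<mu> (F w) z1 # z) - msum ?\<mu> (\<lambda>s. H (F w # s)) (z1 # z)"
      unfolding as using w by (simp add: win_def)
    have c3: "win m F (hmul ?\<mu> a H) r = H (?\<mu> a (F (take m r)) # z)"
      using 3 ar by (simp add: win_def)
    have 4: "win (Suc m) (bdR F) H ?as = H (bdR F (w @ [z1]) # z)"
      unfolding as using w z by (simp add: win_def)
    have 5: "bdR F (w @ [z1]) = ?\<mu> a (F (take m r)) - msum ?\<mu> F (w @ [z1]) + signed (int (Suc m)) (?\<mu> (F w) z1)"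
      using bar_bd_msum[of "w @ [z1]" R "regular R" F] w by (simp add: ht)
    show ?thesis
      unfolding 1 2 c3 4 5 lin_add[OF H1] lin_diff[OF H1] lin_signed[OF H1] using 3
      by (simp add: signed_add signed_diff signed_signed; simp add: signed_def)
  qed
qed

text \<open>\<open>win_step\<close> is added up along the list. The leftover term can occur only at
  the last place, where the window abuts the right outer entry; its sign collects one factor for
  every entry passed.\<close>

lemma ins_msum:
  fixes H :: "'r list \<Rightarrow> 'n::ab_group_add"
  assumes "multilinear R s H"
  shows "ins m F (msum (amul R) H) as + signed (int m) (msum (amul R) (ins m F H) as)
    = signed (int m - 1) (ins (Suc m) (bdR F) H as)
      + (if m < length as then signed (int m * (int (length as) - int m - 1))
           (H (take (length as - m - 1) as @ [amul R (F (take m (drop (length as - m - 1) as))) (last as)])) else 0)"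
  using assms
proof (induction as arbitrary: H)
  case (Cons a r)
  let ?\<mu> = "amul R" and ?e = "signed (int m - 1) :: 'n \<Rightarrow> 'n"
  let ?Ha = "\<lambda>s. H (a # s)"
  note Ha = multilinear_Cons[OF Cons.prems, of a]
  \<comment> \<open>The contributions that involve the head \<open>a\<close> are separated from
    those of the tail. The term where the window starts right after a product \<open>a b\<close>
    occurs in both summands and cancels.\<close>
  have *: "ins m F (msum ?\<mu> H) (a # r) + signed (int m) (msum ?\<mu> (ins m F H) (a # r))
     = (win m F (msum ?\<mu> H) (a # r) + ?e (win m F (hmul ?\<mu> a H) r) - ?e (msum ?\<mu> (win m F H) (a # r)))
       + signed (int m) (ins m F (msum ?\<mu> ?Ha) r + signed (int m) (msum ?\<mu> (ins m F ?Ha) r))"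
  proof (cases r)
    case Nil
    then show ?thesis by (simp add: win_def hmul_def signed_0)
  next
    case (Cons b r')
    have e1: "(\<lambda>s. msum ?\<mu> H (a # s)) = (\<lambda>s. hmul ?\<mu> a H s - msum ?\<mu> ?Ha s)" by (rule ext) (rule msum_Cons)
    have e2: "(\<lambda>s. hmul ?\<mu> a H (b # s)) = (\<lambda>s. H (?\<mu> a b # s))" by simp
    have e3: "(\<lambda>s. ins m F H (a # s)) = (\<lambda>s. win m F H (a # s) + ?e (ins m F ?Ha s))" by simp
    have s: "msum ?\<mu> (\<lambda>s. ?e (ins m F ?Ha s)) (b # r') = ?e (msum ?\<mu> (ins m F ?Ha) (b # r'))"
      by (rule msum_additive[of ?e]) (rule signed_add)
    have A: "ins m F (msum ?\<mu> H) (a # r)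
      = win m F (msum ?\<mu> H) (a # r) + ?e (ins m F (hmul ?\<mu> a H) r - ins m F (msum ?\<mu> ?Ha) r)"
      by (simp only: ins.simps e1 ins_diff)
    have B: "ins m F (hmul ?\<mu> a H) r = win m F (hmul ?\<mu> a H) r + ?e (ins m F (\<lambda>s. H (?\<mu> a b # s)) r')"
      by (simp only: Cons ins.simps e2)
    have C: "msum ?\<mu> (ins m F H) (a # r) = win m F H (?\<mu> a b # r') + ?e (ins m F (\<lambda>s. H (?\<mu> a b # s)) r')
      - (msum ?\<mu> (\<lambda>s. win m F H (a # s)) r + ?e (msum ?\<mu> (ins m F ?Ha) r))"
      by (simp only: Cons msum.simps(1) e3 msum_add s) (simp only: ins.simps)
    have D: "msum ?\<mu> (win m F H) (a # r) = win m F H (?\<mu> a b # r') - msum ?\<mu> (\<lambda>s. win m F H (a # s)) r"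
      by (simp only: Cons msum.simps(1))
    show ?thesis
      unfolding A B C D by (simp add: signed_def)
  qed
  show ?case
    unfolding * win_step[OF Cons.prems] Cons.IH[OF Ha]
  proof -
    consider "length r < m" | "length r = m" | "m < length r" by linarith
    then show "?e (win (Suc m) (bdR F) H (a # r)) + (if length r = m then H [?\<mu> (F (take m (a # r))) (last (a # r))] else 0) +
      signed (int m) (?e (ins (Suc m) (bdR F) ?Ha r) + (if m < length r then signed (int m * (int (length r) - int m - 1))
        (H (a # take (length r - m - 1) r @ [?\<mu> (F (take m (drop (length r - m - 1) r))) (last r)])) else 0))
      = ?e (ins (Suc m) (bdR F) H (a # r)) + (if m < length (a # r) then signed (int m * (int (length (a # r)) - int m - 1))
        (H (take (length (a # r) - m - 1) (a # r) @ [?\<mu> (F (take m (drop (length (a # r) - m - 1) (a # r)))) (last (a # r))])) else 0)"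
    proof cases
      case 1
      then show ?thesis by (simp add: signed_0 signed_add signed_signed; simp add: signed_def)
    next
      case 2
      then show ?thesis by (simp add: signed_0 signed_zero signed_add signed_signed; simp add: signed_def)
    next
      case 3
      then obtain j where j: "length r = Suc (m + j)" using less_imp_Suc_add by blast
      then have "r \<noteq> []" by auto
      then show ?thesis using j
        by (simp add: Suc_diff_le signed_0 signed_zero signed_add signed_signed; auto simp: signed_def algebra_simps)
    qed
  qed
qed (simp add: signed_0)

end

context bimod
begin

text \<open>Windows that avoid both outer entries see only the inner list, so insertion into the
  bimodule extension is the bimodule extension of the circle product.\<close>

lemma ins_hat: "ins m F (\<lambda>s. hat M G (x # s)) (as @ [y]) = lact M x (ract M (ccirc m G F as) y)"
proof -
  have "hat M G (x # take (i - 1) as @ [F (take m (drop (i - 1) as))] @ drop (i - 1 + m) as @ [y])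
    = lact M x (ract M (G (take (i - 1) as @ [F (take m (drop (i - 1) as))] @ drop (i - 1 + m) as)) y)" for i
    using hat_snoc[of M G x "take (i - 1) as @ [F (take m (drop (i - 1) as))] @ drop (i - 1 + m) as" y] by simp
  then show ?thesis
    unfolding ins_closed ccirc_def
    by (simp only: lin_sum[OF la_lin] lin_sum[OF ra_lin] lin_signed[OF la_lin] lin_signed[OF ra_lin])
qed

lemma hat_ccirc: "hat M (ccirc m G F) (x # s) = ins m F (\<lambda>s. hat M G (x # s)) s"
  by (cases s rule: rev_cases) (simp_all add: ins_hat)

lemma multilinear_ccirc:
  assumes "multilinear R (asc R) F" "multilinear R (msc M) G"
  shows "multilinear R (msc M) (ccirc m G F)"
proof -
  have "multilinear R (msc M) (ins m F (\<lambda>s. hat M G (aone R # s)))"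
    by (intro multilinear_ins assms multilinear_hat vsR vsM)
  then have "lin (asc R) (msc M) (\<lambda>a. ins m F (\<lambda>s. hat M G (aone R # s)) (p @ a # z @ [aone R]))" for p z
    unfolding multilinear_iff by blast
  moreover have "ins m F (\<lambda>s. hat M G (aone R # s)) (p @ a # z @ [aone R]) = ccirc m G F (p @ a # z)" for p a z
    using ins_hat[of m F G "aone R" "p @ a # z" "aone R"] by simp
  ultimately show ?thesis unfolding multilinear_iff by simp
qed

text \<open>The circle product fails to be compatible with the differentials by the two cup products
  of \<open>F\<close> and \<open>G\<close>. One comes from a window at the very beginning,
  multiplied into the left outer entry, the other from the leftover term of \<open>ins_msum\<close>
  at the right outer entry.\<close>

lemma ccirc_bar_bd:
  assumes G: "multilinear R (msc M) G"
  shows "ccirc m (bar_bd R M G) F as + signed (int m) (bar_bd R M (ccirc m G F) as)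
    = (if m \<le> length as then lact M (F (take m as)) (G (drop m as))
         - signed (int m * (int (length as) - int m)) (ract M (G (take (length as - m) as)) (F (drop (length as - m) as)))
       else 0) - signed (int m - 1) (ccirc (Suc m) G (bar_bd R (regular R) F) as)"
proof -
  let ?\<mu> = "amul R" and ?x = "aone R" and ?e = "signed (int m - 1) :: 'm \<Rightarrow> 'm"
  let ?H = "\<lambda>s. hat M G (?x # s)"
  \<comment> \<open>Naming the first entry exposes its product with the left outer unit; for an
    empty inner list it is the right outer unit.\<close>
  obtain a r where ar: "as @ [?x] = a # r" by (cases as) auto
  have e0: "hat M (bar_bd R M G) = msum ?\<mu> (hat M G)" for G by (rule ext) (rule hat_bar_bd)
  have e1: "(\<lambda>s. msum ?\<mu> (hat M G) (?x # s)) = (\<lambda>s. hmul ?\<mu> ?x (hat M G) s - msum ?\<mu> ?H s)"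
    by (rule ext) (rule msum_Cons)
  have A: "ccirc m (bar_bd R M G) F as = ins m F (hmul ?\<mu> ?x (hat M G)) (as @ [?x]) - ins m F (msum ?\<mu> ?H) (as @ [?x])"
    using ins_hat[of m F "bar_bd R M G" ?x as ?x] by (simp add: e0 e1 ins_diff)
  have "ins m F (hmul ?\<mu> ?x (hat M G)) (as @ [?x]) = win m F (hmul ?\<mu> ?x (hat M G)) (as @ [?x])
      + ?e (ins m F (\<lambda>s. hat M G (?\<mu> ?x a # s)) r)"
    unfolding ar by simp
  moreover have "bar_bd R M (ccirc m G F) as = ins m F (\<lambda>s. hat M G (?\<mu> ?x a # s)) r - msum ?\<mu> (ins m F ?H) (as @ [?x])"
  proof -
    have "bar_bd R M (ccirc m G F) as = msum ?\<mu> (hat M (ccirc m G F)) (?x # as @ [?x])"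
      by (subst bar_bd_hat) (rule hat_bar_bd)
    also have "\<dots> = hat M (ccirc m G F) (?\<mu> ?x a # r) - msum ?\<mu> (\<lambda>s. hat M (ccirc m G F) (?x # s)) (as @ [?x])"
      unfolding ar by simp
    finally show ?thesis unfolding hat_ccirc .
  qed
  ultimately have "ccirc m (bar_bd R M G) F as + signed (int m) (bar_bd R M (ccirc m G F) as)
    = win m F (hmul ?\<mu> ?x (hat M G)) (as @ [?x])
      - (ins m F (msum ?\<mu> ?H) (as @ [?x]) + signed (int m) (msum ?\<mu> (ins m F ?H) (as @ [?x])))"
    unfolding A by (simp add: signed_def)
  also have "\<dots> = win m F (hmul ?\<mu> ?x (hat M G)) (as @ [?x]) - (?e (ccirc (Suc m) G (bdR F) as)
      + (if m \<le> length as then signed (int m * (int (length as) - int m)) (hat M G (?x # take (length as - m) as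
          @ [?\<mu> (F (take m (drop (length as - m) as))) ?x])) else 0))"
    unfolding ins_msum[OF multilinear_hat[OF G]] ins_hat by (auto simp: less_Suc_eq_le)
  also have "win m F (hmul ?\<mu> ?x (hat M G)) (as @ [?x]) = (if m \<le> length as then lact M (F (take m as)) (G (drop m as)) else 0)"
    by (auto simp: win_def mul_one)
  finally show ?thesis by (auto simp: mul_one)
qed

end

section \<open>Splitting\<close>

text \<open>Deconcatenation. With \<open>P u v\<close> the tensor product of \<open>u\<close> and
  \<open>v\<close> this is the usual diagonal of the bar resolution.\<close>

definition split_sum :: "('r list \<Rightarrow> 'r list \<Rightarrow> 'm) \<Rightarrow> 'r list \<Rightarrow> 'm::ab_group_add" where
  "split_sum P as = (\<Sum>i\<le>length as. P (take i as) (drop i as))"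

lemma multilinear_split_sum:
  assumes s: "vector_space (asc A)" "vector_space s"
    and P: "\<And>v. multilinear A s (\<lambda>u. P u v)" "\<And>u. multilinear A s (P u)"
  shows "multilinear A s (split_sum P)"
  unfolding multilinear_iff
proof (intro allI)
  fix p z
  have "lin (asc A) s (\<lambda>a. P (take i (p @ a # z)) (drop i (p @ a # z)))" for i
  proof (cases "i \<le> length p")
    case True
    then show ?thesis using P(2)[unfolded multilinear_iff, rule_format, of "take i p" "drop i p" z] by simp
  next
    case False
    then obtain j where j: "i = length p + Suc j" using less_imp_add_positive[of "length p" i] by (auto simp: gr0_conv_Suc)
    show ?thesis using P(1)[unfolded multilinear_iff, rule_format, of p "take j z" "drop j z"] by (simp add: j)
  qed
  then have "lin (asc A) s (\<lambda>a. \<Sum>i\<le>length p + length (undefined # z). P (take i (p @ a # z)) (drop i (p @ a # z)))"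
    by (intro lin_sums s)
  then show "lin (asc A) s (\<lambda>a. split_sum P (p @ a # z))"
    by (simp only: split_sum_def length_append list.size)
qed

lemma split_sum_Nil [simp]: "split_sum P [] = P [] []"
  by (simp add: split_sum_def)

lemma split_sum_Cons [simp]: "split_sum P (a # r) = P [] (a # r) + split_sum (\<lambda>u. P (a # u)) r"
  by (simp add: split_sum_def sum.atMost_Suc_shift del: sum.atMost_Suc)

lemma split_sum_snoc: "split_sum P (r @ [a]) = split_sum (\<lambda>u v. P u (v @ [a])) r + P (r @ [a]) []"
  by (induction r arbitrary: P) (simp_all add: add.assoc)

lemma split_sum_cong: "(\<And>u v. as = u @ v \<Longrightarrow> P u v = P' u v) \<Longrightarrow> split_sum P as = split_sum P' as"
  by (simp add: split_sum_def)

lemma split_sum_add: "split_sum (\<lambda>u v. P u v + P' u v) as = split_sum P as + split_sum P' as"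
  and split_sum_diff: "split_sum (\<lambda>u v. P u v - P' u v) as = split_sum P as - split_sum P' as"
  by (simp_all add: split_sum_def sum.distrib sum_subtractf)

lemma split_sum_additive:
  assumes "\<And>x y. f (x + y) = f x + (f y :: 'b::ab_group_add)"
  shows "f (split_sum P as) = split_sum (\<lambda>u v. f (P u v)) as"
  unfolding split_sum_def by (rule additive_sum) (rule assms)

lemma split_sum_single:
  assumes "\<And>u v. as = u @ v \<Longrightarrow> length u \<noteq> j \<Longrightarrow> P u v = 0"
  shows "split_sum P as = (if j \<le> length as then P (take j as) (drop j as) else 0)"
proof -
  have "split_sum P as = (\<Sum>i\<le>length as. if i = j then P (take j as) (drop j as) else 0)"
    unfolding split_sum_def
  proof (rule sum.cong[OF refl])
    fix i assume "i \<in> {..length as}"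
    then show "P (take i as) (drop i as) = (if i = j then P (take j as) (drop j as) else 0)"
      using assms[of "take i as" "drop i as"] by auto
  qed
  then show ?thesis by simp
qed

lemma split_sum_single_right:
  assumes "\<And>u v. as = u @ v \<Longrightarrow> length v \<noteq> j \<Longrightarrow> P u v = 0"
  shows "split_sum P as = (if j \<le> length as then P (take (length as - j) as) (drop (length as - j) as) else 0)"
proof (cases "j \<le> length as")
  case True
  show ?thesis
    using split_sum_single[of as "length as - j" P] assms True by force
next
  case False
  have "split_sum P as = split_sum (\<lambda>u v. 0) as"
    by (rule split_sum_cong) (use assms False in force)
  then show ?thesis using False by (simp add: split_sum_def)
qed

text \<open>A cut never separates two entries already multiplied together, so multiplying first and
  cutting then is the same as cutting first and multiplying within one of the pieces.\<close>

lemma msum_split_sum: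
  "msum \<mu> (split_sum P) as = split_sum (\<lambda>u v. msum \<mu> (\<lambda>s. P s v) u + signed (int (length u)) (msum \<mu> (P u) v)) as"
proof (induction as arbitrary: P)
  case (Cons a r)
  show ?case
  proof (cases r)
    case (Cons b r')
    have z: "(\<lambda>u v. msum \<mu> (\<lambda>s. P s v) (a # u) + signed (int (length (a # u))) (msum \<mu> (P (a # u)) v))
      = (\<lambda>u v. hmul \<mu> a (\<lambda>s. P s v) u - (msum \<mu> (\<lambda>s. P (a # s) v) u + signed (int (length u)) (msum \<mu> (P (a # u)) v)))"
      by (intro ext) (simp add: msum_Cons signed_Suc)
    have h: "split_sum (\<lambda>u v. hmul \<mu> a (\<lambda>s. P s v) u) r = split_sum (\<lambda>u. P (\<mu> a b # u)) r'"
      by (simp add: Cons) (simp add: hmul_def)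
    have "msum \<mu> (split_sum P) (a # r) = P [] (\<mu> a b # r') + split_sum (\<lambda>u. P (\<mu> a b # u)) r'
        - msum \<mu> (\<lambda>s. P [] (a # s)) r - msum \<mu> (split_sum (\<lambda>u. P (a # u))) r"
      by (simp add: Cons msum_add)
    also have "\<dots> = msum \<mu> (P []) (a # r) + (split_sum (\<lambda>u v. hmul \<mu> a (\<lambda>s. P s v) u) r
        - msum \<mu> (split_sum (\<lambda>u. P (a # u))) r)"
      unfolding h by (simp add: Cons)
    finally show ?thesis
      unfolding Cons.IH[of "\<lambda>u. P (a # u)"] split_sum_diff[symmetric] z[symmetric]
      by (simp add: signed_zero)
  qed (simp add: signed_0)
qed (simp add: signed_0)

text \<open>Both sides run over decompositions into a left list, one entry and a right list; the
  entry is counted once with the left and once with the right piece. The left length differs by one,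
  hence the sign. In a balanced tensor product this cancels the outer terms at the cut.\<close>

lemma split_sum_shift:
  "split_sum (\<lambda>u v. if u = [] then 0 else signed (int (length u)) (B (butlast u) (last u) v)) as
   = - split_sum (\<lambda>u v. if v = [] then 0 else signed (int (length u)) (B u (hd v) (tl v))) as"
proof (induction as arbitrary: B)
  case (Cons a r)
  have "(\<lambda>u v. if a # u = [] then 0 else signed (int (length (a # u))) (B (butlast (a # u)) (last (a # u)) v))
     = (\<lambda>u v. (if u = [] then - B [] a v else 0) - (if u = [] then 0 else signed (int (length u)) (B (a # butlast u) (last u) v)))"
    by (intro ext) (auto simp: signed_Suc signed_zero)
  moreover have "split_sum (\<lambda>u v. if u = [] then - B [] a v else 0) r = - B [] a r"
    using split_sum_single[of r 0 "\<lambda>u v. if u = [] then - B [] a v else 0"] by auto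
  moreover have "(\<lambda>u v. if v = [] then 0 else signed (int (length (a # u))) (B (a # u) (hd v) (tl v)))
     = (\<lambda>u v. 0 - (if v = [] then 0 else signed (int (length u)) (B (a # u) (hd v) (tl v))))"
    by (intro ext) (auto simp: signed_Suc)
  ultimately show ?case
    by (simp only: split_sum_Cons split_sum_diff Cons[of "\<lambda>u. B (a # u)"])
      (simp add: signed_zero split_sum_def)
qed simp

section \<open>Null homotopies on the bar resolution\<close>

lemma bar_bd_cong:
  assumes "\<And>s. Suc (length s) = length as \<Longrightarrow> F s = G s"
  shows "bar_bd A M F as = bar_bd A M G as"
proof (cases "as = []")
  case False
  have "F (tl as) = G (tl as)" "F (butlast as) = G (butlast as)" "msum (amul A) F as = msum (amul A) G as"
    using False by (auto intro!: assms msum_cong)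
  then show ?thesis using bar_bd_msum[OF False, of A M F] bar_bd_msum[OF False, of A M G] by simp
qed (simp add: bar_bd_def)

lemma bar_bd_hom:
  assumes "bimod_hom M N f"
  shows "f (bar_bd A M F as) = bar_bd A N (\<lambda>s. f (F s)) as"
proof -
  note L = bh_lin[OF assms]
  show ?thesis
    by (simp add: bar_bd_def bh_l[OF assms] bh_r[OF assms] lin_add[OF L] lin_0[OF L] lin_sum[OF L] lin_signed[OF L])
qed

context bimod
begin

lemma bar_bd_add: "bar_bd R M (\<lambda>s. F s + G s) as = bar_bd R M F as + bar_bd R M G as"
  by (simp add: bar_bd_parts msum_add lin_add[OF la_lin] lin_add[OF ra_lin] signed_add signed_0)

lemma bar_bd_diff: "bar_bd R M (\<lambda>s. F s - G s) as = bar_bd R M F as - bar_bd R M G as"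
  by (simp add: bar_bd_parts msum_diff lin_diff[OF la_lin] lin_diff[OF ra_lin] signed_diff signed_0)

lemma bar_bd_signed: "bar_bd R M (\<lambda>s. signed e (F s)) as = signed e (bar_bd R M F as)"
  by (cases "even e") (simp_all add: signed_def bar_bd_diff[of "\<lambda>_. 0", simplified] bar_bd_add[of "\<lambda>_. 0" "\<lambda>_. 0", simplified])

lemma bar_bd_Nil: "bar_bd R M F [] = 0"
  by (simp add: bar_bd_def)

lemma bar_bd_mem:
  assumes V: "module.subspace (msc M) V" "\<And>a v. v \<in> V \<Longrightarrow> lact M a v \<in> V" "\<And>a v. v \<in> V \<Longrightarrow> ract M v a \<in> V"
    and F: "\<And>s. Suc (length s) = length as \<Longrightarrow> F s \<in> V"
  shows "bar_bd R M F as \<in> V"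
proof -
  note V' = subspaceD[OF vsM V(1)]
  have "(\<Sum>i = 1..<length as. signed (int i)
              (F (take (i - 1) as @ [amul R (as ! (i - 1)) (as ! i)] @ drop (i + 1) as))) \<in> V"
    by (intro V'(7) V'(6) F) auto
  then show ?thesis unfolding bar_bd_def by (auto intro!: V' V F)
qed

text \<open>The bar resolution is free, so prescribing \<open>N\<close> on inner entries is enough,
  and the contraction \<open>s\<close> supplies the value as soon as the part still to be killed is
  a cycle in \<open>Z\<close>. Working with subspaces \<open>Z k\<close> instead of degrees
  restricts everything to a part on which \<open>s\<close> contracts without an augmentation
  term.\<close>

lemma null_homotopy:
  fixes Z :: "int \<Rightarrow> 'm set"
  assumes Z: "\<And>k. module.subspace (msc M) (Z k)" "\<And>k a v. v \<in> Z k \<Longrightarrow> lact M a v \<in> Z k"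
      "\<And>k a v. v \<in> Z k \<Longrightarrow> ract M v a \<in> Z k"
    and d: "bimod_hom M M d" and s: "lin (msc M) (msc M) s" "\<And>k v. v \<in> Z k \<Longrightarrow> s v \<in> Z (k + 1)"
    and ds: "\<And>k v. v \<in> Z k \<Longrightarrow> d (s v) + s (d v) = v"
    and \<eta>: "multilinear R (msc M) \<eta>" "\<And>as. \<eta> as \<in> Z (int (length as) + p)"
      "\<And>as. d (\<eta> as) = signed e (bar_bd R M \<eta> as)"
  shows "\<exists>N. multilinear R (msc M) N \<and> (\<forall>as. N as \<in> Z (int (length as) + p + 1)) \<and>
     (\<forall>as. \<eta> as = d (N as) + signed e (bar_bd R M N as))"
proof -
  \<comment> \<open>\<open>B k\<close> carries the intended value only on lists of length
    \<open>k\<close>, but it is a multilinear function on all lists, so multilinearity can be proved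
    first by induction on \<open>k\<close>.\<close>
  define B where "B = rec_nat (\<lambda>as. s (\<eta> as)) (\<lambda>k N as. s (\<eta> as - signed e (bar_bd R M N as)))"
  have B0: "B 0 as = s (\<eta> as)" and BS: "B (Suc k) as = s (\<eta> as - signed e (bar_bd R M (B k) as))" for k as
    by (simp_all add: B_def)
  have Bm: "multilinear R (msc M) (B k)" for k
  proof (induction k)
    case 0
    have "B 0 = (\<lambda>as. s (\<eta> as))" by (rule ext) (rule B0)
    then show ?case by (simp add: multilinear_comp[OF \<eta>(1) s(1)])
  next
    case (Suc k)
    have "B (Suc k) = (\<lambda>as. s (\<eta> as - signed e (bar_bd R M (B k) as)))" by (rule ext) (rule BS)
    then show ?case
      using multilinear_comp[OF multilinear_minus[OF \<eta>(1) multilinear_sgn[OF multilinear_bar_bd[OF Suc]]] s(1)] by simp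
  qed
  \<comment> \<open>The diagonal choice is still multilinear, since varying one entry keeps the
    length; \<open>bar_bd\<close> at a list of length \<open>Suc k\<close> sees lists of length
    \<open>k\<close> only, so \<open>N\<close> satisfies the recursion as a fixed point
    equation.\<close>
  define N where "N as = B (length as) as" for as
  have Nm: "multilinear R (msc M) N"
    using Bm unfolding multilinear_iff N_def by simp
  have N: "N as = s (\<eta> as - signed e (bar_bd R M N as))" for as
  proof (cases as)
    case Nil
    then show ?thesis by (simp add: N_def B0 bar_bd_Nil signed_0)
  next
    case (Cons a r)
    have "bar_bd R M (B (length r)) as = bar_bd R M N as"
      by (rule bar_bd_cong) (simp add: N_def Cons)
    then show ?thesis by (simp add: N_def Cons BS)
  qed
  have *: "N as \<in> Z (int (length as) + p + 1) \<and> \<eta> as = d (N as) + signed e (bar_bd R M N as)" for as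
  proof (induction "length as" arbitrary: as rule: less_induct)
    case less
    let ?w = "\<eta> as - signed e (bar_bd R M N as)"
    have IH: "N t \<in> Z (int (length as) + p)" "d (N t) = \<eta> t - signed e (bar_bd R M N t)" if "Suc (length t) = length as" for t
    proof -
      have eq: "int (length t) + p + 1 = int (length as) + p" using that by linarith
      have "length t < length as" using that by simp
      from less[OF this] show "N t \<in> Z (int (length as) + p)" "d (N t) = \<eta> t - signed e (bar_bd R M N t)"
        unfolding eq by simp_all
    qed
    have "bar_bd R M N as \<in> Z (int (length as) + p)"
      by (rule bar_bd_mem[OF Z(1)]; fact Z IH)
    then have w: "?w \<in> Z (int (length as) + p)"
      by (intro subspaceD(5)[OF vsM Z(1)] subspaceD(6)[OF vsM Z(1)] \<eta>(2))
    have "d (bar_bd R M N as) = bar_bd R M (\<lambda>t. d (N t)) as" by (rule bar_bd_hom[OF d])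
    also have "\<dots> = bar_bd R M (\<lambda>t. \<eta> t - signed e (bar_bd R M N t)) as"
      by (rule bar_bd_cong) (rule IH)
    also have "\<dots> = bar_bd R M \<eta> as"
      by (simp add: bar_bd_diff bar_bd_signed bar_bd_bar_bd signed_0)
    finally have "d ?w = 0" by (simp add: lin_diff[OF bh_lin[OF d]] lin_signed[OF bh_lin[OF d]] \<eta>(3))
    then have "d (N as) = ?w" using ds[OF w] by (simp add: N[of as] lin_0[OF s(1)])
    then show ?case using s(2)[OF w] by (simp add: N[of as, symmetric])
  qed
  show ?thesis
    by (intro exI[of _ N] conjI allI Nm *[THEN conjunct1] *[THEN conjunct2])
qed

end

section \<open>Cohomologous cochains\<close>

lemma hcohomologousI:
  assumes "hcochain A (p - 1) H" "\<And>as. F as - F' as = bar_bd A (regular A) H as"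
  shows "hcohomologous A p F F'"
  using assms unfolding hcohomologous_def by blast

context algebra
begin

sublocale reg: bimod R "regular R"
  by unfold_locales (rule bimodule_regular)

lemma hcochain_add: "hcochain R p F \<Longrightarrow> hcochain R p G \<Longrightarrow> hcochain R p (\<lambda>as. F as + G as)"
  and hcochain_diff: "hcochain R p F \<Longrightarrow> hcochain R p G \<Longrightarrow> hcochain R p (\<lambda>as. F as - G as)"
  and hcochain_signed: "hcochain R p F \<Longrightarrow> hcochain R p (\<lambda>as. signed e (F as))"
  by (simp_all add: hcochain_def multilinear_plus multilinear_minus multilinear_sgn signed_0)

lemma hcohomologous_sym:
  assumes "hcohomologous R p F F'" shows "hcohomologous R p F' F"
proof -
  obtain H where H: "hcochain R (p - 1) H" "\<And>as. F as - F' as = bdR H as"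
    using assms unfolding hcohomologous_def by blast
  show ?thesis
  proof (rule hcohomologousI)
    show "hcochain R (p - 1) (\<lambda>as. signed 1 (H as))" by (rule hcochain_signed[OF H(1)])
    show "F' as - F as = bdR (\<lambda>as. signed 1 (H as)) as" for as
      unfolding reg.bar_bd_signed H(2)[symmetric] by (simp add: signed_def)
  qed
qed

lemma hcohomologous_trans:
  assumes "hcohomologous R p F F'" "hcohomologous R p F' F''" shows "hcohomologous R p F F''"
proof -
  obtain H where H: "hcochain R (p - 1) H" "\<And>as. F as - F' as = bdR H as"
    using assms unfolding hcohomologous_def by blast
  obtain K where K: "hcochain R (p - 1) K" "\<And>as. F' as - F'' as = bdR K as"
    using assms unfolding hcohomologous_def by blast
  show ?thesis
  proof (rule hcohomologousI)
    show "hcochain R (p - 1) (\<lambda>as. H as + K as)" by (rule hcochain_add[OF H(1) K(1)])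
    show "F as - F'' as = bdR (\<lambda>as. H as + K as) as" for as
      unfolding reg.bar_bd_add H(2)[symmetric] K(2)[symmetric] by simp
  qed
qed

section \<open>The bracket on cohomology classes\<close>

lemma ccirc_zero: "multilinear R s F \<Longrightarrow> ccirc m F (\<lambda>_. 0) as = 0"
proof -
  assume F: "multilinear R s F"
  have "F (p @ 0 # z) = 0" for p z using lin_0[OF F[unfolded multilinear_iff, rule_format]] .
  then show ?thesis by (simp add: ccirc_def signed_0)
qed

lemma ccirc_diff_outer: "ccirc m (\<lambda>as. F as - G as) F' as = ccirc m F F' as - ccirc m G F' as"
  by (simp_all add: ccirc_def signed_add signed_diff sum.distrib sum_subtractf)

lemma ccirc_diff_inner:
  assumes "multilinear R s F"
  shows "ccirc m F (\<lambda>as. F' as - G as) as = ccirc m F F' as - ccirc m F G as"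
proof -
  have "F (p @ (a - b) # z) = F (p @ a # z) - F (p @ b # z)" for p z a b
    using lin_diff[OF assms[unfolded multilinear_iff, rule_format]] .
  then show ?thesis by (simp add: ccirc_def signed_diff sum_subtractf)
qed

text \<open>In a list of the wrong length every insertion produces an argument on which
  \<open>F\<close> vanishes, so the length test in \<open>circ\<close> changes nothing.\<close>

lemma circ_hcochain:
  assumes "hcochain R (int n) F"
  shows "circ n m F F' as = ccirc m F F' as"
proof (cases "length as + 1 = n + m")
  case False
  have "F (take (i - 1) as @ [F' (take m (drop (i - 1) as))] @ drop (i - 1 + m) as) = 0"
    if "i \<in> {1..length as + 1 - m}" for i
  proof -
    have "length (take (i - 1) as @ [F' (take m (drop (i - 1) as))] @ drop (i - 1 + m) as) = length as + 1 - m"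
      using that by auto
    then show ?thesis using assms False that by (auto simp: hcochain_def)
  qed
  then have "ccirc m F F' as = 0" unfolding ccirc_def by (intro sum.neutral ballI) (simp only: signed_0)
  then show ?thesis using False by (simp add: circ_def)
qed (simp add: circ_ccirc)

lemma gerstenhaber_swap: "gerstenhaber n m F F' as = signed ((int n - 1) * (int m - 1) + 1) (gerstenhaber m n F' F as)"
  by (simp add: gerstenhaber_def signed_diff signed_signed mult.commute) (simp add: signed_def)

lemma multilinear_circ:
  assumes "multilinear R (asc R) F" "multilinear R (asc R) F'"
  shows "multilinear R (asc R) (ccirc m F F')"
  using reg.multilinear_ccirc[of F' F m] assms by simp

lemma hcochain_ccirc:
  assumes "hcochain R p F" "hcochain R q F'"
  shows "hcochain R (p + int m - 1) (ccirc m F F')"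
  unfolding hcochain_def
proof (intro conjI allI impI)
  show "multilinear R (asc R) (ccirc m F F')" using assms by (simp add: hcochain_def multilinear_circ)
  fix as :: "'r list" assume l: "int (length as) \<noteq> p + int m - 1"
  have "F (take (i - 1) as @ [F' (take m (drop (i - 1) as))] @ drop (i - 1 + m) as) = 0"
    if "i \<in> {1..length as + 1 - m}" for i
  proof -
    have "length (take (i - 1) as @ [F' (take m (drop (i - 1) as))] @ drop (i - 1 + m) as) = length as + 1 - m"
      using that by auto
    then show ?thesis using assms l that by (auto simp: hcochain_def)
  qed
  then show "ccirc m F F' as = 0" unfolding ccirc_def by (intro sum.neutral ballI) (simp only: signed_0)
qed

text \<open>\<open>ccirc_bar_bd\<close> is applied to both orders of composition. As
  \<open>F'\<close> is a cocycle, only cup products and coboundaries remain, and the cup products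
  cancel in the graded commutator. For \<open>n = 0\<close> there is no nonzero \<open>H\<close> in
  degree \<open>-1\<close>.\<close>

lemma gerstenhaber_coboundary:
  assumes H: "hcochain R (int n - 1) H" and F': "hcocycle R (int m) F'"
  shows "\<exists>K. hcochain R (int n + int m - 2) K \<and>
     (\<forall>as. ccirc m (bdR H) F' as - signed ((int n - 1) * (int m - 1)) (ccirc n F' (bdR H) as) = bdR K as)"
proof (cases n)
  case 0
  then have "H = (\<lambda>_. 0)" using H by (auto simp: hcochain_def fun_eq_iff)
  moreover have "bdR (\<lambda>_. 0) = (\<lambda>_. 0)"
    using reg.bar_bd_diff[of "\<lambda>_. 0" "\<lambda>_. 0"] by (simp add: fun_eq_iff)
  moreover have m: "multilinear R (asc R) F'" using F' by (simp add: hcocycle_def hcochain_def)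
  moreover have "hcochain R p (\<lambda>_. 0)" for p
    by (simp add: hcochain_def multilinear_iff lin_zero vsR)
  ultimately show ?thesis
    by (intro exI[of _ "\<lambda>_. 0"]) (simp add: ccirc_zero[OF m] signed_0 ccirc_def[of _ "\<lambda>_. 0"])
next
  case (Suc k)
  have Hm: "multilinear R (asc R) H" and H0: "\<And>as. length as \<noteq> k \<Longrightarrow> H as = 0"
    using H by (auto simp: hcochain_def Suc)
  have Fm: "multilinear R (asc R) F'" and F0: "\<And>as. length as \<noteq> m \<Longrightarrow> F' as = 0" and dF: "bdR F' = (\<lambda>_. 0)"
    and Fc: "hcochain R (int m) F'"
    using F' by (auto simp: hcocycle_def hcochain_def fun_eq_iff)
  note I1 = reg.ccirc_bar_bd[of H m F', simplified, OF Hm]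
  note I2 = reg.ccirc_bar_bd[of F' k H, simplified, OF Fm]
  \<comment> \<open>The two cup products of \<open>F'\<close> and \<open>H\<close>, which are
    nonzero only on lists of length \<open>k + m\<close>.\<close>
  let ?a = "\<lambda>as. if length as = k + m then amul R (F' (take m as)) (H (drop m as)) else 0"
  let ?b = "\<lambda>as. if length as = k + m then amul R (H (take k as)) (F' (drop k as)) else 0"
  have z: "amul R 0 x = 0" "amul R x 0 = 0" for x
    using lin_0[OF mul_lin_left] lin_0[OF mul_lin_right] by auto
  have 1: "ccirc m (bdR H) F' as = ?a as - signed (int m * int k) (?b as) - signed (int m) (bdR (ccirc m H F') as)" for as
  proof -
    have "ccirc m (bdR H) F' as + signed (int m) (bdR (ccirc m H F') as) = ?a as - signed (int m * int k) (?b as)"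
      using I1[of as] H0 by (auto simp: dF ccirc_zero[OF Hm] z signed_0)
    then show ?thesis by (simp add: algebra_simps)
  qed
  have 2: "ccirc n F' (bdR H) as = signed (int k - 1) (?b as - signed (int m * int k) (?a as) - signed (int k) (bdR (ccirc k F' H) as))" for as
  proof -
    have "ccirc k (bdR F') H as = 0" by (simp add: dF ccirc_def signed_0)
    then have "signed (int k - 1) (ccirc n F' (bdR H) as)
      = ?b as - signed (int m * int k) (?a as) - signed (int k) (bdR (ccirc k F' H) as)"
      using I2[of as] F0 by (auto simp: Suc z signed_0 mult.commute algebra_simps)
    then have "signed (int k - 1) (signed (int k - 1) (ccirc n F' (bdR H) as))
      = signed (int k - 1) (?b as - signed (int m * int k) (?a as) - signed (int k) (bdR (ccirc k F' H) as))"
      by (rule arg_cong)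
    then show ?thesis unfolding signed_signed signed_double .
  qed
  \<comment> \<open>The coefficients are those with which the coboundaries enter the formulas
    \<open>1\<close> and \<open>2\<close> above.\<close>
  define K where "K as = signed (int m + 1) (ccirc m H F' as) - signed (int k * (int m - 1)) (ccirc k F' H as)" for as
  have "hcochain R (int n - 1 + int m - 1) (ccirc m H F')" by (rule hcochain_ccirc[OF H Fc])
  moreover have "hcochain R (int m + int k - 1) (ccirc k F' H)" by (rule hcochain_ccirc[OF Fc H])
  ultimately have "hcochain R (int n + int m - 2) K"
    unfolding K_def using Suc by (intro hcochain_diff hcochain_signed) (simp_all add: algebra_simps)
  moreover have "ccirc m (bdR H) F' as - signed ((int n - 1) * (int m - 1)) (ccirc n F' (bdR H) as) = bdR K as" for as
    unfolding K_def reg.bar_bd_diff reg.bar_bd_signed Suc 1 2[unfolded Suc]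
    by (cases "even k"; cases "even m") (simp_all add: signed_def)
  ultimately show ?thesis by blast
qed

lemma gerstenhaber_cong_left:
  assumes "hcochain R (int n) F" "hcochain R (int n) G" "hcohomologous R (int n) F G" "hcocycle R (int m) F'"
  shows "hcohomologous R (int n + int m - 1) (gerstenhaber n m F F') (gerstenhaber n m G F')"
proof -
  obtain H where H: "hcochain R (int n - 1) H" "\<And>as. F as - G as = bdR H as"
    using assms(3) unfolding hcohomologous_def by blast
  have F': "hcochain R (int m) F'" "multilinear R (asc R) F'" using assms(4) by (auto simp: hcocycle_def hcochain_def)
  obtain K where K: "hcochain R (int n + int m - 2) K"
     "\<And>as. ccirc m (bdR H) F' as - signed ((int n - 1) * (int m - 1)) (ccirc n F' (bdR H) as) = bdR K as"
    using gerstenhaber_coboundary[OF H(1) assms(4)] by blast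
  have e: "bdR H = (\<lambda>as. F as - G as)" using H(2) by (simp add: fun_eq_iff)
  show ?thesis
  proof (rule hcohomologousI)
    show "hcochain R (int n + int m - 1 - 1) K" using K(1) by (simp add: algebra_simps)
    show "gerstenhaber n m F F' as - gerstenhaber n m G F' as = bdR K as" for as
      unfolding K(2)[symmetric] e ccirc_diff_outer ccirc_diff_inner[OF F'(2)]
      by (simp add: gerstenhaber_def circ_hcochain assms(1,2) F' signed_diff)
  qed
qed

text \<open>Graded antisymmetry, in the form of \<open>gerstenhaber_swap\<close>, moves the varying
  argument to the left.\<close>

lemma gerstenhaber_cong_right:
  assumes "hcochain R (int m) F" "hcochain R (int m) G" "hcohomologous R (int m) F G" "hcocycle R (int n) F'"
  shows "hcohomologous R (int n + int m - 1) (gerstenhaber n m F' F) (gerstenhaber n m F' G)"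
proof -
  have "hcohomologous R (int m + int n - 1) (gerstenhaber m n F F') (gerstenhaber m n G F')"
    by (rule gerstenhaber_cong_left[OF assms])
  then obtain H where H: "hcochain R (int m + int n - 1 - 1) H"
    "\<And>as. gerstenhaber m n F F' as - gerstenhaber m n G F' as = bdR H as"
    unfolding hcohomologous_def by blast
  show ?thesis
  proof (rule hcohomologousI)
    show "hcochain R (int n + int m - 1 - 1) (\<lambda>as. signed ((int n - 1) * (int m - 1) + 1) (H as))"
      using H(1) by (intro hcochain_signed) (simp add: algebra_simps)
    show "gerstenhaber n m F' F as - gerstenhaber n m F' G as = bdR (\<lambda>as. signed ((int n - 1) * (int m - 1) + 1) (H as)) as" for as
      unfolding reg.bar_bd_signed H(2)[symmetric] gerstenhaber_swap[of n m F'] signed_diff ..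
  qed
qed

end

section \<open>The bracket on a differential graded coalgebra with a homotopy\<close>

text \<open>The setting is met three times: by \<open>C\<close>, by \<open>D\<close>, and in the end
  by the twisted product, whose structure maps are built from those of the first two.\<close>

locale dgc = tcplx R P T + resolution R P
  for R :: "('k::field, 'r::ab_group_add) kalg" and P :: "('k, 'r, 'm::ab_group_add) cplx"
    and T :: "('k, 'm, 'm, 't::ab_group_add) tensor" +
  fixes T3 :: "('k, 'm, 't, 'u::ab_group_add) tensor" and \<Delta> :: "'m \<Rightarrow> 't" and \<phi> :: "'t \<Rightarrow> 'm"
  assumes tens3: "is_tensor_over P (tensor_cplx R P P T) T3"
    and \<Delta>_hom: "bimod_hom P (tensor_cplx R P P T) \<Delta>"
    and \<Delta>_gr: "\<And>n p. p \<in> gr P n \<Longrightarrow> \<Delta> p \<in> gr (tensor_cplx R P P T) n"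
    and \<Delta>_bd: "\<And>p. \<Delta> (bd P p) = bd (tensor_cplx R P P T) (\<Delta> p)"
    and \<mu>\<Delta>: "\<And>p. mu_one P T (\<Delta> p) = p" "\<And>p. one_mu P T (\<Delta> p) = p"
    and hom: "homotopy R P T \<phi>"
begin

lemma \<Delta>_lin: "lin (msc P) (tsc T) \<Delta>"
  using bh_lin[OF \<Delta>_hom] by simp

lemma \<phi>_hom: "bimod_hom Q P \<phi>" and \<phi>_gr: "z \<in> gr Q n \<Longrightarrow> \<phi> z \<in> gr P (Suc n)"
  and \<phi>_bd: "bd P (\<phi> z) + \<phi> (bd Q z) = \<mu>1 z - r\<mu> z"
  using hom by (auto simp: homotopy_def)

lemma \<phi>_lin: "lin (tsc T) (msc P) \<phi>"
  using bh_lin[OF \<phi>_hom] by simp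

text \<open>Contraction with a cochain of degree \<open>m\<close> lowers degrees by
  \<open>m\<close>. Integer degrees with zero below \<open>0\<close> avoid truncated
  subtraction.\<close>

definition Zg :: "int \<Rightarrow> 'm set" where "Zg k = (if k < 0 then {0} else gr P (nat k))"
definition ZQ :: "int \<Rightarrow> 't set" where "ZQ k = (if k < 0 then {0} else gr Q (nat k))"

lemma Zg_sub: "module.subspace (msc P) (Zg k)"
  by (auto simp: Zg_def gr_sub intro!: subspaceI[OF vsM] simp: vs_simps(2)[OF vsM])

lemma ZQ_sub: "module.subspace (tsc T) (ZQ k)"
  by (auto simp: ZQ_def grQ_sub intro!: subspaceI[OF vsT] simp: vs_simps(2)[OF vsT])

lemmas Zg_mem = subspaceD[OF vsM Zg_sub] and ZQ_mem = subspaceD[OF vsT ZQ_sub]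

text \<open>The sign for moving a map of degree \<open>m\<close> past an element, as the
  \<open>m\<close>-th power of the parity operator, so that it makes sense for inhomogeneous
  elements.\<close>

definition pw :: "nat \<Rightarrow> 'm \<Rightarrow> 'm" where "pw m p = (if even m then p else parity P p)"

lemma pw_lin: "lin (msc P) (msc P) (pw m)"
  by (cases "even m") (simp_all add: pw_def[abs_def] parity_lin lin_id[OF vsM])

lemma pw_eq: "p \<in> gr P i \<Longrightarrow> pw m p = signed (int i * int m) p"
  by (auto simp: pw_def parity_eq signed_def)

lemma pw_simps: "pw m (lact P a p) = lact P a (pw m p)" "pw m (ract P p a) = ract P (pw m p) a"
  "bd P (pw m p) = signed (int m) (pw m (bd P p))" "aug P (pw m p) = aug P p"
  "parity P (pw m p) = pw m (parity P p)" "p \<in> gr P i \<Longrightarrow> pw m p \<in> gr P i"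
  by (auto simp: pw_def parity_l parity_r signed_def bd_parity aug_parity parity_gr)

section \<open>Cap products with a cocycle and the map \<open>psi\<close>\<close>

context
  fixes m :: nat and f :: "'m \<Rightarrow> 'r"
  assumes f: "cocycle R P (int m) f"
begin

lemma f_hom: "bimod_hom P (regular R) f" and f_0: "p \<in> gr P i \<Longrightarrow> i \<noteq> m \<Longrightarrow> f p = 0" and f_bd: "f (bd P p) = 0"
  using f by (auto simp: cocycle_def cochain_def)

lemmas f_lin = bh_lin[OF f_hom, simplified] and f_l = bh_l[OF f_hom, simplified] and f_r = bh_r[OF f_hom, simplified]

text \<open>In turn: \<open>f \<otimes> 1\<close> and the signed \<open>1 \<otimes> f\<close> from
  \<open>P \<otimes> P\<close> to \<open>P\<close>, the cap product
  \<open>(f \<otimes> 1) \<Delta>\<close>, and \<open>1 \<otimes> cap\<close> with its sign.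
  Contracting with \<open>f\<close> directly after the inner \<open>\<Delta>\<close> turns the
  threefold tensor product of the bracket formula into maps of \<open>P \<otimes> P\<close>.\<close>

definition fone :: "'t \<Rightarrow> 'm" where "fone = tlift T (msc P) (\<lambda>p q. lact P (f p) q)"
definition onef :: "'t \<Rightarrow> 'm" where "onef = tlift T (msc P) (\<lambda>p q. ract P (pw m p) (f q))"
definition cap :: "'m \<Rightarrow> 'm" where "cap p = fone (\<Delta> p)"
definition capr :: "'t \<Rightarrow> 't" where "capr = tlift T (tsc T) (\<lambda>p q. tpr T (pw m p) (cap q))"
definition psi :: "'m \<Rightarrow> 'm" where "psi p = \<phi> (capr (\<Delta> p))"

lemma fone_lin: "lin (tsc T) (msc P) fone" and fone_tpr: "fone (tpr T p q) = lact P (f p) q"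
  unfolding fone_def by (rule t_lift[OF vsM]; auto simp: f_r la_mul intro!: la_lin lin_comp[OF f_lin la_lin'])+

lemma onef_lin: "lin (tsc T) (msc P) onef" and onef_tpr: "onef (tpr T p q) = ract P (pw m p) (f q)"
  unfolding onef_def
  by (rule t_lift[OF vsM]; auto simp: f_l ra_mul pw_simps intro!: lin_comp[OF pw_lin ra_lin] lin_comp[OF f_lin ra_lin'])+

lemma fone_hom: "bimod_hom Q P fone"
proof (rule bimod_homI)
  show "fone (lact Q a z) = lact P a (fone z)" for a z
    by (induction z rule: t_induct) (simp_all add: Q_l fone_tpr f_l la_mul lin_add[OF Q_l_lin] lin_add[OF fone_lin] lin_add[OF la_lin])
  show "fone (ract Q z a) = ract P (fone z) a" for a z
    by (induction z rule: t_induct) (simp_all add: Q_r fone_tpr ra_la lin_add[OF Q_r_lin] lin_add[OF fone_lin] lin_add[OF ra_lin])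
qed (simp add: fone_lin)

lemma onef_hom: "bimod_hom Q P onef"
proof (rule bimod_homI)
  show "onef (lact Q a z) = lact P a (onef z)" for a z
    by (induction z rule: t_induct) (simp_all add: Q_l onef_tpr pw_simps ra_la lin_add[OF Q_l_lin] lin_add[OF onef_lin] lin_add[OF la_lin])
  show "onef (ract Q z a) = ract P (onef z) a" for a z
    by (induction z rule: t_induct) (simp_all add: Q_r onef_tpr f_r ra_mul lin_add[OF Q_r_lin] lin_add[OF onef_lin] lin_add[OF ra_lin])
qed (simp add: onef_lin)

lemma fone_gr: "z \<in> gr Q k \<Longrightarrow> fone z \<in> Zg (int k - int m)"
proof (erule grQ_lin_image[OF _ fone_lin Zg_sub])
  fix p q i j assume *: "p \<in> gr P i" "q \<in> gr P j" "i + j = k"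
  show "fone (tpr T p q) \<in> Zg (int k - int m)"
  proof (cases "i = m")
    case True
    then have "int k - int m = int j" using * by simp
    then show ?thesis using * by (simp add: fone_tpr Zg_def gr_l)
  qed (simp add: fone_tpr f_0[OF *(1)] lin_0[OF la_lin'] Zg_mem)
qed

lemma onef_gr: "z \<in> gr Q k \<Longrightarrow> onef z \<in> Zg (int k - int m)"
proof (erule grQ_lin_image[OF _ onef_lin Zg_sub])
  fix p q i j assume *: "p \<in> gr P i" "q \<in> gr P j" "i + j = k"
  show "onef (tpr T p q) \<in> Zg (int k - int m)"
  proof (cases "j = m")
    case True
    then have "int k - int m = int i" using * by simp
    then show ?thesis using * by (simp add: onef_tpr Zg_def gr_r pw_simps)
  qed (simp add: onef_tpr f_0[OF *(2)] lin_0[OF ra_lin'] Zg_mem)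
qed

text \<open>One half of the Leibniz rule dies because \<open>f\<close> is a cocycle. In the other
  the sign of the left factor of degree \<open>i\<close> occurs, and \<open>f\<close> sees that
  factor only for \<open>i = m\<close>.\<close>

lemma fone_bd: "bd P (fone z) = signed (int m) (fone (bd Q z))"
proof (induction z rule: t_induct)
  case (tpr p q i j)
  then show ?case
    by (cases "i = m") (simp_all add: fone_tpr bdQ lin_add[OF fone_lin] f_bd bd_l parity_eq lin_signed[OF f_lin]
        lin_signed[OF la_lin'] lin_0[OF la_lin'] signed_signed f_0 signed_0 lin_0[OF bd_lin])
qed (simp add: lin_add[OF fone_lin] lin_add[OF bdQ_lin] lin_add[OF bd_lin] signed_add)

lemma onef_bd: "bd P (onef z) = signed (int m) (onef (bd Q z))"
proof (induction z rule: t_induct)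
  case (tpr p q i j)
  then show ?case
    by (simp add: onef_tpr bdQ lin_add[OF onef_lin] f_bd bd_r pw_simps lin_signed[OF ra_lin] lin_0[OF ra_lin'])
qed (simp add: lin_add[OF onef_lin] lin_add[OF bdQ_lin] lin_add[OF bd_lin] signed_add)

text \<open>The value \<open>f p\<close> can be moved through the augmentation of the other factor,
  which then acts on \<open>p\<close> inside \<open>f\<close>. With counitality this gives
  \<open>aug_cap\<close>.\<close>

lemma aug_fone: "aug P (fone z) = f (r\<mu> z)"
  by (induction z rule: t_induct)
    (simp_all add: fone_tpr rmu_tpr aug_l f_r lin_add[OF fone_lin] lin_add[OF rmu_lin] lin_add[OF aug_lin] lin_add[OF f_lin])

lemma aug_onef: "aug P (onef z) = f (\<mu>1 z)"
  by (induction z rule: t_induct)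
    (simp_all add: onef_tpr mu_tpr aug_r pw_simps f_l lin_add[OF onef_lin] lin_add[OF mu_lin] lin_add[OF aug_lin] lin_add[OF f_lin])

lemma cap_hom: "bimod_hom P P cap"
  unfolding cap_def[abs_def] by (rule bh_comp[OF \<Delta>_hom fone_hom])

lemmas cap_lin = bh_lin[OF cap_hom] and cap_l = bh_l[OF cap_hom] and cap_r = bh_r[OF cap_hom]

lemma cap_gr: "p \<in> gr P k \<Longrightarrow> cap p \<in> Zg (int k - int m)"
  unfolding cap_def by (intro fone_gr \<Delta>_gr)

lemma cap_bd: "bd P (cap p) = signed (int m) (cap (bd P p))"
  by (simp add: cap_def fone_bd \<Delta>_bd)

lemma aug_cap: "aug P (cap p) = f p"
  by (simp add: cap_def aug_fone \<mu>\<Delta>)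

lemma capr_lin: "lin (tsc T) (tsc T) capr" and capr_tpr: "capr (tpr T p q) = tpr T (pw m p) (cap q)"
  unfolding capr_def
  by (rule t_lift[OF vsT]; auto simp: cap_l bal pw_simps intro!: lin_comp[OF pw_lin tl_lin] lin_comp[OF cap_lin tr_lin])+

lemma capr_hom: "bimod_hom Q Q capr"
proof (rule bimod_homI)
  show "capr (lact Q a z) = lact Q a (capr z)" for a z
    by (induction z rule: t_induct) (simp_all add: Q_l capr_tpr pw_simps lin_add[OF Q_l_lin] lin_add[OF capr_lin])
  show "capr (ract Q z a) = ract Q (capr z) a" for a z
    by (induction z rule: t_induct) (simp_all add: Q_r capr_tpr cap_r lin_add[OF Q_r_lin] lin_add[OF capr_lin])
qed (simp add: capr_lin)

lemma capr_bd: "bd Q (capr z) = signed (int m) (capr (bd Q z))"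
  by (induction z rule: t_induct)
    (simp_all add: capr_tpr bdQ lin_add[OF capr_lin] lin_add[OF bdQ_lin] pw_simps cap_bd signed_add
      lin_signed[OF tl_lin] lin_signed[OF tr_lin])

text \<open>Together with \<open>rmu_capr\<close> this evaluates the right side of the homotopy
  identity of \<open>\<phi>\<close> at \<open>capr (\<Delta> p)\<close>: by counitality the two ends
  become \<open>(f \<otimes> 1) \<Delta>\<close> and \<open>(1 \<otimes> f) \<Delta>\<close>, as
  \<open>psi_bd\<close> needs.\<close>

lemma mu_capr: "\<mu>1 (capr z) = cap (\<mu>1 z)"
  by (induction z rule: t_induct)
    (simp_all add: capr_tpr mu_tpr pw_simps cap_l lin_add[OF capr_lin] lin_add[OF mu_lin] lin_add[OF cap_lin])

lemma rmu_capr: "r\<mu> (capr z) = onef z"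
  by (induction z rule: t_induct)
    (simp_all add: capr_tpr rmu_tpr aug_cap onef_tpr lin_add[OF capr_lin] lin_add[OF rmu_lin] lin_add[OF onef_lin])

lemma capr_gr: "z \<in> gr Q k \<Longrightarrow> capr z \<in> ZQ (int k - int m)"
proof (erule grQ_lin_image[OF _ capr_lin ZQ_sub])
  fix p q i j assume *: "p \<in> gr P i" "q \<in> gr P j" "i + j = k"
  show "capr (tpr T p q) \<in> ZQ (int k - int m)"
  proof (cases "j < m")
    case True
    then have "cap q = 0" using cap_gr[OF *(2)] by (simp add: Zg_def)
    then show ?thesis by (simp add: capr_tpr lin_0[OF tr_lin] ZQ_mem)
  next
    case False
    then have "cap q \<in> gr P (j - m)" using cap_gr[OF *(2)] by (simp add: Zg_def nat_diff_distrib)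
    then have "capr (tpr T p q) \<in> gr Q (k - m)" using * False by (auto simp: capr_tpr pw_simps intro!: grQ_tpr)
    then show ?thesis using False * by (simp add: ZQ_def nat_diff_distrib)
  qed
qed

lemma psi_hom: "bimod_hom P P psi"
  unfolding psi_def[abs_def] by (rule bh_comp[OF bh_comp[OF \<Delta>_hom capr_hom] \<phi>_hom])

lemmas psi_lin = bh_lin[OF psi_hom]

lemma psi_gr: "p \<in> gr P k \<Longrightarrow> (if k < m then psi p = 0 else psi p \<in> gr P (Suc (k - m)))"
  using capr_gr[OF \<Delta>_gr, of p k] \<phi>_gr[of "capr (\<Delta> p)" "k - m"]
  by (auto simp: psi_def ZQ_def nat_diff_distrib lin_0[OF \<phi>_lin] split: if_splits)

lemma psi_bd: "bd P (psi p) + signed (int m) (psi (bd P p)) = fone (\<Delta> p) - onef (\<Delta> p)"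
  using \<phi>_bd[of "capr (\<Delta> p)"]
  by (simp add: psi_def \<Delta>_bd capr_bd mu_capr rmu_capr \<mu>\<Delta> cap_def lin_signed[OF \<phi>_lin])

text \<open>The signed map defined by a unique description on
  \<open>P \<otimes> (P \<otimes> P)\<close> is \<open>1 \<otimes> (f \<otimes> 1)\<close>, and
  composing it with \<open>1 \<otimes> \<Delta>\<close> gives \<open>capr\<close>. From here on the
  threefold tensor product no longer appears.\<close>

lemma one_f_one_psi: "\<phi> (one_f_one P T T3 m f (one_Delta T T3 \<Delta> (\<Delta> p))) = psi p"
proof -
  note T3 = tens3[unfolded is_tensor_over_def]
  note vs3 = tensor_vs[OF T3]
  define E where "E = tlift T3 (tsc T) (\<lambda>x w. tpr T (pw m x) (fone w))"
  have E: "lin (tsc T3) (tsc T) E" "\<And>x w. E (tpr T3 x w) = tpr T (pw m x) (fone w)"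
    unfolding E_def
    by (rule lin_tlift[OF T3 vsT] tlift_tpr[OF T3 vsT]; simp add: pw_simps bh_l[OF fone_hom] bal lin_simps[OF fone_lin]
        lin_simps[OF pw_lin] lin_scale[OF fone_lin] lin_scale[OF pw_lin] lin_simps[OF tl_lin] lin_simps[OF tr_lin]
        lin_scale[OF fone_lin, simplified] lin_scale[OF tl_lin] lin_scale[OF tr_lin])+
  have "one_f_one P T T3 m f = E"
    unfolding one_f_one_def
  proof (rule the_equality)
    show "lin (tsc T3) (tsc T) E \<and> (\<forall>i. \<forall>x\<in>gr P i. \<forall>y z. E (tpr T3 x (tpr T y z)) = signed (int i * int m) (tpr T x (lact P (f y) z)))"
      by (simp add: E fone_tpr pw_eq lin_signed[OF tl_lin])
    fix F assume F: "lin (tsc T3) (tsc T) F \<and> (\<forall>i. \<forall>x\<in>gr P i. \<forall>y z. F (tpr T3 x (tpr T y z)) = signed (int i * int m) (tpr T x (lact P (f y) z)))"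
    then have Fl: "lin (tsc T3) (tsc T) F" by simp
    have 1: "F (tpr T3 x (tpr T y z)) = E (tpr T3 x (tpr T y z))" for x y z
      by (induction x rule: gr_induct)
        (use F in \<open>simp_all add: E fone_tpr pw_eq lin_signed[OF tl_lin] tpr_add_left[OF T3] lin_add[OF Fl] lin_add[OF E(1)]\<close>)
    have 2: "F (tpr T3 x w) = E (tpr T3 x w)" for x w
      by (rule tensor_induct[OF T, of "\<lambda>w. F (tpr T3 x w) = E (tpr T3 x w)"])
        (simp_all only: 1 tpr_add_right[OF T3] lin_add[OF Fl] lin_add[OF E(1)])
    show "F = E"
      by (rule ext, rule tensor_lin_eq[OF T3, where F = F and G = E, OF lin_add[OF Fl] lin_add[OF E(1)] 2])
  qed
  moreover have "E (one_Delta T T3 \<Delta> z) = capr z" for z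
  proof -
    note tl3 = tpr_add_left[OF T3] tpr_add_right[OF T3]
    have O: "lin (tsc T) (tsc T3) (one_Delta T T3 \<Delta>)" "\<And>p q. one_Delta T T3 \<Delta> (tpr T p q) = tpr T3 p (\<Delta> q)"
      unfolding one_Delta_def
      by (rule lin_tlift[OF T vs3] tlift_tpr[OF T vs3]; simp add: tl3 tpr_scale_left[OF T3] tpr_scale_right[OF T3, simplified]
          lin_add[OF \<Delta>_lin] lin_scale[OF \<Delta>_lin] bh_l[OF \<Delta>_hom] tpr_bal[OF T3])+
    show ?thesis
      by (induction z rule: t_induct) (simp_all add: O E capr_tpr cap_def lin_add[OF O(1)] lin_add[OF E(1)] lin_add[OF capr_lin])
  qed
  ultimately show ?thesis by (simp add: psi_def)
qed

end

lemma circ_X_psi: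
  assumes "cocycle R P (int m) f'"
  shows "circ_X P T T3 \<Delta> \<phi> m f f' x = f (psi m f' x)"
  using one_f_one_psi[OF assms, of x] by (simp add: circ_X_def)

text \<open>Both sides are signed sums of \<open>f(x) f'(y)\<close> and \<open>f'(x) f(y)\<close>; they are the obstructions
  that cancel in the graded commutator.\<close>

lemma cup_terms:
  assumes f: "cocycle R P (int n) f" and f': "cocycle R P (int m) f'"
  shows "signed (int m) (f (fone f' z - onef m f' z))
    = signed ((int n - 1) * (int m - 1)) (signed (int n) (f' (fone f z - onef n f z)))"
proof (induction z rule: t_induct)
  case (tpr p q i j)
  \<comment> \<open>A product with \<open>f p\<close> vanishes unless \<open>i = n\<close>, so its
    sign may be rewritten with \<open>n\<close> in place of the degree of \<open>p\<close>.\<close>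
  have 1: "signed e (amul R (f p) (f' q)) = signed e' (amul R (f p) (f' q))" if "i = n \<Longrightarrow> even (e - e')" for e e'
    using signed_cong[of e e'] that f_0[OF f tpr(1)] lin_0[OF mul_lin_left] by (cases "i = n") (auto simp: signed_0)
  have 2: "signed e (amul R (f' p) (f q)) = signed e' (amul R (f' p) (f q))" if "i = m \<Longrightarrow> even (e - e')" for e e'
    using signed_cong[of e e'] that f_0[OF f' tpr(1)] lin_0[OF mul_lin_left] by (cases "i = m") (auto simp: signed_0)
  have A: "signed (int m) (f (fone f' (tpr T p q) - onef m f' (tpr T p q)))
    = signed (int m) (amul R (f' p) (f q)) - signed (int n * int m + int m) (amul R (f p) (f' q))"
  proof -
    have "signed (int m) (signed (int i * int m) (amul R (f p) (f' q))) = signed (int n * int m + int m) (amul R (f p) (f' q))"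
      unfolding signed_signed by (rule 1) simp
    then show ?thesis
      by (simp add: fone_tpr[OF f'] onef_tpr[OF f'] lin_diff[OF f_lin[OF f]] f_l[OF f] f_r[OF f] pw_eq[OF tpr(1)]
          lin_signed[OF f_lin[OF f]] lin_signed[OF mul_lin_left] signed_diff)
  qed
  have B: "signed (int n) (f' (fone f (tpr T p q) - onef n f (tpr T p q)))
    = signed (int n) (amul R (f p) (f' q)) - signed (int n * int m + int n) (amul R (f' p) (f q))"
  proof -
    have "signed (int n) (signed (int i * int n) (amul R (f' p) (f q))) = signed (int n * int m + int n) (amul R (f' p) (f q))"
      unfolding signed_signed by (rule 2) simp
    then show ?thesis
      by (simp add: fone_tpr[OF f] onef_tpr[OF f] lin_diff[OF f_lin[OF f']] f_l[OF f'] f_r[OF f'] pw_eq[OF tpr(1)]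
          lin_signed[OF f_lin[OF f']] lin_signed[OF mul_lin_left] signed_diff)
  qed
  show ?case
    unfolding A B by (cases "even n"; cases "even m") (simp_all add: signed_def)
qed (simp add: lin_add[OF fone_lin[OF f]] lin_add[OF fone_lin[OF f']] lin_add[OF onef_lin[OF f]] lin_add[OF onef_lin[OF f']]
      lin_add[OF f_lin[OF f]] lin_add[OF f_lin[OF f']] lin_diff[OF f_lin[OF f]] lin_diff[OF f_lin[OF f']] signed_add signed_diff algebra_simps)

lemma psi_bd_cocycle:
  assumes f: "cocycle R P (int n) f" and f': "cocycle R P (int m) f'"
  shows "f (psi m f' (bd P x)) = signed (int m) (f (fone f' (\<Delta> x) - onef m f' (\<Delta> x)))"
proof -
  have "f (bd P (psi m f' x)) + signed (int m) (f (psi m f' (bd P x))) = f (fone f' (\<Delta> x) - onef m f' (\<Delta> x))"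
    using psi_bd[OF f', of x] by (metis lin_add[OF f_lin[OF f]] lin_signed[OF f_lin[OF f]])
  then show ?thesis by (simp add: f_bd[OF f] signed_signed flip: signed_signed[of "int m" "int m"]) (metis signed_double(1) signed_signed)
qed

text \<open>On a boundary each composition reduces by \<open>psi_bd_cocycle\<close> to its cup
  terms, and \<open>cup_terms\<close> makes the two cancel.\<close>

lemma bracket_cocycle:
  assumes f: "cocycle R P (int n) f" and f': "cocycle R P (int m) f'"
  shows "cocycle R P (int n + int m - 1) (bracket_X P T T3 \<Delta> \<phi> n m f f')"
proof -
  have e: "bracket_X P T T3 \<Delta> \<phi> n m f f' x = f (psi m f' x) - signed ((int n - 1) * (int m - 1)) (f' (psi n f x))" for x
    by (simp add: bracket_X_def circ_X_psi f f')
  have z: "f (psi m f' x) = 0" if f: "cocycle R P (int n) f" and f': "cocycle R P (int m) f'"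
      and "x \<in> gr P l" "int l \<noteq> int n + int m - 1" for f f' n m x l
    using psi_gr[OF f' that(3)] f_0[OF f, of "psi m f' x" "Suc (l - m)"] that(4) lin_0[OF f_lin[OF f]]
    by (auto split: if_splits)
  have h: "bimod_hom P (regular R) (\<lambda>x. f (psi m f' x))" if f: "cocycle R P (int n) f" and f': "cocycle R P (int m) f'" for f f' n m
    by (rule bh_comp[OF psi_hom[OF f'] f_hom[OF f]])
  note h1 = h[OF f f'] and h2 = h[OF f' f]
  have "bimod_hom P (regular R) (bracket_X P T T3 \<Delta> \<phi> n m f f')"
  proof (rule bimod_homI)
    show "lin (msc P) (msc (regular R)) (bracket_X P T T3 \<Delta> \<phi> n m f f')"
      unfolding e[abs_def] by (intro lin_minus lin_sgn bh_lin[OF h1] bh_lin[OF h2])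
  qed (simp_all add: e bh_l[OF h1] bh_l[OF h2] bh_r[OF h1] bh_r[OF h2] lin_diff[OF mul_lin_left] lin_diff[OF mul_lin_right]
      lin_signed[OF mul_lin_left] lin_signed[OF mul_lin_right])
  moreover have "bracket_X P T T3 \<Delta> \<phi> n m f f' x = 0" if "x \<in> gr P l" "int l \<noteq> int n + int m - 1" for x l
    using z[OF f f' that] z[OF f' f that(1)] that(2) by (simp add: e signed_0)
  moreover have "bracket_X P T T3 \<Delta> \<phi> n m f f' (bd P x) = 0" for x
    unfolding e psi_bd_cocycle[OF f f'] psi_bd_cocycle[OF f' f] cup_terms[OF f f'] by simp
  ultimately show ?thesis by (auto simp: cocycle_def cochain_def)
qed

text \<open>This is the chain map property of \<open>(\<theta> \<otimes> \<theta>)\<close> after the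
  diagonal of the bar resolution. The Leibniz rule yields six sums; two of them live at the cut and
  cancel, the inner products recombine by \<open>msum_split_sum\<close>, and the two at the ends
  give the outer terms.\<close>

lemma comparison_split:
  assumes "comparison R P \<theta>"
  shows "bd Q (split_sum (\<lambda>u v. tpr T (\<theta> u) (\<theta> v)) as) = bar_bd R Q (split_sum (\<lambda>u v. tpr T (\<theta> u) (\<theta> v))) as"
proof -
  have gr: "\<theta> u \<in> gr P (length u)" and bd: "bd P (\<theta> u) = bar_bd R P \<theta> u" for u
    using assms by (auto simp: comparison_def)
  let ?t = "\<lambda>u v. tpr T (\<theta> u) (\<theta> v)"
  let ?L = "\<lambda>u. if u = [] then 0 else lact P (hd u) (\<theta> (tl u))"
  let ?R = "\<lambda>u. if u = [] then 0 else ract P (\<theta> (butlast u)) (last u)"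
  let ?m = "msum (amul R) \<theta>"
  define SL where "SL = split_sum (\<lambda>u v. tpr T (?L u) (\<theta> v)) as"
  define S1 where "S1 = split_sum (\<lambda>u v. tpr T (?m u) (\<theta> v)) as"
  define SR where "SR = split_sum (\<lambda>u v. signed (int (length u)) (tpr T (?R u) (\<theta> v))) as"
  define TL where "TL = split_sum (\<lambda>u v. signed (int (length u)) (tpr T (\<theta> u) (?L v))) as"
  define S2 where "S2 = split_sum (\<lambda>u v. signed (int (length u)) (tpr T (\<theta> u) (?m v))) as"
  define TR where "TR = split_sum (\<lambda>u v. signed (int (length u) + int (length v)) (tpr T (\<theta> u) (?R v))) as"
  have "bd Q (split_sum ?t as) = split_sum (\<lambda>u v. tpr T (bar_bd R P \<theta> u) (\<theta> v)
      + signed (int (length u)) (tpr T (\<theta> u) (bar_bd R P \<theta> v))) as"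
    by (subst split_sum_additive[of "bd Q", OF lin_add[OF bdQ_lin]])
      (simp add: bdQ bd parity_eq[OF gr] lin_signed[OF tl_lin])
  also have "\<dots> = split_sum (\<lambda>u v. (((((tpr T (?L u) (\<theta> v) - tpr T (?m u) (\<theta> v)) + signed (int (length u)) (tpr T (?R u) (\<theta> v)))
      + signed (int (length u)) (tpr T (\<theta> u) (?L v))) - signed (int (length u)) (tpr T (\<theta> u) (?m v)))
      + signed (int (length u) + int (length v)) (tpr T (\<theta> u) (?R v)))) as"
    unfolding bar_bd_parts
    by (intro split_sum_cong)
      (simp add: lin_add[OF tl_lin] lin_add[OF tr_lin] lin_diff[OF tl_lin] lin_diff[OF tr_lin] lin_signed[OF tl_lin]
        lin_signed[OF tr_lin] signed_add signed_diff signed_signed del: if_split)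
  also have "\<dots> = ((((SL - S1) + SR) + TL) - S2) + TR"
    unfolding split_sum_add split_sum_diff SL_def S1_def SR_def TL_def S2_def TR_def ..
  \<comment> \<open>The entry at the cut acts from the right on the left factor or from the left on
    the right factor. These agree in the balanced tensor product, and their signs are
    opposite.\<close>
  also have "SR + TL = 0"
  proof -
    have "SR = split_sum (\<lambda>u v. if u = [] then 0 else signed (int (length u)) (tpr T (ract P (\<theta> (butlast u)) (last u)) (\<theta> v))) as"
      unfolding SR_def by (rule split_sum_cong) (simp add: lin_0[OF tl_lin] signed_0)
    moreover have "TL = split_sum (\<lambda>u v. if v = [] then 0 else signed (int (length u)) (tpr T (ract P (\<theta> u) (hd v)) (\<theta> (tl v)))) as"
      unfolding TL_def by (rule split_sum_cong) (simp add: lin_0[OF tr_lin] signed_0 bal)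
    ultimately show ?thesis
      using split_sum_shift[of "\<lambda>u a v. tpr T (ract P (\<theta> u) a) (\<theta> v)" as] by simp
  qed
  then have "SL - S1 + SR + TL - S2 + TR = SL - (S1 + S2) + TR" by (simp add: algebra_simps)
  also have "S1 + S2 = msum (amul R) (split_sum ?t) as"
    unfolding msum_split_sum S1_def S2_def split_sum_add[symmetric]
    by (simp add: msum_additive[of "\<lambda>x. tpr T x _", OF lin_add[OF tl_lin]] msum_additive[of "tpr T _", OF lin_add[OF tr_lin]])
  also have "SL = (if as = [] then 0 else lact Q (hd as) (split_sum ?t (tl as)))"
    unfolding SL_def
    by (cases as) (simp_all add: lin_0[OF tl_lin] split_sum_additive[of "lact Q _", OF lin_add[OF Q_l_lin]] Q_l)
  also have "TR = signed (int (length as)) (if as = [] then 0 else ract Q (split_sum ?t (butlast as)) (last as))"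
  proof (cases as rule: rev_cases)
    case Nil
    then show ?thesis by (simp add: TR_def lin_0[OF tr_lin] signed_0)
  next
    case (snoc r y)
    have "TR = split_sum (\<lambda>u v. signed (int (length as)) (ract Q (?t u v) y)) r"
      unfolding TR_def snoc split_sum_snoc
      by (simp add: lin_0[OF tr_lin] signed_0) (rule split_sum_cong, simp add: Q_r algebra_simps)
    also have "\<dots> = signed (int (length as)) (ract Q (split_sum ?t r) y)"
      by (subst split_sum_additive[of "\<lambda>z. signed (int (length as)) (ract Q z y)"])
        (simp_all add: lin_add[OF Q_r_lin] signed_add)
    finally show ?thesis by (simp add: snoc)
  qed
  finally show ?thesis unfolding Q.bar_bd_parts .
qed

text \<open>Both diagonals become \<open>\<theta>\<close> under \<open>\<mu>1\<close>, so their
  difference lies in the kernel of \<open>\<mu>1\<close>. That kernel is a subcomplex contracted by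
  \<open>s \<otimes> 1\<close>, so \<open>null_homotopy\<close> applies inside it and the resulting
  \<open>h\<close> inherits \<open>\<mu>1 (h as) = 0\<close>.\<close>

lemma diagonal_homotopy:
  assumes \<theta>: "comparison R P \<theta>"
  shows "\<exists>h. multilinear R (tsc T) h \<and> (\<forall>as. h as \<in> gr Q (Suc (length as))) \<and> (\<forall>as. \<mu>1 (h as) = 0) \<and>
    (\<forall>as. \<Delta> (\<theta> as) - split_sum (\<lambda>u v. tpr T (\<theta> u) (\<theta> v)) as = bd Q (h as) + bar_bd R Q h as)"
proof -
  have ml: "multilinear R (msc P) \<theta>" and gr: "\<theta> u \<in> gr P (length u)" and bd: "bd P (\<theta> u) = bar_bd R P \<theta> u"
    and one: "aug P (\<theta> []) = aone R" for u
    using \<theta> by (auto simp: comparison_def)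
  let ?s2 = "split_sum (\<lambda>u v. tpr T (\<theta> u) (\<theta> v))"
  obtain s e where s: "lin (msc P) (msc P) s" "\<And>p a. s (ract P p a) = ract P (s p) a"
    "\<And>n p. p \<in> gr P n \<Longrightarrow> s p \<in> gr P (Suc n)" "e \<in> gr P 0" "\<And>p. bd P (s p) + s (bd P p) = p - ract P e (aug P p)"
    using right_contraction by blast
  \<comment> \<open>\<open>s \<otimes> 1\<close> is balanced because \<open>s\<close> is right
    linear. It contracts \<open>P \<otimes> P\<close> onto \<open>e \<otimes> P\<close>, and its
    values have left factors of positive degree, hence are killed by \<open>\<mu>1\<close>.\<close>
  define t where "t = tlift T (tsc T) (\<lambda>p q. tpr T (s p) q)"
  have t: "lin (tsc T) (tsc T) t" "\<And>p q. t (tpr T p q) = tpr T (s p) q"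
    unfolding t_def by (rule t_lift[OF vsT]; auto simp: s(2) bal intro!: lin_comp[OF s(1) tl_lin] tr_lin)+
  have ps: "parity P (s p) = - s (parity P p)" for p
    by (induction p rule: gr_induct)
      (simp_all add: parity_eq[OF s(3)] parity_eq lin_signed[OF s(1)] signed_Suc lin_add[OF s(1)] lin_add[OF parity_lin])
  have dt: "bd Q (t z) + t (bd Q z) = z - tpr T e (\<mu>1 z)" for z
  proof (induction z rule: t_induct)
    case (tpr p q i j)
    have "bd Q (t (tpr T p q)) + t (bd Q (tpr T p q)) = tpr T (bd P (s p) + s (bd P p)) q"
      by (simp add: t bdQ lin_add[OF t(1)] ps lin_neg[OF tl_lin] lin_add[OF tl_lin])
    also have "\<dots> = tpr T p q - tpr T e (\<mu>1 (tpr T p q))"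
      by (simp add: s(5) lin_diff[OF tl_lin] mu_tpr bal)
    finally show ?case .
  next
    case (add x y)
    show ?case
      using arg_cong2[of _ _ _ _ "(+)", OF add]
      by (simp add: lin_add[OF t(1)] lin_add[OF bdQ_lin] lin_add[OF mu_lin] lin_add[OF tr_lin] algebra_simps)
  qed
  have tgr: "t z \<in> gr Q (Suc k)" if "z \<in> gr Q k" for z k
    by (rule grQ_lin_image[OF that t(1) grQ_sub]) (auto simp: t intro: grQ_tpr s(3))
  have mt: "\<mu>1 (t z) = 0" for z
  proof (induction z rule: t_induct)
    case (tpr p q i j)
    then show ?case using aug_Suc[OF s(3)] by (simp add: t mu_tpr lin_0[OF la_lin'])
  qed (simp add: lin_add[OF t(1)] lin_add[OF mu_lin])
  define Z where "Z k = {z \<in> ZQ k. \<mu>1 z = 0}" for k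
  have "\<exists>h. multilinear R (msc Q) h \<and> (\<forall>as. h as \<in> Z (int (length as) + 0 + 1)) \<and>
     (\<forall>as. \<Delta> (\<theta> as) - ?s2 as = bd Q (h as) + signed 0 (bar_bd R Q h as))"
  proof (rule Q.null_homotopy[where Z = Z and s = t and d = "bd Q"])
    show "module.subspace (msc Q) (Z k)" for k
      unfolding Z_def by (rule subspaceI) (auto simp: vsT lin_0[OF mu_lin] lin_add[OF mu_lin] lin_scale[OF mu_lin] vs_simps(2)[OF vsM] intro: ZQ_mem)
    show "lact Q a v \<in> Z k" "ract Q v a \<in> Z k" if "v \<in> Z k" for k a v
      using that bh_l[OF mu_hom] bh_r[OF mu_hom]
      by (auto simp: Z_def ZQ_def grQ_l grQ_r lin_0[OF Q_l_lin] lin_0[OF Q_r_lin] lin_0[OF la_lin] lin_0[OF ra_lin])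
    show "t v \<in> Z (k + 1)" if "v \<in> Z k" for k v
      using that tgr[of v "nat k"] by (auto simp: Z_def ZQ_def mt nat_add_distrib lin_0[OF t(1)] grQ_mem split: if_splits)
    show "bd Q (t v) + t (bd Q v) = v" if "v \<in> Z k" for k v
      using dt[of v] that by (simp add: Z_def lin_0[OF tr_lin])
    show "multilinear R (msc Q) (\<lambda>as. \<Delta> (\<theta> as) - ?s2 as)"
      by (auto intro!: multilinear_minus multilinear_comp[OF ml \<Delta>_lin] multilinear_split_sum vsR vsT
          multilinear_comp[OF ml tl_lin] multilinear_comp[OF ml tr_lin])
    show "\<Delta> (\<theta> as) - ?s2 as \<in> Z (int (length as) + 0)" for as
    proof -
      have "?s2 as \<in> gr Q (length as)"
        unfolding split_sum_def by (intro grQ_mem(7) grQ_tpr[OF gr gr]) auto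
      moreover have "\<mu>1 (?s2 as) = \<theta> as"
      proof -
        have "\<mu>1 (?s2 as) = split_sum (\<lambda>u v. lact P (aug P (\<theta> u)) (\<theta> v)) as"
          by (subst split_sum_additive[of \<mu>1, OF lin_add[OF mu_lin]]) (simp add: mu_tpr)
        also have "\<dots> = \<theta> as"
          by (subst split_sum_single[of as 0]) (auto simp: aug_pos[OF gr] lin_0[OF la_lin'] one)
        finally show ?thesis .
      qed
      ultimately show ?thesis
        using \<Delta>_gr[OF gr, of as] by (simp add: Z_def ZQ_def grQ_mem lin_diff[OF mu_lin] \<mu>\<Delta>)
    qed
    show "bd Q (\<Delta> (\<theta> as) - ?s2 as) = signed 0 (bar_bd R Q (\<lambda>as. \<Delta> (\<theta> as) - ?s2 as) as)" for as
      unfolding Q.bar_bd_diff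
      by (simp add: lin_diff[OF bdQ_lin] comparison_split[OF \<theta>] signed_zero \<Delta>_bd[symmetric] bd bar_bd_hom[OF \<Delta>_hom])
  qed (use bdQ_hom t(1) in auto)
  then obtain h where h: "multilinear R (tsc T) h" "\<And>as. h as \<in> Z (int (length as) + 0 + 1)"
     "\<And>as. \<Delta> (\<theta> as) - ?s2 as = bd Q (h as) + bar_bd R Q h as" by (auto simp: signed_zero)
  have "h as \<in> gr Q (Suc (length as)) \<and> \<mu>1 (h as) = 0" for as
    using h(2)[of as] by (simp add: Z_def ZQ_def nat_add_distrib)
  with h(1,3) show ?thesis by (intro exI[of _ h] conjI allI) simp_all
qed

text \<open>On these subspaces the \<open>k\<close>-linear contraction satisfies the homotopy
  identity without augmentation term, as \<open>null_homotopy\<close> requires.\<close>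

definition ZX :: "int \<Rightarrow> 'm set" where "ZX k = {p \<in> Zg k. aug P p = 0}"

lemma null_homotopy_X:
  assumes "multilinear R (msc P) \<eta>" "\<And>as. \<eta> as \<in> ZX (int (length as) + p)"
      "\<And>as. bd P (\<eta> as) = signed e (bar_bd R P \<eta> as)"
  shows "\<exists>N. multilinear R (msc P) N \<and> (\<forall>as. N as \<in> ZX (int (length as) + p + 1)) \<and>
     (\<forall>as. \<eta> as = bd P (N as) + signed e (bar_bd R P N as))"
proof -
  obtain c \<eta>' where c: "lin (msc P) (msc P) c" "\<And>n p. p \<in> gr P n \<Longrightarrow> c p \<in> gr P (Suc n)"
    "\<And>p. bd P (c p) + c (bd P p) = p - \<eta>' (aug P p)" "lin (asc R) (msc P) \<eta>'"
    using k_contraction by blast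
  show ?thesis
  proof (rule null_homotopy[where Z = ZX and s = c and d = "bd P"])
    show "module.subspace (msc P) (ZX k)" for k
      unfolding ZX_def by (rule subspaceI) (auto simp: vsM lin_0[OF aug_lin] lin_add[OF aug_lin] lin_scale[OF aug_lin] vs_simps(2)[OF vsR] intro: Zg_mem)
    show "lact P a v \<in> ZX k" "ract P v a \<in> ZX k" if "v \<in> ZX k" for k a v
      using that by (auto simp: ZX_def Zg_def gr_l gr_r aug_l aug_r lin_0[OF mul_lin_left] lin_0[OF mul_lin_right] lin_0[OF la_lin] lin_0[OF ra_lin])
    show "c v \<in> ZX (k + 1)" if "v \<in> ZX k" for k v
      using that c(2)[of v "nat k"] aug_Suc[OF c(2), of v "nat k"]
      by (auto simp: ZX_def Zg_def nat_add_distrib lin_0[OF c(1)] gr.F_mem lin_0[OF aug_lin] split: if_splits)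
    show "bd P (c v) + c (bd P v) = v" if "v \<in> ZX k" for k v
      using c(3)[of v] that by (simp add: ZX_def lin_0[OF c(4)])
  qed (use bd_hom c(1) assms in auto)
qed

lemma cocycle_comparison:
  assumes f: "cocycle R P p f" and \<theta>: "comparison R P \<theta>"
  shows "hcocycle R p (f \<circ> \<theta>)"
proof -
  have ml: "multilinear R (msc P) \<theta>" and gr: "\<theta> u \<in> gr P (length u)" and bd: "bar_bd R P \<theta> u = bd P (\<theta> u)" for u
    using \<theta> by (auto simp: comparison_def)
  have fh: "bimod_hom P (regular R) f" and f0: "\<And>l x. x \<in> gr P l \<Longrightarrow> int l \<noteq> p \<Longrightarrow> f x = 0" and fb: "\<And>x. f (bd P x) = 0"
    using f by (auto simp: cocycle_def cochain_def)
  have "multilinear R (asc R) (\<lambda>as. f (\<theta> as))" using multilinear_comp[OF ml bh_lin[OF fh]] by simp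
  then show ?thesis
    using bar_bd_hom[OF fh, of R \<theta>] f0[OF gr] fb by (auto simp: hcocycle_def hcochain_def comp_def bd)
qed

text \<open>The difference of two chain maps over the identity has zero augmentation, hence is null
  homotopic; \<open>f\<close> annihilates the boundary part of the homotopy and turns the rest into
  a coboundary.\<close>

lemma comparison_homotopic:
  assumes f: "cocycle R P p f" and \<theta>: "comparison R P \<theta>" "comparison R P \<theta>'"
  shows "hcohomologous R p (f \<circ> \<theta>) (f \<circ> \<theta>')"
proof -
  have ml: "multilinear R (msc P) \<theta>" and gr: "\<theta> u \<in> gr P (length u)" and bd: "bar_bd R P \<theta> u = bd P (\<theta> u)"
    and ml': "multilinear R (msc P) \<theta>'" and gr': "\<theta>' u \<in> gr P (length u)" and bd': "bar_bd R P \<theta>' u = bd P (\<theta>' u)"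
    and a: "aug P (\<theta> []) = aug P (\<theta>' [])" for u
    using \<theta> by (auto simp: comparison_def)
  have fh: "bimod_hom P (regular R) f" and f0: "\<And>l x. x \<in> gr P l \<Longrightarrow> int l \<noteq> p \<Longrightarrow> f x = 0" and fb: "\<And>x. f (bd P x) = 0"
    using f by (auto simp: cocycle_def cochain_def)
  have "aug P (\<theta> as - \<theta>' as) = 0" for as
    using aug_pos[OF gr, of as] aug_pos[OF gr', of as] a by (cases as) (auto simp: lin_diff[OF aug_lin])
  then obtain N where N: "multilinear R (msc P) N" "\<And>as. N as \<in> ZX (int (length as) + 0 + 1)"
     "\<And>as. \<theta> as - \<theta>' as = bd P (N as) + signed 0 (bar_bd R P N as)"
    using null_homotopy_X[of "\<lambda>as. \<theta> as - \<theta>' as" 0 0]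
    by (auto simp: multilinear_minus ml ml' ZX_def Zg_def gr gr' gr.F_mem lin_diff[OF bd_lin] bar_bd_diff bd bd' signed_zero)
  show ?thesis
  proof (rule hcohomologousI)
    have "N as \<in> gr P (Suc (length as))" for as using N(2)[of as] by (simp add: ZX_def Zg_def nat_add_distrib)
    then show "hcochain R (p - 1) (\<lambda>as. f (N as))"
      using multilinear_comp[OF N(1) bh_lin[OF fh]] f0 by (force simp: hcochain_def)
    show "(f \<circ> \<theta>) as - (f \<circ> \<theta>') as = bdR (\<lambda>as. f (N as)) as" for as
    proof -
      have "(f \<circ> \<theta>) as - (f \<circ> \<theta>') as = f (\<theta> as - \<theta>' as)" by (simp add: lin_diff[OF bh_lin[OF fh]])
      also have "\<dots> = f (bar_bd R P N as)" unfolding N(3) by (simp add: lin_add[OF bh_lin[OF fh]] fb signed_zero)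
      finally show ?thesis by (simp add: bar_bd_hom[OF fh])
    qed
  qed
qed

end

section \<open>Comparison of the circle products and passage to cohomology classes\<close>

context dgc
begin

text \<open>The comparison of the two circle products.  The difference of \<open>psi m f' \<circ> \<theta>\<close> and
  \<open>\<theta> \<circ> (circle with f' \<theta>)\<close>, corrected by \<open>h\<close>, is a chain map up to sign whose augmentation is a
  coboundary, hence it is null homotopic.\<close>

lemma circ_comparison:
  assumes f: "cocycle R P (int n) f" and f': "cocycle R P (int m) f'" and \<theta>: "comparison R P \<theta>"
    and h: "multilinear R (tsc T) h" "\<And>as. h as \<in> gr Q (Suc (length as))" "\<And>as. \<mu>1 (h as) = 0"
      "\<And>as. \<Delta> (\<theta> as) - split_sum (\<lambda>u v. tpr T (\<theta> u) (\<theta> v)) as = bd Q (h as) + bar_bd R Q h as"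
  shows "\<exists>H. hcochain R (int n + int m - 2) H \<and> (\<forall>as. f (psi m f' (\<theta> as)) - ccirc m (f \<circ> \<theta>) (f' \<circ> \<theta>) as
      - signed (int m) (f (fone f' (h as) - onef m f' (h as))) = bdR H as)"
proof -
  have ml: "multilinear R (msc P) \<theta>" and gr: "\<theta> u \<in> gr P (length u)" and bd: "bd P (\<theta> u) = bar_bd R P \<theta> u"
    and one: "aug P (\<theta> []) = aone R" for u
    using \<theta> by (auto simp: comparison_def)
  define F where "F = f' \<circ> \<theta>"
  have F: "hcocycle R (int m) F" unfolding F_def by (rule cocycle_comparison[OF f' \<theta>])
  then have Fm: "multilinear R (asc R) F" and F0: "\<And>as. length as \<noteq> m \<Longrightarrow> F as = 0" and dF: "bdR F = (\<lambda>_. 0)"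
    by (auto simp: hcocycle_def hcochain_def fun_eq_iff)
  note fl = f_lin[OF f] and f'l = f_lin[OF f'] and psl = psi_lin[OF f'] and fol = fone_lin[OF f'] and onl = onef_lin[OF f']
  \<comment> \<open>\<open>f' \<otimes> 1 - 1 \<otimes> f'\<close>, the right side of the boundary
    formula for \<open>psi\<close>, viewed as a chain map up to sign on
    \<open>P \<otimes> P\<close>.\<close>
  define Tt where "Tt z = fone f' z - onef m f' z" for z
  have Tl: "lin (tsc T) (msc P) Tt" unfolding Tt_def[abs_def] by (rule lin_minus[OF fol onl])
  have Th: "bimod_hom Q P Tt"
    unfolding Tt_def[abs_def]
    by (rule bimod_homI) (simp_all add: lin_minus fol onl bh_l[OF fone_hom[OF f']] bh_l[OF onef_hom[OF f']]
        bh_r[OF fone_hom[OF f']] bh_r[OF onef_hom[OF f']] lin_diff[OF la_lin] lin_diff[OF ra_lin])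
  have Tbd: "bd P (Tt z) = signed (int m) (Tt (bd Q z))" for z
    by (simp add: Tt_def lin_diff[OF bd_lin] fone_bd[OF f'] onef_bd[OF f'] signed_diff)
  have Tgr: "Tt z \<in> Zg (int k - int m)" if "z \<in> gr Q k" for z k
    unfolding Tt_def by (intro Zg_mem fone_gr[OF f'] onef_gr[OF f'] that)
  have Taug: "aug P (Tt z) = f' (r\<mu> z) - f' (\<mu>1 z)" for z
    by (simp add: Tt_def lin_diff[OF aug_lin] aug_fone[OF f'] aug_onef[OF f'])
  let ?s2 = "split_sum (\<lambda>u v. tpr T (\<theta> u) (\<theta> v))"
  \<comment> \<open>\<open>h\<close> is killed by \<open>\<mu>1\<close> but not controlled under
    \<open>r\<mu>\<close>. Since both diagonals become \<open>\<theta>\<close> under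
    \<open>r\<mu>\<close> as well, \<open>k\<close> is a chain map up to sign of degree one, hence
    null homotopic through \<open>l\<close>.\<close>
  define k where "k as = r\<mu> (h as)" for as
  have kml: "multilinear R (msc P) k" unfolding k_def[abs_def] by (rule multilinear_comp[OF h(1) rmu_lin])
  have kbd: "bd P (k as) = signed 1 (bar_bd R P k as)" for as
  proof -
    have "r\<mu> (?s2 as) = split_sum (\<lambda>u v. ract P (\<theta> u) (aug P (\<theta> v))) as"
      by (subst split_sum_additive[of r\<mu>, OF lin_add[OF rmu_lin]]) (simp add: rmu_tpr)
    also have "\<dots> = \<theta> as"
      by (subst split_sum_single_right[of as 0]) (auto simp: aug_pos[OF gr] lin_0[OF ra_lin'] one)
    finally have "r\<mu> (\<Delta> (\<theta> as) - ?s2 as) = 0" by (simp add: lin_diff[OF rmu_lin] \<mu>\<Delta>)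
    then have "bd P (k as) + bar_bd R P k as = 0"
      unfolding h(4) by (simp add: lin_add[OF rmu_lin] rmu_bd bar_bd_hom[OF rmu_hom] k_def[abs_def])
    then show ?thesis by (simp add: signed_def eq_neg_iff_add_eq_0)
  qed
  have kgr: "k as \<in> ZX (int (length as) + 1)" for as
  proof -
    have "k as \<in> gr P (Suc (length as))" unfolding k_def by (rule rmu_gr[OF h(2)])
    moreover have "aug P (k as) = 0" by (rule aug_Suc[OF calculation])
    ultimately show ?thesis by (simp add: ZX_def Zg_def nat_add_distrib)
  qed
  obtain l where l: "multilinear R (msc P) l" "\<And>as. l as \<in> ZX (int (length as) + 1 + 1)"
    "\<And>as. k as = bd P (l as) + signed 1 (bar_bd R P l as)"
    using null_homotopy_X[OF kml kgr kbd] by blast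
  have lgr: "l as \<in> gr P (Suc (Suc (length as)))" for as
    using l(2)[of as] by (simp add: ZX_def Zg_def nat_add_distrib)
  have f'k: "f' (k as) = - bdR (\<lambda>as. f' (l as)) as" for as
    unfolding l(3) by (simp add: lin_add[OF f'l] f_bd[OF f'] lin_signed[OF f'l] bar_bd_hom[OF f_hom[OF f']]) (simp add: signed_def)
  \<comment> \<open>The last term compensates for \<open>psi\<close> being built on
    \<open>\<Delta>\<close> while the circle product belongs to the diagonal of the bar
    resolution.\<close>
  define \<eta> where "\<eta> as = psi m f' (\<theta> as) - ccirc m \<theta> F as - signed (int m) (Tt (h as))" for as
  have cml: "multilinear R (msc P) (ccirc m \<theta> F)" by (rule multilinear_ccirc[OF Fm ml])
  have \<eta>ml: "multilinear R (msc P) \<eta>"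
    unfolding \<eta>_def[abs_def]
    by (intro multilinear_minus multilinear_sgn multilinear_comp[OF ml psl] cml multilinear_comp[OF h(1) Tl])
  have cgr: "ccirc m \<theta> F as \<in> Zg (int (length as) + (1 - int m)) \<and> aug P (ccirc m \<theta> F as) = 0" for as
  proof -
    have t: "\<theta> (take (i - 1) as @ [F (take m (drop (i - 1) as))] @ drop (i - 1 + m) as) \<in> {p \<in> Zg (int (length as) + (1 - int m)). aug P p = 0}"
      if "i \<in> {1..length as + 1 - m}" for i
    proof -
      have len: "length (take (i - 1) as @ [F (take m (drop (i - 1) as))] @ drop (i - 1 + m) as) = length as + 1 - m"
        and pos: "length as + 1 - m \<noteq> 0"
        using that by auto
      have "int (length as) + (1 - int m) = int (length as + 1 - m)" using pos by linarith
      then have "Zg (int (length as) + (1 - int m)) = gr P (length as + 1 - m)"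
        unfolding Zg_def by (metis nat_int of_nat_less_0_iff)
      then show ?thesis using gr[of "take (i - 1) as @ [F (take m (drop (i - 1) as))] @ drop (i - 1 + m) as"] aug_pos[OF _ pos]
        unfolding len by simp
    qed
    have sub: "module.subspace (msc P) {p \<in> Zg (int (length as) + (1 - int m)). aug P p = 0}"
      by (rule subspaceI) (auto simp: vsM lin_0[OF aug_lin] lin_add[OF aug_lin] lin_scale[OF aug_lin] vs_simps(2)[OF vsR] intro: Zg_mem)
    have "ccirc m \<theta> F as \<in> {p \<in> Zg (int (length as) + (1 - int m)). aug P p = 0}"
      unfolding ccirc_def by (intro subspaceD(7)[OF vsM sub] subspaceD(6)[OF vsM sub] t)
    then show ?thesis by simp
  qed
  have pgr: "psi m f' (\<theta> as) \<in> Zg (int (length as) + (1 - int m)) \<and> aug P (psi m f' (\<theta> as)) = 0" for as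
  proof (cases "length as < m")
    case True
    then show ?thesis using psi_gr[OF f' gr[of as]] by (simp add: Zg_mem lin_0[OF aug_lin])
  next
    case False
    then have "psi m f' (\<theta> as) \<in> gr P (Suc (length as - m))" using psi_gr[OF f' gr[of as]] by simp
    moreover have "nat (int (length as) + (1 - int m)) = Suc (length as - m)" using False by linarith
    ultimately show ?thesis using False aug_Suc by (auto simp: Zg_def)
  qed
  have Tgr': "Tt (h as) \<in> Zg (int (length as) + (1 - int m))" for as
    using Tgr[OF h(2)[of as]] by (simp add: algebra_simps)
  have \<eta>gr: "\<eta> as \<in> Zg (int (length as) + (1 - int m))" for as
    unfolding \<eta>_def using pgr cgr Tgr' by (intro Zg_mem(5) Zg_mem(6)) auto
  have \<eta>aug: "aug P (\<eta> as) = bdR (\<lambda>as. signed (int m) (f' (l as))) as" for as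
    using pgr[of as] cgr[of as] f'k[of as]
    by (simp add: \<eta>_def lin_diff[OF aug_lin] lin_signed[OF aug_lin] Taug h(3) lin_0[OF f'l] k_def reg.bar_bd_signed signed_neg)
  have \<eta>bd: "bd P (\<eta> as) = signed (int m + 1) (bar_bd R P \<eta> as)" for as
  proof -
    \<comment> \<open>The cup terms of the Leibniz rule for the circle product. They are what
      \<open>Tt\<close> gives on the diagonal of the bar resolution, by \<open>4\<close> below: a
      cut contributes only where the piece fed to \<open>F\<close> has length
      \<open>m\<close>.\<close>
    let ?cup = "if m \<le> length as then lact P (F (take m as)) (\<theta> (drop m as))
         - signed (int m * (int (length as) - int m)) (ract P (\<theta> (take (length as - m) as)) (F (drop (length as - m) as))) else 0"
    have 1: "bd P (psi m f' (\<theta> as)) = Tt (\<Delta> (\<theta> as)) - signed (int m) (bar_bd R P (\<lambda>as. psi m f' (\<theta> as)) as)"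
      using psi_bd[OF f', of "\<theta> as"] by (simp add: Tt_def bd bar_bd_hom[OF psi_hom[OF f']] algebra_simps)
    have "bd P (ccirc m \<theta> F as) = ccirc m (bar_bd R P \<theta>) F as"
      unfolding ccirc_def by (simp add: lin_sum[OF bd_lin] lin_signed[OF bd_lin] bd)
    then have 2: "bd P (ccirc m \<theta> F as) = ?cup - signed (int m) (bar_bd R P (ccirc m \<theta> F) as)"
      using ccirc_bar_bd[OF ml, of m F as] by (simp add: dF ccirc_zero[OF ml] signed_0 algebra_simps)
    have 3: "bd P (signed (int m) (Tt (h as))) = Tt (bd Q (h as))"
      by (simp add: lin_signed[OF bd_lin] Tbd signed_signed)
    have 4: "Tt (?s2 as) = ?cup"
    proof -
      have "fone f' (?s2 as) = split_sum (\<lambda>u v. lact P (F u) (\<theta> v)) as"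
        by (subst split_sum_additive[of "fone f'", OF lin_add[OF fol]]) (simp add: fone_tpr[OF f'] F_def)
      also have "\<dots> = (if m \<le> length as then lact P (F (take m as)) (\<theta> (drop m as)) else 0)"
        by (rule split_sum_single) (simp add: F0 lin_0[OF la_lin'])
      finally have a: "fone f' (?s2 as) = (if m \<le> length as then lact P (F (take m as)) (\<theta> (drop m as)) else 0)" .
      have "onef m f' (?s2 as) = split_sum (\<lambda>u v. signed (int (length u) * int m) (ract P (\<theta> u) (F v))) as"
        by (subst split_sum_additive[of "onef m f'", OF lin_add[OF onl]]) (simp add: onef_tpr[OF f'] F_def pw_eq[OF gr] lin_signed[OF ra_lin])
      also have "\<dots> = (if m \<le> length as then signed (int (length (take (length as - m) as)) * int m)
          (ract P (\<theta> (take (length as - m) as)) (F (drop (length as - m) as))) else 0)"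
        by (rule split_sum_single_right) (simp add: F0 lin_0[OF ra_lin'] signed_0)
      finally have b: "onef m f' (?s2 as) = (if m \<le> length as then signed (int m * (int (length as) - int m))
          (ract P (\<theta> (take (length as - m) as)) (F (drop (length as - m) as))) else 0)"
        by (simp add: of_nat_diff mult.commute)
      show ?thesis unfolding Tt_def a b by simp
    qed
    have 5: "Tt (\<Delta> (\<theta> as)) - Tt (?s2 as) = Tt (bd Q (h as)) + bar_bd R P (\<lambda>as. Tt (h as)) as"
      using arg_cong[OF h(4)[of as], of Tt] by (simp add: lin_diff[OF Tl] lin_add[OF Tl] bar_bd_hom[OF Th])
    have "bd P (\<eta> as) = (Tt (\<Delta> (\<theta> as)) - Tt (?s2 as) - Tt (bd Q (h as)))
        - signed (int m) (bar_bd R P (\<lambda>as. psi m f' (\<theta> as)) as) + signed (int m) (bar_bd R P (ccirc m \<theta> F) as)"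
      unfolding \<eta>_def lin_diff[OF bd_lin] 1 2 3 4 by (simp add: algebra_simps)
    also have "\<dots> = bar_bd R P (\<lambda>as. Tt (h as)) as
        - signed (int m) (bar_bd R P (\<lambda>as. psi m f' (\<theta> as)) as) + signed (int m) (bar_bd R P (ccirc m \<theta> F) as)"
      using 5 by (simp add: algebra_simps)
    also have "\<dots> = signed (int m + 1) (bar_bd R P \<eta> as)"
      unfolding \<eta>_def[abs_def] bar_bd_diff bar_bd_signed by (simp add: signed_def)
    finally show ?thesis .
  qed
  obtain e where e: "lin (asc R) (msc P) e" "\<And>r. e r \<in> gr P 0" "\<And>r. aug P (e r) = r"
    using k_contraction by blast
  \<comment> \<open>A lift to degree 0 of the cochain whose coboundary is the augmentation of
    \<open>\<eta>\<close>. Subtracting \<open>bar_bd R P w\<close> leaves augmentation zero and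
    affects neither degree nor boundary, since \<open>w\<close> takes values in degree 0.\<close>
  define w where "w as = e (signed (int m) (f' (l as)))" for as
  have wml: "multilinear R (msc P) w"
    unfolding w_def[abs_def] by (intro multilinear_comp[OF multilinear_sgn[OF multilinear_comp[OF l(1) f'l]] e(1)])
  have wgr: "w as \<in> gr P 0" and w0: "Suc (Suc (length as)) \<noteq> m \<Longrightarrow> w as = 0" for as
    using f_0[OF f' lgr[of as]] by (auto simp: w_def e signed_0 lin_0[OF e(1)])
  define \<eta>2 where "\<eta>2 as = \<eta> as - bar_bd R P w as" for as
  have wbgr: "bar_bd R P w as \<in> Zg (int (length as) + (1 - int m))" for as
  proof (cases "Suc (length as) = m")
    case True
    have "bar_bd R P w as \<in> gr P 0" by (rule bar_bd_mem[OF gr_sub]) (auto intro: gr_l gr_r wgr)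
    then show ?thesis using True by (simp add: Zg_def True[symmetric])
  next
    case False
    have "bar_bd R P w as \<in> {0}"
      by (rule bar_bd_mem) (use False w0 in \<open>auto simp: lin_0[OF la_lin] lin_0[OF ra_lin] vs_simps(2)[OF vsM] intro!: subspaceI vsM\<close>)
    then show ?thesis by (simp add: Zg_mem)
  qed
  have "\<exists>N. multilinear R (msc P) N \<and> (\<forall>as. N as \<in> ZX (int (length as) + (1 - int m) + 1)) \<and>
     (\<forall>as. \<eta>2 as = bd P (N as) + signed (int m + 1) (bar_bd R P N as))"
  proof (rule null_homotopy_X)
    show "multilinear R (msc P) \<eta>2"
      unfolding \<eta>2_def[abs_def] by (intro multilinear_minus \<eta>ml multilinear_bar_bd wml)
    have "aug P (\<eta>2 as) = 0" for as
      unfolding \<eta>2_def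
      by (simp add: lin_diff[OF aug_lin] \<eta>aug bar_bd_hom[OF aug_hom]) (simp add: w_def[abs_def] e)
    then show "\<eta>2 as \<in> ZX (int (length as) + (1 - int m))" for as
      unfolding ZX_def using \<eta>gr wbgr by (auto simp: \<eta>2_def intro: Zg_mem)
    show "bd P (\<eta>2 as) = signed (int m + 1) (bar_bd R P \<eta>2 as)" for as
    proof -
      have "bd P (bar_bd R P w as) = 0"
        unfolding bar_bd_hom[OF bd_hom] using bar_bd_diff[of "\<lambda>_. 0" "\<lambda>_. 0" as] by (simp add: bd_0[OF wgr])
      then show ?thesis
        unfolding \<eta>2_def[abs_def] bar_bd_diff bar_bd_bar_bd by (simp add: lin_diff[OF bd_lin] \<eta>bd)
    qed
  qed
  then obtain N where N: "multilinear R (msc P) N" "\<And>as. N as \<in> ZX (int (length as) + (1 - int m) + 1)"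
     "\<And>as. \<eta>2 as = bd P (N as) + signed (int m + 1) (bar_bd R P N as)" by blast
  \<comment> \<open>\<open>f\<close> kills the boundary in the decomposition of
    \<open>\<eta>\<close>, so only the two terms coming from \<open>bar_bd\<close> survive, with the
    signs seen here.\<close>
  define H where "H as = f (w as) + signed (int m + 1) (f (N as))" for as
  have "hcochain R (int n + int m - 2) H"
    unfolding hcochain_def
  proof (intro conjI allI impI)
    show "multilinear R (asc R) H"
      unfolding H_def[abs_def]
      by (intro multilinear_plus multilinear_sgn multilinear_comp[OF wml fl] multilinear_comp[OF N(1) fl])
    fix as :: "'r list" assume l: "int (length as) \<noteq> int n + int m - 2"
    \<comment> \<open>Values of \<open>w\<close> have degree 0, so \<open>f\<close> can be nonzero
      on them only for \<open>n = 0\<close>; then \<open>w\<close> requires lists of length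
      \<open>m - 2\<close>, which is the asserted degree.\<close>
    have "f (w as) = 0"
    proof (cases "n = 0")
      case True
      then have "w as = 0" using l by (intro w0) linarith
      then show ?thesis by (simp add: lin_0[OF fl])
    qed (use f_0[OF f wgr[of as]] in auto)
    moreover have "f (N as) = 0"
    proof (cases "int (length as) + (1 - int m) + 1 < 0")
      case True
      then show ?thesis using N(2)[of as] by (simp add: ZX_def Zg_def lin_0[OF fl])
    next
      case False
      then have "N as \<in> gr P (nat (int (length as) + (1 - int m) + 1))" using N(2)[of as] by (simp add: ZX_def Zg_def)
      then show ?thesis by (rule f_0[OF f]) (use False l in linarith)
    qed
    ultimately show "H as = 0" by (simp add: H_def signed_0)
  qed
  moreover have "f (psi m f' (\<theta> as)) - ccirc m (f \<circ> \<theta>) (f' \<circ> \<theta>) as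
      - signed (int m) (f (fone f' (h as) - onef m f' (h as))) = bdR H as" for as
  proof -
    have "ccirc m (f \<circ> \<theta>) F as = f (ccirc m \<theta> F as)"
      by (simp add: ccirc_def lin_sum[OF fl] lin_signed[OF fl])
    then have "f (psi m f' (\<theta> as)) - ccirc m (f \<circ> \<theta>) F as - signed (int m) (f (Tt (h as))) = f (\<eta> as)"
      by (simp add: \<eta>_def lin_diff[OF fl] lin_signed[OF fl])
    also have "\<eta> as = bar_bd R P w as + (bd P (N as) + signed (int m + 1) (bar_bd R P N as))"
      using N(3)[of as] by (simp add: \<eta>2_def algebra_simps)
    also have "f \<dots> = bdR H as"
      unfolding H_def[abs_def] reg.bar_bd_add reg.bar_bd_signed
      by (simp add: lin_add[OF fl] lin_signed[OF fl] f_bd[OF f] bar_bd_hom[OF f_hom[OF f]])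
    finally show ?thesis unfolding F_def Tt_def .
  qed
  ultimately show ?thesis by blast
qed

text \<open>The diagonal homotopy \<open>h\<close> depends on \<open>\<theta>\<close> alone, so one
  and the same \<open>h\<close> serves both orders of composition. Only then do the two correction
  terms match in \<open>cup_terms\<close>.\<close>

theorem bracket_comparison:
  assumes f: "cocycle R P (int n) f" and f': "cocycle R P (int m) f'" and \<theta>: "comparison R P \<theta>"
  shows "hcohomologous R (int n + int m - 1) (bracket_X P T T3 \<Delta> \<phi> n m f f' \<circ> \<theta>)
    (gerstenhaber n m (f \<circ> \<theta>) (f' \<circ> \<theta>))"
proof -
  obtain h where h: "multilinear R (tsc T) h" "\<And>as. h as \<in> gr Q (Suc (length as))" "\<And>as. \<mu>1 (h as) = 0"
      "\<And>as. \<Delta> (\<theta> as) - split_sum (\<lambda>u v. tpr T (\<theta> u) (\<theta> v)) as = bd Q (h as) + bar_bd R Q h as"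
    using diagonal_homotopy[OF \<theta>] by blast
  obtain H where H: "hcochain R (int n + int m - 2) H" "\<And>as. f (psi m f' (\<theta> as)) - ccirc m (f \<circ> \<theta>) (f' \<circ> \<theta>) as
      - signed (int m) (f (fone f' (h as) - onef m f' (h as))) = bdR H as"
    using circ_comparison[OF f f' \<theta> h] by blast
  obtain K where K: "hcochain R (int m + int n - 2) K" "\<And>as. f' (psi n f (\<theta> as)) - ccirc n (f' \<circ> \<theta>) (f \<circ> \<theta>) as
      - signed (int n) (f' (fone f (h as) - onef n f (h as))) = bdR K as"
    using circ_comparison[OF f' f \<theta> h] by blast
  let ?s = "(int n - 1) * (int m - 1)"
  have c: "hcochain R (int n) (f \<circ> \<theta>)" "hcochain R (int m) (f' \<circ> \<theta>)"
    using cocycle_comparison[OF f \<theta>] cocycle_comparison[OF f' \<theta>] by (simp_all add: hcocycle_def)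
  show ?thesis
  proof (rule hcohomologousI)
    show "hcochain R (int n + int m - 1 - 1) (\<lambda>as. H as - signed ?s (K as))"
      using H(1) K(1) by (intro hcochain_diff hcochain_signed) (simp_all add: algebra_simps)
    show "(bracket_X P T T3 \<Delta> \<phi> n m f f' \<circ> \<theta>) as - gerstenhaber n m (f \<circ> \<theta>) (f' \<circ> \<theta>) as
        = bdR (\<lambda>as. H as - signed ?s (K as)) as" for as
      unfolding reg.bar_bd_diff reg.bar_bd_signed H(2)[symmetric] K(2)[symmetric] signed_diff cup_terms[OF f f']
      by (simp add: bracket_X_def circ_X_psi f f' gerstenhaber_def circ_hcochain[OF c(1)] circ_hcochain[OF c(2)] signed_diff)
  qed
qed

theorem bracket_represents:
  assumes f: "cocycle R P (int n) f" and f': "cocycle R P (int m) f'"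
    and \<alpha>: "HH_represents R P (int n) f \<alpha>" and \<beta>: "HH_represents R P (int m) f' \<beta>"
  shows "HH_represents R P (int n + int m - 1) (bracket_X P T T3 \<Delta> \<phi> n m f f') (HH_bracket R n m \<alpha> \<beta>)"
proof -
  let ?br = "bracket_X P T T3 \<Delta> \<phi> n m f f'" and ?p = "int n + int m - 1"
  \<comment> \<open>The two given classes may be witnessed by different comparison maps. Since these
    are homotopic, each member of a class is cohomologous to the pullback along any prescribed
    \<open>\<theta>\<close>, and one \<open>\<theta>\<close> can be used for both.\<close>
  have cl: "hcocycle R p G \<and> hcohomologous R p G (g \<circ> \<theta>)"
    if t: "HH_represents R P p g \<gamma>" "comparison R P \<theta>" "G \<in> \<gamma>" for p g \<gamma> \<theta> G
  proof -
    obtain \<theta>' where \<theta>': "comparison R P \<theta>'" "g \<circ> \<theta>' \<in> \<gamma>" and g: "cocycle R P p g" "\<gamma> \<in> HH R p"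
      using t(1) by (auto simp: HH_represents_def)
    obtain G' where "\<gamma> = {F. hcocycle R p F \<and> hcohomologous R p F G'}" using g(2) by (auto simp: HH_def)
    then have "hcocycle R p G" "hcohomologous R p G G'" "hcohomologous R p (g \<circ> \<theta>') G'" using t(3) \<theta>'(2) by auto
    then show ?thesis
      using hcohomologous_trans hcohomologous_sym comparison_homotopic[OF g(1) \<theta>'(1) t(2)] by blast
  qed
  obtain \<theta> where \<theta>: "comparison R P \<theta>" "f \<circ> \<theta> \<in> \<alpha>" using \<alpha> by (auto simp: HH_represents_def)
  obtain \<theta>' where \<theta>': "comparison R P \<theta>'" "f' \<circ> \<theta>' \<in> \<beta>" using \<beta> by (auto simp: HH_represents_def)
  have br: "cocycle R P ?p ?br" by (rule bracket_cocycle[OF f f'])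
  have key: "hcohomologous R ?p (?br \<circ> \<theta>) (gerstenhaber n m F F')" if "F \<in> \<alpha>" "F' \<in> \<beta>" for F F'
  proof -
    have F: "hcocycle R (int n) F" "hcohomologous R (int n) F (f \<circ> \<theta>)"
      and F': "hcocycle R (int m) F'" "hcohomologous R (int m) F' (f' \<circ> \<theta>)"
      using cl[OF \<alpha> \<theta>(1) that(1)] cl[OF \<beta> \<theta>(1) that(2)] by auto
    have c: "hcocycle R (int n) (f \<circ> \<theta>)" "hcocycle R (int m) (f' \<circ> \<theta>)"
      using cocycle_comparison[OF f \<theta>(1)] cocycle_comparison[OF f' \<theta>(1)] by auto
    have "hcohomologous R ?p (gerstenhaber n m F F') (gerstenhaber n m (f \<circ> \<theta>) F')"
      by (rule gerstenhaber_cong_left) (use F F' c in \<open>auto simp: hcocycle_def\<close>)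
    moreover have "hcohomologous R ?p (gerstenhaber n m (f \<circ> \<theta>) F') (gerstenhaber n m (f \<circ> \<theta>) (f' \<circ> \<theta>))"
      by (rule gerstenhaber_cong_right) (use F F' c in \<open>auto simp: hcocycle_def\<close>)
    moreover note bracket_comparison[OF f f' \<theta>(1)]
    ultimately show ?thesis using hcohomologous_trans hcohomologous_sym by blast
  qed
  \<comment> \<open>All brackets of representatives are cohomologous to the pullback of the bracket
    on \<open>P\<close>, so the set of admissible results is one cohomology class.\<close>
  have "HH_bracket R n m \<alpha> \<beta> = {K. hcocycle R ?p K \<and> hcohomologous R ?p K (?br \<circ> \<theta>)}"
    unfolding HH_bracket_def using key hcohomologous_trans hcohomologous_sym \<theta>(2) \<theta>'(2) by blast
  moreover have hb: "hcocycle R ?p (?br \<circ> \<theta>)" by (rule cocycle_comparison[OF br \<theta>(1)])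
  moreover have "hcohomologous R ?p (?br \<circ> \<theta>) (?br \<circ> \<theta>)" by (rule comparison_homotopic[OF br \<theta>(1) \<theta>(1)])
  ultimately show ?thesis
    using br \<theta>(1) unfolding HH_represents_def HH_def by blast
qed

end

section \<open>Group algebras and skew group algebras\<close>

lemma single_sum_finite: "(a :: 'g::finite \<Rightarrow>\<^sub>0 's::comm_monoid_add) = (\<Sum>g\<in>UNIV. Poly_Mapping.single g (Poly_Mapping.lookup a g))"
  by (rule poly_mapping_eqI) (simp add: lookup_sum lookup_single when_def)

lemma pm_finite_induct:
  assumes "\<And>g s. \<Phi> (Poly_Mapping.single g s)" "\<And>a b. \<Phi> a \<Longrightarrow> \<Phi> b \<Longrightarrow> \<Phi> (a + b)"
  shows "\<Phi> (a :: 'g::finite \<Rightarrow>\<^sub>0 's::comm_monoid_add)"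
proof -
  have "\<Phi> 0" using assms(1)[of undefined 0] by simp
  then have "\<Phi> (\<Sum>g\<in>K. Poly_Mapping.single g (Poly_Mapping.lookup a g))" for K
    by (induction K rule: infinite_finite_induct) (auto intro: assms)
  then show ?thesis using single_sum_finite[of a] by metis
qed

lemma pm_scale_single: "pm_scale c (Poly_Mapping.single g x) = Poly_Mapping.single g (c * x)"
  by (rule poly_mapping_eqI) (simp add: lookup_single when_def)

lemma group_algebra_simps [simp]: "asc group_algebra = pm_scale" "amul group_algebra = (*)" "aone group_algebra = 1"
  by (simp_all add: group_algebra_def)

lemma k_algebra_group_algebra: "k_algebra (group_algebra :: ('k::field, 'g::{finite,group_add} \<Rightarrow>\<^sub>0 'k) kalg)"
proof -
  have l: "pm_scale c a * b = pm_scale c (a * b)" for c and a b :: "'g \<Rightarrow>\<^sub>0 'k"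
    by (simp add: pm_scale_def mult_map_scale_conv_mult mult.assoc)
  have r: "a * pm_scale c b = pm_scale c (a * b)" for c and a b :: "'g \<Rightarrow>\<^sub>0 'k"
  proof (induction a rule: pm_finite_induct)
    case (1 g x)
    show ?case
      by (induction b rule: pm_finite_induct)
        (simp_all add: pm_scale_single mult_single distrib_left vs_add[OF vs_pm_scale] mult.left_commute)
  qed (simp add: distrib_right vs_add[OF vs_pm_scale])
  show ?thesis
    unfolding k_algebra_def
    by (auto simp: l r vs_pm_scale mult.assoc distrib_left distrib_right intro!: linI)
qed

locale skew = algebra S for S :: "('k::field, 's::ab_group_add) kalg" +
  fixes act :: "'g::{finite,group_add} \<Rightarrow> 's \<Rightarrow> 's"
  assumes action: "algebra_action S act"
begin

abbreviation A where "A \<equiv> skew_group_algebra S act"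

lemma act_0 [simp]: "act 0 s = s"
  and act_act: "act g (act h s) = act (g + h) s"
  and act_lin: "lin (asc S) (asc S) (act g)"
  and act_mul: "act g (amul S s t) = amul S (act g s) (act g t)"
  and act_one [simp]: "act g (aone S) = aone S"
  using action by (simp_all add: algebra_action_def)

lemma A_one: "aone A = Poly_Mapping.single 0 (aone S)"
  by (simp add: skew_group_algebra_def)

lemma A_sc_lookup: "Poly_Mapping.lookup (asc A c a) g = asc S c (Poly_Mapping.lookup a g)"
  by (simp add: skew_group_algebra_def Poly_Mapping.map.rep_eq when_def vs_simps(2)[OF vsR])

lemma A_sc_single: "asc A c (Poly_Mapping.single g s) = Poly_Mapping.single g (asc S c s)"
  by (rule poly_mapping_eqI) (simp add: A_sc_lookup lookup_single when_def vs_simps(2)[OF vsR])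

lemma vsA: "vector_space (asc A)"
  unfolding vector_space_def
  by (auto intro!: poly_mapping_eqI simp: A_sc_lookup lookup_add vs_add[OF vsR] vs_add_left[OF vsR] vs_assoc[OF vsR] vs_one[OF vsR])

lemma A_mul_lin_right: "lin (asc A) (asc A) (amul A a)"
  by (rule linI[OF vsA vsA])
    (simp_all add: skew_group_algebra_def[of S act, THEN arg_cong[of _ _ amul], simplified] lookup_add lin_add[OF act_lin]
      lin_add[OF mul_lin_right] single_add sum.distrib A_sc_lookup lin_scale[OF act_lin] lin_scale[OF mul_lin_right]
      lin_sum[OF lin_scale_map[OF vsA]] A_sc_single)

lemma A_mul_lin_left: "lin (asc A) (asc A) (\<lambda>a. amul A a b)"
  by (rule linI[OF vsA vsA])
    (simp_all add: skew_group_algebra_def[of S act, THEN arg_cong[of _ _ amul], simplified] lookup_add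
      lin_add[OF mul_lin_left] single_add sum.distrib A_sc_lookup lin_scale[OF mul_lin_left]
      lin_sum[OF lin_scale_map[OF vsA]] A_sc_single)

lemma A_mul_single: "amul A (Poly_Mapping.single g s) (Poly_Mapping.single h t) = Poly_Mapping.single (g + h) (amul S s (act g t))"
proof -
  have "amul A (Poly_Mapping.single g s) (Poly_Mapping.single h t)
    = (\<Sum>g'\<in>UNIV. \<Sum>h'\<in>UNIV. if g' = g then if h' = h then Poly_Mapping.single (g + h) (amul S s (act g t)) else 0 else 0)"
    unfolding skew_group_algebra_def kalg.simps
    by (intro sum.cong refl)
      (auto simp: lookup_single when_def lin_0[OF mul_lin_left] lin_0[OF mul_lin_right] lin_0[OF act_lin])
  also have "\<dots> = (\<Sum>g'\<in>UNIV. if g' = g then Poly_Mapping.single (g + h) (amul S s (act g t)) else 0)"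
    by (intro sum.cong refl) simp
  also have "\<dots> = Poly_Mapping.single (g + h) (amul S s (act g t))" by simp
  finally show ?thesis .
qed

lemma k_algebra_A: "k_algebra A"
proof -
  have "amul A (amul A a b) c = amul A a (amul A b c)" for a b c
  proof (induction a rule: pm_finite_induct)
    case (1 g s)
    show ?case
    proof (induction b rule: pm_finite_induct)
      case (1 h t)
      show ?case
        by (induction c rule: pm_finite_induct)
          (simp_all add: A_mul_single mul_assoc act_mul act_act add.assoc lin_add[OF A_mul_lin_right])
    qed (simp add: lin_add[OF A_mul_lin_right] lin_add[OF A_mul_lin_left])
  qed (simp add: lin_add[OF A_mul_lin_left])
  moreover have "amul A (aone A) a = a \<and> amul A a (aone A) = a" for a
    by (induction a rule: pm_finite_induct)
      (auto simp: A_one A_mul_single mul_one lin_add[OF A_mul_lin_right] lin_add[OF A_mul_lin_left])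
  ultimately show ?thesis
    by (auto simp: k_algebra_def vsA A_mul_lin_right A_mul_lin_left)
qed

lemma kG_incl_lookup: "Poly_Mapping.lookup (kG_incl S a) g = asc S (Poly_Mapping.lookup a g) (aone S)"
  by (simp add: kG_incl_def Poly_Mapping.map.rep_eq when_def vs_0_left[OF vsR])

lemma kG_incl_single: "kG_incl S (Poly_Mapping.single g x) = Poly_Mapping.single g (asc S x (aone S))"
  by (rule poly_mapping_eqI) (simp add: kG_incl_lookup lookup_single when_def vs_0_left[OF vsR])

lemma kG_incl_lin: "lin pm_scale (asc A) (kG_incl S)"
  by (rule linI[OF vs_pm_scale vsA])
    (auto intro!: poly_mapping_eqI simp: kG_incl_lookup lookup_add A_sc_lookup vs_add_left[OF vsR] vs_assoc[OF vsR])

lemma single_lin: "lin (asc S) (asc A) (Poly_Mapping.single g)"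
  by (rule linI[OF vsR vsA]) (simp_all add: single_add A_sc_single)

end

section \<open>Refining a grading\<close>

text \<open>Gives the bigrading of \<open>C\<close> by degree and group element. As the inner index
  type is finite, inner decompositions are sums over the whole type, and uniqueness follows by
  comparing first the outer and then the inner components.\<close>

lemma direct_sum_nested:
  fixes F :: "'i \<Rightarrow> 'g::finite \<Rightarrow> 'm::ab_group_add set"
  assumes G: "grading s G" and F: "\<And>i. direct_sum (G i) (F i)" and Fsub: "\<And>i g. module.subspace s (F i g)"
  shows "direct_sum UNIV (\<lambda>(i, g). F i g)"
proof -
  interpret grading s G by fact
  note Fm = subspaceD[OF vs Fsub]
  have sums: "(\<Sum>g\<in>{g. p g \<noteq> 0}. p g) = (\<Sum>g\<in>UNIV. p g)" for p :: "'g \<Rightarrow> 'm"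
    by (rule sum.mono_neutral_left) auto
  have ex1: "\<exists>!p. (\<forall>g. p g \<in> F i g) \<and> x = (\<Sum>g\<in>UNIV. p g)" if "x \<in> G i" for i x
    using F[of i] that unfolding direct_sum_def sums by simp
  define q where "q i x = (THE p. (\<forall>g. p g \<in> F i g) \<and> x = (\<Sum>g\<in>UNIV. p g))" for i x
  have q: "q i x g \<in> F i g" "x = (\<Sum>g\<in>UNIV. q i x g)" if "x \<in> G i" for i x g
    using theI'[OF ex1[OF that]] unfolding q_def by auto
  have q_eq: "p = q i x" if "x \<in> G i" "\<And>g. p g \<in> F i g" "x = (\<Sum>g\<in>UNIV. p g)" for i x p
    using the1_equality[OF ex1[OF that(1)], of p] that(2,3) unfolding q_def by simp
  have q0: "q i 0 g = 0" for i g
  proof -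
    have "(\<lambda>_. 0) = q i 0" by (rule q_eq) (simp_all add: F_mem(1) Fm(1))
    then show ?thesis by (simp add: fun_eq_iff)
  qed
  show ?thesis
    unfolding direct_sum_def
  proof (intro conjI allI ballI)
    fix v
    let ?p = "\<lambda>(i, g). q i (dcomp G i v) g"
    let ?K = "{i. dcomp G i v \<noteq> 0}"
    show "\<exists>!p. (\<forall>i. p i \<in> (case i of (i, g) \<Rightarrow> F i g)) \<and> finite {i. p i \<noteq> 0} \<and> v = (\<Sum>i\<in>{i. p i \<noteq> 0}. p i)"
    proof (rule ex1I[of _ ?p])
      have K: "{i. ?p i \<noteq> 0} \<subseteq> ?K \<times> UNIV" using q0 by force
      have "(\<Sum>i\<in>{i. ?p i \<noteq> 0}. ?p i) = (\<Sum>i\<in>?K \<times> UNIV. ?p i)"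
        by (rule sum.mono_neutral_left) (use K in \<open>auto simp: dcomp_fin\<close>)
      also have "\<dots> = (\<Sum>i\<in>?K. \<Sum>g\<in>UNIV. q i (dcomp G i v) g)"
        by (simp add: sum.cartesian_product)
      also have "\<dots> = (\<Sum>i\<in>?K. dcomp G i v)" using q(2)[OF dcomp_mem] by simp
      finally have "v = (\<Sum>i\<in>{i. ?p i \<noteq> 0}. ?p i)" using dcomp_sum[of v] by simp
      moreover have "finite {i. ?p i \<noteq> 0}" using K by (rule finite_subset) (simp add: dcomp_fin)
      ultimately show "(\<forall>i. ?p i \<in> (case i of (i, g) \<Rightarrow> F i g)) \<and> finite {i. ?p i \<noteq> 0} \<and> v = (\<Sum>i\<in>{i. ?p i \<noteq> 0}. ?p i)"
        using q(1)[OF dcomp_mem] by auto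
      fix p assume p: "(\<forall>i. p i \<in> (case i of (i, g) \<Rightarrow> F i g)) \<and> finite {i. p i \<noteq> 0} \<and> v = (\<Sum>i\<in>{i. p i \<noteq> 0}. p i)"
      have pF: "p (i, g) \<in> F i g" for i g using p by force
      let ?L = "fst ` {i. p i \<noteq> 0}"
      have fL: "finite ?L" using p by simp
      have "v = (\<Sum>i\<in>{i. p i \<noteq> 0}. p i)" using p by blast
      also have "\<dots> = (\<Sum>i\<in>?L \<times> UNIV. p i)"
        by (rule sum.mono_neutral_left) (auto simp: fL intro: rev_image_eqI)
      also have "\<dots> = (\<Sum>i\<in>?L. \<Sum>g\<in>UNIV. p (i, g))" by (simp add: sum.cartesian_product)
      finally have v: "v = (\<Sum>i\<in>?L. \<Sum>g\<in>UNIV. p (i, g))" .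
      have z: "p (i, g) = 0" if "i \<notin> ?L" for i g using that by force
      have FG: "F i g \<subseteq> G i" for i g using F by (auto simp: direct_sum_def)
      have "dcomp G i v = (\<Sum>g\<in>UNIV. p (i, g))" for i
        by (rule dcomp_eqI[OF _ fL _ v]) (auto intro!: F_mem(7) sum.neutral z subsetD[OF FG pF])
      then have "(\<lambda>g. p (i, g)) = q i (dcomp G i v)" for i
        using q_eq[OF dcomp_mem, of "\<lambda>g. p (i, g)" i v] pF by simp
      then show "p = ?p" by (auto simp: fun_eq_iff)
    qed
  qed simp
qed

section \<open>The twisted product resolution\<close>

lemma dgc_coalgebra:
  assumes "k_algebra R" "dg_coalgebra R P T T3 \<Delta>" "homotopy R P T \<phi>"
  shows "dgc R P T T3 \<Delta> \<phi>"
proof -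
  have r: "projective_resolution R P" "is_tensor_over P P T" "is_tensor_over P (tensor_cplx R P P T) T3"
     "bimod_hom P (tensor_cplx R P P T) \<Delta>" "\<And>n. \<Delta> ` gr P n \<subseteq> gr (tensor_cplx R P P T) n"
     "\<And>p. \<Delta> (bd P p) = bd (tensor_cplx R P P T) (\<Delta> p)" "\<And>p. mu_one P T (\<Delta> p) = p" "\<And>p. one_mu P T (\<Delta> p) = p"
    using assms(2) unfolding dg_coalgebra_def by simp_all
  interpret gcplx R P by (rule gcplx_resolution[OF assms(1) r(1)])
  show ?thesis
    by unfold_locales (use r assms(3) in auto)
qed

locale twisted = skew S act
  for S :: "('k::field, 's::ab_group_add) kalg" and act :: "'g::{finite,group_add} \<Rightarrow> 's \<Rightarrow> 's" +
  fixes C :: "('k, 'g \<Rightarrow>\<^sub>0 'k, 'c::ab_group_add) cplx"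
    and Cg :: "nat \<Rightarrow> 'g \<Rightarrow> 'c set"
    and C2 :: "('k, 'c, 'c, 'c2::ab_group_add) tensor"
    and C3 :: "('k, 'c, 'c2, 'c3::ab_group_add) tensor"
    and \<Delta>C :: "'c \<Rightarrow> 'c2" and \<phi>C :: "'c2 \<Rightarrow> 'c"
    and D :: "('k, 's, 'd::ab_group_add) cplx"
    and dact :: "'g \<Rightarrow> 'd \<Rightarrow> 'd"
    and D2 :: "('k, 'd, 'd, 'd2::ab_group_add) tensor"
    and D3 :: "('k, 'd, 'd2, 'd3::ab_group_add) tensor"
    and \<Delta>D :: "'d \<Rightarrow> 'd2" and \<phi>D :: "'d2 \<Rightarrow> 'd"
    and XT :: "('k, 'c, 'd, 'x::ab_group_add) tensor"
  assumes dgC: "dg_coalgebra (group_algebra :: ('k, 'g \<Rightarrow>\<^sub>0 'k) kalg) C C2 C3 \<Delta>C"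
    and gradC: "G_graded C C2 \<Delta>C Cg"
    and homC: "homotopy (group_algebra :: ('k, 'g \<Rightarrow>\<^sub>0 'k) kalg) C C2 \<phi>C"
    and presC: "preserves_G_grading C2 Cg \<phi>C"
    and dgD: "dg_coalgebra S D D2 D3 \<Delta>D"
    and actD: "G_action D D2 \<Delta>D act dact"
    and homD: "homotopy S D D2 \<phi>D"
    and eqD: "G_equivariant D2 dact \<phi>D"
    and XT: "is_tensor_k (msc C) (msc D) XT"
begin

abbreviation kG :: "('k, 'g \<Rightarrow>\<^sub>0 'k) kalg" where "kG \<equiv> group_algebra"
abbreviation X where "X \<equiv> twisted_product S act C Cg D dact XT"

sublocale A: algebra A
  by unfold_locales (rule k_algebra_A)

sublocale C: dgc kG C C2 C3 \<Delta>C \<phi>C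
  by (rule dgc_coalgebra[OF k_algebra_group_algebra dgC homC])

sublocale D: dgc S D D2 D3 \<Delta>D \<phi>D
  by (rule dgc_coalgebra[OF alg dgD homD])

abbreviation gl where "gl g c \<equiv> lact C (gen g) c"
abbreviation gr' where "gr' c g \<equiv> ract C c (gen g)"

lemma gl_gl: "gl g (gl h c) = gl (g + h) c" and gr_gr: "gr' (gr' c g) h = gr' c (g + h)"
  and gl_0 [simp]: "lact C 1 c = c" and gr_0 [simp]: "ract C c 1 = c"
  using C.la_mul[of "gen g" "gen h" c] C.ra_mul[of c "gen g" "gen h"] C.la_one[of c] C.ra_one[of c]
  by (simp_all add: mult_single)

lemma Cg_sub: "module.subspace (msc C) (Cg i g)" and Cg_ds: "direct_sum (gr C i) (Cg i)"
  and Cg_bd: "c \<in> Cg (Suc i) g \<Longrightarrow> bd C c \<in> Cg i g"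
  and Cg_\<Delta>: "c \<in> Cg i g \<Longrightarrow> \<Delta>C c \<in> tensor_Ggr C2 Cg i g"
  and Cg_aug0: "c \<in> Cg 0 g \<Longrightarrow> \<exists>x. aug C c = Poly_Mapping.single g x"
  and Cg_act: "c \<in> Cg i g2 \<Longrightarrow> gr' (gl g1 c) g3 \<in> Cg i (g1 + g2 + g3)"
proof -
  note r = gradC[unfolded G_graded_def]
  have 1: "\<forall>i g. module.subspace (msc C) (Cg i g)" "\<forall>i. direct_sum (gr C i) (Cg i)"
    and 2: "\<forall>i g. bd C ` Cg (Suc i) g \<subseteq> Cg i g" "\<forall>i g. \<Delta>C ` Cg i g \<subseteq> tensor_Ggr C2 Cg i g"
      "\<forall>g. aug C ` Cg 0 g \<subseteq> range (\<lambda>c. Poly_Mapping.single g c)"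
    and 3: "\<forall>i g1 g2 g3. (\<lambda>c. gr' (gl g1 c) g3) ` Cg i g2 = Cg i (g1 + g2 + g3)"
    by (insert r, (elim conjE, assumption)+)
  show "module.subspace (msc C) (Cg i g)" "direct_sum (gr C i) (Cg i)" using 1 by simp_all
  show "c \<in> Cg (Suc i) g \<Longrightarrow> bd C c \<in> Cg i g" "c \<in> Cg i g \<Longrightarrow> \<Delta>C c \<in> tensor_Ggr C2 Cg i g"
    by (rule subsetD[OF 2(1)[rule_format] imageI], assumption) (rule subsetD[OF 2(2)[rule_format] imageI])
  show "\<exists>x. aug C c = Poly_Mapping.single g x" if "c \<in> Cg 0 g"
    using subsetD[OF 2(3)[rule_format] imageI[OF that]] by (rule imageE) (rule exI)
  show "gr' (gl g1 c) g3 \<in> Cg i (g1 + g2 + g3)" if "c \<in> Cg i g2"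
    using imageI[OF that, of "\<lambda>c. gr' (gl g1 c) g3"] by (simp only: 3[rule_format])
qed

lemmas Cg_mem = subspaceD[OF C.vsM Cg_sub]

lemma Cg_l: "c \<in> Cg i h \<Longrightarrow> gl g c \<in> Cg i (g + h)"
  using Cg_act[of c i h g 0] by simp

lemma Cg_r: "c \<in> Cg i h \<Longrightarrow> gr' c g \<in> Cg i (h + g)"
  using Cg_act[of c i h 0 g] by simp

lemma Cg_gr: "c \<in> Cg i g \<Longrightarrow> c \<in> gr C i"
  using Cg_ds[of i] by (auto simp: direct_sum_def)

lemma Cg_bd': "c \<in> Cg i g \<Longrightarrow> bd C c \<in> Cg (i - 1) g"
  by (cases i) (auto simp: Cg_bd C.bd_0[OF Cg_gr] Cg_mem)

lemma Cg_aug: "c \<in> Cg i g \<Longrightarrow> \<exists>x. aug C c = Poly_Mapping.single g x"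
  using Cg_aug0[of c g] C.aug_Suc[OF Cg_gr, of c] by (cases i) (auto intro!: exI[of _ 0])

lemma Cg_parity: "c \<in> Cg i g \<Longrightarrow> parity C c \<in> Cg i g"
  by (simp add: C.parity_eq[OF Cg_gr] Cg_mem)

sublocale cg: grading "msc C" "\<lambda>(i, g). Cg i g"
proof (rule grading.intro)
  show "vector_space (msc C)" by (rule C.vsM)
  show "module.subspace (msc C) (case i of (i, g) \<Rightarrow> Cg i g)" for i using Cg_sub by (cases i) simp
  show "direct_sum UNIV (\<lambda>(i, g). Cg i g)"
    by (rule direct_sum_nested[OF C.gr.grading_axioms Cg_ds Cg_sub])
qed

lemma c_induct [case_names hom add]:
  assumes "\<And>i g c. c \<in> Cg i g \<Longrightarrow> \<Phi> c" "\<And>x y. \<Phi> x \<Longrightarrow> \<Phi> y \<Longrightarrow> \<Phi> (x + y)"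
  shows "\<Phi> c"
  by (rule cg.dsum_induct[of \<Phi>]) (use assms in \<open>auto split: prod.splits\<close>)

lemma dact_0 [simp]: "dact 0 d = d" and dact_dact: "dact g (dact h d) = dact (g + h) d"
  and dact_lin: "lin (msc D) (msc D) (dact g)" and dact_gr: "d \<in> gr D j \<Longrightarrow> dact g d \<in> gr D j"
  and dact_l: "dact g (lact D s d) = lact D (act g s) (dact g d)"
  and dact_r: "dact g (ract D d s) = ract D (dact g d) (act g s)"
  and dact_bd: "dact g (bd D d) = bd D (dact g d)"
  and dact_\<Delta>: "\<Delta>D (dact g d) = diag_act D2 dact g (\<Delta>D d)"
  and dact_aug: "aug D (dact g d) = act g (aug D d)"
  using actD unfolding G_action_def by (simp_all add: image_subset_iff)

lemma dact_parity: "parity D (dact g d) = dact g (parity D d)"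
  by (induction d rule: D.gr_induct)
    (simp_all add: D.parity_eq dact_gr D.parity_eq[OF dact_gr] lin_signed[OF dact_lin] lin_add[OF dact_lin] lin_add[OF D.parity_lin])

section \<open>The bimodule structure of the twisted product\<close>

lemmas XTt = XT[unfolded is_tensor_k_def]
lemmas vsX = tensor_vs[OF XTt]

lemma X_sc [simp]: "msc X = tsc XT" by (simp add: twisted_product_def)

lemma xl_lin: "lin (msc C) (tsc XT) (\<lambda>c. tpr XT c d)" and xr_lin: "lin (msc D) (tsc XT) (tpr XT c)"
  by (auto intro!: linI vsX C.vsM D.vsM simp: tpr_add_left[OF XTt] tpr_add_right[OF XTt] tpr_scale_left[OF XTt] tpr_scale_right[OF XTt])

lemma x_induct [case_names hom add]:
  assumes "\<And>c d i g j. c \<in> Cg i g \<Longrightarrow> d \<in> gr D j \<Longrightarrow> \<Phi> (tpr XT c d)" "\<And>x y. \<Phi> x \<Longrightarrow> \<Phi> y \<Longrightarrow> \<Phi> (x + y)"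
  shows "\<Phi> x"
proof (rule tensor_induct[OF XTt])
  show "\<Phi> (tpr XT c d)" for c d
  proof (induction c rule: c_induct)
    case (hom i g c)
    then show ?case
      by (induction d rule: D.gr_induct) (auto simp: lin_add[OF xr_lin] intro: assms)
  qed (auto simp: lin_add[OF xl_lin] intro: assms)
qed (fact assms)

lemma x_lift:
  assumes s: "vector_space s" and h: "\<And>d. lin (msc C) s (\<lambda>c. h c d)" "\<And>c. lin (msc D) s (h c)"
  shows "lin (tsc XT) s (tlift XT s h)" "tlift XT s h (tpr XT c d) = h c d"
  by (rule lin_tlift[OF XTt s] tlift_tpr[OF XTt s]; simp add: lin_add[OF h(1)] lin_add[OF h(2)]
      lin_scale[OF h(1)] lin_scale[OF h(2)])+

text \<open>The formula involves the group degree \<open>h\<close> of \<open>c\<close>, so it is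
  linear in \<open>c\<close> only on each piece of the bigrading; existence comes from extending
  over these pieces and uniqueness from their sums.\<close>

lemma tact_all:
  "lin (tsc XT) (tsc XT) (twisted_act C Cg D act dact XT s' g' s g) \<and>
   (\<forall>i h. \<forall>c\<in>Cg i h. \<forall>d. twisted_act C Cg D act dact XT s' g' s g (tpr XT c d) =
     tpr XT (gr' (gl g' c) g) (lact D (act (- (g' + h + g)) s') (dact (- g) (ract D d s))))"
proof -
  define H where "H ih c d = tpr XT (gr' (gl g' c) g) (lact D (act (- (g' + snd ih + g)) s') (dact (- g) (ract D d s)))"
    for ih :: "nat \<times> 'g" and c d
  have L1: "lin (msc C) (tsc XT) (\<lambda>c. H ih c d)" for ih d
    unfolding H_def by (intro lin_comp[OF C.la_lin lin_comp[OF C.ra_lin xl_lin]])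
  have L2: "lin (msc D) (tsc XT) (H ih c)" for ih c
    unfolding H_def[abs_def] by (intro lin_comp[OF D.ra_lin lin_comp[OF dact_lin lin_comp[OF D.la_lin xr_lin]]])
  have "\<exists>Fu. lin (tsc XT) (tsc XT) Fu \<and> (\<forall>i. \<forall>m\<in>(case i of (i, g) \<Rightarrow> Cg i g). \<forall>n. Fu (tpr XT m n) = H i m n)"
    by (rule tensor_k_graded_ex[OF XT cg.grading_axioms vsX D.vsM])
      (simp_all add: lin_add[OF L1] lin_scale[OF L1] lin_add[OF L2] lin_scale[OF L2])
  then obtain Fu where Fu: "lin (tsc XT) (tsc XT) Fu" "\<And>i g c d. c \<in> Cg i g \<Longrightarrow> Fu (tpr XT c d) = H (i, g) c d"
    by fastforce
  have "twisted_act C Cg D act dact XT s' g' s g = Fu"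
    unfolding twisted_act_def
  proof (rule the_equality)
    fix G assume G: "lin (tsc XT) (tsc XT) G \<and> (\<forall>i h. \<forall>c\<in>Cg i h. \<forall>d. G (tpr XT c d) =
       tpr XT (gr' (gl g' c) g) (lact D (act (- (g' + h + g)) s') (dact (- g) (ract D d s))))"
    show "G = Fu"
    proof
      fix x show "G x = Fu x"
        by (induction x rule: x_induct)
          (use G in \<open>auto simp: Fu(2) H_def lin_add[OF Fu(1)] lin_add[of "tsc XT" "tsc XT" G]\<close>)
    qed
  qed (use Fu in \<open>auto simp: H_def\<close>)
  then show ?thesis using Fu by (simp add: H_def)
qed

lemma tact_lin: "lin (tsc XT) (tsc XT) (twisted_act C Cg D act dact XT s' g' s g)"
  and tact: "c \<in> Cg i h \<Longrightarrow> twisted_act C Cg D act dact XT s' g' s g (tpr XT c d) =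
     tpr XT (gr' (gl g' c) g) (lact D (act (- (g' + h + g)) s') (dact (- g) (ract D d s)))"
  using tact_all by blast+

lemma X_l_lin: "lin (tsc XT) (tsc XT) (lact X a)" and X_r_lin: "lin (tsc XT) (tsc XT) (\<lambda>x. ract X x a)"
  unfolding twisted_product_def by (auto intro!: lin_sums vsX tact_lin)

lemma X_l: "c \<in> Cg i h \<Longrightarrow> lact X a (tpr XT c d)
    = (\<Sum>g\<in>UNIV. tpr XT (gl g c) (lact D (act (- (g + h)) (Poly_Mapping.lookup a g)) d))"
  by (simp add: twisted_product_def tact)

text \<open>The coefficient on the left is the unit here, which the group fixes, so the group degree
  of \<open>c\<close> drops out and the formula holds for every \<open>c\<close>.\<close>

lemma X_r: "ract X (tpr XT c d) a = (\<Sum>g\<in>UNIV. tpr XT (gr' c g) (dact (- g) (ract D d (Poly_Mapping.lookup a g))))"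
  by (induction c rule: c_induct)
    (simp_all add: twisted_product_def tact lin_add[OF xl_lin] lin_sum[OF tact_lin] lin_add[OF tact_lin] lin_add[OF C.ra_lin] sum.distrib)

lemma X_l_single: "c \<in> Cg i h \<Longrightarrow> lact X (Poly_Mapping.single g s) (tpr XT c d) = tpr XT (gl g c) (lact D (act (- (g + h)) s) d)"
proof -
  assume c: "c \<in> Cg i h"
  have "(\<Sum>g'\<in>UNIV. tpr XT (gl g' c) (lact D (act (- (g' + h)) (Poly_Mapping.lookup (Poly_Mapping.single g s) g')) d))
    = (\<Sum>g'\<in>UNIV. if g' = g then tpr XT (gl g c) (lact D (act (- (g + h)) s) d) else 0)"
    by (intro sum.cong refl) (auto simp: lookup_single when_def lin_0[OF act_lin] lin_0[OF D.la_lin'] lin_0[OF xr_lin])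
  then show ?thesis unfolding X_l[OF c] by simp
qed

lemma X_r_single: "ract X (tpr XT c d) (Poly_Mapping.single g s) = tpr XT (gr' c g) (dact (- g) (ract D d s))"
proof -
  have "(\<Sum>g'\<in>UNIV. tpr XT (gr' c g') (dact (- g') (ract D d (Poly_Mapping.lookup (Poly_Mapping.single g s) g'))))
    = (\<Sum>g'\<in>UNIV. if g' = g then tpr XT (gr' c g) (dact (- g) (ract D d s)) else 0)"
    by (intro sum.cong refl) (auto simp: lookup_single when_def lin_0[OF dact_lin] lin_0[OF D.ra_lin'] lin_0[OF xr_lin])
  then show ?thesis unfolding X_r by simp
qed

lemma X_l_lin': "lin (asc A) (tsc XT) (\<lambda>a. lact X a x)" and X_r_lin': "lin (asc A) (tsc XT) (ract X x)"
proof -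
  have "lact X (a + b) x = lact X a x + lact X b x \<and> ract X x (a + b) = ract X x a + ract X x b" for a b
    by (induction x rule: x_induct)
      (simp_all add: X_l X_r lin_add[OF X_l_lin] lin_add[OF X_r_lin] lookup_add lin_add[OF act_lin] lin_add[OF D.la_lin']
        lin_add[OF D.ra_lin'] lin_add[OF dact_lin] lin_add[OF xr_lin] sum.distrib)
  moreover have "lact X (asc A k a) x = tsc XT k (lact X a x) \<and> ract X x (asc A k a) = tsc XT k (ract X x a)" for k a
    by (induction x rule: x_induct)
      (simp_all add: X_l X_r lin_add[OF X_l_lin] lin_add[OF X_r_lin] A_sc_lookup lin_scale[OF act_lin] lin_scale[OF D.la_lin']
        lin_scale[OF D.ra_lin'] lin_scale[OF dact_lin] lin_scale[OF xr_lin] vs_simps(5)[OF vsX] vs_add[OF vsX])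
  ultimately show "lin (asc A) (tsc XT) (\<lambda>a. lact X a x)" "lin (asc A) (tsc XT) (ract X x)"
    by (auto intro!: linI vsA vsX)
qed

text \<open>The group is noncommutative, so differences are expanded before normalising.\<close>

lemmas gsimps = add.assoc minus_add diff_conv_add_uminus

text \<open>All laws are checked on elements \<open>s g\<close> and on \<open>c \<otimes> d\<close>
  with \<open>c\<close> homogeneous. That the two actions commute rests on
  \<open>c \<cdot> h\<close> having group degree increased by \<open>h\<close>, which is compensated
  by the inverse of \<open>h\<close> acting on the \<open>D\<close> factor.\<close>

lemma X_bimodule: "bimodule A X"
proof -
  have one: "lact X (aone A) x = x \<and> ract X x (aone A) = x" for x
    by (induction x rule: x_induct)
      (auto simp: A_one X_l_single X_r_single lin_add[OF X_l_lin] lin_add[OF X_r_lin])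
  have l: "lact X (amul A a b) x = lact X a (lact X b x)" for a b x
  proof (induction a rule: pm_finite_induct)
    case (1 g s)
    show ?case
    proof (induction b rule: pm_finite_induct)
      case (1 h t)
      show ?case
      proof (induction x rule: x_induct)
        case (hom c d i k j)
        show ?case
          by (simp add: A_mul_single X_l_single[OF hom(1)] X_l_single[OF Cg_l[OF hom(1)]] gl_gl act_mul act_act D.la_mul gsimps
              del: add_uminus_conv_diff)
      qed (simp add: lin_add[OF X_l_lin])
    qed (simp add: lin_add[OF A.mul_lin_right] lin_add[OF X_l_lin'] lin_add[OF X_l_lin])
  qed (simp add: lin_add[OF A.mul_lin_left] lin_add[OF X_l_lin'])
  have r: "ract X x (amul A a b) = ract X (ract X x a) b" for a b x
  proof (induction a rule: pm_finite_induct)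
    case (1 g s)
    show ?case
    proof (induction b rule: pm_finite_induct)
      case (1 h t)
      show ?case
      proof (induction x rule: x_induct)
        case (hom c d i k j)
        show ?case
          by (simp add: A_mul_single X_r_single gr_gr D.ra_mul dact_r dact_dact act_act gsimps
              del: add_uminus_conv_diff)
      qed (simp add: lin_add[OF X_r_lin])
    qed (simp add: lin_add[OF A.mul_lin_right] lin_add[OF X_r_lin'])
  qed (simp add: lin_add[OF A.mul_lin_left] lin_add[OF X_r_lin'] lin_add[OF X_r_lin])
  have lr: "ract X (lact X a x) b = lact X a (ract X x b)" for a b x
  proof (induction a rule: pm_finite_induct)
    case (1 g s)
    show ?case
    proof (induction b rule: pm_finite_induct)
      case (1 h t)
      show ?case
      proof (induction x rule: x_induct)
        case (hom c d i k j)
        show ?case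
          by (simp add: X_r_single X_l_single[OF hom(1)] X_l_single[OF Cg_r[OF hom(1)]] C.ra_la dact_l D.ra_la act_act gsimps
              del: add_uminus_conv_diff)
      qed (simp add: lin_add[OF X_r_lin] lin_add[OF X_l_lin])
    qed (simp add: lin_add[OF X_r_lin'] lin_add[OF X_l_lin])
  qed (simp add: lin_add[OF X_l_lin'] lin_add[OF X_r_lin])
  show ?thesis
    unfolding bimodule_def using one l r lr X_l_lin X_r_lin X_l_lin' X_r_lin' vsX by simp
qed

section \<open>Differential, augmentation and grading of the twisted product\<close>

lemma bdX_all: "lin (tsc XT) (tsc XT) (bd X) \<and> (\<forall>c d. bd X (tpr XT c d) = tpr XT (bd C c) d + tpr XT (parity C c) (bd D d))"
proof -
  define B where "B = tlift XT (tsc XT) (\<lambda>c d. tpr XT (bd C c) d + tpr XT (parity C c) (bd D d))"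
  have B: "lin (tsc XT) (tsc XT) B" "\<And>c d. B (tpr XT c d) = tpr XT (bd C c) d + tpr XT (parity C c) (bd D d)"
    unfolding B_def
    by (rule x_lift[OF vsX]; auto intro!: lin_plus lin_comp[OF C.bd_lin xl_lin] lin_comp[OF C.parity_lin xl_lin]
        lin_comp[OF D.bd_lin xr_lin] xr_lin)+
  have "bd X = B"
    unfolding twisted_product_def cplx.simps
  proof (rule the_equality)
    show "lin (tsc XT) (tsc XT) B \<and> (\<forall>i. \<forall>c\<in>gr C i. \<forall>d. B (tpr XT c d) = tpr XT (bd C c) d + signed (int i) (tpr XT c (bd D d)))"
      by (simp add: B C.parity_eq lin_signed[OF xl_lin])
    fix G assume G: "lin (tsc XT) (tsc XT) G \<and> (\<forall>i. \<forall>c\<in>gr C i. \<forall>d. G (tpr XT c d) = tpr XT (bd C c) d + signed (int i) (tpr XT c (bd D d)))"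
    then have Gl: "lin (tsc XT) (tsc XT) G" by simp
    show "G = B"
    proof
      fix x show "G x = B x"
      proof (induction x rule: x_induct)
        case (hom c d i g j)
        then show ?case using G Cg_gr by (simp add: B C.parity_eq[OF Cg_gr] lin_signed[OF xl_lin])
      qed (simp add: lin_add[OF B(1)] lin_add[OF Gl])
    qed
  qed
  with B show ?thesis by simp
qed

lemma bdX_lin: "lin (tsc XT) (tsc XT) (bd X)" and bdX: "bd X (tpr XT c d) = tpr XT (bd C c) d + tpr XT (parity C c) (bd D d)"
  using bdX_all by simp_all

lemma bdX_hom: "bimod_hom X X (bd X)"
proof (rule bimod_homI)
  show "bd X (lact X a x) = lact X a (bd X x)" for a x
  proof (induction a rule: pm_finite_induct)
    case (1 g s)
    show ?case
    proof (induction x rule: x_induct)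
      case (hom c d i h j)
      show ?case
        by (simp add: X_l_single[OF hom(1)] X_l_single[OF Cg_bd'[OF hom(1)]] X_l_single[OF Cg_parity[OF hom(1)]] bdX
            C.bd_l D.bd_l C.parity_l lin_add[OF X_l_lin])
    qed (simp add: lin_add[OF X_l_lin] lin_add[OF bdX_lin])
  qed (simp add: lin_add[OF X_l_lin'] lin_add[OF bdX_lin])
  show "bd X (ract X x a) = ract X (bd X x) a" for a x
  proof (induction a rule: pm_finite_induct)
    case (1 g s)
    show ?case
      by (induction x rule: x_induct)
        (simp_all add: X_r_single bdX C.bd_r D.bd_r C.parity_r dact_bd[symmetric] lin_add[OF X_r_lin] lin_add[OF bdX_lin])
  qed (simp add: lin_add[OF X_r_lin'] lin_add[OF bdX_lin])
qed (simp add: bdX_lin)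

lemma augX_lin: "lin (tsc XT) (asc A) (aug X)"
  and augX: "aug X (tpr XT c d) = amul A (kG_incl S (aug C c)) (Poly_Mapping.single 0 (aug D d))"
proof -
  note 1 = lin_comp[OF C.aug_lin[simplified] lin_comp[OF kG_incl_lin A_mul_lin_left]]
  note 2 = lin_comp[OF D.aug_lin lin_comp[OF single_lin A_mul_lin_right]]
  show "lin (tsc XT) (asc A) (aug X)" "aug X (tpr XT c d) = amul A (kG_incl S (aug C c)) (Poly_Mapping.single 0 (aug D d))"
    unfolding twisted_product_def cplx.simps
    by (rule x_lift[OF vsA 1 2])+
qed

text \<open>The group element \<open>h\<close> is moved to the right past the coefficient
  \<open>aug D d\<close>, which is thereby twisted.\<close>

lemma augX_single: "aug C c = Poly_Mapping.single h y \<Longrightarrow> aug X (tpr XT c d) = Poly_Mapping.single h (asc S y (act h (aug D d)))"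
  by (simp add: augX kG_incl_single A_mul_single lin_scale[OF mul_lin_left] mul_one)

lemma augX_hom: "bimod_hom X (regular A) (aug X)"
proof (rule bimod_homI)
  show "aug X (lact X a x) = lact (regular A) a (aug X x)" for a x
  proof (induction a rule: pm_finite_induct)
    case (1 g s)
    show ?case
    proof (induction x rule: x_induct)
      case (hom c d i h j)
      obtain y where y: "aug C c = Poly_Mapping.single h y" using Cg_aug[OF hom(1)] by blast
      then have "aug C (gl g c) = Poly_Mapping.single (g + h) y" by (simp add: C.aug_l mult_single)
      then show ?case
        by (simp add: X_l_single[OF hom(1)] augX_single[OF y] augX_single D.aug_l act_mul act_act A_mul_single
            lin_scale[OF mul_lin_right] lin_scale[OF act_lin])
    qed (simp add: lin_add[OF X_l_lin] lin_add[OF augX_lin] lin_add[OF A_mul_lin_right])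
  qed (simp add: lin_add[OF X_l_lin'] lin_add[OF augX_lin] lin_add[OF A_mul_lin_left])
  show "aug X (ract X x a) = ract (regular A) (aug X x) a" for a x
  proof (induction a rule: pm_finite_induct)
    case (1 g s)
    show ?case
    proof (induction x rule: x_induct)
      case (hom c d i h j)
      obtain y where y: "aug C c = Poly_Mapping.single h y" using Cg_aug[OF hom(1)] by blast
      then have "aug C (gr' c g) = Poly_Mapping.single (h + g) y" by (simp add: C.aug_r mult_single)
      then show ?case
        by (simp add: X_r_single augX_single[OF y] augX_single D.aug_r act_mul act_act A_mul_single dact_aug
            lin_scale[OF mul_lin_left] lin_scale[OF act_lin] gsimps del: add_uminus_conv_diff)
    qed (simp add: lin_add[OF X_r_lin] lin_add[OF augX_lin] lin_add[OF A_mul_lin_left])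
  qed (simp add: lin_add[OF X_r_lin'] lin_add[OF augX_lin] lin_add[OF A_mul_lin_right])
qed (simp add: augX_lin)

lemma grX: "gr X n = module.span (tsc XT) {tpr XT c d | c d i j. c \<in> gr C i \<and> d \<in> gr D j \<and> i + j = n}"
  by (simp add: twisted_product_def)

lemma grX_sub: "module.subspace (tsc XT) (gr X n)"
  unfolding grX by (rule span_sub[OF vsX])

lemmas grX_mem = subspaceD[OF vsX grX_sub]

lemma grX_tpr: "c \<in> gr C i \<Longrightarrow> d \<in> gr D j \<Longrightarrow> i + j = n \<Longrightarrow> tpr XT c d \<in> gr X n"
  unfolding grX by (rule span_mem[OF vsX]) blast

lemma grX_image:
  assumes x: "x \<in> gr X n" and F: "lin (tsc XT) s F" and V: "module.subspace s V"
    and h: "\<And>c d i g j. c \<in> Cg i g \<Longrightarrow> d \<in> gr D j \<Longrightarrow> i + j = n \<Longrightarrow> F (tpr XT c d) \<in> V"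
  shows "F x \<in> V"
proof -
  note V' = subspaceD[OF lin_vs(2)[OF F] V]
  have "F (tpr XT c d) \<in> V" if cd: "c \<in> gr C i" "d \<in> gr D j" "i + j = n" for c d i j
  proof -
    have "\<exists>!p. (\<forall>g. p g \<in> Cg i g) \<and> finite {g. p g \<noteq> 0} \<and> c = (\<Sum>g\<in>{g. p g \<noteq> 0}. p g)"
      using Cg_ds[of i, unfolded direct_sum_def] cd(1) by simp
    then obtain p where p: "\<forall>g. p g \<in> Cg i g" "c = (\<Sum>g\<in>{g. p g \<noteq> 0}. p g)"
      by (elim ex1E conjE) (rule that)
    show ?thesis
      unfolding p(2) lin_sum[OF xl_lin] lin_sum[OF F] by (intro V'(7) h[OF p(1)[rule_format] cd(2,3)])
  qed
  then show ?thesis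
    using x unfolding grX by (elim span_lin_ind[OF vsX]) (auto simp: lin_0[OF F] lin_add[OF F] lin_scale[OF F] intro: V')
qed

lemma grX_l: "x \<in> gr X n \<Longrightarrow> lact X a x \<in> gr X n"
  by (erule grX_image[OF _ X_l_lin grX_sub])
    (simp only: X_l, rule grX_mem(7), rule grX_tpr[OF C.gr_l[OF Cg_gr] D.gr_l])

lemma grX_r: "x \<in> gr X n \<Longrightarrow> ract X x a \<in> gr X n"
  by (erule grX_image[OF _ X_r_lin grX_sub])
    (simp only: X_r, rule grX_mem(7), rule grX_tpr[OF C.gr_r[OF Cg_gr] dact_gr[OF D.gr_r]])

lemma grX_ds: "direct_sum UNIV (gr X)"
proof -
  \<comment> \<open>The candidate for the projection to degree \<open>n\<close>: on \<open>c\<close>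
    of degree \<open>i\<close> it picks the component of \<open>d\<close> in degree
    \<open>n - i\<close>. The guard is needed because the subtraction is truncated.\<close>
  define H where "H n i c d = (if i \<le> n then tpr XT c (dcomp (gr D) (n - i) d) else 0)" for n i c d
  have L1: "lin (msc C) (tsc XT) (\<lambda>c. H n i c d)" for n i d
    unfolding H_def by (cases "i \<le> n") (simp_all add: xl_lin lin_zero C.vsM vsX)
  have L2: "lin (msc D) (tsc XT) (H n i c)" for n i c
    unfolding H_def[abs_def] by (cases "i \<le> n") (simp_all add: lin_comp[OF D.gr.dcomp_lin xr_lin] lin_zero D.vsM vsX)
  have "\<exists>Fu. lin (tsc XT) (tsc XT) Fu \<and> (\<forall>i. \<forall>m\<in>gr C i. \<forall>d. Fu (tpr XT m d) = H n i m d)" for n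
    by (rule tensor_k_graded_ex[OF XT C.gr.grading_axioms vsX D.vsM])
      (simp_all add: lin_add[OF L1] lin_scale[OF L1] lin_add[OF L2] lin_scale[OF L2])
  then obtain \<pi> where \<pi>: "\<And>n. lin (tsc XT) (tsc XT) (\<pi> n)" "\<And>n i c d. c \<in> gr C i \<Longrightarrow> \<pi> n (tpr XT c d) = H n i c d"
    by metis
  have \<pi>': "\<pi> n (tpr XT c d) = (if n = i + j then tpr XT c d else 0)" if "c \<in> gr C i" "d \<in> gr D j" for n i j c d
    using that by (auto simp: \<pi> H_def D.gr.dcomp_same lin_0[OF xr_lin])
  have *: "\<pi> n x \<in> gr X n" for n x
    by (induction x rule: x_induct)
      (auto simp: \<pi>'[OF Cg_gr] lin_add[OF \<pi>(1)] intro: grX_mem grX_tpr Cg_gr)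
  have **: "\<pi> n x = (if n = m then x else 0)" if "x \<in> gr X m" for n m x
  proof -
    have "\<pi> n x - (if n = m then x else 0) \<in> {0}"
    proof (rule grX_image[OF that, where F = "\<lambda>x. \<pi> n x - (if n = m then x else 0)"])
      show "lin (tsc XT) (tsc XT) (\<lambda>x. \<pi> n x - (if n = m then x else 0))"
        by (cases "n = m") (simp_all add: lin_minus \<pi>(1) lin_id vsX)
      show "module.subspace (tsc XT) {0}" by (rule subspaceI[OF vsX]) (simp_all add: vs_simps(2)[OF vsX])
    qed (simp add: \<pi>'[OF Cg_gr])
    then show ?thesis by simp
  qed
  have ***: "\<exists>N. (\<forall>n>N. \<pi> n x = 0) \<and> x = (\<Sum>n\<le>N. \<pi> n x)" for x
  proof (induction x rule: x_induct)
    case (hom c d i g j)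
    then show ?case by (intro exI[of _ "i + j"]) (simp add: \<pi>'[OF Cg_gr] sum.delta')
  next
    case (add x y)
    then obtain N M where NM: "\<forall>n>N. \<pi> n x = 0" "x = (\<Sum>n\<le>N. \<pi> n x)" "\<forall>n>M. \<pi> n y = 0" "y = (\<Sum>n\<le>M. \<pi> n y)" by blast
    have "(\<Sum>n\<le>N. \<pi> n x) = (\<Sum>n\<le>max N M. \<pi> n x)" "(\<Sum>n\<le>M. \<pi> n y) = (\<Sum>n\<le>max N M. \<pi> n y)"
      by (rule sum.mono_neutral_left; use NM in auto)+
    then have "x + y = (\<Sum>n\<le>max N M. \<pi> n (x + y))" using NM(2,4) by (simp add: lin_add[OF \<pi>(1)] sum.distrib)
    moreover have "\<forall>n>max N M. \<pi> n (x + y) = 0" using NM(1,3) by (simp add: lin_add[OF \<pi>(1)])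
    ultimately show ?case by (intro exI[of _ "max N M"] conjI)
  qed
  show ?thesis
  proof (rule direct_sum_projections[OF vsX \<pi>(1) * **])
    fix x
    obtain N where N: "\<forall>n>N. \<pi> n x = 0" "x = (\<Sum>n\<le>N. \<pi> n x)" using *** by blast
    have sub: "{n. \<pi> n x \<noteq> 0} \<subseteq> {..N}" using N(1) by (auto simp: not_less[symmetric])
    then show "finite {n. \<pi> n x \<noteq> 0}" by (rule finite_subset) simp
    show "x = (\<Sum>n\<in>{n. \<pi> n x \<noteq> 0}. \<pi> n x)"
      using N(2) sum.mono_neutral_left[OF _ sub, of "\<lambda>n. \<pi> n x"] by simp
  qed
qed

lemma gcplx_X: "gcplx A X"
proof (intro gcplx.intro bimod.intro bimod_axioms.intro gcplx_axioms.intro A.algebra_axioms X_bimodule bdX_hom augX_hom grX_ds)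
  show "module.subspace (msc X) (gr X n)" for n by (simp add: grX_sub)
  show "lact X a x \<in> gr X n" "ract X x a \<in> gr X n" if "x \<in> gr X n" for n a x
    using that by (rule grX_l, rule grX_r)
  have z: "module.subspace (tsc XT) {0}" by (rule subspaceI[OF vsX]) (simp_all add: vs_simps(2)[OF vsX])
  have zA: "module.subspace (asc A) {0}" by (rule subspaceI[OF vsA]) (simp_all add: vs_simps(2)[OF vsA])
  show "bd X x = 0" if "x \<in> gr X 0" for x
    using grX_image[OF that bdX_lin z]
    by (simp add: bdX C.bd_0[OF Cg_gr] D.bd_0 lin_0[OF xl_lin] lin_0[OF xr_lin])
  show "bd X x \<in> gr X n" if x: "x \<in> gr X (Suc n)" for n x
  proof (rule grX_image[OF x bdX_lin grX_sub])
    fix c d i g j assume *: "c \<in> Cg i g" "d \<in> gr D j" "i + j = Suc n"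
    note c = Cg_gr[OF *(1)]
    have "tpr XT (bd C c) d \<in> gr X n"
      using * c by (cases i) (auto simp: C.bd_0 lin_0[OF xl_lin] intro: grX_mem grX_tpr C.bd_gr)
    moreover have "tpr XT (parity C c) (bd D d) \<in> gr X n"
      using * c by (cases j) (auto simp: D.bd_0 lin_0[OF xr_lin] intro: grX_mem grX_tpr D.bd_gr C.parity_gr)
    ultimately show "bd X (tpr XT c d) \<in> gr X n" by (simp add: bdX grX_mem)
  qed
  show "aug X x = 0" if x: "x \<in> gr X (Suc n)" for n x
  proof -
    have "aug X x \<in> {0}"
    proof (rule grX_image[OF x augX_lin zA])
      fix c d i g j assume *: "c \<in> Cg i g" "d \<in> gr D j" "i + j = Suc n"
      then show "aug X (tpr XT c d) \<in> {0}"
        using C.aug_pos[OF Cg_gr[OF *(1)]] D.aug_pos[OF *(2)]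
        by (cases "i = 0") (auto simp: augX lin_0[OF kG_incl_lin] lin_0[OF A_mul_lin_left] lin_0[OF A_mul_lin_right])
    qed
    then show ?thesis by simp
  qed
  show "bd X (bd X x) = 0" for x
    by (induction x rule: x_induct)
      (simp_all add: bdX C.bd_bd D.bd_bd C.parity_bd lin_add[OF bdX_lin] lin_neg[OF xl_lin] lin_0[OF xl_lin] lin_0[OF xr_lin])
  show "aug X (bd X x) = 0" for x
    by (induction x rule: x_induct)
      (simp_all add: bdX augX C.aug_bd D.aug_bd lin_add[OF bdX_lin] lin_add[OF augX_lin] lin_0[OF kG_incl_lin]
        lin_0[OF A_mul_lin_left] lin_0[OF A_mul_lin_right])
qed

text \<open>The contraction of \<open>C \<otimes> D\<close> is the usual one, \<open>c\<^sub>C \<otimes> 1 + \<eta>\<^sub>C \<mu>\<^sub>C \<otimes> c\<^sub>D\<close>.\<close>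

lemma resolution_X:
  assumes "\<And>n. projective_bimodule A X (gr X n)"
  shows "projective_resolution A X"
proof -
  obtain cC eC where cC: "lin (msc C) (msc C) cC" "lin pm_scale (msc C) eC" "\<And>n p. p \<in> gr C n \<Longrightarrow> cC p \<in> gr C (Suc n)"
    "\<And>r. eC r \<in> gr C 0" "\<And>r. aug C (eC r) = r" "\<And>p. bd C (cC p) + cC (bd C p) = p - eC (aug C p)"
    using C.k_contraction by auto
  obtain cD eD where cD: "lin (msc D) (msc D) cD" "lin (asc S) (msc D) eD" "\<And>n p. p \<in> gr D n \<Longrightarrow> cD p \<in> gr D (Suc n)"
    "\<And>r. eD r \<in> gr D 0" "\<And>r. aug D (eD r) = r" "\<And>p. bd D (cD p) + cD (bd D p) = p - eD (aug D p)"
    using D.k_contraction by auto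
  let ?e = "\<lambda>c. eC (aug C c)"
  have el: "lin (msc C) (msc C) ?e" by (rule lin_comp[OF C.aug_lin[simplified] cC(2)])
  define cX where "cX = tlift XT (tsc XT) (\<lambda>c d. tpr XT (cC c) d + tpr XT (?e c) (cD d))"
  have cX: "lin (tsc XT) (tsc XT) cX" "\<And>c d. cX (tpr XT c d) = tpr XT (cC c) d + tpr XT (?e c) (cD d)"
    unfolding cX_def
    by (rule x_lift[OF vsX]; auto intro!: lin_plus lin_comp[OF cC(1) xl_lin] lin_comp[OF el xl_lin] lin_comp[OF cD(1) xr_lin] xr_lin)+
  \<comment> \<open>In \<open>A\<close> one has \<open>t g = g s\<close> with \<open>s\<close> the
    image of \<open>t\<close> under the inverse of \<open>g\<close>. Lifting \<open>g\<close> to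
    \<open>C\<close> and \<open>s\<close> to \<open>D\<close> gives a section of the augmentation
    that matches \<open>eC \<otimes> eD\<close>, as \<open>ja\<close> records.\<close>
  define j where "j a = (\<Sum>g\<in>UNIV. tpr XT (eC (gen g)) (eD (act (- g) (Poly_Mapping.lookup a g))))" for a
  have jl: "lin (asc A) (tsc XT) j"
    by (rule linI[OF vsA vsX]) (simp_all add: j_def lookup_add A_sc_lookup lin_add[OF act_lin] lin_add[OF cD(2)] lin_add[OF xr_lin]
        lin_scale[OF act_lin] lin_scale[OF cD(2)] lin_scale[OF xr_lin] sum.distrib vs_simps(5)[OF vsX])
  have ja: "j (aug X (tpr XT c d)) = tpr XT (?e c) (eD (aug D d))" if ch: "c \<in> Cg i h" for c d i h
  proof -
    obtain y where y: "aug C c = Poly_Mapping.single h y" using Cg_aug[OF ch] by blast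
    then have e: "?e c = msc C y (eC (gen h))"
      using lin_scale[OF cC(2), of y "gen h"] by (simp add: pm_scale_single)
    have "j (aug X (tpr XT c d)) = (\<Sum>g\<in>UNIV. if g = h then tpr XT (eC (gen h)) (eD (asc S y (aug D d))) else 0)"
      unfolding j_def augX_single[OF y]
      by (intro sum.cong refl)
        (auto simp: lookup_single when_def lin_0[OF act_lin] lin_0[OF cD(2)] lin_0[OF xr_lin] lin_scale[OF act_lin] act_act)
    then show ?thesis by (simp add: e lin_scale[OF cD(2)] lin_scale[OF xr_lin] lin_scale[OF xl_lin])
  qed
  have pc: "parity C (cC c) = - cC (parity C c)" for c
    by (induction c rule: C.gr_induct)
      (simp_all add: C.parity_eq C.parity_eq[OF cC(3)] lin_signed[OF cC(1)] signed_Suc lin_add[OF cC(1)] lin_add[OF C.parity_lin])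
  show ?thesis
  proof (rule projective_resolutionI[OF gcplx_X assms, of j cX])
    show "j a \<in> gr X 0" for a
      unfolding j_def by (intro grX_mem(7) grX_tpr[OF cC(4) cD(4)]) simp
    have "aug X (tpr XT (eC (gen g)) (eD (act (- g) t))) = Poly_Mapping.single g t" for g t
      using augX_single[OF cC(5), where d = "eD (act (- g) t)"] by (simp add: cD(5) act_act vs_one[OF vsR])
    then show "aug X (j a) = a" for a
      unfolding j_def lin_sum[OF augX_lin] by (simp flip: single_sum_finite)
    show "cX x \<in> gr X (Suc n)" if "x \<in> gr X n" for n x
    proof (rule grX_image[OF that cX(1) grX_sub])
      fix c d i g k assume *: "c \<in> Cg i g" "d \<in> gr D k" "i + k = n"
      note c = Cg_gr[OF *(1)]
      have "tpr XT (?e c) (cD d) \<in> gr X (Suc n)"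
        using * c C.aug_pos[OF c] by (cases "i = 0") (auto simp: lin_0[OF cC(2)] lin_0[OF xl_lin] grX_mem intro: grX_tpr cC cD)
      then show "cX (tpr XT c d) \<in> gr X (Suc n)"
        unfolding cX using * by (intro grX_mem(2) grX_tpr[OF cC(3)[OF c] *(2)]) simp
    qed
    show "cX 0 = 0" "j 0 = 0" by (rule lin_0[OF cX(1)], rule lin_0[OF jl])
    show "bd X (cX x) + cX (bd X x) = x - j (aug X x)" for x
    proof (induction x rule: x_induct)
      case (hom c d i g k)
      have p: "parity C (?e c) = ?e c" using C.parity_eq[OF cC(4)] by (simp add: signed_zero)
      have "bd X (cX (tpr XT c d)) + cX (bd X (tpr XT c d))
        = tpr XT (bd C (cC c) + cC (bd C c)) d + tpr XT (?e c) (bd D (cD d) + cD (bd D d))"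
        by (simp add: cX bdX lin_add[OF bdX_lin] lin_add[OF cX(1)] C.bd_0[OF cC(4)] lin_0[OF xl_lin] p pc C.aug_bd
            lin_0[OF cC(2)] C.aug_parity lin_neg[OF xl_lin] lin_add[OF xl_lin] lin_add[OF xr_lin])
      also have "\<dots> = tpr XT c d - tpr XT (?e c) (eD (aug D d))"
        by (simp add: cC(6) cD(6) lin_diff[OF xl_lin] lin_diff[OF xr_lin])
      finally show ?case by (simp add: ja[OF hom(1)])
    next
      case (add x y)
      show ?case
        using arg_cong2[of _ _ _ _ "(+)", OF add]
        by (simp add: lin_add[OF bdX_lin] lin_add[OF cX(1)] lin_add[OF augX_lin] lin_add[OF jl] algebra_simps)
    qed
  qed
qed

end

text \<open>Maps out of a tensor product of two tensor products, prescribed on fourfold pure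
  tensors. The outer balancing concerns arbitrary elements, so it is left to the caller, for the
  bilinear map \<open>V\<close> that has already been constructed. It is used over the ground field
  for the twisting map and over \<open>A\<close> for its inverse.\<close>

lemma tensor_tensor_ex:
  assumes T1: "is_tensor s1 s2 \<rho>1 \<Lambda>1 T1" and T2: "is_tensor s3 s4 \<rho>2 \<Lambda>2 T2"
    and T: "is_tensor (tsc T1) (tsc T2) \<rho> \<Lambda> T" and s: "vector_space s"
    and k: "\<And>n p q. lin s1 s (\<lambda>m. \<kappa> m n p q)" "\<And>m p q. lin s2 s (\<lambda>n. \<kappa> m n p q)"
      "\<And>m n q. lin s3 s (\<lambda>p. \<kappa> m n p q)" "\<And>m n p. lin s4 s (\<lambda>q. \<kappa> m n p q)"
    and b: "\<And>m r n p q. \<kappa> (\<rho>1 m r) n p q = \<kappa> m (\<Lambda>1 r n) p q" "\<And>m n p r q. \<kappa> m n (\<rho>2 p r) q = \<kappa> m n p (\<Lambda>2 r q)"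
    and bal: "\<And>V x r y. (\<And>x. lin (tsc T2) s (V x)) \<Longrightarrow> (\<And>y. lin (tsc T1) s (\<lambda>x. V x y)) \<Longrightarrow>
      (\<And>m n p q. V (tpr T1 m n) (tpr T2 p q) = \<kappa> m n p q) \<Longrightarrow> V (\<rho> x r) y = V x (\<Lambda> r y)"
  shows "\<exists>F. lin (tsc T) s F \<and> (\<forall>m n p q. F (tpr T (tpr T1 m n) (tpr T2 p q)) = \<kappa> m n p q)"
proof -
  have "\<exists>U. lin (tsc T2) s U \<and> (\<forall>p q. U (tpr T2 p q) = \<kappa> m n p q)" for m n
    by (rule tensor_ex[OF T2 s])
      (simp_all add: lin_add[OF k(3)] lin_add[OF k(4)] lin_scale[OF k(3)] lin_scale[OF k(4)] b(2))
  then obtain U where U: "\<And>m n. lin (tsc T2) s (U m n)" "\<And>m n p q. U m n (tpr T2 p q) = \<kappa> m n p q" by metis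
  have U1: "U (m + m') n y = U m n y + U m' n y" for m m' n y
    by (rule tensor_induct[OF T2, of "\<lambda>y. U (m + m') n y = U m n y + U m' n y"])
      (simp_all add: U(2) lin_add[OF k(1)] lin_add[OF U(1)])
  have U2: "U m (n + n') y = U m n y + U m n' y" for m n n' y
    by (rule tensor_induct[OF T2, of "\<lambda>y. U m (n + n') y = U m n y + U m n' y"])
      (simp_all add: U(2) lin_add[OF k(2)] lin_add[OF U(1)])
  have U3: "U (s1 c m) n y = s c (U m n y)" for m n c y
    by (rule tensor_induct[OF T2, of "\<lambda>y. U (s1 c m) n y = s c (U m n y)"])
      (simp_all add: U(2) lin_scale[OF k(1)] lin_add[OF U(1)] vs_add[OF s])
  have U4: "U m (s2 c n) y = s c (U m n y)" for m n c y
    by (rule tensor_induct[OF T2, of "\<lambda>y. U m (s2 c n) y = s c (U m n y)"])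
      (simp_all add: U(2) lin_scale[OF k(2)] lin_add[OF U(1)] vs_add[OF s])
  have U5: "U (\<rho>1 m r) n y = U m (\<Lambda>1 r n) y" for m n r y
    by (rule tensor_induct[OF T2, of "\<lambda>y. U (\<rho>1 m r) n y = U m (\<Lambda>1 r n) y"])
      (simp_all add: U(2) b(1) lin_add[OF U(1)])
  have "\<exists>V. lin (tsc T1) s V \<and> (\<forall>m n. V (tpr T1 m n) = U m n y)" for y
    by (rule tensor_ex[OF T1 s]) (simp_all add: U1 U2 U3 U4 U5)
  then obtain V where V: "\<And>y. lin (tsc T1) s (V y)" "\<And>y m n. V y (tpr T1 m n) = U m n y" by metis
  have V1: "V (y + y') x = V y x + V y' x" for x y y'
    by (rule tensor_induct[OF T1, of "\<lambda>x. V (y + y') x = V y x + V y' x"])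
      (simp_all add: V(2) lin_add[OF V(1)] lin_add[OF U(1)])
  have V2: "V (tsc T2 c y) x = s c (V y x)" for x y c
    by (rule tensor_induct[OF T1, of "\<lambda>x. V (tsc T2 c y) x = s c (V y x)"])
      (simp_all add: V(2) lin_add[OF V(1)] lin_scale[OF U(1)] vs_add[OF s])
  have V3: "V y (\<rho> x r) = V (\<Lambda> r y) x" for x r y
    by (rule bal[of "\<lambda>x y. V y x"]) (auto intro!: linI tensor_vs[OF T2] s V(1) simp: V1 V2 V(2) U(2))
  have "\<exists>F. lin (tsc T) s F \<and> (\<forall>x y. F (tpr T x y) = V y x)"
    by (rule tensor_ex[OF T s]) (simp_all add: lin_add[OF V(1)] lin_scale[OF V(1)] V1 V2 V3)
  then obtain F where F: "lin (tsc T) s F" "\<And>x y. F (tpr T x y) = V y x" by blast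
  show ?thesis by (rule exI[of _ F]) (simp add: F V(2) U(2))
qed

text \<open>The fourfold prescriptions below are extended by \<open>gext\<close> in the argument
  \<open>c'\<close>; this gives linearity in the remaining three.\<close>

lemma (in grading) gext_param:
  assumes "vector_space s1" "vector_space s2" "\<And>i m. lin s1 s2 (\<lambda>x. L x i m)"
  shows "lin s1 s2 (\<lambda>x. gext F (L x) m)"
  unfolding gext_def by (rule lin_sums[OF assms])

section \<open>The twisting map\<close>

locale twisted_square = twisted S act C Cg C2 C3 \<Delta>C \<phi>C D dact D2 D3 \<Delta>D \<phi>D XT
  for S :: "('k::field, 's::ab_group_add) kalg"
    and act :: "'g::{finite,group_add} \<Rightarrow> 's \<Rightarrow> 's"
    and C :: "('k, 'g \<Rightarrow>\<^sub>0 'k, 'c::ab_group_add) cplx"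
    and Cg :: "nat \<Rightarrow> 'g \<Rightarrow> 'c set"
    and C2 :: "('k, 'c, 'c, 'c2::ab_group_add) tensor"
    and C3 :: "('k, 'c, 'c2, 'c3::ab_group_add) tensor"
    and \<Delta>C :: "'c \<Rightarrow> 'c2" and \<phi>C :: "'c2 \<Rightarrow> 'c"
    and D :: "('k, 's, 'd::ab_group_add) cplx"
    and dact :: "'g \<Rightarrow> 'd \<Rightarrow> 'd"
    and D2 :: "('k, 'd, 'd, 'd2::ab_group_add) tensor"
    and D3 :: "('k, 'd, 'd2, 'd3::ab_group_add) tensor"
    and \<Delta>D :: "'d \<Rightarrow> 'd2" and \<phi>D :: "'d2 \<Rightarrow> 'd"
    and XT :: "('k, 'c, 'd, 'x::ab_group_add) tensor" +
  fixes Y :: "('k, 'c2, 'd2, 'y::ab_group_add) tensor"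
    and X2 :: "('k, 'x, 'x, 'x2::ab_group_add) tensor"
  assumes Y: "is_tensor_k (tsc C2) (tsc D2) Y"
    and X2: "is_tensor_over X X X2"
begin

sublocale X: tcplx A X X2
proof -
  interpret X: gcplx A X by (rule gcplx_X)
  show "tcplx A X X2" by unfold_locales (rule X2)
qed

lemmas Yt = Y[unfolded is_tensor_k_def]
lemmas vsY = tensor_vs[OF Yt]
lemmas x2l_lin = X.tl_lin[simplified] and x2r_lin = X.tr_lin[simplified]

lemma yl_lin: "lin (tsc C2) (tsc Y) (\<lambda>u. tpr Y u v)" and yr_lin: "lin (tsc D2) (tsc Y) (tpr Y u)"
  by (auto intro!: linI vsY C.vsT D.vsT simp: tpr_add_left[OF Yt] tpr_add_right[OF Yt] tpr_scale_left[OF Yt] tpr_scale_right[OF Yt])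

lemma y_lift:
  assumes s: "vector_space s" and h: "\<And>v. lin (tsc C2) s (\<lambda>u. h u v)" "\<And>u. lin (tsc D2) s (h u)"
  shows "lin (tsc Y) s (tlift Y s h)" "tlift Y s h (tpr Y u v) = h u v"
  by (rule lin_tlift[OF Yt s] tlift_tpr[OF Yt s]; simp add: lin_add[OF h(1)] lin_add[OF h(2)]
      lin_scale[OF h(1)] lin_scale[OF h(2)])+

lemma c2_induct [case_names hom add]:
  assumes "\<And>c c' p a i g. c \<in> Cg p a \<Longrightarrow> c' \<in> Cg i g \<Longrightarrow> \<Phi> (tpr C2 c c')" "\<And>x y. \<Phi> x \<Longrightarrow> \<Phi> y \<Longrightarrow> \<Phi> (x + y)"
  shows "\<Phi> u"
proof (rule tensor_induct[OF C.T])
  show "\<Phi> (tpr C2 c c')" for c c'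
  proof (induction c rule: c_induct)
    case (hom i g c)
    then show ?case
      by (induction c' rule: c_induct) (auto simp: lin_add[OF C.tr_lin] intro: assms)
  qed (auto simp: lin_add[OF C.tl_lin] intro: assms)
qed (fact assms)

lemma y_induct [case_names hom add]:
  assumes "\<And>c c' d d' p a i g j k. c \<in> Cg p a \<Longrightarrow> c' \<in> Cg i g \<Longrightarrow> d \<in> gr D j \<Longrightarrow> d' \<in> gr D k \<Longrightarrow>
      \<Phi> (tpr Y (tpr C2 c c') (tpr D2 d d'))" "\<And>x y. \<Phi> x \<Longrightarrow> \<Phi> y \<Longrightarrow> \<Phi> (x + y)"
  shows "\<Phi> y"
proof (rule tensor_induct[OF Yt])
  show "\<Phi> (tpr Y u v)" for u v
  proof (induction u rule: c2_induct)
    case (hom c c' p a i g)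
    then show ?case
      by (induction v rule: D.t_induct) (auto simp: lin_add[OF yr_lin] intro: assms)
  qed (auto simp: lin_add[OF yl_lin] intro: assms)
qed (fact assms)

lemma x2_induct [case_names hom add]:
  assumes "\<And>c c' d d' p a i g j k. c \<in> Cg p a \<Longrightarrow> c' \<in> Cg i g \<Longrightarrow> d \<in> gr D j \<Longrightarrow> d' \<in> gr D k \<Longrightarrow>
      \<Phi> (tpr X2 (tpr XT c d) (tpr XT c' d'))" "\<And>x y. \<Phi> x \<Longrightarrow> \<Phi> y \<Longrightarrow> \<Phi> (x + y)"
  shows "\<Phi> z"
proof (rule tensor_induct[OF X.T])
  show "\<Phi> (tpr X2 x x')" for x x'
  proof (induction x rule: x_induct)
    case (hom c d i g j)
    then show ?case
      by (induction x' rule: x_induct) (auto simp: lin_add[OF x2r_lin] intro: assms)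
  qed (auto simp: lin_add[OF x2l_lin] intro: assms)
qed (fact assms)

lemma kG_eq:
  assumes "lin pm_scale s F" "lin pm_scale s G" "\<And>g. F (gen g) = G (gen g)"
  shows "F r = G r"
  unfolding lin_free_eq[OF assms(1), of r] lin_free_eq[OF assms(2), of r] assms(3) ..

lemma dact_pw: "D.pw m (dact g d) = dact g (D.pw m d)"
  by (simp add: D.pw_def dact_parity)

lemma pw_flip: "parity D (D.pw (Suc m) d) = D.pw m d"
  by (simp add: D.pw_def)

abbreviation \<tau> where "\<tau> \<equiv> tau_map Cg D dact C2 D2 XT Y X2"

text \<open>Two balancing conditions must be respected. A group element crossing the tensor sign
  over \<open>kG\<close> changes the group degree of \<open>c'\<close>, which the right action on
  \<open>X\<close> undoes on \<open>d\<close>. A scalar \<open>s\<close> crossing the one over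
  \<open>S\<close> becomes the element \<open>act g s\<close> of \<open>A\<close>, with
  \<open>g\<close> the degree of \<open>c'\<close>.\<close>

lemma tau_all: "lin (tsc Y) (tsc X2) \<tau> \<and> (\<forall>c i g. \<forall>c'\<in>Cg i g. \<forall>d d'.
   \<tau> (tpr Y (tpr C2 c c') (tpr D2 d d')) = tpr X2 (tpr XT c (dact g (D.pw i d))) (tpr XT c' d'))"
proof -
  define L where "L c d d' ig c' = tpr X2 (tpr XT c (dact (snd ig) (D.pw (fst ig) d))) (tpr XT c' d')"
    for c d d' c' and ig :: "nat \<times> 'g"
  define \<kappa> where "\<kappa> c c' d d' = gext (\<lambda>(i, g). Cg i g) (L c d d') c'" for c c' d d'
  have L1: "lin (msc C) (tsc X2) (\<lambda>c. L c d d' ig c')" for d d' ig c'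
    unfolding L_def by (rule lin_comp[OF xl_lin x2l_lin])
  have L2: "lin (msc C) (tsc X2) (\<lambda>c'. L c d d' ig c')" for c d d' ig
    unfolding L_def by (rule lin_comp[OF xl_lin x2r_lin])
  have L3: "lin (msc D) (tsc X2) (\<lambda>d. L c d d' ig c')" for c d' ig c'
    unfolding L_def by (intro lin_comp[OF D.pw_lin lin_comp[OF dact_lin lin_comp[OF xr_lin x2l_lin]]])
  have L4: "lin (msc D) (tsc X2) (\<lambda>d'. L c d d' ig c')" for c d ig c'
    unfolding L_def by (rule lin_comp[OF xr_lin x2r_lin])
  have k1: "lin (msc C) (tsc X2) (\<lambda>c. \<kappa> c c' d d')" for c' d d'
    unfolding \<kappa>_def by (rule cg.gext_param[OF C.vsM X.vsT L1])
  have k2: "lin (msc C) (tsc X2) (\<lambda>c'. \<kappa> c c' d d')" for c d d'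
    unfolding \<kappa>_def by (rule cg.gext_lin[OF X.vsT]) (simp_all add: lin_add[OF L2] lin_scale[OF L2])
  have k3: "lin (msc D) (tsc X2) (\<lambda>d. \<kappa> c c' d d')" for c c' d'
    unfolding \<kappa>_def by (rule cg.gext_param[OF D.vsM X.vsT L3])
  have k4: "lin (msc D) (tsc X2) (\<lambda>d'. \<kappa> c c' d d')" for c c' d
    unfolding \<kappa>_def by (rule cg.gext_param[OF D.vsM X.vsT L4])
  have K: "\<kappa> c c' d d' = tpr X2 (tpr XT c (dact g (D.pw i d))) (tpr XT c' d')" if "c' \<in> Cg i g" for c c' d d' i g
  proof -
    have "\<kappa> c c' d d' = L c d d' (i, g) c'"
      unfolding \<kappa>_def by (rule cg.gext_eq[OF X.vsT]) (simp_all add: lin_add[OF L2] lin_scale[OF L2] that)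
    then show ?thesis by (simp add: L_def)
  qed
  have "\<exists>F. lin (tsc Y) (tsc X2) F \<and> (\<forall>c c' d d'. F (tpr Y (tpr C2 c c') (tpr D2 d d')) = \<kappa> c c' d d')"
  proof (rule tensor_tensor_ex[OF C.T D.T Yt X.vsT k1 k2 k3 k4])
    fix c c' d d' and r :: "'g \<Rightarrow>\<^sub>0 'k"
    show "\<kappa> (ract C c r) c' d d' = \<kappa> c (lact C r c') d d'"
    proof (induction c' rule: c_induct)
      case (hom i g c')
      show ?case
      proof (rule kG_eq[of "tsc X2" "\<lambda>r. \<kappa> (ract C c r) c' d d'" "\<lambda>r. \<kappa> c (lact C r c') d d'"])
        show "lin pm_scale (tsc X2) (\<lambda>r. \<kappa> (ract C c r) c' d d')" by (rule lin_comp[OF C.ra_lin'[simplified] k1])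
        show "lin pm_scale (tsc X2) (\<lambda>r. \<kappa> c (lact C r c') d d')" by (rule lin_comp[OF C.la_lin'[simplified] k2])
        fix h
        have "tpr XT (gl h c') d' = lact X (Poly_Mapping.single h (aone S)) (tpr XT c' d')"
          by (simp add: X_l_single[OF hom])
        then show "\<kappa> (gr' c h) c' d d' = \<kappa> c (gl h c') d d'"
          by (simp add: K[OF hom] K[OF Cg_l[OF hom]] X.bal[symmetric] X_r_single dact_dact)
      qed
    qed (simp add: lin_add[OF k2] lin_add[OF C.la_lin])
  next
    fix c c' d s d'
    show "\<kappa> c c' (ract D d s) d' = \<kappa> c c' d (lact D s d')"
    proof (induction c' rule: c_induct)
      case (hom i g c')
      have "tpr XT c' (lact D s d') = lact X (Poly_Mapping.single 0 (act g s)) (tpr XT c' d')"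
        by (simp add: X_l_single[OF hom] act_act)
      then show ?case by (simp add: K[OF hom] X.bal[symmetric] X_r_single D.pw_simps dact_r)
    qed (simp add: lin_add[OF k2])
  next
    fix V :: "'c2 \<Rightarrow> 'd2 \<Rightarrow> 'x2" and x r y
    assume "\<And>x. lin (tsc D2) (tsc X2) (V x)" "\<And>y. lin (tsc C2) (tsc X2) (\<lambda>x. V x y)"
    then show "V (tsc C2 r x) y = V x (tsc D2 r y)" by (simp add: Vector_Spaces.linear_iff)
  qed
  then obtain F where F: "lin (tsc Y) (tsc X2) F" "\<And>c c' d d'. F (tpr Y (tpr C2 c c') (tpr D2 d d')) = \<kappa> c c' d d'" by blast
  have sgn: "tpr X2 (tpr XT c (dact g (D.pw i d))) z = signed (int i * int j) (tpr X2 (tpr XT c (dact g d)) z)"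
    if "d \<in> gr D j" for c g i d j z
    using that by (simp add: D.pw_eq lin_signed[OF dact_lin] lin_signed[OF xr_lin] lin_signed[OF x2l_lin] mult.commute)
  have "\<tau> = F"
    unfolding tau_map_def
  proof (rule the_equality)
    show "lin (tsc Y) (tsc X2) F \<and> (\<forall>c i g. \<forall>c'\<in>Cg i g. \<forall>j. \<forall>d\<in>gr D j. \<forall>d'. F (tpr Y (tpr C2 c c') (tpr D2 d d')) =
             signed (int i * int j) (tpr X2 (tpr XT c (dact g d)) (tpr XT c' d')))"
      by (simp add: F K sgn)
    fix G assume G: "lin (tsc Y) (tsc X2) G \<and> (\<forall>c i g. \<forall>c'\<in>Cg i g. \<forall>j. \<forall>d\<in>gr D j. \<forall>d'. G (tpr Y (tpr C2 c c') (tpr D2 d d')) =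
             signed (int i * int j) (tpr X2 (tpr XT c (dact g d)) (tpr XT c' d')))"
    then have Gl: "lin (tsc Y) (tsc X2) G" by simp
    show "G = F"
    proof
      fix y show "G y = F y"
      proof (induction y rule: y_induct)
        case (hom c c' d d' p a i g j k)
        have "F (tpr Y (tpr C2 c c') (tpr D2 d d')) = signed (int i * int j) (tpr X2 (tpr XT c (dact g d)) (tpr XT c' d'))"
          by (simp only: F(2) K[OF hom(2)] sgn[OF hom(3)])
        moreover have "G (tpr Y (tpr C2 c c') (tpr D2 d d')) = signed (int i * int j) (tpr X2 (tpr XT c (dact g d)) (tpr XT c' d'))"
          using G hom by blast
        ultimately show ?case by simp
      qed (simp add: lin_add[OF F(1)] lin_add[OF Gl])
    qed
  qed
  with F K show ?thesis by simp
qed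

lemma tau_lin: "lin (tsc Y) (tsc X2) \<tau>" using tau_all by blast

lemma tau: "c' \<in> Cg i g \<Longrightarrow>
   \<tau> (tpr Y (tpr C2 c c') (tpr D2 d d')) = tpr X2 (tpr XT c (dact g (D.pw i d))) (tpr XT c' d')"
  using tau_all by blast

text \<open>The formula undoes the twist by acting with the inverse group element; the sign is its
  own inverse. The point to check is that it respects the balancing over \<open>A\<close>.\<close>

lemma tau_inverse: "\<exists>\<sigma>. lin (tsc X2) (tsc Y) \<sigma> \<and> (\<forall>c d i g. \<forall>c'\<in>Cg i g. \<forall>d'.
   \<sigma> (tpr X2 (tpr XT c d) (tpr XT c' d')) = tpr Y (tpr C2 c c') (tpr D2 (dact (- g) (D.pw i d)) d'))"
proof -
  define L where "L c d d' ig c' = tpr Y (tpr C2 c c') (tpr D2 (dact (- snd ig) (D.pw (fst ig) d)) d')"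
    for c d d' c' and ig :: "nat \<times> 'g"
  define \<kappa> where "\<kappa> c d c' d' = gext (\<lambda>(i, g). Cg i g) (L c d d') c'" for c c' d d'
  have L1: "lin (msc C) (tsc Y) (\<lambda>c. L c d d' ig c')" for d d' ig c'
    unfolding L_def by (rule lin_comp[OF C.tl_lin yl_lin])
  have L2: "lin (msc C) (tsc Y) (\<lambda>c'. L c d d' ig c')" for c d d' ig
    unfolding L_def by (rule lin_comp[OF C.tr_lin yl_lin])
  have L3: "lin (msc D) (tsc Y) (\<lambda>d. L c d d' ig c')" for c d' ig c'
    unfolding L_def by (intro lin_comp[OF D.pw_lin lin_comp[OF dact_lin lin_comp[OF D.tl_lin yr_lin]]])
  have L4: "lin (msc D) (tsc Y) (\<lambda>d'. L c d d' ig c')" for c d ig c'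
    unfolding L_def by (rule lin_comp[OF D.tr_lin yr_lin])
  have k1: "lin (msc C) (tsc Y) (\<lambda>c. \<kappa> c d c' d')" for c' d d'
    unfolding \<kappa>_def by (rule cg.gext_param[OF C.vsM vsY L1])
  have k2: "lin (msc C) (tsc Y) (\<lambda>c'. \<kappa> c d c' d')" for c d d'
    unfolding \<kappa>_def by (rule cg.gext_lin[OF vsY]) (simp_all add: lin_add[OF L2] lin_scale[OF L2])
  have k3: "lin (msc D) (tsc Y) (\<lambda>d. \<kappa> c d c' d')" for c c' d'
    unfolding \<kappa>_def by (rule cg.gext_param[OF D.vsM vsY L3])
  have k4: "lin (msc D) (tsc Y) (\<lambda>d'. \<kappa> c d c' d')" for c c' d
    unfolding \<kappa>_def by (rule cg.gext_param[OF D.vsM vsY L4])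
  have K: "\<kappa> c d c' d' = tpr Y (tpr C2 c c') (tpr D2 (dact (- g) (D.pw i d)) d')" if "c' \<in> Cg i g" for c c' d d' i g
  proof -
    have "\<kappa> c d c' d' = L c d d' (i, g) c'"
      unfolding \<kappa>_def by (rule cg.gext_eq[OF vsY]) (simp_all add: lin_add[OF L2] lin_scale[OF L2] that)
    then show ?thesis by (simp add: L_def)
  qed
  have "\<exists>F. lin (tsc X2) (tsc Y) F \<and> (\<forall>c d c' d'. F (tpr X2 (tpr XT c d) (tpr XT c' d')) = \<kappa> c d c' d')"
  proof (rule tensor_tensor_ex[OF XTt XTt X.T[simplified] vsY k1 k3 k2 k4])
    show "\<kappa> (msc C r c) d c' d' = \<kappa> c (msc D r d) c' d'" "\<kappa> c d (msc C r c') d' = \<kappa> c d c' (msc D r d')" for c d c' d' r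
      by (simp_all only: lin_scale[OF k1] lin_scale[OF k2] lin_scale[OF k3] lin_scale[OF k4])
    fix V :: "'x \<Rightarrow> 'x \<Rightarrow> 'y" and x a y
    assume V: "\<And>x. lin (tsc XT) (tsc Y) (V x)" "\<And>y. lin (tsc XT) (tsc Y) (\<lambda>x. V x y)"
      "\<And>c d c' d'. V (tpr XT c d) (tpr XT c' d') = \<kappa> c d c' d'"
    show "V (ract X x a) y = V x (lact X a y)"
    proof (induction a rule: pm_finite_induct)
      case (1 h s)
      show ?case
      proof (induction x rule: x_induct)
        case (hom c d p b j)
        show ?case
        proof (induction y rule: x_induct)
          case (hom c' d' i g k)
          \<comment> \<open>For \<open>a = s h\<close> the group part crosses the tensor sign over
            \<open>kG\<close> and the coefficient the one over \<open>S\<close>; this equation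
            brings the coefficient into the form produced by twisting \<open>d\<close>
            twice.\<close>
          have "lact D (act (- (h + g)) s) d' = lact D (act (- g) (act (- h) s)) d'"
            by (simp add: act_act gsimps del: add_uminus_conv_diff)
          then show ?case
            by (simp add: V(3) X_r_single X_l_single[OF hom(1)] K[OF hom(1)] K[OF Cg_l[OF hom(1)]] dact_pw D.pw_simps
              dact_r dact_dact C.bal D.bal gsimps del: add_uminus_conv_diff)
        qed (simp add: lin_add[OF V(1)] lin_add[OF X_l_lin])
      qed (simp add: lin_add[OF V(2)] lin_add[OF X_r_lin])
    qed (simp add: lin_add[OF V(2)] lin_add[OF V(1)] lin_add[OF X_r_lin'] lin_add[OF X_l_lin'])
  qed
  then obtain F where F: "lin (tsc X2) (tsc Y) F" "\<And>c d c' d'. F (tpr X2 (tpr XT c d) (tpr XT c' d')) = \<kappa> c d c' d'" by blast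
  with K show ?thesis by (intro exI[of _ F]) simp
qed

definition \<sigma> where "\<sigma> = inv \<tau>"

text \<open>The formula for \<open>phi_X\<close> uses the abstract inverse of \<open>\<tau>\<close>;
  it is identified with the explicit map, which makes it linear and computable.\<close>

lemma sigma_tau [simp]: "\<sigma> (\<tau> y) = y" and tau_sigma [simp]: "\<tau> (\<sigma> z) = z" and sigma_lin: "lin (tsc X2) (tsc Y) \<sigma>"
  and sigma: "c' \<in> Cg i g \<Longrightarrow>
   \<sigma> (tpr X2 (tpr XT c d) (tpr XT c' d')) = tpr Y (tpr C2 c c') (tpr D2 (dact (- g) (D.pw i d)) d')"
proof -
  obtain s where s: "lin (tsc X2) (tsc Y) s" "\<And>c d i g c' d'. c' \<in> Cg i g \<Longrightarrow>
   s (tpr X2 (tpr XT c d) (tpr XT c' d')) = tpr Y (tpr C2 c c') (tpr D2 (dact (- g) (D.pw i d)) d')"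
    using tau_inverse by blast
  have pp: "D.pw i (D.pw i d) = d" for i d by (simp add: D.pw_def)
  have 1: "s (\<tau> y) = y" for y
  proof (induction y rule: y_induct)
    case (hom c c' d d' p a i g j k)
    then show ?case by (simp add: tau[OF hom(2)] s(2)[OF hom(2)] dact_pw pp dact_dact)
  qed (simp add: lin_add[OF s(1)] lin_add[OF tau_lin])
  have 2: "\<tau> (s z) = z" for z
  proof (induction z rule: x2_induct)
    case (hom c c' d d' p a i g j k)
    then show ?case by (simp add: tau[OF hom(2)] s(2)[OF hom(2)] dact_pw pp dact_dact)
  qed (simp add: lin_add[OF s(1)] lin_add[OF tau_lin])
  have "\<sigma> = s" unfolding \<sigma>_def by (rule inv_equality) (simp_all add: 1 2)
  then show "\<sigma> (\<tau> y) = y" "\<tau> (\<sigma> z) = z" "lin (tsc X2) (tsc Y) \<sigma>"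
    "c' \<in> Cg i g \<Longrightarrow> \<sigma> (tpr X2 (tpr XT c d) (tpr XT c' d')) = tpr Y (tpr C2 c c') (tpr D2 (dact (- g) (D.pw i d)) d')"
    by (simp_all add: 1 2 s)
qed

section \<open>Structure carried along the twisting map\<close>

lemma parity_X: "parity X (tpr XT c d) = tpr XT (parity C c) (parity D d)"
proof (induction c rule: c_induct)
  case (hom i g c)
  note c = Cg_gr[OF hom]
  show ?case
  proof (induction d rule: D.gr_induct)
    case (hom j d)
    show ?case
      by (simp add: X.parity_eq[OF grX_tpr[OF c hom refl]] C.parity_eq[OF c] D.parity_eq[OF hom] lin_signed[OF xl_lin]
          lin_signed[OF xr_lin] signed_signed add.commute)
  qed (simp add: lin_add[OF xr_lin] lin_add[OF X.parity_lin[simplified]] lin_add[OF D.parity_lin])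
qed (simp add: lin_add[OF xl_lin] lin_add[OF X.parity_lin[simplified]] lin_add[OF C.parity_lin])

text \<open>The parity operator of \<open>C \<otimes> C\<close> for its total degree, written on
  pure tensors so that no direct sum decomposition of the tensor square is required.\<close>

definition \<epsilon>2 :: "'c2 \<Rightarrow> 'c2" where "\<epsilon>2 = tlift C2 (tsc C2) (\<lambda>c c'. tpr C2 (parity C c) (parity C c'))"

lemma eps2_lin: "lin (tsc C2) (tsc C2) \<epsilon>2" and eps2: "\<epsilon>2 (tpr C2 c c') = tpr C2 (parity C c) (parity C c')"
  unfolding \<epsilon>2_def
  by (rule C.t_lift[OF C.vsT]; auto simp: C.parity_l C.parity_r C.bal
      intro!: lin_comp[OF C.parity_lin C.tl_lin] lin_comp[OF C.parity_lin C.tr_lin])+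

lemma eps2_gr: "u \<in> gr C.Q p \<Longrightarrow> \<epsilon>2 u = signed (int p) u"
proof -
  assume u: "u \<in> gr C.Q p"
  have "\<epsilon>2 u - signed (int p) u \<in> {0}"
  proof (rule C.grQ_lin_image[OF u, where F = "\<lambda>u. \<epsilon>2 u - signed (int p) u"])
    show "lin (tsc C2) (tsc C2) (\<lambda>u. \<epsilon>2 u - signed (int p) u)"
      by (intro lin_minus lin_sgn eps2_lin lin_id C.vsT)
    show "module.subspace (tsc C2) {0}" by (rule subspaceI[OF C.vsT]) (simp_all add: vs_simps(2)[OF C.vsT])
  qed (auto simp: eps2 C.parity_eq lin_signed[OF C.tl_lin] lin_signed[OF C.tr_lin] signed_signed add.commute)
  then show ?thesis by simp
qed

text \<open>The total differential on the tensor product of \<open>C \<otimes> C\<close> with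
  \<open>D \<otimes> D\<close>, the sign of the first factor being supplied by
  \<open>\<epsilon>2\<close>.\<close>

definition dY :: "'y \<Rightarrow> 'y" where
  "dY = tlift Y (tsc Y) (\<lambda>u v. tpr Y (bd C.Q u) v + tpr Y (\<epsilon>2 u) (bd D.Q v))"

lemma dY_lin: "lin (tsc Y) (tsc Y) dY" and dY: "dY (tpr Y u v) = tpr Y (bd C.Q u) v + tpr Y (\<epsilon>2 u) (bd D.Q v)"
  unfolding dY_def
  by (rule y_lift[OF vsY]; auto intro!: lin_plus lin_comp[OF C.bdQ_lin yl_lin] lin_comp[OF eps2_lin yl_lin]
      lin_comp[OF D.bdQ_lin yr_lin] yr_lin)+

text \<open>Differentiating \<open>c'\<close> lowers its degree by one and so changes the sign with
  which it passes \<open>d\<close>; the missing sign is the parity of \<open>d\<close> in the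
  differential of \<open>X\<close>, by \<open>pw_flip\<close>. The other terms agree since the group
  action commutes with the differential of \<open>D\<close>.\<close>

lemma tau_bd: "bd X.Q (\<tau> y) = \<tau> (dY y)"
proof (induction y rule: y_induct)
  case (hom c c' d d' p a i g j k)
  let ?e = "dact g (D.pw i d)"
  \<comment> \<open>In degree 0 there is no smaller degree to refer to, but then
    \<open>bd C c'\<close> is zero.\<close>
  have 1: "\<tau> (tpr Y (tpr C2 c0 (bd C c')) (tpr D2 d d')) = tpr X2 (tpr XT c0 (parity D ?e)) (tpr XT (bd C c') d')" for c0
  proof (cases i)
    case 0
    then have "bd C c' = 0" using C.bd_0[OF Cg_gr] hom(2) by simp
    then show ?thesis by (simp add: lin_0[OF C.tr_lin] lin_0[OF yl_lin] lin_0[OF tau_lin] lin_0[OF xl_lin] lin_0[OF x2r_lin])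
  next
    case (Suc m)
    have b: "bd C c' \<in> Cg m g" using hom(2) Suc by (simp add: Cg_bd)
    show ?thesis by (simp add: tau[OF b] dact_parity Suc pw_flip)
  qed
  have 2: "parity C c' = signed (int i) c'" by (rule C.parity_eq[OF Cg_gr[OF hom(2)]])
  have 3: "bd D ?e = signed (int i) (dact g (D.pw i (bd D d)))"
    by (simp add: dact_bd[symmetric] D.pw_simps lin_signed[OF dact_lin])
  have 4: "parity D ?e = dact g (D.pw i (parity D d))" by (simp add: dact_parity D.pw_simps)
  have "\<tau> (dY (tpr Y (tpr C2 c c') (tpr D2 d d')))
    = (tpr X2 (tpr XT (bd C c) ?e) (tpr XT c' d') + tpr X2 (tpr XT (parity C c) (parity D ?e)) (tpr XT (bd C c') d'))
      + (tpr X2 (tpr XT (parity C c) (dact g (D.pw i (bd D d)))) (tpr XT (parity C c') d')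
      + tpr X2 (tpr XT (parity C c) (parity D ?e)) (tpr XT (parity C c') (bd D d')))"
    by (simp only: dY C.bdQ D.bdQ eps2 lin_add[OF yl_lin] lin_add[OF yr_lin] lin_add[OF tau_lin] 1 tau[OF hom(2)]
        tau[OF Cg_parity[OF hom(2)]] 4)
  also have "\<dots> = bd X.Q (\<tau> (tpr Y (tpr C2 c c') (tpr D2 d d')))"
    by (simp add: tau[OF hom(2)] X.bdQ bdX parity_X lin_add[OF x2l_lin] lin_add[OF x2r_lin] 2 3 lin_signed[OF xl_lin] lin_signed[OF xr_lin]
        lin_signed[OF x2l_lin] lin_signed[OF x2r_lin] algebra_simps)
  finally show ?case ..
qed (simp add: lin_add[OF tau_lin] lin_add[OF dY_lin] lin_add[OF X.bdQ_lin])

abbreviation diag where "diag g \<equiv> diag_act D2 dact g"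

lemma diag_lin: "lin (tsc D2) (tsc D2) (diag g)" and diag: "diag g (tpr D2 d d') = tpr D2 (dact g d) (dact g d')"
  unfolding diag_act_def
  by (rule D.t_lift[OF D.vsT]; auto simp: dact_l dact_r D.bal intro!: lin_comp[OF dact_lin D.tl_lin] lin_comp[OF dact_lin D.tr_lin])+

lemma Ggr_tpr: "c \<in> Cg p a \<Longrightarrow> c' \<in> Cg q b \<Longrightarrow> tpr C2 c c' \<in> tensor_Ggr C2 Cg (p + q) (a + b)"
  unfolding tensor_Ggr_def by (rule span_mem[OF C.vsT]) blast

text \<open>Left \<open>A\<close>-linearity of the twisting map: the action on \<open>Y\<close> has
  the same form as that on \<open>X\<close>, with the total group degree \<open>h\<close> of
  \<open>u\<close> in place of the degree of \<open>c\<close>. On pure tensors the degree of the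
  second factor cancels against its twist of \<open>d\<close>.\<close>

lemma tau_l:
  assumes "u \<in> tensor_Ggr C2 Cg n h"
  shows "\<tau> (tpr Y (lact C.Q (gen g) u) (lact D.Q (act (- (g + h)) s) v)) = lact X.Q (Poly_Mapping.single g s) (\<tau> (tpr Y u v))"
  using assms unfolding tensor_Ggr_def
proof (rule span_lin_ind[OF C.vsT])
  fix u assume "u \<in> {tpr C2 c c' | c c' p q a b. c \<in> Cg p a \<and> c' \<in> Cg q b \<and> p + q = n \<and> a + b = h}"
  then obtain c c' p q a b where u: "u = tpr C2 c c'" "c \<in> Cg p a" "c' \<in> Cg q b" "a + b = h" by blast
  have e: "act b (act (- (g + (a + b))) s) = act (- (g + a)) s"
    by (simp add: act_act gsimps del: add_uminus_conv_diff)
  show "\<tau> (tpr Y (lact C.Q (gen g) u) (lact D.Q (act (- (g + h)) s) v)) = lact X.Q (Poly_Mapping.single g s) (\<tau> (tpr Y u v))"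
  proof (induction v rule: D.t_induct)
    case (tpr d d' i j)
    show ?case
      by (simp add: u(1) u(4)[symmetric] C.Q_l D.Q_l tau[OF u(3)] X.Q_l X_l_single[OF u(2)] D.pw_simps dact_l e)
  qed (simp add: lin_add[OF D.Q_l_lin] lin_add[OF yr_lin] lin_add[OF tau_lin] lin_add[OF X.Q_l_lin])
next
  fix x y
  assume "\<tau> (tpr Y (lact C.Q (gen g) x) (lact D.Q (act (- (g + h)) s) v)) = lact X.Q (Poly_Mapping.single g s) (\<tau> (tpr Y x v))"
    "\<tau> (tpr Y (lact C.Q (gen g) y) (lact D.Q (act (- (g + h)) s) v)) = lact X.Q (Poly_Mapping.single g s) (\<tau> (tpr Y y v))"
  then show "\<tau> (tpr Y (lact C.Q (gen g) (x + y)) (lact D.Q (act (- (g + h)) s) v)) = lact X.Q (Poly_Mapping.single g s) (\<tau> (tpr Y (x + y) v))"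
    by (simp add: lin_add[OF C.Q_l_lin] lin_add[OF yl_lin] lin_add[OF tau_lin] lin_add[OF X.Q_l_lin])
next
  fix k x
  assume "\<tau> (tpr Y (lact C.Q (gen g) x) (lact D.Q (act (- (g + h)) s) v)) = lact X.Q (Poly_Mapping.single g s) (\<tau> (tpr Y x v))"
  then show "\<tau> (tpr Y (lact C.Q (gen g) (tsc C2 k x)) (lact D.Q (act (- (g + h)) s) v)) = lact X.Q (Poly_Mapping.single g s) (\<tau> (tpr Y (tsc C2 k x) v))"
    by (simp add: lin_scale[OF C.Q_l_lin] lin_scale[OF yl_lin] lin_scale[OF tau_lin] lin_scale[OF X.Q_l_lin])
qed (simp add: lin_0[OF C.Q_l_lin] lin_0[OF yl_lin] lin_0[OF tau_lin] lin_0[OF X.Q_l_lin])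

text \<open>The right action involves no group degree, but it moves both \<open>D\<close> factors
  diagonally by the inverse of \<open>g\<close>. This is where equivariance of the maps on
  \<open>D\<close> will enter.\<close>

lemma tau_r: "\<tau> (tpr Y (ract C.Q u (gen g)) (diag (- g) (ract D.Q v s))) = ract X.Q (\<tau> (tpr Y u v)) (Poly_Mapping.single g s)"
proof (induction u rule: c2_induct)
  case (hom c c' p a i k)
  show ?case
  proof (induction v rule: D.t_induct)
    case (tpr d d' j l)
    have "dact (k + g) (dact (- g) (D.pw i d)) = dact k (D.pw i d)"
      by (simp add: dact_dact gsimps del: add_uminus_conv_diff)
    then show ?case
      by (simp add: C.Q_r D.Q_r diag tau[OF hom(2)] tau[OF Cg_r[OF hom(2)]] X.Q_r X_r_single dact_pw)
  qed (simp add: lin_add[OF D.Q_r_lin] lin_add[OF diag_lin] lin_add[OF yr_lin] lin_add[OF tau_lin] lin_add[OF X.Q_r_lin])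
qed (simp add: lin_add[OF C.Q_r_lin] lin_add[OF yl_lin] lin_add[OF tau_lin] lin_add[OF X.Q_r_lin])

lemma X_l_incl: "lact X (kG_incl S r) (tpr XT c d) = tpr XT (lact C r c) d"
proof (rule kG_eq[of "tsc XT" "\<lambda>r. lact X (kG_incl S r) (tpr XT c d)" "\<lambda>r. tpr XT (lact C r c) d"])
  show "lin pm_scale (tsc XT) (\<lambda>r. lact X (kG_incl S r) (tpr XT c d))" by (rule lin_comp[OF kG_incl_lin X_l_lin'])
  show "lin pm_scale (tsc XT) (\<lambda>r. tpr XT (lact C r c) d)" by (rule lin_comp[OF C.la_lin'[simplified] xl_lin])
  show "lact X (kG_incl S (gen g)) (tpr XT c d) = tpr XT (gl g c) d" for g
    by (induction c rule: c_induct)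
      (simp_all add: kG_incl_single vs_one[OF vsR] X_l_single lin_add[OF X_l_lin] lin_add[OF xl_lin] lin_add[OF C.la_lin])
qed

text \<open>The twist of \<open>d\<close> by the degree of \<open>c'\<close> is exactly what the
  left action of its augmentation on \<open>c' \<otimes> d'\<close> removes again.\<close>

lemma mu_tau: "X.\<mu>1 (\<tau> (tpr Y u v)) = tpr XT (C.\<mu>1 u) (D.\<mu>1 v)"
proof (induction u rule: c2_induct)
  case (hom c c' p a i g)
  show ?case
  proof (induction v rule: D.t_induct)
    case (tpr d d' j l)
    have "X.\<mu>1 (\<tau> (tpr Y (tpr C2 c c') (tpr D2 d d')))
      = lact X (kG_incl S (aug C c)) (lact X (Poly_Mapping.single 0 (act g (aug D d))) (tpr XT c' d'))"
      by (simp add: tau[OF hom(2)] X.mu_tpr augX X.la_mul dact_aug D.pw_simps)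
    also have "\<dots> = tpr XT (lact C (aug C c) c') (lact D (aug D d) d')"
      by (simp add: X_l_single[OF hom(2)] X_l_incl act_act)
    finally show ?case by (simp add: C.mu_tpr D.mu_tpr)
  qed (simp add: lin_add[OF yr_lin] lin_add[OF tau_lin] lin_add[OF X.mu_lin[simplified]] lin_add[OF D.mu_lin] lin_add[OF xr_lin])
qed (simp add: lin_add[OF yl_lin] lin_add[OF tau_lin] lin_add[OF X.mu_lin[simplified]] lin_add[OF C.mu_lin] lin_add[OF xl_lin])

lemma rmu_tau: "X.r\<mu> (\<tau> (tpr Y u v)) = tpr XT (C.r\<mu> u) (D.r\<mu> v)"
proof (induction u rule: c2_induct)
  case (hom c c' p a i g)
  obtain y where y: "aug C c' = Poly_Mapping.single g y" using Cg_aug[OF hom(2)] by blast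
  have y': "ract C c (aug C c') = msc C y (gr' c g)"
    using lin_scale[OF C.ra_lin'[simplified], of c y "gen g"] by (simp add: y pm_scale_single)
  show ?case
  proof (induction v rule: D.t_induct)
    case (tpr d d' j l)
    have "X.r\<mu> (\<tau> (tpr Y (tpr C2 c c') (tpr D2 d d')))
      = ract X (ract X (tpr XT c (dact g (D.pw i d))) (Poly_Mapping.single g (asc S y (aone S)))) (Poly_Mapping.single 0 (aug D d'))"
      by (simp add: tau[OF hom(2)] X.rmu_tpr augX X.ra_mul y kG_incl_single)
    also have "\<dots> = tpr XT (ract C c (aug C c')) (ract D (D.pw i d) (aug D d'))"
      by (simp add: X_r_single dact_dact lin_scale[OF D.ra_lin'] lin_scale[OF dact_lin] lin_scale[OF D.ra_lin] lin_scale[OF xr_lin]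
          lin_scale[OF xl_lin] lin_scale[OF X_r_lin] y')
    \<comment> \<open>The sign depends on the degree of \<open>c'\<close>, whose augmentation
      vanishes outside degree 0.\<close>
    also have "\<dots> = tpr XT (ract C c (aug C c')) (ract D d (aug D d'))"
      using C.aug_pos[OF Cg_gr[OF hom(2)]] by (cases "i = 0") (simp_all add: D.pw_def lin_0[OF C.ra_lin'] lin_0[OF xl_lin])
    finally show ?case by (simp add: C.rmu_tpr D.rmu_tpr)
  qed (simp add: lin_add[OF yr_lin] lin_add[OF tau_lin] lin_add[OF X.rmu_lin[simplified]] lin_add[OF D.rmu_lin] lin_add[OF xr_lin])
qed (simp add: lin_add[OF yl_lin] lin_add[OF tau_lin] lin_add[OF X.rmu_lin[simplified]] lin_add[OF C.rmu_lin] lin_add[OF xl_lin])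

lemma cgr_image:
  assumes c: "c \<in> gr C i" and F: "lin (msc C) s F" and V: "module.subspace s V" and h: "\<And>c g. c \<in> Cg i g \<Longrightarrow> F c \<in> V"
  shows "F c \<in> V"
proof -
  have "\<exists>!p. (\<forall>g. p g \<in> Cg i g) \<and> finite {g. p g \<noteq> 0} \<and> c = (\<Sum>g\<in>{g. p g \<noteq> 0}. p g)"
    using Cg_ds[of i, unfolded direct_sum_def] c by simp
  then obtain p where p: "\<forall>g. p g \<in> Cg i g" "c = (\<Sum>g\<in>{g. p g \<noteq> 0}. p g)"
    by (elim ex1E conjE) (rule that)
  show ?thesis
    unfolding p(2) lin_sum[OF F] by (intro subspaceD(7)[OF lin_vs(2)[OF F] V] h[OF p(1)[rule_format]])
qed

lemma tau_gr: "u \<in> gr C.Q p \<Longrightarrow> v \<in> gr D.Q q \<Longrightarrow> \<tau> (tpr Y u v) \<in> gr X.Q (p + q)"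
proof (erule C.grQ_lin_image[OF _ lin_comp[OF yl_lin tau_lin] X.grQ_sub])
  fix c c' i i' assume v: "v \<in> gr D.Q q" and c: "c \<in> gr C i" and c': "c' \<in> gr C i'" and ii: "i + i' = p"
  show "\<tau> (tpr Y (tpr C2 c c') v) \<in> gr X.Q (p + q)"
  proof (rule cgr_image[OF c' lin_comp[OF C.tr_lin lin_comp[OF yl_lin tau_lin]] X.grQ_sub])
    fix c' g assume c': "c' \<in> Cg i' g"
    show "\<tau> (tpr Y (tpr C2 c c') v) \<in> gr X.Q (p + q)"
    proof (rule D.grQ_lin_image[OF v lin_comp[OF yr_lin tau_lin] X.grQ_sub])
      fix d d' j j' assume d: "d \<in> gr D j" "d' \<in> gr D j'" "j + j' = q"
      show "\<tau> (tpr Y (tpr C2 c c') (tpr D2 d d')) \<in> gr X.Q (p + q)"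
        unfolding tau[OF c']
        by (rule X.grQ_tpr[OF grX_tpr[OF c dact_gr[OF D.pw_simps(6)[OF d(1)]] refl] grX_tpr[OF Cg_gr[OF c'] d(2) refl]])
          (use ii d in simp)
    qed
  qed
qed

section \<open>The coalgebra structure and the homotopy of the twisted product\<close>

abbreviation \<Delta>X where "\<Delta>X \<equiv> Delta_X Cg D dact C2 D2 XT Y X2 \<Delta>C \<Delta>D"
abbreviation \<phi>X where "\<phi>X \<equiv> phi_X C Cg D dact C2 D2 XT Y X2 \<phi>C \<phi>D"

lemma DeltaX_lin: "lin (tsc XT) (tsc X2) \<Delta>X" and DeltaX: "\<Delta>X (tpr XT c d) = \<tau> (tpr Y (\<Delta>C c) (\<Delta>D d))"
proof -
  note * = x_lift[OF vsY lin_comp[OF C.\<Delta>_lin yl_lin] lin_comp[OF D.\<Delta>_lin yr_lin]]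
  show "lin (tsc XT) (tsc X2) \<Delta>X" "\<Delta>X (tpr XT c d) = \<tau> (tpr Y (\<Delta>C c) (\<Delta>D d))"
    using lin_comp[OF *(1) tau_lin] by (simp_all add: Delta_X_def comp_def *(2))
qed

lemma DeltaX_hom: "bimod_hom X X.Q \<Delta>X"
proof (rule bimod_homI)
  show "\<Delta>X (lact X a x) = lact X.Q a (\<Delta>X x)" for a x
  proof (induction a rule: pm_finite_induct)
    case (1 g s)
    show ?case
    proof (induction x rule: x_induct)
      case (hom c d i h j)
      show ?case
        by (simp add: X_l_single[OF hom(1)] DeltaX bh_l[OF C.\<Delta>_hom] bh_l[OF D.\<Delta>_hom] tau_l[OF Cg_\<Delta>[OF hom(1)]])
    qed (simp add: lin_add[OF X_l_lin] lin_add[OF DeltaX_lin] lin_add[OF X.Q_l_lin])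
  qed (simp add: lin_add[OF X_l_lin'] lin_add[OF DeltaX_lin] lin_add[OF X.Q.la_lin'[simplified]])
  show "\<Delta>X (ract X x a) = ract X.Q (\<Delta>X x) a" for a x
  proof (induction a rule: pm_finite_induct)
    case (1 g s)
    show ?case
      by (induction x rule: x_induct)
        (simp_all add: X_r_single DeltaX bh_r[OF C.\<Delta>_hom] bh_r[OF D.\<Delta>_hom] dact_\<Delta> tau_r
          lin_add[OF X_r_lin] lin_add[OF DeltaX_lin] lin_add[OF X.Q_r_lin])
  qed (simp add: lin_add[OF X_r_lin'] lin_add[OF DeltaX_lin] lin_add[OF X.Q.ra_lin'[simplified]])
qed (simp add: DeltaX_lin)

lemma DeltaX_gr: "x \<in> gr X n \<Longrightarrow> \<Delta>X x \<in> gr X.Q n"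
proof (erule grX_image[OF _ DeltaX_lin X.grQ_sub])
  fix c d i g j assume "c \<in> Cg i g" "d \<in> gr D j" "i + j = n"
  then show "\<Delta>X (tpr XT c d) \<in> gr X.Q n"
    using tau_gr[OF C.\<Delta>_gr[OF Cg_gr] D.\<Delta>_gr] by (auto simp: DeltaX)
qed

lemma DeltaX_bd: "\<Delta>X (bd X x) = bd X.Q (\<Delta>X x)"
proof (induction x rule: x_induct)
  case (hom c d i g j)
  note c = Cg_gr[OF hom(1)]
  show ?case
    by (simp add: bdX DeltaX tau_bd dY C.\<Delta>_bd D.\<Delta>_bd lin_add[OF DeltaX_lin] eps2_gr[OF C.\<Delta>_gr[OF c]] C.parity_eq[OF c]
        lin_signed[OF C.\<Delta>_lin] lin_add[OF tau_lin])
qed (simp add: lin_add[OF bdX_lin] lin_add[OF DeltaX_lin] lin_add[OF X.bdQ_lin])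

lemma DeltaX_mu: "X.\<mu>1 (\<Delta>X x) = x" "X.r\<mu> (\<Delta>X x) = x"
  by (induction x rule: x_induct)
    (simp_all add: DeltaX mu_tau rmu_tau C.\<mu>\<Delta> D.\<mu>\<Delta> lin_add[OF DeltaX_lin] lin_add[OF X.mu_lin[simplified]] lin_add[OF X.rmu_lin[simplified]])

lemma one_mu_parity: "C.r\<mu> (parity_one C C2 u) = parity C (C.r\<mu> u)"
proof -
  have 1: "lin (tsc C2) (tsc C2) (parity_one C C2)" "\<And>c c'. parity_one C C2 (tpr C2 c c') = tpr C2 (parity C c) c'"
    unfolding parity_one_def
    by (rule C.t_lift[OF C.vsT]; auto simp: C.parity_r C.bal intro!: lin_comp[OF C.parity_lin C.tl_lin] C.tr_lin)+
  show ?thesis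
    by (induction u rule: C.t_induct)
      (simp_all add: 1(2) C.rmu_tpr C.parity_r lin_add[OF 1(1)] lin_add[OF C.rmu_lin] lin_add[OF C.parity_lin])
qed

text \<open>The homotopy before transport by the inverse twist: the standard one for a tensor
  product of two homotopic pairs, passing through the intermediate map
  \<open>r\<mu> \<otimes> \<mu>1\<close>.\<close>

definition \<Phi> :: "'y \<Rightarrow> 'x" where
  "\<Phi> = tlift Y (tsc XT) (\<lambda>u v. tpr XT (\<phi>C u) (D.\<mu>1 v) + tpr XT (parity C (C.r\<mu> u)) (\<phi>D v))"

lemma Phi_lin: "lin (tsc Y) (tsc XT) \<Phi>"
  and Phi: "\<Phi> (tpr Y u v) = tpr XT (\<phi>C u) (D.\<mu>1 v) + tpr XT (parity C (C.r\<mu> u)) (\<phi>D v)"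
  unfolding \<Phi>_def
  by (rule y_lift[OF vsX]; intro lin_plus lin_comp[OF C.\<phi>_lin xl_lin] lin_comp[OF D.mu_lin xr_lin]
      lin_comp[OF C.rmu_lin lin_comp[OF C.parity_lin xl_lin]] lin_comp[OF D.\<phi>_lin xr_lin])+

lemma phiX: "\<phi>X z = \<Phi> (\<sigma> z)"
proof -
  let ?P1 = "tlift Y (tsc XT) (\<lambda>u v. tpr XT (\<phi>C u) (D.\<mu>1 v))"
  let ?P2 = "tlift Y (tsc XT) (\<lambda>u v. tpr XT (C.r\<mu> (parity_one C C2 u)) (\<phi>D v))"
  have P1: "lin (tsc Y) (tsc XT) ?P1" "\<And>u v. ?P1 (tpr Y u v) = tpr XT (\<phi>C u) (D.\<mu>1 v)"
    by (rule y_lift[OF vsX]; intro lin_comp[OF C.\<phi>_lin xl_lin] lin_comp[OF D.mu_lin xr_lin])+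
  have P2: "lin (tsc Y) (tsc XT) ?P2" "\<And>u v. ?P2 (tpr Y u v) = tpr XT (parity C (C.r\<mu> u)) (\<phi>D v)"
    unfolding one_mu_parity
    by (rule y_lift[OF vsX]; intro lin_comp[OF C.rmu_lin lin_comp[OF C.parity_lin xl_lin]] lin_comp[OF D.\<phi>_lin xr_lin])+
  have "?P1 y + ?P2 y = \<Phi> y" for y
    by (rule tensor_induct[OF Yt, of "\<lambda>y. ?P1 y + ?P2 y = \<Phi> y"])
      (simp_all add: P1(2) P2(2) Phi lin_add[OF P1(1)] lin_add[OF P2(1)] lin_add[OF Phi_lin] algebra_simps)
  then show ?thesis by (simp add: phi_X_def \<sigma>_def)
qed

lemma phiX_lin: "lin (tsc X2) (tsc XT) \<phi>X"
  using lin_comp[OF sigma_lin Phi_lin] by (simp add: phiX[abs_def])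

lemma phiX_tau: "\<phi>X (\<tau> y) = \<Phi> y"
  by (simp add: phiX)

text \<open>The first summand connects \<open>\<mu>1 \<otimes> \<mu>1\<close> with
  \<open>r\<mu> \<otimes> \<mu>1\<close>, the second continues to
  \<open>r\<mu> \<otimes> r\<mu>\<close>. The mixed terms cancel since \<open>\<phi>C\<close> raises
  degrees by one and so anticommutes with parity, while \<open>r\<mu>\<close> and
  \<open>\<mu>1\<close> are chain maps.\<close>

lemma Phi_homotopy: "bd X (\<Phi> (tpr Y u v)) + \<Phi> (dY (tpr Y u v)) = tpr XT (C.\<mu>1 u) (D.\<mu>1 v) - tpr XT (C.r\<mu> u) (D.r\<mu> v)"
proof -
  have 1: "parity C (\<phi>C u) = - \<phi>C (\<epsilon>2 u)"
    by (induction u rule: C.t_induct)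
      (simp_all add: eps2_gr[OF C.grQ_tpr[OF _ _ refl]] C.parity_eq[OF C.\<phi>_gr[OF C.grQ_tpr[OF _ _ refl]]] signed_Suc
        lin_signed[OF C.\<phi>_lin] lin_add[OF C.\<phi>_lin] lin_add[OF eps2_lin] lin_add[OF C.parity_lin])
  have 2: "C.r\<mu> (\<epsilon>2 u) = parity C (C.r\<mu> u)"
    by (induction u rule: C.t_induct)
      (simp_all add: eps2 C.rmu_tpr C.aug_parity C.parity_r lin_add[OF C.rmu_lin] lin_add[OF eps2_lin] lin_add[OF C.parity_lin])
  have "bd X (\<Phi> (tpr Y u v)) + \<Phi> (dY (tpr Y u v))
    = tpr XT (bd C (\<phi>C u) + \<phi>C (bd C.Q u)) (D.\<mu>1 v) + tpr XT (C.r\<mu> u) (bd D (\<phi>D v) + \<phi>D (bd D.Q v))"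
    by (simp add: Phi dY bdX lin_add[OF bdX_lin] lin_add[OF Phi_lin] 1 2 C.rmu_bd D.mu_bd C.bd_parity lin_neg[OF xl_lin]
        lin_add[OF xl_lin] lin_add[OF xr_lin])
  also have "\<dots> = tpr XT (C.\<mu>1 u) (D.\<mu>1 v) - tpr XT (C.r\<mu> u) (D.r\<mu> v)"
    by (simp add: C.\<phi>_bd D.\<phi>_bd lin_diff[OF xl_lin] lin_diff[OF xr_lin])
  finally show ?thesis .
qed

lemma phiX_homotopy: "bd X (\<phi>X z) + \<phi>X (bd X.Q z) = X.\<mu>1 z - X.r\<mu> z"
proof -
  have "bd X (\<Phi> y) + \<Phi> (dY y) = X.\<mu>1 (\<tau> y) - X.r\<mu> (\<tau> y)" for y
  proof (rule tensor_induct[OF Yt, of "\<lambda>y. bd X (\<Phi> y) + \<Phi> (dY y) = X.\<mu>1 (\<tau> y) - X.r\<mu> (\<tau> y)"])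
    show "bd X (\<Phi> (tpr Y u v)) + \<Phi> (dY (tpr Y u v)) = X.\<mu>1 (\<tau> (tpr Y u v)) - X.r\<mu> (\<tau> (tpr Y u v))" for u v
      unfolding Phi_homotopy mu_tau rmu_tau ..
    fix x y assume "bd X (\<Phi> x) + \<Phi> (dY x) = X.\<mu>1 (\<tau> x) - X.r\<mu> (\<tau> x)" "bd X (\<Phi> y) + \<Phi> (dY y) = X.\<mu>1 (\<tau> y) - X.r\<mu> (\<tau> y)"
    from arg_cong2[of _ _ _ _ "(+)", OF this]
    show "bd X (\<Phi> (x + y)) + \<Phi> (dY (x + y)) = X.\<mu>1 (\<tau> (x + y)) - X.r\<mu> (\<tau> (x + y))"
      by (simp add: lin_add[OF bdX_lin] lin_add[OF Phi_lin] lin_add[OF dY_lin] lin_add[OF tau_lin]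
          lin_add[OF X.mu_lin[simplified]] lin_add[OF X.rmu_lin[simplified]] algebra_simps)
  qed
  from this[of "\<sigma> z"] show ?thesis using tau_bd[of "\<sigma> z"] by (simp add: phiX)
qed

lemma mu_diag: "D.\<mu>1 (diag g v) = dact g (D.\<mu>1 v)"
  by (induction v rule: D.t_induct)
    (simp_all add: diag D.mu_tpr dact_aug dact_l lin_add[OF diag_lin] lin_add[OF D.mu_lin] lin_add[OF dact_lin])

lemma phiD_diag: "\<phi>D (diag g v) = dact g (\<phi>D v)"
  using eqD by (simp add: G_equivariant_def)

lemma phiC_Cg: "u \<in> tensor_Ggr C2 Cg n g \<Longrightarrow> \<phi>C u \<in> Cg (n + 1) g"
  using presC by (auto simp: preserves_G_grading_def)

lemma rmu_Cg: "c \<in> Cg p a \<Longrightarrow> c' \<in> Cg q b \<Longrightarrow> C.r\<mu> (tpr C2 c c') \<in> Cg p (a + b)"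
proof -
  assume c: "c \<in> Cg p a" and c': "c' \<in> Cg q b"
  obtain y where y: "aug C c' = Poly_Mapping.single b y" using Cg_aug[OF c'] by blast
  have "ract C c (aug C c') = msc C y (gr' c b)"
    using lin_scale[OF C.ra_lin'[simplified], of c y "gen b"] by (simp add: y pm_scale_single)
  then show ?thesis using Cg_r[OF c, of b] by (simp add: C.rmu_tpr Cg_mem)
qed

text \<open>For left linearity the coefficient acts through the group degree of the \<open>C\<close>
  factor, so \<open>\<phi>C\<close> and \<open>r\<mu>\<close> must keep it. For right linearity the
  \<open>D\<close> factor is moved by a group element, with which \<open>\<phi>D\<close> and
  \<open>\<mu>1\<close> must commute.\<close>

lemma phiX_hom: "bimod_hom X.Q X \<phi>X"
proof (rule bimod_homI)
  have l: "\<phi>X (lact X.Q (Poly_Mapping.single g s) (\<tau> y)) = lact X (Poly_Mapping.single g s) (\<Phi> y)" for g s y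
  proof (induction y rule: y_induct)
    case (hom c c' d d' p a i b j k)
    note u = Ggr_tpr[OF hom(1,2)]
    show ?case
      unfolding tau_l[OF u, symmetric] phiX_tau Phi lin_add[OF X_l_lin] X_l_single[OF phiC_Cg[OF u]]
        X_l_single[OF Cg_parity[OF rmu_Cg[OF hom(1,2)]]]
      by (simp only: bh_l[OF C.\<phi>_hom] bh_l[OF D.\<phi>_hom] bh_l[OF C.rmu_hom] bh_l[OF D.mu_hom] C.parity_l)
  qed (simp add: lin_add[OF tau_lin] lin_add[OF X.Q_l_lin] lin_add[OF phiX_lin] lin_add[OF Phi_lin] lin_add[OF X_l_lin])
  have r: "\<phi>X (ract X.Q (\<tau> y) (Poly_Mapping.single g s)) = ract X (\<Phi> y) (Poly_Mapping.single g s)" for g s y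
  proof (rule tensor_induct[OF Yt, of "\<lambda>y. \<phi>X (ract X.Q (\<tau> y) (Poly_Mapping.single g s)) = ract X (\<Phi> y) (Poly_Mapping.single g s)"])
    show "\<phi>X (ract X.Q (\<tau> (tpr Y u v)) (Poly_Mapping.single g s)) = ract X (\<Phi> (tpr Y u v)) (Poly_Mapping.single g s)" for u v
      unfolding tau_r[symmetric] phiX_tau Phi lin_add[OF X_r_lin] X_r_single
      by (simp only: bh_r[OF C.\<phi>_hom] bh_r[OF D.\<phi>_hom] bh_r[OF C.rmu_hom] bh_r[OF D.mu_hom] C.parity_r mu_diag phiD_diag)
  qed (simp add: lin_add[OF tau_lin] lin_add[OF X.Q_r_lin] lin_add[OF phiX_lin] lin_add[OF Phi_lin] lin_add[OF X_r_lin])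
  show "\<phi>X (lact X.Q a z) = lact X a (\<phi>X z)" for a z
  proof (induction a rule: pm_finite_induct)
    case (1 g s)
    show ?case using l[of g s "\<sigma> z"] by (simp add: phiX)
  qed (simp add: lin_add[OF X.Q.la_lin'[simplified]] lin_add[OF phiX_lin] lin_add[OF X_l_lin'])
  show "\<phi>X (ract X.Q z a) = ract X (\<phi>X z) a" for a z
  proof (induction a rule: pm_finite_induct)
    case (1 g s)
    show ?case using r[of "\<sigma> z" g s] by (simp add: phiX)
  qed (simp add: lin_add[OF X.Q.ra_lin'[simplified]] lin_add[OF phiX_lin] lin_add[OF X_r_lin'])
qed (simp add: phiX_lin)

lemma phiX_gr: "z \<in> gr X.Q n \<Longrightarrow> \<phi>X z \<in> gr X (n + 1)"
proof (erule X.grQ_lin_image[OF _ phiX_lin[folded X_sc] grX_sub[folded X_sc]])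
  fix x x' i j assume x: "x \<in> gr X i" and x': "x' \<in> gr X j" and ij: "i + j = n"
  show "\<phi>X (tpr X2 x x') \<in> gr X (n + 1)"
  proof (rule grX_image[OF x lin_comp[OF x2l_lin phiX_lin] grX_sub])
    fix c d p a q assume c: "c \<in> Cg p a" and d: "d \<in> gr D q" and pq: "p + q = i"
    show "\<phi>X (tpr X2 (tpr XT c d) x') \<in> gr X (n + 1)"
    proof (rule grX_image[OF x' lin_comp[OF x2r_lin phiX_lin] grX_sub])
      fix c' d' p' b q' assume c': "c' \<in> Cg p' b" and d': "d' \<in> gr D q'" and pq': "p' + q' = j"
      have u: "tpr C2 c c' \<in> gr C.Q (p + p')" by (rule C.grQ_tpr[OF Cg_gr[OF c] Cg_gr[OF c'] refl])
      have v: "tpr D2 (dact (- b) (D.pw p' d)) d' \<in> gr D.Q (q + q')"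
        by (rule D.grQ_tpr[OF dact_gr[OF D.pw_simps(6)[OF d]] d' refl])
      show "\<phi>X (tpr X2 (tpr XT c d) (tpr XT c' d')) \<in> gr X (n + 1)"
        unfolding phiX sigma[OF c'] Phi
        by (intro grX_mem(2) grX_tpr[OF C.\<phi>_gr[OF u] D.mu_gr[OF v]] grX_tpr[OF C.parity_gr[OF C.rmu_gr[OF u]] D.\<phi>_gr[OF v]])
          (use ij pq pq' in simp_all)
    qed
  qed
qed

lemma dgc_X:
  assumes proj: "\<And>n. projective_bimodule A X (gr X n)"
    and X3: "is_tensor_over X (tensor_cplx A X X X2) X3"
  shows "dgc A X X2 X3 \<Delta>X \<phi>X"
proof (intro dgc.intro resolution.intro dgc_axioms.intro X.tcplx_axioms X.gcplx_axioms resolution_axioms.intro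
    resolution_X[OF proj] X3 DeltaX_hom DeltaX_gr DeltaX_bd DeltaX_mu)
  show "homotopy A X X2 \<phi>X"
    using phiX_hom phiX_gr phiX_homotopy by (auto simp: homotopy_def)
qed

end

theorem theorem4p9:
  fixes S :: "('k::field, 's::ab_group_add) kalg"
    and act :: "'g::{finite,group_add} \<Rightarrow> 's \<Rightarrow> 's"
    and C :: "('k, 'g \<Rightarrow>\<^sub>0 'k, 'c::ab_group_add) cplx"
    and Cg :: "nat \<Rightarrow> 'g \<Rightarrow> 'c set"
    and C2 :: "('k, 'c, 'c, 'c2::ab_group_add) tensor"
    and C3 :: "('k, 'c, 'c2, 'c3::ab_group_add) tensor"
    and \<Delta>C :: "'c \<Rightarrow> 'c2" and \<phi>C :: "'c2 \<Rightarrow> 'c"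
    and D :: "('k, 's, 'd::ab_group_add) cplx"
    and dact :: "'g \<Rightarrow> 'd \<Rightarrow> 'd"
    and D2 :: "('k, 'd, 'd, 'd2::ab_group_add) tensor"
    and D3 :: "('k, 'd, 'd2, 'd3::ab_group_add) tensor"
    and \<Delta>D :: "'d \<Rightarrow> 'd2" and \<phi>D :: "'d2 \<Rightarrow> 'd"
    and XT :: "('k, 'c, 'd, 'x::ab_group_add) tensor"
    and Y :: "('k, 'c2, 'd2, 'y::ab_group_add) tensor"
    and X2 :: "('k, 'x, 'x, 'x2::ab_group_add) tensor"
    and X3 :: "('k, 'x, 'x2, 'x3::ab_group_add) tensor"
    and f f' :: "'x \<Rightarrow> 'g \<Rightarrow>\<^sub>0 's"
    and n m :: nat
  defines "A \<equiv> skew_group_algebra S act"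
    and "X \<equiv> twisted_product S act C Cg D dact XT"
    and "\<Delta>X \<equiv> Delta_X Cg D dact C2 D2 XT Y X2 \<Delta>C \<Delta>D"
    and "\<phi>X \<equiv> phi_X C Cg D dact C2 D2 XT Y X2 \<phi>C \<phi>D"
  assumes "k_algebra S"
    and "algebra_action S act"
    and "dg_coalgebra (group_algebra :: ('k, 'g \<Rightarrow>\<^sub>0 'k) kalg) C C2 C3 \<Delta>C"
    and "G_graded C C2 \<Delta>C Cg"
    and "homotopy (group_algebra :: ('k, 'g \<Rightarrow>\<^sub>0 'k) kalg) C C2 \<phi>C"
    and "preserves_G_grading C2 Cg \<phi>C"
    and "dg_coalgebra S D D2 D3 \<Delta>D"
    and "G_action D D2 \<Delta>D act dact"
    and "homotopy S D D2 \<phi>D"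
    and "G_equivariant D2 dact \<phi>D"
    and "is_tensor_k (msc C) (msc D) XT"
    and "is_tensor_k (tsc C2) (tsc D2) Y"
    and "is_tensor_over X X X2"
    and "is_tensor_over X (tensor_cplx A X X X2) X3"
    and "\<And>i. projective_bimodule A X (gr X i)"
    and "cocycle A X (int n) f"
    and "cocycle A X (int m) f'"
  shows "cocycle A X (int n + int m - 1) (bracket_X X X2 X3 \<Delta>X \<phi>X n m f f') \<and>
         (\<forall>\<alpha> \<beta>. HH_represents A X (int n) f \<alpha> \<and> HH_represents A X (int m) f' \<beta> \<longrightarrow>
            HH_represents A X (int n + int m - 1) (bracket_X X X2 X3 \<Delta>X \<phi>X n m f f')
              (HH_bracket A n m \<alpha> \<beta>))"
proof -
  note defs = A_def X_def \<Delta>X_def \<phi>X_def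
  interpret tw: twisted_square S act C Cg C2 C3 \<Delta>C \<phi>C D dact D2 D3 \<Delta>D \<phi>D XT Y X2
    by (intro twisted_square.intro twisted.intro skew.intro algebra.intro skew_axioms.intro twisted_axioms.intro
        twisted_square_axioms.intro assms(5-16) assms(17)[unfolded defs])
  interpret dg: dgc A X X2 X3 \<Delta>X \<phi>X
    unfolding defs by (rule tw.dgc_X) (use assms(18,19) in \<open>simp_all only: defs\<close>)
  show ?thesis
    using dg.bracket_cocycle dg.bracket_represents assms(20,21) by blast
qed

end
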